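(* Let $(X,g,\mu_g)$ be a (Riemannian) $n$-pseudomanifold (with $\partial X=\emptyset$). Let $f\in W^{1,2}_{\mathrm{loc}}(X)$ be a weakly subharmonic function such that $\|\nabla f\|_{L^1}$ is finite. Then there exists a unique locally finite Borel measure $\mathbf m_f$ on $X$ such that $$\int_X h\,d\mathbf m_f=-\int_X\langle\nabla f,\nabla h\rangle\,d\mu_g\qquad\text{for all }h\in\mathrm{Lip}_c(X).$$
   Context: Riemannian polyhedra. A polyhedron is a connected locally compact separable Hausdorff space $X$ homeomorphic, via some $\theta:|K|\to X$, to the space $|K|$ of a countable, locally finite simplicial complex $K$ of finite dimension; $(K,\theta)$ is a triangulation. $|K|$ carries the barycentric distance $\rho(\alpha,\beta)=(\sum_v(\alpha(v)-\beta(v))^2)^{1/2}$ and is affinely Lipschitz-homeomorphically embedded as a closed subset of a Euclidean space. $X$ is a Lipschitz polyhedron if it is a metric space and $\theta$ is a Lipschitz homeomorphism. A Riemannian polyhedron is a Lipschitz polyhedron $X$ such that, for some triangulation, each maximal simplex $s$ (viewed in the Euclidean space) carries a measurable Riemannian metric $g^s=g_{ij}dx^idx^j$ with $\Lambda^{-2}\|\xi\|^2\le g_{ij}(x)\xi^i\xi^j\le\Lambda^2\|\xi\|^2$ for a.e. $x\in s$, with $\Lambda$ independent of $s$. $d_X=d_X^g$ is the associated intrinsic distance: $d_X^g(x,y)$ is the supremum, over null sets $Z$, of the infimum of $g$-lengths of Lipschitz paths from $x$ to $y$ meeting $Z$ only on a parameter set of measure zero. The volume measure $\mu_g$ is given simplexwise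 by $d\mu_g=\sqrt{\det(g_{ij})}\,dx_1\cdots dx_n$. $X^{k}$ denotes the $k$-skeleton. Admissible: in some (hence any) triangulation, all maximal simplexes have the same dimension $n=\dim X$, and for every connected open $U\subset X$ the set $U\setminus X^{n-2}$ is connected. $\partial X$ is the union of all non-maximal simplexes contained in only one maximal simplex; it is always assumed that $\partial X=\emptyset$. An $n$-circuit is a polyhedron of homogeneous dimension $n$ such that every $(n-1)$-simplex is a face of at most two $n$-simplexes (exactly two if $\partial X=\emptyset$) and $X\setminus X^{n-2}$ is connected. An ($n$-)pseudomanifold is an admissible ($n$-)circuit. Sobolev spaces. $W^{1,2}(X)$ is the completion of the space of Lipschitz functions $u:(X,d_X)\to\mathbb R$ with finite norm $\|u\|_{1,2}^2=\int_X(u^2+|\nabla u|^2)\,d\mu_g$, where $\nabla u$ is the Riemannian gradient, defined a.e. on each $n$-simplex. $\mathrm{Lip}_c(X)$: Lipschitz functions with compact support. $W^{1,2}_{\mathrm{loc}}(X)$: all $u\in L^2_{\mathrm{loc}}(X)$ with $u\in W^{1,2}(U)$ for all relatively compact subdomains $U\subset X$. $\|\nabla f\|_{L^1}=\int_X|\nabla f|\,d\mu_g$. $f\in W^{1,2}_{\mathrm{loc}}(X)$ is weakly subharmonic if $\int_X\langle\nabla f,\nabla\rho\rangle\,d\mu_g\le 0$ for every non-negative $\rho\in\mathrm{Lip}_c(X)$. *)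

theory Defs
  imports "HOL-Analysis.Analysis"
begin

definition simplicial_cplx :: "'v set set \<Rightarrow> bool" where
  "simplicial_cplx K \<longleftrightarrow>
     (\<forall>s\<in>K. finite s \<and> s \<noteq> {}) \<and>
     (\<forall>s\<in>K. \<forall>t. t \<subseteq> s \<and> t \<noteq> {} \<longrightarrow> t \<in> K)"

definition locally_finite_cplx :: "'v set set \<Rightarrow> bool" where
  "locally_finite_cplx K \<longleftrightarrow> (\<forall>v. finite {s \<in> K. v \<in> s})"

definition finite_dimensional_cplx :: "'v set set \<Rightarrow> bool" where
  "finite_dimensional_cplx K \<longleftrightarrow> (\<exists>N. \<forall>s\<in>K. card s \<le> N)"

definition maximal_simplices :: "'v set set \<Rightarrow> 'v set set" where
  "maximal_simplices K = {s \<in> K. \<forall>t\<in>K. s \<subseteq> t \<longrightarrow> t = s}"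

definition realization :: "'v set set \<Rightarrow> ('v \<Rightarrow> real) set" where
  "realization K =
     {\<alpha>. (\<forall>v. 0 \<le> \<alpha> v) \<and> {v. \<alpha> v \<noteq> 0} \<in> K \<and> (\<Sum>v | \<alpha> v \<noteq> 0. \<alpha> v) = 1}"

definition bary_dist :: "('v \<Rightarrow> real) \<Rightarrow> ('v \<Rightarrow> real) \<Rightarrow> real" where
  "bary_dist \<alpha> \<beta> = sqrt (\<Sum>v | \<alpha> v \<noteq> 0 \<or> \<beta> v \<noteq> 0. (\<alpha> v - \<beta> v)\<^sup>2)"

text \<open>Lipschitz conditions on homeomorphisms are local. A realization has barycentric diameter at
  most \<open>sqrt 2\<close>, so with a global condition no unbounded space would be a Lipschitz polyhedron and
  no infinite complex could be embedded as a closed subset of a Euclidean space.\<close>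

definition locally_lipschitz ::
  "'a set \<Rightarrow> ('a \<Rightarrow> 'a \<Rightarrow> real) \<Rightarrow> ('b \<Rightarrow> 'b \<Rightarrow> real) \<Rightarrow> ('a \<Rightarrow> 'b) \<Rightarrow> bool" where
  "locally_lipschitz S d d' F \<longleftrightarrow>
     (\<forall>x\<in>S. \<exists>r>0. \<exists>L. \<forall>y\<in>S. \<forall>z\<in>S. d x y < r \<and> d x z < r \<longrightarrow> d' (F y) (F z) \<le> L * d y z)"

definition lipschitz_homeo ::
  "'a set \<Rightarrow> ('a \<Rightarrow> 'a \<Rightarrow> real) \<Rightarrow> 'b set \<Rightarrow> ('b \<Rightarrow> 'b \<Rightarrow> real) \<Rightarrow> ('a \<Rightarrow> 'b) \<Rightarrow> bool" where
  "lipschitz_homeo S d T d' F \<longleftrightarrow>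
     bij_betw F S T \<and> locally_lipschitz S d d' F \<and> locally_lipschitz T d' d (the_inv_into S F)"

text \<open>The space \<open>X\<close> is the whole type \<open>'x\<close>; its class metric is the one that makes it a Lipschitz
  polyhedron, not the intrinsic distance. The data are the complex, the triangulation
  \<open>\<theta> : |K| \<rightarrow> X\<close>, the images of the vertices under the affine embedding of \<open>|K|\<close> in the
  Euclidean space \<open>'e\<close>, and the metrics \<open>g\<^sup>s\<close>: \<open>riem P s x \<xi> \<eta>\<close> is meaningful
  for a maximal simplex \<open>s\<close>, a point \<open>x\<close> of the embedded simplex, and \<open>\<xi>\<close>, \<open>\<eta>\<close> parallel to it.\<close>

record ('v, 'e, 'x) riem_poly =
  cplx :: "'v set set"
  tri  :: "('v \<Rightarrow> real) \<Rightarrow> 'x"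
  vert :: "'v \<Rightarrow> 'e"
  riem :: "'v set \<Rightarrow> 'e \<Rightarrow> 'e \<Rightarrow> 'e \<Rightarrow> real"

definition embed :: "('v, 'e::euclidean_space, 'x::metric_space) riem_poly \<Rightarrow> ('v \<Rightarrow> real) \<Rightarrow> 'e" where
  "embed P \<alpha> = (\<Sum>v | \<alpha> v \<noteq> 0. \<alpha> v *\<^sub>R vert P v)"

definition bary :: "('v, 'e::euclidean_space, 'x::metric_space) riem_poly \<Rightarrow> 'x \<Rightarrow> 'v \<Rightarrow> real" where
  "bary P x = the_inv_into (realization (cplx P)) (tri P) x"

definition coord :: "('v, 'e::euclidean_space, 'x::metric_space) riem_poly \<Rightarrow> 'x \<Rightarrow> 'e" where
  "coord P x = embed P (bary P x)"

text \<open>The simplex whose relative interior contains \<open>x\<close>.\<close>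

definition carrier_simplex :: "('v, 'e::euclidean_space, 'x::metric_space) riem_poly \<Rightarrow> 'x \<Rightarrow> 'v set" where
  "carrier_simplex P x = {v. bary P x v \<noteq> 0}"

definition closed_simplex :: "('v, 'e::euclidean_space, 'x::metric_space) riem_poly \<Rightarrow> 'v set \<Rightarrow> 'x set" where
  "closed_simplex P s = {x. carrier_simplex P x \<subseteq> s}"

definition tangent :: "('v, 'e::euclidean_space, 'x::metric_space) riem_poly \<Rightarrow> 'v set \<Rightarrow> 'e set" where
  "tangent P s = span {vert P v - vert P w | v w. v \<in> s \<and> w \<in> s}"

text \<open>The affine coordinates \<open>dx\<^sub>1 \<dots> dx\<^sub>n\<close> on \<open>s\<close> are its barycentric coordinates at the vertices other
  than a base vertex. Changing the base vertex is an affine change of coordinates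
  of determinant \<open>\<plusminus>1\<close>, so nothing below depends on it.\<close>

definition base_vertex :: "'v set \<Rightarrow> 'v" where
  "base_vertex s = (SOME v. v \<in> s)"

definition free_vertices :: "'v set \<Rightarrow> 'v set" where
  "free_vertices s = s - {base_vertex s}"

definition param_simplex :: "'v set \<Rightarrow> ('v \<Rightarrow> real) set" where
  "param_simplex s =
     {c \<in> extensional (free_vertices s).
        (\<forall>v\<in>free_vertices s. 0 \<le> c v) \<and> (\<Sum>v\<in>free_vertices s. c v) \<le> 1}"

definition param_point :: "'v set \<Rightarrow> ('v \<Rightarrow> real) \<Rightarrow> 'v \<Rightarrow> real" where
  "param_point s c v =
     (if v \<in> free_vertices s then c v
      else if v = base_vertex s then 1 - (\<Sum>w\<in>free_vertices s. c w)
      else 0)"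

definition simplex_lebesgue :: "'v set \<Rightarrow> ('v \<Rightarrow> real) measure" where
  "simplex_lebesgue s =
     restrict_space (completion (Pi\<^sub>M (free_vertices s) (\<lambda>_. lborel))) (param_simplex s)"

definition frame :: "('v, 'e::euclidean_space, 'x::metric_space) riem_poly \<Rightarrow> 'v set \<Rightarrow> 'v \<Rightarrow> 'e" where
  "frame P s i = vert P i - vert P (base_vertex s)"

definition riem_comp ::
  "('v, 'e::euclidean_space, 'x::metric_space) riem_poly \<Rightarrow> 'v set \<Rightarrow> ('v \<Rightarrow> real) \<Rightarrow> 'v \<Rightarrow> 'v \<Rightarrow> real" where
  "riem_comp P s c i j = riem P s (embed P (param_point s c)) (frame P s i) (frame P s j)"

definition inner_product_on :: "'e::real_vector set \<Rightarrow> ('e \<Rightarrow> 'e \<Rightarrow> real) \<Rightarrow> bool" where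
  "inner_product_on T B \<longleftrightarrow>
     (\<forall>\<xi>\<in>T. \<forall>\<eta>\<in>T. B \<xi> \<eta> = B \<eta> \<xi>) \<and>
     (\<forall>\<xi>\<in>T. \<forall>\<eta>\<in>T. \<forall>\<zeta>\<in>T. B (\<xi> + \<eta>) \<zeta> = B \<xi> \<zeta> + B \<eta> \<zeta>) \<and>
     (\<forall>a. \<forall>\<xi>\<in>T. \<forall>\<zeta>\<in>T. B (a *\<^sub>R \<xi>) \<zeta> = a * B \<xi> \<zeta>) \<and>
     (\<forall>\<xi>\<in>T. \<xi> \<noteq> 0 \<longrightarrow> 0 < B \<xi> \<xi>)"

definition lipschitz_polyhedron ::
  "('v, 'e::euclidean_space, 'x::metric_space) riem_poly \<Rightarrow> bool" where
  "lipschitz_polyhedron P \<longleftrightarrow>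
     connected (UNIV :: 'x set) \<and> locally compact (UNIV :: 'x set) \<and>
     (\<exists>D :: 'x set. countable D \<and> closure D = UNIV) \<and>
     simplicial_cplx (cplx P) \<and> countable (cplx P) \<and>
     locally_finite_cplx (cplx P) \<and> finite_dimensional_cplx (cplx P) \<and>
     lipschitz_homeo (realization (cplx P)) bary_dist UNIV dist (tri P)"

definition euclidean_embedding ::
  "('v, 'e::euclidean_space, 'x::metric_space) riem_poly \<Rightarrow> bool" where
  "euclidean_embedding P \<longleftrightarrow>
     lipschitz_homeo (realization (cplx P)) bary_dist (embed P ` realization (cplx P)) dist (embed P) \<and>
     closed (embed P ` realization (cplx P))"

definition riemannian_polyhedron ::
  "('v, 'e::euclidean_space, 'x::metric_space) riem_poly \<Rightarrow> bool" where
  "riemannian_polyhedron P \<longleftrightarrow>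
     lipschitz_polyhedron P \<and> euclidean_embedding P \<and>
     (\<forall>s\<in>maximal_simplices (cplx P). \<forall>i\<in>free_vertices s. \<forall>j\<in>free_vertices s.
        (\<lambda>c. riem_comp P s c i j) \<in> borel_measurable (simplex_lebesgue s)) \<and>
     (\<exists>\<Lambda>>0. \<forall>s\<in>maximal_simplices (cplx P). AE c in simplex_lebesgue s.
        (let B = riem P s (embed P (param_point s c)) in
           inner_product_on (tangent P s) B \<and>
           (\<forall>\<xi>\<in>tangent P s. (norm \<xi>)\<^sup>2 / \<Lambda>\<^sup>2 \<le> B \<xi> \<xi> \<and> B \<xi> \<xi> \<le> \<Lambda>\<^sup>2 * (norm \<xi>)\<^sup>2)))"

text \<open>The Leibniz formula, as in the library definition of \<open>det\<close>, for matrices indexed by a finite set.\<close>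

definition det_on :: "'v set \<Rightarrow> ('v \<Rightarrow> 'v \<Rightarrow> real) \<Rightarrow> real" where
  "det_on I A = (\<Sum>p | p permutes I. of_int (sign p) * (\<Prod>i\<in>I. A i (p i)))"

definition simplex_volume ::
  "('v, 'e::euclidean_space, 'x::metric_space) riem_poly \<Rightarrow> 'v set \<Rightarrow> 'x measure" where
  "simplex_volume P s =
     distr (density (simplex_lebesgue s)
              (\<lambda>c. ennreal (sqrt (det_on (free_vertices s) (riem_comp P s c)))))
       borel (\<lambda>c. tri P (param_point s c))"

text \<open>The volume is completed because the coefficients of \<open>g\<close>, and hence gradients, are only
  Lebesgue measurable.\<close>

definition vol :: "('v, 'e::euclidean_space, 'x::metric_space) riem_poly \<Rightarrow> 'x measure" where
  "vol P = completion (measure_of UNIV (sets borel)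
     (\<lambda>A. \<integral>\<^sup>+ s. emeasure (simplex_volume P s) A \<partial>count_space (maximal_simplices (cplx P))))"

text \<open>\<open>\<langle>\<xi>,\<eta>\<rangle>\<close> at \<open>x\<close>; almost every \<open>x\<close> is interior to a maximal simplex.\<close>

definition ginner :: "('v, 'e::euclidean_space, 'x::metric_space) riem_poly \<Rightarrow> 'x \<Rightarrow> 'e \<Rightarrow> 'e \<Rightarrow> real" where
  "ginner P x \<xi> \<eta> = riem P (carrier_simplex P x) (coord P x) \<xi> \<eta>"

definition gnorm :: "('v, 'e::euclidean_space, 'x::metric_space) riem_poly \<Rightarrow> 'x \<Rightarrow> 'e \<Rightarrow> real" where
  "gnorm P x \<xi> = sqrt (ginner P x \<xi> \<xi>)"

definition glength :: "('v, 'e::euclidean_space, 'x::metric_space) riem_poly \<Rightarrow> (real \<Rightarrow> 'x) \<Rightarrow> ennreal" where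
  "glength P \<gamma> =
     (\<integral>\<^sup>+ t\<in>{0..1}. ennreal (gnorm P (\<gamma> t)
        (vector_derivative (\<lambda>\<tau>. coord P (\<gamma> \<tau>)) (at t within {0..1}))) \<partial>lebesgue)"

definition lipschitz_paths :: "'x::metric_space set \<Rightarrow> 'x \<Rightarrow> 'x \<Rightarrow> (real \<Rightarrow> 'x) set" where
  "lipschitz_paths Z x y =
     {\<gamma>. (\<exists>L. L-lipschitz_on {0..1} \<gamma>) \<and> \<gamma> 0 = x \<and> \<gamma> 1 = y \<and>
         {t \<in> {0..1}. \<gamma> t \<in> Z} \<in> null_sets lebesgue}"

definition gdist :: "('v, 'e::euclidean_space, 'x::metric_space) riem_poly \<Rightarrow> 'x \<Rightarrow> 'x \<Rightarrow> ennreal" where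
  "gdist P x y = (SUP Z\<in>null_sets (vol P). INF \<gamma>\<in>lipschitz_paths Z x y. glength P \<gamma>)"

text \<open>The dimension is an integer, so that the \<open>(n - 2)\<close>-skeleton is empty for \<open>n < 2\<close>.\<close>

definition skeleton :: "('v, 'e::euclidean_space, 'x::metric_space) riem_poly \<Rightarrow> int \<Rightarrow> 'x set" where
  "skeleton P k = (\<Union>s\<in>{s \<in> cplx P. int (card s) - 1 \<le> k}. closed_simplex P s)"

definition homogeneous_dim :: "('v, 'e::euclidean_space, 'x::metric_space) riem_poly \<Rightarrow> nat \<Rightarrow> bool" where
  "homogeneous_dim P n \<longleftrightarrow> (\<forall>s\<in>maximal_simplices (cplx P). card s = n + 1)"

definition admissible :: "('v, 'e::euclidean_space, 'x::metric_space) riem_poly \<Rightarrow> nat \<Rightarrow> bool" where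
  "admissible P n \<longleftrightarrow>
     homogeneous_dim P n \<and>
     (\<forall>U. open U \<and> connected U \<longrightarrow> connected (U - skeleton P (int n - 2)))"

definition poly_boundary :: "('v, 'e::euclidean_space, 'x::metric_space) riem_poly \<Rightarrow> 'x set" where
  "poly_boundary P =
     (\<Union>s\<in>{s \<in> cplx P - maximal_simplices (cplx P). \<exists>!t. t \<in> maximal_simplices (cplx P) \<and> s \<subseteq> t}.
        closed_simplex P s)"

definition circuit :: "('v, 'e::euclidean_space, 'x::metric_space) riem_poly \<Rightarrow> nat \<Rightarrow> bool" where
  "circuit P n \<longleftrightarrow>
     homogeneous_dim P n \<and>
     (\<forall>s\<in>cplx P. card s = n \<longrightarrow> card {t \<in> cplx P. card t = n + 1 \<and> s \<subseteq> t} \<le> 2) \<and>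
     connected (UNIV - skeleton P (int n - 2))"

definition pseudomanifold :: "('v, 'e::euclidean_space, 'x::metric_space) riem_poly \<Rightarrow> nat \<Rightarrow> bool" where
  "pseudomanifold P n \<longleftrightarrow> admissible P n \<and> circuit P n"

definition glipschitz_on ::
  "('v, 'e::euclidean_space, 'x::metric_space) riem_poly \<Rightarrow> 'x set \<Rightarrow> ('x \<Rightarrow> real) \<Rightarrow> bool" where
  "glipschitz_on P U u \<longleftrightarrow>
     (\<exists>L. \<forall>x\<in>U. \<forall>y\<in>U. ennreal \<bar>u x - u y\<bar> \<le> ennreal L * gdist P x y)"

definition Lip_c :: "('v, 'e::euclidean_space, 'x::metric_space) riem_poly \<Rightarrow> ('x \<Rightarrow> real) set" where
  "Lip_c P = {h. glipschitz_on P UNIV h \<and> compact (closure {x. h x \<noteq> 0})}"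

text \<open>The Riemannian gradient: the tangent vector representing the differential of \<open>u\<close>, read in the
  embedded simplex. It is unspecified where \<open>u\<close> is not differentiable.\<close>

definition rgrad ::
  "('v, 'e::euclidean_space, 'x::metric_space) riem_poly \<Rightarrow> ('x \<Rightarrow> real) \<Rightarrow> 'x \<Rightarrow> 'e" where
  "rgrad P u x =
     (THE G. G \<in> tangent P (carrier_simplex P x) \<and>
        (\<exists>D. ((\<lambda>y. u (the_inv (coord P) y)) has_derivative D)
                (at (coord P x) within coord P ` closed_simplex P (carrier_simplex P x)) \<and>
             (\<forall>\<xi>\<in>tangent P (carrier_simplex P x). ginner P x G \<xi> = D \<xi>)))"

definition lip12 ::
  "('v, 'e::euclidean_space, 'x::metric_space) riem_poly \<Rightarrow> 'x set \<Rightarrow> ('x \<Rightarrow> real) set" where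
  "lip12 P U =
     {u. glipschitz_on P U u \<and>
         (\<integral>\<^sup>+ x\<in>U. ennreal ((u x)\<^sup>2 + (gnorm P x (rgrad P u x))\<^sup>2) \<partial>vol P) < \<infinity>}"

text \<open>The completion of \<open>lip12 P U\<close> is realized as the closure in \<open>L\<^sup>2\<close> of the pairs \<open>(u, \<nabla>u)\<close>;
  \<open>sobolev_grad P U u G\<close> states that \<open>u\<close> belongs to it, with gradient \<open>G\<close> on \<open>U\<close>.\<close>

definition sobolev_grad ::
  "('v, 'e::euclidean_space, 'x::metric_space) riem_poly \<Rightarrow> 'x set \<Rightarrow> ('x \<Rightarrow> real) \<Rightarrow> ('x \<Rightarrow> 'e) \<Rightarrow> bool" where
  "sobolev_grad P U u G \<longleftrightarrow>
     set_borel_measurable (vol P) U u \<and> set_borel_measurable (vol P) U G \<and>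
     (AE x in vol P. x \<in> U \<longrightarrow> G x \<in> tangent P (carrier_simplex P x)) \<and>
     (\<exists>\<phi>. (\<forall>k::nat. \<phi> k \<in> lip12 P U) \<and>
          (\<lambda>k. \<integral>\<^sup>+ x\<in>U. ennreal ((\<phi> k x - u x)\<^sup>2 + (gnorm P x (rgrad P (\<phi> k) x - G x))\<^sup>2) \<partial>vol P)
             \<longlonglongrightarrow> 0)"

definition W12 :: "('v, 'e::euclidean_space, 'x::metric_space) riem_poly \<Rightarrow> 'x set \<Rightarrow> ('x \<Rightarrow> real) set" where
  "W12 P U = {u. \<exists>G. sobolev_grad P U u G}"

definition L2_loc :: "('v, 'e::euclidean_space, 'x::metric_space) riem_poly \<Rightarrow> ('x \<Rightarrow> real) set" where
  "L2_loc P =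
     {u. u \<in> borel_measurable (vol P) \<and>
         (\<forall>C. compact C \<longrightarrow> (\<integral>\<^sup>+ x\<in>C. ennreal ((u x)\<^sup>2) \<partial>vol P) < \<infinity>)}"

definition rel_compact_domain :: "'x::metric_space set \<Rightarrow> bool" where
  "rel_compact_domain U \<longleftrightarrow> open U \<and> connected U \<and> U \<noteq> {} \<and> compact (closure U)"

definition W12_loc :: "('v, 'e::euclidean_space, 'x::metric_space) riem_poly \<Rightarrow> ('x \<Rightarrow> real) set" where
  "W12_loc P = {u. u \<in> L2_loc P \<and> (\<forall>U. rel_compact_domain U \<longrightarrow> u \<in> W12 P U)}"

text \<open>The gradient of an element of \<open>W12_loc P\<close>, which is determined almost everywhere.\<close>

definition sgrad ::
  "('v, 'e::euclidean_space, 'x::metric_space) riem_poly \<Rightarrow> ('x \<Rightarrow> real) \<Rightarrow> 'x \<Rightarrow> 'e" where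
  "sgrad P f = (SOME G. \<forall>U. rel_compact_domain U \<longrightarrow> sobolev_grad P U f G)"

definition weakly_subharmonic ::
  "('v, 'e::euclidean_space, 'x::metric_space) riem_poly \<Rightarrow> ('x \<Rightarrow> real) \<Rightarrow> bool" where
  "weakly_subharmonic P f \<longleftrightarrow>
     f \<in> W12_loc P \<and>
     (\<forall>\<rho>\<in>Lip_c P. (\<forall>x. 0 \<le> \<rho> x) \<longrightarrow>
        (\<integral>x. ginner P x (sgrad P f x) (rgrad P \<rho> x) \<partial>vol P) \<le> 0)"

definition locally_finite_borel :: "'x::topological_space measure \<Rightarrow> bool" where
  "locally_finite_borel m \<longleftrightarrow>
     sets m = sets borel \<and> (\<forall>x. \<exists>U. open U \<and> x \<in> U \<and> emeasure m U < \<infinity>)"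

end

theory Submission
  imports Defs
begin

text \<open>The map sending \<open>h\<close> to \<open>- \<integral>\<langle>\<nabla>f,\<nabla>h\<rangle>\<close> is a linear functional on the compactly supported Lipschitz functions,
  and subharmonicity makes it positive, so it is integration against a unique locally finite measure.
  For the functional to make sense one needs that Lipschitz functions for the intrinsic distance are
  Lipschitz in the parameters of each simplex, because the intrinsic and Euclidean distances
  are comparable there. Rademacher's theorem then provides their gradients almost everywhere and makes these
  linear, and the bound on gradients makes the integrand integrable. Finally \<open>\<nabla>f\<close> has
  to be a single vector field: gradients on different domains agree almost everywhere by
  integration by parts, and they are glued along the open maximal simplices.\<close>

section \<open>Riesz representation on Lipschitz functions\<close>

text \<open>The test functions form only a part of the continuous functions with compact support, so
  the measure is built from them directly, by an outer measure of Daniell type. The locale lists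
  what this construction uses: \<open>comp\<close> supplies positive parts and truncations,
  \<open>cutoff\<close> approximates the indicator of an open set from below by multipliers that
  start at 0 so that their increments telescope, and \<open>exhaust\<close> replaces the constant 1,
  which need not have compact support. The analysis on the polyhedron takes place in the open
  maximal simplices, which fill it up to a null set. One ellipticity constant \<open>Lam\<close>
  compares g with the Euclidean metric almost everywhere. It bounds the pairing of \<nabla>f with
  the gradient of a Lipschitz function by a multiple of the length of \<nabla>f, and it bounds the
  volume density from below, so that null sets and L2 limits pass from the polyhedron to the
  parameters. A Lipschitz function on part of a simplex is first extended to the whole parameter
  space; translations and Fubini are then available, and test functions supported in boxes leave no
  boundary terms.\<close>

locale lipschitz_functional =
  fixes Lc :: "('x::metric_space \<Rightarrow> real) set" and T :: "('x \<Rightarrow> real) \<Rightarrow> real"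
  assumes cont: "h \<in> Lc \<Longrightarrow> continuous_on UNIV h"
    and supp: "h \<in> Lc \<Longrightarrow> compact (closure {x. h x \<noteq> 0})"
    and add: "h \<in> Lc \<Longrightarrow> k \<in> Lc \<Longrightarrow> (\<lambda>x. h x + k x) \<in> Lc"
    and scale: "h \<in> Lc \<Longrightarrow> (\<lambda>x. a * h x) \<in> Lc"
    and comp: "h \<in> Lc \<Longrightarrow> 1-lipschitz_on UNIV F \<Longrightarrow> F 0 = (0::real) \<Longrightarrow> (\<lambda>x. F (h x)) \<in> Lc"
    and cutoff: "open U \<Longrightarrow> \<exists>g :: nat \<Rightarrow> 'x \<Rightarrow> real. (\<forall>x. g 0 x = 0) \<and>
        (\<forall>k x. g k x \<le> g (Suc k) x \<and> g k x \<le> 1) \<and> (\<forall>k x. x \<notin> U \<longrightarrow> g k x = 0) \<and>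
        (\<forall>x\<in>U. \<exists>k. g k x = 1) \<and> (\<forall>k. \<forall>h\<in>Lc. (\<lambda>x. g k x * h x) \<in> Lc)"
    and exhaust: "\<exists>\<eta> :: nat \<Rightarrow> 'x \<Rightarrow> real. \<forall>k x. \<eta> k \<in> Lc \<and> 0 \<le> \<eta> k x \<and> \<eta> k x \<le> \<eta> (Suc k) x \<and>
        \<eta> k x \<le> 1 \<and> (\<exists>j. \<eta> j x = 1)"
    and T_add: "h \<in> Lc \<Longrightarrow> k \<in> Lc \<Longrightarrow> T (\<lambda>x. h x + k x) = T h + T k"
    and T_scale: "h \<in> Lc \<Longrightarrow> T (\<lambda>x. a * h x) = a * T h"
    and T_pos: "h \<in> Lc \<Longrightarrow> (\<And>x. 0 \<le> h x) \<Longrightarrow> 0 \<le> T h"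
begin

lemma zero: "(\<lambda>x. 0) \<in> Lc"
  using exhaust scale[of _ 0] by fastforce

lemma T_zero: "T (\<lambda>x. 0) = 0"
  using T_scale[OF zero, of 0] by simp

lemma diff: "h \<in> Lc \<Longrightarrow> k \<in> Lc \<Longrightarrow> (\<lambda>x. h x - k x) \<in> Lc"
  using add[OF _ scale[of k "-1"], of h] by simp

lemma T_diff: "h \<in> Lc \<Longrightarrow> k \<in> Lc \<Longrightarrow> T (\<lambda>x. h x - k x) = T h - T k"
  using T_add[OF _ scale[of k "-1"], of h] T_scale[of k "-1"] by simp

lemma T_mono:
  assumes "h \<in> Lc" "k \<in> Lc" "\<And>x. h x \<le> k x"
  shows "T h \<le> T k"
  using T_pos[OF diff[OF assms(2,1)]] T_diff[OF assms(2,1)] assms(3) by simp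

lemma sum_Lc: "finite I \<Longrightarrow> (\<And>i. i \<in> I \<Longrightarrow> h i \<in> Lc) \<Longrightarrow> (\<lambda>x. \<Sum>i\<in>I. h i x) \<in> Lc"
  by (induction I rule: finite_induct) (auto intro: zero add)

lemma T_sum: "finite I \<Longrightarrow> (\<And>i. i \<in> I \<Longrightarrow> h i \<in> Lc) \<Longrightarrow> T (\<lambda>x. \<Sum>i\<in>I. h i x) = (\<Sum>i\<in>I. T (h i))"
  by (induction I rule: finite_induct) (auto simp: T_zero T_add sum_Lc)

definition pos :: "('x \<Rightarrow> real) set" where
  "pos = {h \<in> Lc. \<forall>x. 0 \<le> h x}"

lemma compact_incseq_cover:
  fixes W :: "nat \<Rightarrow> 'x set"
  assumes "compact K" "\<And>n. open (W n)" "incseq W" "K \<subseteq> (\<Union>n. W n)"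
  shows "\<exists>n. K \<subseteq> W n"
proof -
  obtain N where N: "finite N" "K \<subseteq> (\<Union>n\<in>N. W n)"
    using compactE_image[OF assms(1), of UNIV W] assms by auto
  then have "W n \<subseteq> W (Max (insert 0 N))" if "n \<in> N" for n
    using that by (intro incseqD[OF assms(3)]) auto
  with N show ?thesis by blast
qed

lemma bump:
  assumes "compact K"
  obtains b where "b \<in> pos" "\<And>x. x \<in> K \<Longrightarrow> 1 \<le> b x"
proof -
  obtain \<eta> :: "nat \<Rightarrow> 'x \<Rightarrow> real" where \<eta>: "\<And>k. \<eta> k \<in> Lc" "\<And>k x. 0 \<le> \<eta> k x"
    "\<And>k x. \<eta> k x \<le> \<eta> (Suc k) x" "\<And>x. \<exists>j. \<eta> j x = 1"
    using exhaust by metis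
  \<comment> \<open>Any level below 1 would do: it makes the sets open while they still exhaust the
    space. Doubling \<open>\<eta> n\<close> restores the bound 1 on K.\<close>
  define W where "W k = {x. 1/2 < \<eta> k x}" for k
  have "\<exists>n. K \<subseteq> W n"
  proof (rule compact_incseq_cover[OF assms])
    show "open (W n)" for n
      unfolding W_def using cont[OF \<eta>(1)] by (intro open_Collect_less) auto
    show "incseq W"
      unfolding W_def using \<eta>(3) by (intro incseq_SucI) (auto intro: less_le_trans)
    show "K \<subseteq> (\<Union>n. W n)"
    proof
      fix x obtain j where "\<eta> j x = 1" using \<eta>(4) by blast
      then show "x \<in> (\<Union>n. W n)" by (auto simp: W_def intro!: exI[of _ j])
    qed
  qed
  then obtain n where "K \<subseteq> W n" by blast
  then show thesis
    using \<eta> scale[OF \<eta>(1), of 2 n]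
    by (intro that[of "\<lambda>x. 2 * \<eta> n x"]) (auto simp: pos_def W_def dest!: subsetD)
qed

text \<open>On the compact support of \<open>u\<close>, finitely many of the \<open>h n\<close> sum to more than \<open>u - e\<close>.\<close>

lemma dini:
  assumes u: "u \<in> pos" and h: "\<And>n. h n \<in> pos"
    and le: "\<And>x. ennreal (u x) \<le> (\<Sum>n::nat. ennreal (h n x))"
  shows "ennreal (T u) \<le> (\<Sum>n. ennreal (T (h n)))"
proof -
  obtain b where b: "b \<in> pos" "\<And>x. x \<in> closure {x. u x \<noteq> 0} \<Longrightarrow> 1 \<le> b x"
    using bump[OF supp] u unfolding pos_def by blast
  have Tpos: "0 \<le> T k" if "k \<in> pos" for k using that T_pos by (auto simp: pos_def)
  \<comment> \<open>The error term is a multiple of the bump b rather than a constant, since it has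
    to be a test function; it only has to dominate e on the support of u.\<close>
  have key: "ennreal (T u) \<le> (\<Sum>n. ennreal (T (h n))) + ennreal (e * T b)" if e: "0 < e" for e :: real
  proof -
    define W where "W N = {x. u x < (\<Sum>n<N. h n x) + e}" for N
    have "\<exists>N. closure {x. u x \<noteq> 0} \<subseteq> W N"
    proof (rule compact_incseq_cover)
      show "compact (closure {x. u x \<noteq> 0})" using supp u by (auto simp: pos_def)
      show "open (W n)" for n
        unfolding W_def using cont u h
        by (intro open_Collect_less continuous_intros) (auto simp: pos_def)
      show "incseq W"
        unfolding W_def using h by (intro incseq_SucI) (auto simp: pos_def intro: less_le_trans)
      have "\<exists>N. u x < (\<Sum>n<N. h n x) + e" for x
      proof (cases "u x < e")
        case True then show ?thesis by (intro exI[of _ 0]) auto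
      next
        case False
        have "ennreal (u x - e) < ennreal (u x)" using e False by (intro ennreal_lessI) auto
        also note le[of x]
        finally have "\<exists>N. ennreal (u x - e) < (\<Sum>n<N. ennreal (h n x))"
          by (simp add: suminf_eq_SUP less_SUP_iff)
        then obtain N where "ennreal (u x - e) < ennreal (\<Sum>n<N. h n x)"
          using h by (auto simp: sum_ennreal pos_def)
        then show ?thesis using False by (subst (asm) ennreal_less_iff) (auto intro!: exI[of _ N])
      qed
      then show "closure {x. u x \<noteq> 0} \<subseteq> (\<Union>n. W n)" by (auto simp: W_def)
    qed
    then obtain N where N: "\<And>x. x \<in> closure {x. u x \<noteq> 0} \<Longrightarrow> u x < (\<Sum>n<N. h n x) + e"
      by (auto simp: W_def)
    have "u x \<le> (\<Sum>n<N. h n x) + e * b x" for x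
    proof (cases "u x = 0")
      case True
      then show ?thesis using h b(1) e by (auto simp: pos_def intro!: add_nonneg_nonneg sum_nonneg)
    next
      case False
      then have "x \<in> closure {x. u x \<noteq> 0}"
        using closure_subset[of "{x. u x \<noteq> 0}"] by (metis (mono_tags) mem_Collect_eq subsetD)
      then have "u x \<le> (\<Sum>n<N. h n x) + e * 1" "e * 1 \<le> e * b x"
        using N[of x] b(2)[of x] e by (auto intro: mult_left_mono)
      then show ?thesis by linarith
    qed
    then have "T u \<le> T (\<lambda>x. (\<Sum>n<N. h n x) + e * b x)"
      using u h b by (intro T_mono add sum_Lc scale) (auto simp: pos_def)
    also have "\<dots> = (\<Sum>n<N. T (h n)) + e * T b"
      using h b by (subst T_add, auto intro!: sum_Lc scale simp: pos_def T_scale T_sum)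
    finally have "ennreal (T u) \<le> ennreal (\<Sum>n<N. T (h n)) + ennreal (e * T b)"
      using Tpos h b e by (subst ennreal_plus[symmetric]) (auto intro!: sum_nonneg ennreal_leI)
    also have "ennreal (\<Sum>n<N. T (h n)) = (\<Sum>n<N. ennreal (T (h n)))"
      using Tpos h by (auto simp: sum_ennreal)
    also have "\<dots> \<le> (\<Sum>n. ennreal (T (h n)))"
      by (intro sum_le_suminf) auto
    finally show ?thesis by (simp add: add_right_mono)
  qed
  show ?thesis
  proof (rule ennreal_le_epsilon)
    fix e :: real assume e: "0 < e"
    \<comment> \<open>Dividing by \<open>T b + 1\<close> instead of \<open>T b\<close> covers the
      case \<open>T b = 0\<close>.\<close>
    have "e / (T b + 1) * T b \<le> e"
      using e Tpos[OF b(1)] by (simp add: field_simps)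
    then show "ennreal (T u) \<le> (\<Sum>n. ennreal (T (h n))) + ennreal e"
      using key[of "e / (T b + 1)"] e Tpos[OF b(1)]
      by (smt (verit) add_left_mono divide_pos_pos ennreal_leI order_trans)
  qed
qed

section \<open>The outer measure\<close>

definition covers :: "'x set \<Rightarrow> (nat \<Rightarrow> 'x \<Rightarrow> real) set" where
  "covers A = {h. (\<forall>n. h n \<in> pos) \<and> (\<forall>x\<in>A. 1 \<le> (\<Sum>n. ennreal (h n x)))}"

text \<open>Covering by countable sums of functions, rather than by single functions, builds
  countable subadditivity into the definition. It is \<open>dini\<close> that keeps the infimum from
  collapsing.\<close>

definition \<mu> :: "'x set \<Rightarrow> ennreal" where
  "\<mu> A = (INF h\<in>covers A. \<Sum>n. ennreal (T (h n)))"

text \<open>Covers indexed by pairs are flattened along \<open>prod_decode\<close>; with nonnegative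
  terms the rearrangement changes neither the pointwise sums nor the total cost. Subadditivity and
  the splitting by an open set both produce such double families.\<close>

lemma \<mu>_le_double:
  fixes H :: "nat \<Rightarrow> nat \<Rightarrow> 'x \<Rightarrow> real"
  assumes H: "\<And>n k. H n k \<in> pos" and A: "\<And>x. x \<in> A \<Longrightarrow> 1 \<le> (\<Sum>n. \<Sum>k. ennreal (H n k x))"
  shows "\<mu> A \<le> (\<Sum>n. \<Sum>k. ennreal (T (H n k)))"
proof -
  define G where "G m = (case prod_decode m of (n, k) \<Rightarrow> H n k)" for m
  have sums: "(\<Sum>m. ennreal (\<phi> (G m))) = (\<Sum>n. \<Sum>k. ennreal (\<phi> (H n k)))" for \<phi>
    using suminf_ennreal_2dimen[of "\<lambda>n. \<Sum>k. ennreal (\<phi> (H n k))" "\<lambda>(n, k). ennreal (\<phi> (H n k))"]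
    by (simp add: G_def comp_def case_prod_beta)
  have "G \<in> covers A"
    using A sums[of "\<lambda>h. h x" for x] by (auto simp: covers_def) (auto simp: G_def H split: prod.split)
  then have "\<mu> A \<le> (\<Sum>m. ennreal (T (G m)))"
    unfolding \<mu>_def by (rule INF_lower)
  then show ?thesis using sums[of T] by simp
qed

lemma \<mu>_le:
  assumes "u \<in> pos" "\<And>x. x \<in> A \<Longrightarrow> 1 \<le> u x"
  shows "\<mu> A \<le> ennreal (T u)"
proof -
  define h :: "nat \<Rightarrow> 'x \<Rightarrow> real" where "h n = (if n = 0 then u else (\<lambda>x. 0))" for n
  have s: "(\<Sum>n. ennreal (\<phi> (h n))) = ennreal (\<phi> u)" if "\<phi> (\<lambda>x. 0) = (0::real)" for \<phi>
    using that by (subst suminf_finite[of "{0}"]) (auto simp: h_def)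
  have "h \<in> covers A"
    unfolding covers_def
  proof (intro CollectI conjI allI ballI)
    show "h n \<in> pos" for n using assms(1) zero by (simp add: h_def pos_def)
    show "1 \<le> (\<Sum>n. ennreal (h n x))" if "x \<in> A" for x
      using assms(2)[OF that] s[of "\<lambda>h. h x"] by simp
  qed
  then have "\<mu> A \<le> (\<Sum>m. ennreal (T (h m)))"
    unfolding \<mu>_def by (rule INF_lower)
  then show ?thesis using s[of T] T_zero by simp
qed

text \<open>Any cover of A dominates u pointwise, because u is at most 1 on A and zero elsewhere,
  and \<open>dini\<close> turns this into an inequality under T. Together with
  \<open>\<mu>_le\<close> it encloses T of a slice between outer measures of superlevel
  sets.\<close>

lemma le_\<mu>:
  assumes "u \<in> pos" "\<And>x. u x \<le> 1" "\<And>x. x \<notin> A \<Longrightarrow> u x = 0"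
  shows "ennreal (T u) \<le> \<mu> A"
  unfolding \<mu>_def
proof (rule INF_greatest)
  fix h assume "h \<in> covers A"
  then have h: "\<And>n. h n \<in> pos" "\<And>x. x \<in> A \<Longrightarrow> 1 \<le> (\<Sum>n. ennreal (h n x))"
    by (auto simp: covers_def)
  have "ennreal (u x) \<le> (\<Sum>n. ennreal (h n x))" for x
  proof (cases "x \<in> A")
    case True
    have "ennreal (u x) \<le> 1" using assms(2)[of x] by (simp add: ennreal_le_1)
    with h(2)[OF True] show ?thesis by (rule order_trans[rotated])
  qed (simp add: assms(3))
  then show "ennreal (T u) \<le> (\<Sum>n. ennreal (T (h n)))"
    using dini assms h by blast
qed

lemma \<mu>_mono: "A \<subseteq> B \<Longrightarrow> \<mu> A \<le> \<mu> B"
  unfolding \<mu>_def by (intro INF_superset_mono) (auto simp: covers_def)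

lemma \<mu>_empty: "\<mu> {} = 0"
  using \<mu>_le[of "\<lambda>x. 0" "{}"] zero T_zero by (auto simp: pos_def)

lemma near_cover:
  assumes "\<mu> A \<noteq> \<infinity>" "0 < (e::real)"
  obtains h where "h \<in> covers A" "(\<Sum>n. ennreal (T (h n))) \<le> \<mu> A + ennreal e"
proof -
  have "\<mu> A < \<mu> A + ennreal e" using assms by (simp add: ennreal_add_left_cancel_less less_top)
  then obtain h where "h \<in> covers A" "(\<Sum>n. ennreal (T (h n))) < \<mu> A + ennreal e"
    unfolding \<mu>_def by (subst (asm) INF_less_iff) auto
  then show thesis using that by auto
qed

lemma suminf_half_powers: "0 \<le> (e::real) \<Longrightarrow> (\<Sum>n. ennreal (e * (1/2) ^ Suc n)) = ennreal e"
proof -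
  assume e: "0 \<le> e"
  have "(\<lambda>n. e * (1/2) ^ Suc n) sums (e * 1)"
    by (intro sums_mult power_half_series)
  then show ?thesis using e by (intro suminf_ennreal_eq) auto
qed

lemma \<mu>_subadditive: "\<mu> (\<Union>n. A n) \<le> (\<Sum>n::nat. \<mu> (A n))"
proof (cases "(\<Sum>n. \<mu> (A n)) = \<infinity>")
  case False
  then have fin: "\<mu> (A n) \<noteq> \<infinity>" for n
    by (metis ennreal_suminf_lessD infinity_ennreal_def less_top)
  show ?thesis
  proof (rule ennreal_le_epsilon)
    fix e :: real assume e: "0 < e"
    have "\<exists>h. h \<in> covers (A n) \<and> (\<Sum>k. ennreal (T (h k))) \<le> \<mu> (A n) + ennreal (e * (1/2) ^ Suc n)" for n
      using near_cover[OF fin, of "e * (1/2) ^ Suc n" n] e by (metis mult_pos_pos zero_less_power half_gt_zero zero_less_one)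
    then obtain H where H: "\<And>n. H n \<in> covers (A n)"
      "\<And>n. (\<Sum>k. ennreal (T (H n k))) \<le> \<mu> (A n) + ennreal (e * (1/2) ^ Suc n)"
      by metis
    have "1 \<le> (\<Sum>n. \<Sum>k. ennreal (H n k x))" if "x \<in> (\<Union>n. A n)" for x
    proof -
      from that obtain m where "x \<in> A m" by auto
      then have "1 \<le> (\<Sum>k. ennreal (H m k x))" using H(1)[of m] by (auto simp: covers_def)
      also have "\<dots> \<le> (\<Sum>n. \<Sum>k. ennreal (H n k x))"
        using sum_le_suminf[of "\<lambda>n. \<Sum>k. ennreal (H n k x)" "{m}"] by auto
      finally show ?thesis .
    qed
    then have "\<mu> (\<Union>n. A n) \<le> (\<Sum>n. \<Sum>k. ennreal (T (H n k)))"
      using H(1) by (intro \<mu>_le_double) (auto simp: covers_def)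
    also have "\<dots> \<le> (\<Sum>n. \<mu> (A n) + ennreal (e * (1/2) ^ Suc n))"
      using H(2) by (intro suminf_le) auto
    also have "\<dots> = (\<Sum>n. \<mu> (A n)) + (\<Sum>n. ennreal (e * (1/2) ^ Suc n))"
      by (intro suminf_add[symmetric]) auto
    also have "(\<Sum>n. ennreal (e * (1/2) ^ Suc n)) = ennreal e"
      using e by (intro suminf_half_powers) auto
    finally show "\<mu> (\<Union>n. A n) \<le> (\<Sum>n. \<mu> (A n)) + ennreal e" .
  qed
qed simp

lemma outer_measure_\<mu>: "outer_measure_space (Pow UNIV) \<mu>"
  using \<mu>_subadditive
  by (auto simp: outer_measure_space_def positive_def \<mu>_empty increasing_def \<mu>_mono countably_subadditive_def)

lemma \<mu>_Un: "\<mu> (A \<union> B) \<le> \<mu> A + \<mu> B"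
proof -
  define C where "C n = (if n = 0 then A else if n = 1 then B else {})" for n :: nat
  have "(\<Union>n. C n) = A \<union> B" by (auto simp: C_def split: if_splits)
  moreover have "(\<Sum>n. \<mu> (C n)) = \<mu> A + \<mu> B"
    by (subst suminf_finite[of "{0, 1}"]) (auto simp: C_def \<mu>_empty)
  ultimately show ?thesis using \<mu>_subadditive[of C] by simp
qed

text \<open>The nontrivial half of Caratheodory's criterion. Each member of a near-optimal cover of
  A is cut by the functions g into a part \<open>g k * h n\<close>, which serves on U, and the rest,
  which serves off U because g vanishes there. By additivity of T the two parts share the cost of
  \<open>h n\<close>.\<close>

lemma \<mu>_open_split:
  assumes "open U"
  shows "\<mu> (A \<inter> U) + \<mu> (A - U) \<le> \<mu> A"
proof (cases "\<mu> A = \<infinity>")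
  case False
  obtain g :: "nat \<Rightarrow> 'x \<Rightarrow> real" where g: "\<And>x. g 0 x = 0" "\<And>k x. g k x \<le> g (Suc k) x"
    "\<And>k x. g k x \<le> 1" "\<And>k x. x \<notin> U \<Longrightarrow> g k x = 0" "\<And>x. x \<in> U \<Longrightarrow> \<exists>k. g k x = 1"
    "\<And>k h. h \<in> Lc \<Longrightarrow> (\<lambda>x. g k x * h x) \<in> Lc"
    using cutoff[OF assms] by metis
  have g_mono: "g i x \<le> g j x" if "i \<le> j" for i j x
    using lift_Suc_mono_le[of "\<lambda>k. g k x", OF g(2) that] .
  have g0: "0 \<le> g k x" for k x using g_mono[of 0 k x] g(1) by simp
  have g1: "(\<lambda>k. g k x) \<longlonglongrightarrow> 1" if x: "x \<in> U" for x
  proof -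
    obtain k where "g k x = 1" using g(5) x by blast
    then have "g j x = 1" if "k \<le> j" for j using g_mono[OF that, of x] g(3)[of j x] by simp
    then show ?thesis by (intro tendsto_eventually) (auto simp: eventually_sequentially)
  qed
  show ?thesis
  proof (rule ennreal_le_epsilon)
    fix e :: real assume e: "0 < e"
    obtain h where h: "h \<in> covers A" and hle: "(\<Sum>n. ennreal (T (h n))) \<le> \<mu> A + ennreal (e/2)"
      using near_cover[OF False, of "e/2"] e by auto
    have hp: "h n \<in> Lc" "0 \<le> h n x" for n x using h by (auto simp: covers_def pos_def)
    define a where "a n k = T (\<lambda>x. g k x * h n x)" for n k
    \<comment> \<open>On U the increments of \<open>g k\<close> sum to 1, so the
      \<open>H n k\<close> reproduce \<open>h n\<close> there. A single \<open>g k\<close> need not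
      be 1 on all of U, hence the telescoping series.\<close>
    define H where "H n k = (\<lambda>x. g (Suc k) x * h n x - g k x * h n x)" for n k
    have H: "H n k \<in> pos" for n k
      using diff[OF g(6) g(6), OF hp(1) hp(1)] g(2) hp(2)
      by (auto simp: H_def pos_def intro: mult_right_mono)
    have TH: "T (H n k) = a n (Suc k) - a n k" for n k
      unfolding H_def a_def by (intro T_diff g(6) hp)
    have inc: "incseq (a n)" for n
      using T_pos[of "H n k" for k] H TH by (intro incseq_SucI) (simp add: pos_def)
    have a_le: "a n k \<le> T (h n)" for n k
      unfolding a_def using g(3) hp g(6) by (intro T_mono) (auto intro!: mult_left_le_one_le g0)
    have bdd: "bdd_above (range (a n))" for n using a_le by (intro bdd_aboveI[of _ "T (h n)"]) auto
    define l where "l n = (SUP k. a n k)" for n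
    have lim: "a n \<longlonglongrightarrow> l n" for n
      unfolding l_def by (intro LIMSEQ_incseq_SUP bdd inc)
    have a0: "a n 0 = 0" for n by (simp add: a_def g(1) T_zero)
    have "\<exists>k. l n - a n k < e/2 * (1/2) ^ Suc n" for n
    proof -
      have "l n - e/2 * (1/2) ^ Suc n < l n" using e by simp
      then obtain k where "l n - e/2 * (1/2) ^ Suc n < a n k"
        unfolding l_def[of n] using less_cSUP_iff[OF _ bdd[of n]] by auto
      then show ?thesis by (intro exI[of _ k]) linarith
    qed
    \<comment> \<open>The cutoff stage depends on n, so that the truncation errors of all members of
      the cover add up to at most e/2; the other e/2 is spent on the near-optimality of h.\<close>
    then obtain K where K: "\<And>n. l n - a n (K n) < e/2 * (1/2) ^ Suc n" by metis
    have an: "0 \<le> a n k" for n k using a0[of n] incseqD[OF inc[of n], of 0 k] by simp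
    have sumH: "(\<Sum>k. ennreal (T (H n k))) = ennreal (l n)" for n
    proof -
      have "(\<lambda>k. a n (Suc k) - a n k) sums (l n - a n 0)"
        using telescope_sums[OF lim[of n]] .
      then show ?thesis
        unfolding TH using incseq_SucD[OF inc[of n]] a0 by (intro suminf_ennreal_eq) auto
    qed
    have sumHx: "(\<Sum>k. ennreal (H n k x)) = ennreal (h n x)" if "x \<in> U" for n x
    proof -
      have "(\<lambda>k. g (Suc k) x * h n x - g k x * h n x) sums (1 * h n x - g 0 x * h n x)"
        by (intro telescope_sums tendsto_mult g1 that tendsto_const)
      then show ?thesis
        unfolding H_def using g(1,2) hp(2)
        by (intro suminf_ennreal_eq) (auto intro: mult_right_mono)
    qed
    have "\<mu> (A \<inter> U) \<le> (\<Sum>n. \<Sum>k. ennreal (T (H n k)))"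
      using h by (intro \<mu>_le_double H) (auto simp: sumHx covers_def)
    also have "\<dots> \<le> (\<Sum>n. ennreal (a n (K n)) + ennreal (e/2 * (1/2) ^ Suc n))"
    proof (intro suminf_le)
      show "(\<Sum>k. ennreal (T (H n k))) \<le> ennreal (a n (K n)) + ennreal (e/2 * (1/2) ^ Suc n)" for n
      proof -
        have "l n \<le> a n (K n) + e/2 * (1/2) ^ Suc n" using K[of n] by linarith
        then show ?thesis
          unfolding sumH using an[of n] e by (subst ennreal_plus[symmetric]) (auto intro!: ennreal_leI simp del: ennreal_plus)
      qed
    qed auto
    also have "\<dots> = (\<Sum>n. ennreal (a n (K n))) + ennreal (e/2)"
      using e by (subst suminf_half_powers[symmetric]) (auto intro!: suminf_add[symmetric])
    finally have 1: "\<mu> (A \<inter> U) \<le> (\<Sum>n. ennreal (a n (K n))) + ennreal (e/2)" .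
    define k where "k n = (\<lambda>x. h n x - g (K n) x * h n x)" for n
    have k: "k n \<in> pos" for n
      using diff[OF hp(1) g(6)[OF hp(1)]] g(3) hp(2)
      by (auto simp: k_def pos_def intro!: mult_left_le_one_le g0)
    have "k \<in> covers (A - U)"
      using k h by (auto simp: covers_def) (auto simp: k_def g(4))
    then have 2: "\<mu> (A - U) \<le> (\<Sum>n. ennreal (T (k n)))"
      unfolding \<mu>_def by (rule INF_lower)
    have Tk: "T (k n) = T (h n) - a n (K n)" for n
      unfolding k_def a_def by (intro T_diff hp g(6))
    have "\<mu> (A \<inter> U) + \<mu> (A - U) \<le> (\<Sum>n. ennreal (a n (K n))) + ennreal (e/2) + (\<Sum>n. ennreal (T (k n)))"
      using 1 2 by (intro add_mono)
    also have "\<dots> = (\<Sum>n. ennreal (a n (K n)) + ennreal (T (k n))) + ennreal (e/2)"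
      by (subst suminf_add[symmetric]) (auto simp: ac_simps)
    also have "(\<lambda>n. ennreal (a n (K n)) + ennreal (T (k n))) = (\<lambda>n. ennreal (T (h n)))"
      using an a_le by (auto simp: Tk simp flip: ennreal_plus)
    also have "(\<Sum>n. ennreal (T (h n))) + ennreal (e/2) \<le> \<mu> A + ennreal (e/2) + ennreal (e/2)"
      using hle by (intro add_right_mono)
    also have "\<dots> = \<mu> A + ennreal e"
      using e by (simp add: add.assoc flip: ennreal_plus)
    finally show "\<mu> (A \<inter> U) + \<mu> (A - U) \<le> \<mu> A + ennreal e" .
  qed
qed simp

section \<open>The representing measure\<close>

definition riesz :: "'x measure" where
  "riesz = measure_of UNIV (sets borel) \<mu>"

text \<open>Open sets satisfy Caratheodory's condition by \<open>\<mu>_open_split\<close> and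
  subadditivity, and the sets that satisfy it form a sigma-algebra, which therefore contains the
  Borel sets.\<close>

lemma measure_space_\<mu>: "measure_space UNIV (sets borel) \<mu>"
proof -
  interpret sigma_algebra "UNIV :: 'x set" "Pow UNIV" by (rule sigma_algebra_Pow)
  let ?L = "lambda_system UNIV (Pow UNIV) \<mu>"
  have ms: "measure_space UNIV ?L \<mu>"
    by (rule caratheodory_lemma[OF outer_measure_\<mu>])
  then interpret L: sigma_algebra UNIV ?L by (simp add: measure_space_def)
  have "U \<in> ?L" if "open U" for U
  proof -
    have "\<mu> (U \<inter> A) + \<mu> ((UNIV - U) \<inter> A) = \<mu> A" for A
    proof (rule antisym)
      have "(UNIV - U) \<inter> A = A - U" by auto
      then show "\<mu> (U \<inter> A) + \<mu> ((UNIV - U) \<inter> A) \<le> \<mu> A"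
        using \<mu>_open_split[OF that, of A] by (simp add: Int_commute)
      have "(U \<inter> A) \<union> ((UNIV - U) \<inter> A) = A" by auto
      then show "\<mu> A \<le> \<mu> (U \<inter> A) + \<mu> ((UNIV - U) \<inter> A)"
        using \<mu>_Un[of "U \<inter> A" "(UNIV - U) \<inter> A"] by simp
    qed
    then show ?thesis by (auto simp: lambda_system_def)
  qed
  then have "sets borel \<subseteq> ?L"
    unfolding sets_borel by (intro L.sigma_sets_subset) auto
  then show ?thesis
    using measure_down[OF ms] sets.sigma_algebra_axioms[of "borel :: 'x measure"] by simp
qed

lemma sets_riesz [simp, measurable_cong]: "sets riesz = sets borel"
  by (simp add: riesz_def) (metis sets.sigma_sets_eq space_borel)

lemma space_riesz [simp]: "space riesz = UNIV"
  using sets_eq_imp_space_eq[OF sets_riesz] by simp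

lemma emeasure_riesz: "A \<in> sets borel \<Longrightarrow> emeasure riesz A = \<mu> A"
  unfolding riesz_def using measure_space_\<mu>
  by (subst emeasure_measure_of_sigma) (auto simp: measure_space_def)

text \<open>Stated for every Borel measure that is finite on compact sets, because uniqueness
  applies it to measures other than \<open>riesz\<close>.\<close>

lemma pos_integrable:
  fixes m :: "'x measure"
  assumes "sets m = sets borel" and fin: "\<And>K. compact K \<Longrightarrow> emeasure m K < \<infinity>" and "h \<in> Lc"
  shows "integrable m h"
proof -
  let ?K = "closure {x. h x \<noteq> 0}"
  have K: "compact ?K" using supp assms by auto
  then have "bounded (h ` ?K)"
    using cont[OF assms(3)] by (intro compact_imp_bounded compact_continuous_image) (auto intro: continuous_on_subset)
  then obtain B where B: "\<And>x. x \<in> ?K \<Longrightarrow> norm (h x) \<le> B" by (auto simp: bounded_iff)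
  have "h x = 0" if "x \<notin> ?K" for x 
    using that closure_subset[of "{x. h x \<noteq> 0}"] by (metis (mono_tags) mem_Collect_eq subsetD)
  moreover have "h \<in> borel_measurable m"
    using cont[OF assms(3)] assms(1) by (metis borel_measurable_continuous_onI measurable_cong_sets)
  moreover have "?K \<in> sets m" unfolding assms(1) by (rule borel_closed[OF closed_closure])
  moreover have "AE x in m. x \<in> ?K \<longrightarrow> norm (h x) \<le> B" by (rule AE_I2) (rule impI, rule B)
  moreover have "AE x in m. x \<notin> ?K \<longrightarrow> h x = 0" by (rule AE_I2) (rule impI, rule calculation(1))
  ultimately show ?thesis
    using fin[OF K] integrableI_bounded_set[of ?K m h B] by blast
qed

lemma riesz_compact:
  assumes "compact K" shows "emeasure riesz K < \<infinity>"
proof -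
  obtain b where "b \<in> pos" "\<And>x. x \<in> K \<Longrightarrow> 1 \<le> b x" using bump assms by blast
  then have "\<mu> K \<le> ennreal (T b)" by (intro \<mu>_le)
  then show ?thesis using assms
    by (subst emeasure_riesz) (auto simp: borel_compact intro: le_less_trans)
qed

lemma slice_sum:
  fixes y d :: real
  assumes "0 < d" "0 \<le> y"
  shows "(\<Sum>j<M. min (max (y - real j * d) 0) d) = min y (real M * d)"
proof (induction M)
  case (Suc M)
  then show ?case using assms by (auto simp: min_def max_def algebra_simps)
qed (use assms in auto)

text \<open>Layer cake: \<open>h\<close> is the sum of the slices of height \<open>d\<close> between the levels \<open>j * d\<close> and \<open>(j + 1) * d\<close>.
  Divided by \<open>d\<close>, a slice lies between the indicators of two consecutive superlevel sets, which bound
  its value under \<open>T\<close> as well as its integral.\<close>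

lemma slice_compare:
  assumes h: "h \<in> pos" and d: "0 < d"
  shows "\<bar>T h - (\<integral>x. h x \<partial>riesz)\<bar> \<le> d * measure riesz (closure {x. h x \<noteq> 0})"
proof -
  let ?K = "closure {x. h x \<noteq> 0}"
  have hL: "h \<in> Lc" and h0: "0 \<le> h x" for x using h by (auto simp: pos_def)
  have hc: "continuous_on UNIV h" using cont[OF hL] .
  have K: "compact ?K" using supp[OF hL] .
  have "bounded (h ` ?K)"
    using hc K by (intro compact_imp_bounded compact_continuous_image) (auto intro: continuous_on_subset)
  then obtain B where B: "\<And>x. x \<in> ?K \<Longrightarrow> norm (h x) \<le> B" by (auto simp: bounded_iff)
  \<comment> \<open>Enough levels of height d to pass the maximum of h, so that the slices add up to
    h without remainder.\<close>
  obtain M :: nat where M: "\<bar>B\<bar> \<le> real M * d"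
    using d real_arch_simple[of "\<bar>B\<bar> / d"] by (auto simp: field_simps)
  have hM: "h x \<le> real M * d" for x
  proof (cases "h x = 0")
    case False
    then have "x \<in> ?K" using closure_subset[of "{x. h x \<noteq> 0}"] by blast
    then show ?thesis using B[of x] M by auto
  qed (use d in simp)
  define s where "s j x = min (max (h x - real j * d) 0) d" for j x
  define A where "A j = {x. real j * d < h x}" for j
  have A_sets [measurable]: "A j \<in> sets borel" for j
    unfolding A_def by (intro borel_open open_Collect_less continuous_intros hc)
  have AK: "A j \<subseteq> ?K" for j
    using d closure_subset[of "{x. h x \<noteq> 0}"] by (auto simp: A_def) (metis (mono_tags, lifting) h0 less_le_trans mem_Collect_eq mult_nonneg_nonneg not_less of_nat_0_le_iff less_imp_le order_refl subsetD)
  have Afin: "emeasure riesz (A j) < \<infinity>" for j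
    using emeasure_mono[OF AK[of j], of riesz] riesz_compact[OF K] K by (auto simp: borel_compact intro: le_less_trans)
  have eA: "emeasure riesz (A j) = ennreal (measure riesz (A j))" for j
    using Afin[of j] by (simp add: emeasure_eq_ennreal_measure less_top)
  have sp: "s j \<in> pos" for j
  proof -
    \<comment> \<open>Slicing acts on the values by a 1-Lipschitz function that fixes 0, which is
      the kind of truncation that \<open>comp\<close> admits.\<close>
    have "1-lipschitz_on UNIV (\<lambda>y::real. min (max (y - real j * d) 0) d)"
      by (intro lipschitz_onI) (auto simp: dist_real_def min_def max_def)
    then have "(\<lambda>x. min (max (h x - real j * d) 0) d) \<in> Lc"
      by (rule comp[OF hL]) (use d in \<open>auto simp: min_def max_def\<close>)
    then show ?thesis using d by (auto simp: s_def[abs_def] pos_def)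
  qed
  have s_int: "integrable riesz (s j)" for j
    using sp[of j] riesz_compact by (intro pos_integrable) (auto simp: pos_def)
  have scale_pos: "(\<lambda>x. s j x / d) \<in> pos" for j
    using sp[of j] scale[of "s j" "1/d"] d by (auto simp: pos_def)
  have T_s: "T (\<lambda>x. s j x / d) = T (s j) / d" for j
    using T_scale[of "s j" "1/d"] sp[of j] by (auto simp: pos_def)
  have upT: "T (s j) \<le> d * measure riesz (A j)" for j
  proof -
    have "ennreal (T (\<lambda>x. s j x / d)) \<le> \<mu> (A j)"
      by (rule le_\<mu>[OF scale_pos]) (use d in \<open>auto simp: s_def A_def\<close>)
    also have "\<dots> = ennreal (measure riesz (A j))"
      by (metis emeasure_riesz A_sets eA)
    finally show ?thesis using d by (simp add: T_s field_simps)
  qed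
  have lowT: "d * measure riesz (A (Suc j)) \<le> T (s j)" for j
  proof -
    have "\<mu> (A (Suc j)) \<le> ennreal (T (\<lambda>x. s j x / d))"
      by (rule \<mu>_le[OF scale_pos]) (use d in \<open>auto simp: s_def A_def algebra_simps\<close>)
    then have "ennreal (measure riesz (A (Suc j))) \<le> ennreal (T (s j) / d)"
      by (metis emeasure_riesz A_sets eA T_s)
    moreover have "0 \<le> T (s j) / d" using T_pos[of "s j"] sp[of j] d by (auto simp: pos_def)
    ultimately show ?thesis using d by (simp add: field_simps)
  qed
  have int_ind: "(\<integral>x. d * indicator (A j) x \<partial>riesz) = d * measure riesz (A j)" for j by simp
  have ind_int: "integrable riesz (\<lambda>x. d * indicator (A j) x :: real)" for j
    using Afin[of j] by (intro integrable_mult_right) auto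
  have upI: "(\<integral>x. s j x \<partial>riesz) \<le> d * measure riesz (A j)" for j
    unfolding int_ind[symmetric]
    by (intro integral_mono s_int ind_int) (use d in \<open>auto simp: s_def A_def indicator_def\<close>)
  have lowI: "d * measure riesz (A (Suc j)) \<le> (\<integral>x. s j x \<partial>riesz)" for j
    unfolding int_ind[symmetric]
    by (intro integral_mono s_int ind_int) (use d in \<open>auto simp: s_def A_def indicator_def algebra_simps\<close>)
  have hs: "h = (\<lambda>x. \<Sum>j<M. s j x)"
    using slice_sum[OF d h0] hM by (auto simp: s_def min_def fun_eq_iff)
  have T_h: "T h = (\<Sum>j<M. T (s j))"
    by (subst hs, rule T_sum) (use sp in \<open>auto simp: pos_def\<close>)
  have I_h: "(\<integral>x. h x \<partial>riesz) = (\<Sum>j<M. \<integral>x. s j x \<partial>riesz)"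
    by (subst hs, rule Bochner_Integration.integral_sum) (rule s_int)
  have "\<bar>T h - (\<integral>x. h x \<partial>riesz)\<bar> \<le> (\<Sum>j<M. \<bar>T (s j) - (\<integral>x. s j x \<partial>riesz)\<bar>)"
    unfolding T_h I_h sum_subtractf[symmetric] by (rule sum_abs)
  \<comment> \<open>\<open>T (s j)\<close> and the integral of \<open>s j\<close> lie in the same
    interval, and the intervals for consecutive j share an endpoint; their lengths telescope to at
    most d times the measure of the support.\<close>
  also have "\<dots> \<le> (\<Sum>j<M. d * measure riesz (A j) - d * measure riesz (A (Suc j)))"
    using upT lowT upI lowI by (intro sum_mono) (smt (verit))
  also have "\<dots> = d * measure riesz (A 0) - d * measure riesz (A M)"
    by (rule sum_lessThan_telescope')
  also have "\<dots> \<le> d * measure riesz (A 0)" using d by simp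
  also have "\<dots> \<le> d * measure riesz ?K"
    using d AK riesz_compact[OF K] K by (intro mult_left_mono measure_mono_fmeasurable) (auto simp: fmeasurable_def borel_compact)
  finally show ?thesis .
qed

lemma integral_riesz_pos:
  assumes h: "h \<in> pos"
  shows "(\<integral>x. h x \<partial>riesz) = T h"
proof -
  let ?m = "measure riesz (closure {x. h x \<noteq> 0})"
  have "\<bar>T h - (\<integral>x. h x \<partial>riesz)\<bar> \<le> e" if e: "0 < e" for e
  proof -
    have "e / (?m + 1) * ?m \<le> e"
      using e by (simp add: field_simps add_pos_nonneg)
    then show ?thesis
      using slice_compare[OF h, of "e / (?m + 1)"] e
      by (smt (verit) divide_pos_pos measure_nonneg)
  qed
  then show ?thesis using dense_eq0_I[of "T h - (\<integral>x. h x \<partial>riesz)"] by simp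
qed

lemma pos_part: "h \<in> Lc \<Longrightarrow> (\<lambda>x. max 0 (h x)) \<in> pos"
  using comp[of h "\<lambda>y. max 0 y"]
  by (auto simp: pos_def lipschitz_on_def dist_real_def max_def)

theorem integral_riesz:
  assumes h: "h \<in> Lc"
  shows "(\<integral>x. h x \<partial>riesz) = T h"
proof -
  define p n where "p = (\<lambda>x. max 0 (h x))" and "n = (\<lambda>x. max 0 (- h x))"
  have p: "p \<in> pos" "n \<in> pos"
    using pos_part[OF h] pos_part[OF scale[OF h, of "-1"]] by (auto simp: p_def n_def)
  then have L: "p \<in> Lc" "n \<in> Lc" by (auto simp: pos_def)
  have hd: "h = (\<lambda>x. p x - n x)" by (auto simp: p_def n_def)
  have "(\<integral>x. p x - n x \<partial>riesz) = (\<integral>x. p x \<partial>riesz) - (\<integral>x. n x \<partial>riesz)"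
    using L riesz_compact by (intro Bochner_Integration.integral_diff pos_integrable) auto
  also have "\<dots> = T (\<lambda>x. p x - n x)"
    using p L by (simp add: integral_riesz_pos T_diff)
  finally show ?thesis by (simp add: hd)
qed

section \<open>Uniqueness of the measure\<close>

lemma locally_finite_compact:
  fixes m :: "'x measure"
  assumes "locally_finite_borel m" "compact K"
  shows "emeasure m K < \<infinity>"
proof -
  have "\<exists>U. open U \<and> x \<in> U \<and> emeasure m U < \<infinity>" for x
    using assms(1) by (auto simp: locally_finite_borel_def)
  then obtain U where U: "\<And>x. open (U x)" "\<And>x. x \<in> U x" "\<And>x. emeasure m (U x) < \<infinity>" by metis
  then obtain D where D: "finite D" "K \<subseteq> (\<Union>x\<in>D. U x)"
    using compactE_image[OF assms(2), of UNIV U] by (metis UNIV_I UN_I subsetI)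
  have m: "sets m = sets borel" using assms(1) by (simp add: locally_finite_borel_def)
  have "emeasure m K \<le> emeasure m (\<Union>x\<in>D. U x)"
    using D U m by (intro emeasure_mono) auto
  also have "\<dots> \<le> (\<Sum>x\<in>D. emeasure m (U x))"
    using D U m by (intro emeasure_subadditive_finite) auto
  also have "\<dots> < \<infinity>" using D U by (simp add: less_top)
  finally show ?thesis .
qed

text \<open>The products \<open>g k * \<eta> k\<close> are test functions increasing to the
  indicator of an open set: g confines them to the set and \<open>\<eta>\<close> gives them compact
  support. Monotone convergence identifies the measures on open sets, an intersection-stable
  generator of the Borel sets.\<close>

lemma measure_determined:
  fixes m m' :: "'x measure"
  assumes m: "locally_finite_borel m" and m': "locally_finite_borel m'"
    and eq: "\<And>h. h \<in> Lc \<Longrightarrow> (\<integral>x. h x \<partial>m) = (\<integral>x. h x \<partial>m')"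
  shows "m = m'"
proof -
  have sets: "sets m = sets borel" "sets m' = sets borel"
    using m m' by (auto simp: locally_finite_borel_def)
  obtain \<eta> :: "nat \<Rightarrow> 'x \<Rightarrow> real" where \<eta>: "\<And>k. \<eta> k \<in> Lc" "\<And>k x. 0 \<le> \<eta> k x"
    "\<And>k x. \<eta> k x \<le> \<eta> (Suc k) x" "\<And>x. \<exists>j. \<eta> j x = 1" "\<And>k x. \<eta> k x \<le> 1"
    using exhaust by metis
  have nn: "(\<integral>\<^sup>+x. ennreal (h x) \<partial>m) = (\<integral>\<^sup>+x. ennreal (h x) \<partial>m')" if "h \<in> Lc" "\<And>x. 0 \<le> h x" for h
  proof -
    have "integrable m h" "integrable m' h"
      using that sets locally_finite_compact[OF m] locally_finite_compact[OF m'] by (auto intro!: pos_integrable)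
    then show ?thesis using that eq by (simp add: nn_integral_eq_integral)
  qed
  have open_eq: "emeasure m U = emeasure m' U" if U: "open U" for U
  proof -
    obtain g :: "nat \<Rightarrow> 'x \<Rightarrow> real" where g: "\<And>x. g 0 x = 0" "\<And>k x. g k x \<le> g (Suc k) x"
      "\<And>k x. g k x \<le> 1" "\<And>k x. x \<notin> U \<Longrightarrow> g k x = 0" "\<And>x. x \<in> U \<Longrightarrow> \<exists>k. g k x = 1"
      "\<And>k h. h \<in> Lc \<Longrightarrow> (\<lambda>x. g k x * h x) \<in> Lc"
      using cutoff[OF U] by metis
    have g_mono: "g i x \<le> g j x" if "i \<le> j" for i j x
      using lift_Suc_mono_le[of "\<lambda>k. g k x", OF g(2) that] .
    have \<eta>_mono: "\<eta> i x \<le> \<eta> j x" if "i \<le> j" for i j x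
      using lift_Suc_mono_le[of "\<lambda>k. \<eta> k x", OF \<eta>(3) that] .
    have g0: "0 \<le> g k x" for k x using g_mono[of 0 k x] g(1) by simp
    have sup: "indicator U x = (SUP k. ennreal (g k x * \<eta> k x))" for x
    proof (rule antisym)
      show "(SUP k. ennreal (g k x * \<eta> k x)) \<le> indicator U x"
        using g(3)[of _ x] \<eta>(5)[of _ x] g0[of _ x] \<eta>(2)[of _ x]
        by (intro SUP_least) (auto simp: indicator_def g(4) ennreal_le_1 intro!: mult_le_one)
      show "indicator U x \<le> (SUP k. ennreal (g k x * \<eta> k x))"
      proof (cases "x \<in> U")
        case True
        obtain i j where "g i x = 1" "\<eta> j x = 1" using g(5)[OF True] \<eta>(4) by blast
        then have "g (max i j) x = 1" "\<eta> (max i j) x = 1"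
          using g_mono[of i "max i j" x] g(3)[of "max i j" x] \<eta>_mono[of j "max i j" x] \<eta>(5)[of "max i j" x] by auto
        then have "ennreal (g (max i j) x * \<eta> (max i j) x) = 1" by simp
        moreover have "ennreal (g (max i j) x * \<eta> (max i j) x) \<le> (SUP k. ennreal (g k x * \<eta> k x))"
          by (rule SUP_upper) simp
        ultimately show ?thesis using True by simp
      qed simp
    qed
    have meas: "(\<lambda>x. ennreal (g k x * \<eta> k x)) \<in> borel_measurable borel" for k
      using cont[OF g(6)[OF \<eta>(1)], of k] by (intro measurable_compose[OF _ measurable_ennreal] borel_measurable_continuous_onI)
    have inc: "incseq (\<lambda>k x. ennreal (g k x * \<eta> k x))"
      using g(2) \<eta>(3) g0 \<eta>(2) by (intro incseq_SucI le_funI ennreal_leI mult_mono) auto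
    have e: "emeasure M U = (SUP k. \<integral>\<^sup>+x. ennreal (g k x * \<eta> k x) \<partial>M)" if "sets M = sets borel" for M
    proof -
      have "emeasure M U = (\<integral>\<^sup>+x. (SUP k. ennreal (g k x * \<eta> k x)) \<partial>M)"
        using U that by (subst sup[symmetric]) (simp add: borel_open)
      also have "\<dots> = (SUP k. \<integral>\<^sup>+x. ennreal (g k x * \<eta> k x) \<partial>M)"
        using meas measurable_cong_sets[OF that refl] inc
        by (intro nn_integral_monotone_convergence_SUP) auto
      finally show ?thesis .
    qed
    show ?thesis
      unfolding e[OF sets(1)] e[OF sets(2)] using g(6)[OF \<eta>(1)] g0 \<eta>(2) by (simp add: nn)
  qed
  have opn: "open {x. 1/2 < \<eta> n x}" for n
    by (intro open_Collect_less continuous_intros cont \<eta>)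
  show ?thesis
  \<comment> \<open>The sets \<open>{x. 1/2 < \<eta> n x}\<close> exhaust the space and have finite
    measure, since each lies in a compact support.\<close>
  proof (rule measure_eqI_generator_eq[where \<Omega>=UNIV and E="{U. open U}" and A="\<lambda>n. {x. 1/2 < \<eta> n x}"])
    show "Int_stable {U :: 'x set. open U}" by (auto simp: Int_stable_def)
    show "sets m = sigma_sets UNIV {U. open U}" "sets m' = sigma_sets UNIV {U. open U}"
      using sets by (auto simp: sets_borel)
    show "range (\<lambda>n. {x. 1/2 < \<eta> n x}) \<subseteq> {U. open U}" using opn by auto
    show "(\<Union>n. {x. 1/2 < \<eta> n x}) = UNIV"
    proof (intro equalityI subset_UNIV subsetI)
      fix x obtain j where "\<eta> j x = 1" using \<eta>(4) by blast
      then have "x \<in> {x. 1/2 < \<eta> j x}" by simp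
      then show "x \<in> (\<Union>n. {x. 1/2 < \<eta> n x})" by (rule UN_I[OF UNIV_I])
    qed
    show "emeasure m {x. 1/2 < \<eta> n x} \<noteq> \<infinity>" for n
    proof -
      let ?K = "closure {x. \<eta> n x \<noteq> 0}"
      have "{x. 1/2 < \<eta> n x} \<subseteq> ?K"
        using closure_subset[of "{x. \<eta> n x \<noteq> 0}"] by (rule order_trans[rotated]) auto
      moreover have "emeasure m ?K < \<infinity>"
        by (rule locally_finite_compact[OF m supp[OF \<eta>(1)]])
      ultimately show ?thesis
        using emeasure_mono[of _ ?K m] sets by (metis borel_closed closed_closure infinity_ennreal_def leD)
    qed
  qed (auto intro: open_eq)
qed

lemma riesz_locally_finite: "locally_finite_borel riesz"
proof -
  obtain \<eta> :: "nat \<Rightarrow> 'x \<Rightarrow> real" where \<eta>: "\<And>k. \<eta> k \<in> Lc" "\<And>x. \<exists>j. \<eta> j x = 1"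
    using exhaust by metis
  have "\<exists>U. open U \<and> x \<in> U \<and> emeasure riesz U < \<infinity>" for x
  proof -
    obtain j where j: "\<eta> j x = 1" using \<eta>(2) by blast
    let ?U = "{x. 1/2 < \<eta> j x}" and ?K = "closure {x. \<eta> j x \<noteq> 0}"
    have "open ?U" by (intro open_Collect_less continuous_intros cont \<eta>)
    moreover have "?U \<subseteq> ?K"
      using closure_subset[of "{x. \<eta> j x \<noteq> 0}"] by (rule order_trans[rotated]) auto
    then have "emeasure riesz ?U \<le> emeasure riesz ?K" by (intro emeasure_mono) auto
    then have "emeasure riesz ?U < \<infinity>" using riesz_compact[OF supp[OF \<eta>(1)[of j]]] by (rule le_less_trans)
    ultimately show ?thesis using j by (intro exI[of _ ?U]) auto
  qed
  then show ?thesis by (simp add: locally_finite_borel_def)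
qed

theorem representation:
  "\<exists>!m. locally_finite_borel m \<and> (\<forall>h\<in>Lc. (\<integral>x. h x \<partial>m) = T h)"
  using riesz_locally_finite integral_riesz measure_determined
  by (intro ex1I[of _ riesz]) auto

end

section \<open>Lipschitz functions of one variable\<close>

text \<open>One half of the Lebesgue differentiation theorem: at almost every zero of a bounded
  density, small intervals have mass of smaller order than their length. At an exceptional point
  arbitrarily short intervals carry more mass than e times the radius. Disjoint ones, chosen by
  Vitali's lemma, lie in an open set that exceeds the zero set A only slightly, so their total mass,
  and with it their total length, is small.\<close>

lemma AE_small_intervals:
  fixes k :: "real \<Rightarrow> ennreal"
  assumes k [measurable]: "k \<in> borel_measurable borel" and C: "\<And>x. k x \<le> ennreal C"
  shows "AE x in lborel. k x = 0 \<longrightarrow>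
    (\<forall>e>0. \<exists>d>0. \<forall>r. 0 < r \<and> r < d \<longrightarrow> emeasure (density lborel k) (cball x r) \<le> ennreal (e * r))"
proof -
  let ?\<nu> = "density lborel k"
  define A where "A = {x. k x = 0}"
  have A [measurable]: "A \<in> sets borel" unfolding A_def by measurable
  define S where "S e = {x\<in>A. \<forall>d>0. \<exists>r. 0 < r \<and> r < d \<and> ennreal (e * r) < emeasure ?\<nu> (cball x r)}" for e
  have nu_le: "emeasure ?\<nu> X \<le> ennreal C * emeasure lborel X" if [measurable]: "X \<in> sets borel" for X
  proof -
    have "emeasure ?\<nu> X = (\<integral>\<^sup>+x. k x * indicator X x \<partial>lborel)" by (rule emeasure_density) auto
    also have "\<dots> \<le> (\<integral>\<^sup>+x. ennreal C * indicator X x \<partial>lborel)"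
      using C by (intro nn_integral_mono mult_right_mono) auto
    finally show ?thesis by (simp add: nn_integral_cmult_indicator)
  qed
  have nuA: "emeasure ?\<nu> A = 0"
  proof -
    have "(\<lambda>x. k x * indicator A x) = (\<lambda>x. 0)" by (auto simp: A_def indicator_def)
    then show ?thesis by (subst emeasure_density) auto
  qed
  \<comment> \<open>Covering \<open>S e\<close> from outside is enough, so its measurability never
    has to be settled.\<close>
  have neg: "negligible (S e)" if e: "0 < e" for e
    unfolding negligible_outer_le
  proof (intro allI impI)
    fix \<epsilon> :: real assume \<epsilon>: "0 < \<epsilon>"
    \<comment> \<open>Vitali's lemma enlarges radii by 5, and an interval of radius 5r has length
      10r. The mass of U, at most \<open>\<bar>C\<bar> * \<eta>\<close>, bounds e times the sum of
      the radii; \<open>\<bar>C\<bar> + 1\<close> avoids a division by zero.\<close>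
    define \<eta> where "\<eta> = \<epsilon> * e / (10 * (\<bar>C\<bar> + 1))"
    have \<eta>: "0 < \<eta>" using \<epsilon> e by (simp add: \<eta>_def add_pos_nonneg)
    obtain U where U: "open U" "A \<subseteq> U" and "emeasure lebesgue (U - A) < ennreal \<eta>"
      using sets_lebesgue_outer_open[of A \<eta>] \<eta> A by (metis sets_completionI_sets sets_lborel)
    then have UA: "emeasure lborel (U - A) < ennreal \<eta>"
      using A U by (simp add: borel_open)
    have nuU: "emeasure ?\<nu> U \<le> ennreal (\<bar>C\<bar> * \<eta>)"
    proof -
      have "emeasure ?\<nu> U \<le> emeasure ?\<nu> A + emeasure ?\<nu> (U - A)"
        using emeasure_subadditive[of A ?\<nu> "U - A"] U by (auto simp: borel_open Un_absorb1)
      also have "\<dots> \<le> ennreal C * emeasure lborel (U - A)"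
        using nu_le[of "U - A"] U by (simp add: nuA borel_open)
      also have "\<dots> \<le> ennreal \<bar>C\<bar> * ennreal \<eta>"
        using UA by (intro mult_mono ennreal_leI) auto
      finally show ?thesis by (simp add: ennreal_mult'' \<eta> less_imp_le)
    qed
    define K where "K = {(x, r). x \<in> S e \<and> 0 < r \<and> r < 1 \<and> cball x r \<subseteq> U \<and> ennreal (e * r) < emeasure ?\<nu> (cball x r)}"
    have SK: "S e \<subseteq> (\<Union>i\<in>K. cball (fst i) (snd i))"
    proof
      fix x assume x: "x \<in> S e"
      then have "x \<in> U" using U by (auto simp: S_def)
      then obtain d where d: "0 < d" "cball x d \<subseteq> U" using U open_contains_cball by blast
      obtain r where r: "0 < r" "r < min d 1" "ennreal (e * r) < emeasure ?\<nu> (cball x r)"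
        using x d by (auto simp: S_def dest!: spec[of _ "min d 1"])
      then have "cball x r \<subseteq> U" using d by (metis min_less_iff_conj cball_subset_cball_iff less_imp_le order_trans subset_cball)
      then have "(x, r) \<in> K" using x r by (simp add: K_def)
      then show "x \<in> (\<Union>i\<in>K. cball (fst i) (snd i))" using r(1) by (intro UN_I) auto
    qed
    obtain D where D: "countable D" "D \<subseteq> K"
      "pairwise (\<lambda>i j. disjnt (cball (fst i) (snd i)) (cball (fst j) (snd j))) D"
      "S e \<subseteq> (\<Union>i\<in>D. cball (fst i) (5 * snd i))"
      using Vitali_covering_lemma_cballs[OF SK, of 1] by (force simp: K_def)
    let ?T = "\<Union>i\<in>D. cball (fst i) (5 * snd i)"
    have bound: "measure lebesgue (\<Union>i\<in>F. cball (fst i) (5 * snd i)) \<le> \<epsilon>" if F: "F \<subseteq> D" "finite F" for F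
    proof -
      have Fr: "0 < snd i" "cball (fst i) (snd i) \<subseteq> U" "ennreal (e * snd i) < emeasure ?\<nu> (cball (fst i) (snd i))" if "i \<in> F" for i
      proof -
        have "i \<in> K" using that F D(2) by blast
        then show "0 < snd i" "cball (fst i) (snd i) \<subseteq> U" "ennreal (e * snd i) < emeasure ?\<nu> (cball (fst i) (snd i))"
          unfolding K_def by (cases i; clarsimp)+
      qed
      have "measure lebesgue (\<Union>i\<in>F. cball (fst i) (5 * snd i)) \<le> (\<Sum>i\<in>F. measure lebesgue (cball (fst i) (5 * snd i)))"
        by (intro measure_UNION_le F) auto
      also have "\<dots> = (\<Sum>i\<in>F. 10 * snd i)"
        using Fr(1) by (intro sum.cong refl) (simp add: cball_eq_atLeastAtMost less_imp_le)
      finally have 1: "measure lebesgue (\<Union>i\<in>F. cball (fst i) (5 * snd i)) \<le> (10 / e) * (e * (\<Sum>i\<in>F. snd i))"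
        using e by (simp add: sum_distrib_left)
      have "ennreal (e * (\<Sum>i\<in>F. snd i)) = (\<Sum>i\<in>F. ennreal (e * snd i))"
        using Fr(1) e by (subst sum_ennreal) (auto simp: sum_distrib_left less_imp_le)
      also have "\<dots> \<le> (\<Sum>i\<in>F. emeasure ?\<nu> (cball (fst i) (snd i)))"
        using Fr(3) by (intro sum_mono less_imp_le)
      also have "\<dots> = emeasure ?\<nu> (\<Union>i\<in>F. cball (fst i) (snd i))"
      proof (intro sum_emeasure F)
        have "disjoint_family_on (\<lambda>i. cball (fst i) (snd i)) D"
          using D(3) unfolding pairwise_def disjnt_def disjoint_family_on_def by blast
        then show "disjoint_family_on (\<lambda>i. cball (fst i) (snd i)) F"
          by (rule disjoint_family_on_mono[OF F(1)])
      qed auto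
      also have "\<dots> \<le> emeasure ?\<nu> U"
        using Fr(2) U by (intro emeasure_mono) (auto simp: borel_open)
      also note nuU
      finally have "e * (\<Sum>i\<in>F. snd i) \<le> \<bar>C\<bar> * \<eta>" using \<eta> by simp
      then have "(10 / e) * (e * (\<Sum>i\<in>F. snd i)) \<le> (10 / e) * (\<bar>C\<bar> * \<eta>)"
        using e by (intro mult_left_mono) auto
      also have "\<dots> = \<epsilon> * (\<bar>C\<bar> / (\<bar>C\<bar> + 1))"
        using e by (simp add: \<eta>_def divide_simps)
      also have "\<dots> \<le> \<epsilon>" using \<epsilon> by (simp add: field_simps)
      finally show ?thesis using 1 by linarith
    qed
    have "?T \<in> lmeasurable" "measure lebesgue ?T \<le> \<epsilon>"
      by (rule fmeasurable_UN_bound[OF D(1) _ bound] measure_UN_bound[OF D(1) _ bound]; simp)+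
    then show "\<exists>T. S e \<subseteq> T \<and> T \<in> lmeasurable \<and> measure lebesgue T \<le> \<epsilon>" using D(4) by blast
  qed
  have "AE x in lebesgue. \<forall>n. x \<notin> S (1 / Suc n)"
    using neg by (intro AE_all_countable[THEN iffD2] allI AE_not_in) (auto simp: negligible_iff_null_sets)
  then have "AE x in lebesgue. k x = 0 \<longrightarrow>
    (\<forall>e>0. \<exists>d>0. \<forall>r. 0 < r \<and> r < d \<longrightarrow> emeasure ?\<nu> (cball x r) \<le> ennreal (e * r))"
  proof eventually_elim
    case (elim x)
    show ?case
    proof (intro impI allI)
      fix e :: real assume x: "k x = 0" and e: "0 < e"
      obtain n where n: "1 / Suc n < e" using e by (metis inverse_eq_divide reals_Archimedean)
      obtain d where d: "0 < d" "\<And>r. 0 < r \<Longrightarrow> r < d \<Longrightarrow> emeasure ?\<nu> (cball x r) \<le> ennreal (1 / Suc n * r)"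
      proof -
        have "x \<in> A" using x by (simp add: A_def)
        moreover have "x \<notin> S (1 / Suc n)" using elim by blast
        ultimately have "\<exists>d>0. \<forall>r. 0 < r \<and> r < d \<longrightarrow> \<not> ennreal (1 / Suc n * r) < emeasure ?\<nu> (cball x r)"
          unfolding S_def by blast
        then show thesis using that by (force simp: not_less)
      qed
      have "emeasure ?\<nu> (cball x r) \<le> ennreal (e * r)" if "0 < r" "r < d" for r
        using d(2)[OF that] n that by (elim order_trans) (intro ennreal_leI mult_right_mono, auto)
      then show "\<exists>d>0. \<forall>r. 0 < r \<and> r < d \<longrightarrow> emeasure ?\<nu> (cball x r) \<le> ennreal (e * r)"
        using d(1) by blast
    qed
  qed
  then show ?thesis by (simp add: AE_completion_iff)
qed

text \<open>The function \<open>x / 2 + f x\<close> is increasing with slopes between \<open>0\<close> and \<open>1\<close>, so its Stieltjes measure is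
  dominated by Lebesgue measure and \<open>G\<close> is a Radon-Nikodym derivative.\<close>

lemma lipschitz_half_density:
  fixes f :: "real \<Rightarrow> real"
  assumes f: "(1/2)-lipschitz_on UNIV f"
  obtains G :: "real \<Rightarrow> ennreal" where "G \<in> borel_measurable borel" "\<And>x. G x \<le> 1"
    "\<And>a b. a \<le> b \<Longrightarrow> emeasure (density lborel G) {a..b} = ennreal ((b - a) / 2 + (f b - f a))"
proof -
  \<comment> \<open>F1 and F2 are both increasing and add up to the identity, so their Stieltjes
    measures add up to Lebesgue measure. This gives absolute continuity of both and the bound 1 for
    the density of the first.\<close>
  define F1 F2 where "F1 x = x / 2 + f x" and "F2 x = x / 2 - f x" for x
  have fL: "\<bar>f x - f y\<bar> \<le> \<bar>x - y\<bar> / 2" for x y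
    using lipschitz_onD[OF f, of x y] by (simp add: dist_real_def)
  have mono: "F1 x \<le> F1 y" "F2 x \<le> F2 y" if "x \<le> y" for x y
    proof -
    have "\<bar>x - y\<bar> = y - x" using that by simp
    then have "f x - f y \<le> (y - x) / 2" "f y - f x \<le> (y - x) / 2"
      using fL[of x y] abs_ge_self[of "f x - f y"] abs_ge_minus_self[of "f x - f y"] by simp_all
    then show "F1 x \<le> F1 y" "F2 x \<le> F2 y" by (simp_all add: F1_def F2_def field_simps)
  qed
  have cont_f: "isCont f a" for a
    using lipschitz_on_continuous_on[OF f] by (simp add: continuous_on_eq_continuous_at)
  have cont: "isCont F1 a" "isCont F2 a" for a
    unfolding F1_def[abs_def] F2_def[abs_def] by (intro continuous_intros cont_f; simp)+
  have cr: "continuous (at_right a) F1" "continuous (at_right a) F2" for a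
    using cont by (auto intro: continuous_at_imp_continuous_at_within)
  let ?N1 = "interval_measure F1" and ?N2 = "interval_measure F2"
  have Icc: "emeasure ?N1 {a..b} = ennreal (F1 b - F1 a)" "emeasure ?N2 {a..b} = ennreal (F2 b - F2 a)"
    if "a \<le> b" for a b
    using that mono cont by (auto intro!: emeasure_interval_measure_Icc continuous_at_imp_continuous_on)
  have Ioc: "emeasure ?N1 {a<..b} = ennreal (F1 b - F1 a)" "emeasure ?N2 {a<..b} = ennreal (F2 b - F2 a)"
    if "a \<le> b" for a b
    using that mono cr by (auto intro!: emeasure_interval_measure_Ioc)
  define M where "M = measure_of UNIV (sets borel) (\<lambda>A. emeasure ?N1 A + emeasure ?N2 A)"
  have sM: "sets M = sets borel" by (simp add: M_def) (metis sets.sigma_sets_eq space_borel)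
  have eM: "emeasure M A = emeasure ?N1 A + emeasure ?N2 A" if "A \<in> sets borel" for A
    unfolding M_def
  proof (rule emeasure_measure_of_sigma)
    show "sigma_algebra UNIV (sets borel)" using sets.sigma_algebra_axioms[of borel] by simp
    show "positive (sets borel) (\<lambda>A. emeasure ?N1 A + emeasure ?N2 A)" by (simp add: positive_def)
    show "countably_additive (sets borel) (\<lambda>A. emeasure ?N1 A + emeasure ?N2 A)"
      unfolding countably_additive_def
      by (intro allI impI) (subst suminf_add[symmetric], auto intro!: arg_cong2[where f="(+)"] suminf_emeasure)
  qed fact
  have "interval_measure (\<lambda>x. x) = M"
  proof (rule measure_eqI_generator_eq[where \<Omega>=UNIV and E="range (\<lambda>(a, b). {a<..b::real})" and A="\<lambda>n::nat. {-real n<..real n}"])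
    show "Int_stable (range (\<lambda>(a, b). {a<..b::real}))"
      by (auto simp: Int_stable_def Int_greaterThanAtMost)
    show "X \<in> range (\<lambda>(a, b). {a<..b::real}) \<Longrightarrow> emeasure (interval_measure (\<lambda>x. x)) X = emeasure M X" for X
    proof clarsimp
      fix a b :: real
      show "emeasure (interval_measure (\<lambda>x. x)) {a<..b} = emeasure M {a<..b}"
      proof (cases "a \<le> b")
        case True
        have "ennreal (F1 b - F1 a) + ennreal (F2 b - F2 a) = ennreal (b - a)"
          using mono[OF True] by (subst ennreal_plus[symmetric]) (auto simp: F1_def F2_def)
        then show ?thesis
          using True Ioc[OF True] by (simp add: eM emeasure_interval_measure_Ioc)
      qed simp
    qed
    show "sets (interval_measure (\<lambda>x. x)) = sigma_sets UNIV (range (\<lambda>(a, b). {a<..b::real}))"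
      by (simp add: borel_sigma_sets_Ioc[symmetric]) (simp add: borel_sigma_sets_Ioc)
    then show "sets M = sigma_sets UNIV (range (\<lambda>(a, b). {a<..b::real}))" by (simp add: sM)
    show "(\<Union>n::nat. {-real n<..real n}) = UNIV"
    proof (intro equalityI subset_UNIV subsetI)
      fix x :: real
      obtain n where "\<bar>x\<bar> < real n" using reals_Archimedean2 by blast
      then have "x \<in> {-real n<..real n}" by auto
      then show "x \<in> (\<Union>n::nat. {-real n<..real n})" by blast
    qed
  qed (auto simp: emeasure_interval_measure_Ioc)
  then have leb: "emeasure lborel A = emeasure ?N1 A + emeasure ?N2 A" if "A \<in> sets borel" for A
    using eM[OF that] by (simp add: lborel_eq_real)
  have "absolutely_continuous lborel ?N1"
    by (auto simp: absolutely_continuous_def null_sets_def leb)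
  then obtain G where G [measurable]: "G \<in> borel_measurable borel" "density lborel G = ?N1"
    using sigma_finite_measure.Radon_Nikodym[OF sigma_finite_lborel, of ?N1] by auto
  have "absolutely_continuous lborel ?N2"
    by (auto simp: absolutely_continuous_def null_sets_def leb)
  then obtain G2 where G2 [measurable]: "G2 \<in> borel_measurable borel" "density lborel G2 = ?N2"
    using sigma_finite_measure.Radon_Nikodym[OF sigma_finite_lborel, of ?N2] by auto
  have "density lborel (\<lambda>x. G x + G2 x) = density lborel (\<lambda>x. 1)"
  proof (rule measure_eqI)
    fix A assume "A \<in> sets (density lborel (\<lambda>x. G x + G2 x))"
    then have A [measurable]: "A \<in> sets borel" by simp
    have "emeasure (density lborel (\<lambda>x. G x + G2 x)) A = emeasure (density lborel G) A + emeasure (density lborel G2) A"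
      by (simp add: emeasure_density distrib_right nn_integral_add)
    also have "\<dots> = emeasure lborel A" using leb[OF A] G(2) G2(2) by simp
    finally show "emeasure (density lborel (\<lambda>x. G x + G2 x)) A = emeasure (density lborel (\<lambda>x. 1)) A"
      by (simp add: density_1)
  qed simp
  then have "AE x in lborel. G x + G2 x = 1"
    by (intro sigma_finite_measure.density_unique[OF sigma_finite_lborel]) auto
  \<comment> \<open>The density is at most 1 only almost everywhere; truncation makes the bound hold
    everywhere without changing the measure.\<close>
  then have AE: "AE x in lborel. min (G x) 1 = G x"
    by eventually_elim (metis min_absorb1 le_iff_add)
  then have "density lborel (\<lambda>x. min (G x) 1) = ?N1"
    using G by (subst density_cong[OF _ _ AE]) auto
  then show thesis
    using Icc(1) by (intro that[of "\<lambda>x. min (G x) 1"]) (auto simp: F1_def diff_divide_distrib algebra_simps)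
qed

lemma set_integrable_bounded_Icc:
  fixes f :: "real \<Rightarrow> real"
  assumes "f \<in> borel_measurable borel" "\<And>x. \<bar>f x\<bar> \<le> B"
  shows "set_integrable lborel {a..b} f"
  unfolding set_integrable_def using assms
  by (intro integrableI_bounded_set_indicator[of _ _ _ B]) (auto simp: emeasure_lborel_Icc_eq)

text \<open>Lebesgue differentiation through rational levels. If q is slightly above
  \<open>r x\<close>, the excess of r over q vanishes at x, so by \<open>AE_small_intervals\<close>
  its integral over short intervals at x is negligible and the mean of r is at most about q. Levels
  below \<open>r x\<close> bound the mean from the other side. Rational levels keep the number of
  exceptional null sets countable.\<close>

lemma lipschitz_half_AE_derivative:
  fixes f :: "real \<Rightarrow> real"
  assumes f: "(1/2)-lipschitz_on UNIV f"
  obtains g where "g \<in> borel_measurable borel" "\<And>x. \<bar>g x\<bar> \<le> 1/2"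
    "AE x in lborel. (f has_real_derivative g x) (at x)"
    "\<And>a b. a \<le> b \<Longrightarrow> f b - f a = (\<integral>x\<in>{a..b}. g x \<partial>lborel)"
proof -
  obtain G :: "real \<Rightarrow> ennreal" where G [measurable]: "G \<in> borel_measurable borel" and G1: "\<And>x. G x \<le> 1"
    and GI: "\<And>a b. a \<le> b \<Longrightarrow> emeasure (density lborel G) {a..b} = ennreal ((b - a) / 2 + (f b - f a))"
    using lipschitz_half_density[OF f] by blast
  define r where "r x = enn2real (G x)" for x
  have r [measurable]: "r \<in> borel_measurable borel" unfolding r_def by measurable
  have Gr: "G x = ennreal (r x)" for x
  proof -
    have "G x < top" using G1[of x] by (rule le_less_trans) simp
    then show ?thesis by (simp add: r_def)
  qed
  have r01: "0 \<le> r x" "r x \<le> 1" for x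
    using G1[of x] unfolding Gr[of x] by (auto simp: r_def)
  have r_int: "set_integrable lborel {a..b} r" for a b
    using r01 by (intro set_integrable_bounded_Icc[of _ 1]) auto
  have I: "(\<integral>x\<in>{a..b}. r x \<partial>lborel) = (b - a) / 2 + (f b - f a)" if "a \<le> b" for a b
  proof -
    have fL: "\<bar>f b - f a\<bar> \<le> (b - a) / 2"
      using lipschitz_onD[OF f, of b a] that by (simp add: dist_real_def)
    then have fL': "0 \<le> (b - a) / 2 + (f b - f a)"
      using abs_ge_minus_self[of "f b - f a"] by argo
    have "ennreal (\<integral>x\<in>{a..b}. r x \<partial>lborel) = (\<integral>\<^sup>+x. ennreal (indicator {a..b} x * r x) \<partial>lborel)"
      unfolding set_lebesgue_integral_def using r_int[of a b] r01
      by (subst nn_integral_eq_integral) (auto simp: set_integrable_def)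
    also have "\<dots> = emeasure (density lborel G) {a..b}"
      by (subst emeasure_density) (auto intro!: nn_integral_cong simp: Gr indicator_def)
    finally have "ennreal (\<integral>x\<in>{a..b}. r x \<partial>lborel) = ennreal ((b - a) / 2 + (f b - f a))"
      using GI[OF that] by simp
    then show ?thesis
      using r01 fL' by (subst (asm) ennreal_inj) (auto simp: set_lebesgue_integral_def intro!: integral_nonneg)
  qed
  define up lo where "up q x = ennreal (max 0 (r x - q))" and "lo q x = ennreal (max 0 (q - r x))" for q x
  have [measurable]: "up q \<in> borel_measurable borel" "lo q \<in> borel_measurable borel" for q
    unfolding up_def[abs_def] lo_def[abs_def] by measurable
  have bounds: "up q x \<le> ennreal (1 + \<bar>q\<bar>)" "lo q x \<le> ennreal (1 + \<bar>q\<bar>)" for q x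
    using r01[of x] by (auto simp: up_def lo_def simp del: ennreal_plus intro!: ennreal_leI)
  let ?sm = "\<lambda>k x. k x = 0 \<longrightarrow>
    (\<forall>e>0. \<exists>d>0. \<forall>r. 0 < r \<and> r < d \<longrightarrow> emeasure (density lborel k) (cball x r) \<le> ennreal (e * r))"
  have AE: "AE x in lborel. \<forall>q\<in>\<rat>. ?sm (up q) x \<and> ?sm (lo q) x"
    using bounds by (intro AE_ball_countable[THEN iffD2] ballI AE_conjI AE_small_intervals[where C="1 + \<bar>_\<bar>"] countable_rat) auto
  have upb: "(\<integral>x\<in>{a..b}. r x \<partial>lborel) \<le> q * (b - a) + B"
    if ab: "a \<le> b" and B: "emeasure (density lborel (up q)) {a..b} \<le> ennreal B" "0 \<le> B" for a b q B
  proof -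
    have si: "set_integrable lborel {a..b} (\<lambda>x. max 0 (r x - q))"
    proof (rule set_integrable_bounded_Icc[of _ "1 + \<bar>q\<bar>"])
      show "\<bar>max 0 (r x - q)\<bar> \<le> 1 + \<bar>q\<bar>" for x using r01[of x] by linarith
    qed simp
    have sq: "set_integrable lborel {a..b} (\<lambda>x. q)"
      by (rule set_integrable_bounded_Icc[of _ "\<bar>q\<bar>"]) auto
    have "ennreal (\<integral>x\<in>{a..b}. max 0 (r x - q) \<partial>lborel) = (\<integral>\<^sup>+x. ennreal (indicator {a..b} x * max 0 (r x - q)) \<partial>lborel)"
      unfolding set_lebesgue_integral_def using si
      by (subst nn_integral_eq_integral) (auto simp: set_integrable_def)
    also have "\<dots> = emeasure (density lborel (up q)) {a..b}"
      by (subst emeasure_density) (auto intro!: nn_integral_cong simp: up_def indicator_def)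
    finally have "ennreal (\<integral>x\<in>{a..b}. max 0 (r x - q) \<partial>lborel) \<le> ennreal B" using B by simp
    then have 1: "(\<integral>x\<in>{a..b}. max 0 (r x - q) \<partial>lborel) \<le> B" using B by simp
    have "(\<integral>x\<in>{a..b}. r x \<partial>lborel) \<le> (\<integral>x\<in>{a..b}. q + max 0 (r x - q) \<partial>lborel)"
      by (intro set_integral_mono r_int set_integral_add si sq) auto
    also have "\<dots> = (\<integral>x\<in>{a..b}. q \<partial>lborel) + (\<integral>x\<in>{a..b}. max 0 (r x - q) \<partial>lborel)"
      by (intro set_integral_add si sq)
    also have "(\<integral>x\<in>{a..b}. q \<partial>lborel) = q * (b - a)"
      using ab by (simp add: set_lebesgue_integral_def mult.commute)
    finally show ?thesis using 1 by simp
  qed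
  have lob: "(\<integral>x\<in>{a..b}. r x \<partial>lborel) \<ge> q * (b - a) - B"
    if ab: "a \<le> b" and B: "emeasure (density lborel (lo q)) {a..b} \<le> ennreal B" "0 \<le> B" for a b q B
  proof -
    have si: "set_integrable lborel {a..b} (\<lambda>x. max 0 (q - r x))"
    proof (rule set_integrable_bounded_Icc[of _ "1 + \<bar>q\<bar>"])
      show "\<bar>max 0 (q - r x)\<bar> \<le> 1 + \<bar>q\<bar>" for x using r01[of x] by linarith
    qed simp
    have sq: "set_integrable lborel {a..b} (\<lambda>x. q)"
      by (rule set_integrable_bounded_Icc[of _ "\<bar>q\<bar>"]) auto
    have "ennreal (\<integral>x\<in>{a..b}. max 0 (q - r x) \<partial>lborel) = (\<integral>\<^sup>+x. ennreal (indicator {a..b} x * max 0 (q - r x)) \<partial>lborel)"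
      unfolding set_lebesgue_integral_def using si
      by (subst nn_integral_eq_integral) (auto simp: set_integrable_def)
    also have "\<dots> = emeasure (density lborel (lo q)) {a..b}"
      by (subst emeasure_density) (auto intro!: nn_integral_cong simp: lo_def indicator_def)
    finally have "ennreal (\<integral>x\<in>{a..b}. max 0 (q - r x) \<partial>lborel) \<le> ennreal B" using B by simp
    then have 1: "(\<integral>x\<in>{a..b}. max 0 (q - r x) \<partial>lborel) \<le> B" using B by simp
    have "q * (b - a) = (\<integral>x\<in>{a..b}. q \<partial>lborel)"
      using ab by (simp add: set_lebesgue_integral_def mult.commute)
    also have "\<dots> \<le> (\<integral>x\<in>{a..b}. r x + max 0 (q - r x) \<partial>lborel)"
      by (intro set_integral_mono r_int set_integral_add si sq) auto
    also have "\<dots> = (\<integral>x\<in>{a..b}. r x \<partial>lborel) + (\<integral>x\<in>{a..b}. max 0 (q - r x) \<partial>lborel)"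
      by (intro set_integral_add si r_int)
    finally show ?thesis using 1 by simp
  qed
  have der: "AE x in lborel. (f has_real_derivative (r x - 1/2)) (at x)"
    using AE
  proof eventually_elim
    case (elim x)
    have main: "\<exists>d>0. \<forall>y. \<bar>y - x\<bar> < d \<longrightarrow> \<bar>f y - f x - (r x - 1/2) * (y - x)\<bar> \<le> e * \<bar>y - x\<bar>" if e: "0 < e" for e
    proof -
      obtain q where q: "q \<in> \<rat>" "r x < q" "q < r x + e/2" using Rats_dense_in_real[of "r x" "r x + e/2"] e by auto
      obtain p where p: "p \<in> \<rat>" "r x - e/2 < p" "p < r x" using Rats_dense_in_real[of "r x - e/2" "r x"] e by auto
      have "up q x = 0" "lo p x = 0" using q p by (auto simp: up_def lo_def)
      then obtain d1 d2 where d: "0 < d1" "0 < d2"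
        and d1: "\<And>\<rho>. 0 < \<rho> \<Longrightarrow> \<rho> < d1 \<Longrightarrow> emeasure (density lborel (up q)) (cball x \<rho>) \<le> ennreal (e/2 * \<rho>)"
        and d2: "\<And>\<rho>. 0 < \<rho> \<Longrightarrow> \<rho> < d2 \<Longrightarrow> emeasure (density lborel (lo p)) (cball x \<rho>) \<le> ennreal (e/2 * \<rho>)"
      proof -
        have e2: "0 < e/2" using e by simp
        have "?sm (up q) x" "?sm (lo p) x" using elim q(1) p(1) by blast+
        then have "\<exists>d>0. \<forall>\<rho>. 0 < \<rho> \<and> \<rho> < d \<longrightarrow> emeasure (density lborel (up q)) (cball x \<rho>) \<le> ennreal (e/2 * \<rho>)"
          "\<exists>d>0. \<forall>\<rho>. 0 < \<rho> \<and> \<rho> < d \<longrightarrow> emeasure (density lborel (lo p)) (cball x \<rho>) \<le> ennreal (e/2 * \<rho>)"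
          using \<open>up q x = 0\<close> \<open>lo p x = 0\<close> e2 by presburger+
        then show thesis using that by blast
      qed
      have "\<bar>f y - f x - (r x - 1/2) * (y - x)\<bar> \<le> e * \<bar>y - x\<bar>" if y: "\<bar>y - x\<bar> < min d1 d2" for y
      proof (cases "y = x")
        case False
        \<comment> \<open>Increments to the left and to the right are treated together: the interval
          between x and y lies in the ball of radius \<open>\<bar>y - x\<bar>\<close> around x,
          where the mass bounds hold.\<close>
        define a b where "a = min x y" and "b = max x y"
        have ab: "a \<le> b" "b - a = \<bar>y - x\<bar>" "{a..b} \<subseteq> cball x \<bar>y - x\<bar>"
          by (auto simp: a_def b_def dist_real_def)
        have u: "emeasure (density lborel (up q)) {a..b} \<le> ennreal (e/2 * \<bar>y - x\<bar>)"
          using order_trans[OF emeasure_mono[OF ab(3)] d1] False y by auto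
        have l: "emeasure (density lborel (lo p)) {a..b} \<le> ennreal (e/2 * \<bar>y - x\<bar>)"
          using order_trans[OF emeasure_mono[OF ab(3)] d2] False y by auto
        have 1: "(b - a) / 2 + (f b - f a) \<le> q * (b - a) + e/2 * \<bar>y - x\<bar>"
          using upb[OF ab(1) u] e I[OF ab(1)] by simp
        have 2: "(b - a) / 2 + (f b - f a) \<ge> p * (b - a) - e/2 * \<bar>y - x\<bar>"
          using lob[OF ab(1) l] e I[OF ab(1)] by simp
        have 3: "q * (b - a) \<le> r x * (b - a) + e/2 * (b - a)"
          using q ab(1) mult_right_mono[of q "r x + e/2" "b - a"] by (simp add: algebra_simps)
        have 4: "p * (b - a) \<ge> r x * (b - a) - e/2 * (b - a)"
          using p ab(1) mult_right_mono[of "r x - e/2" p "b - a"] by (simp add: algebra_simps)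
        have 5: "\<bar>f b - f a - (r x - 1/2) * (b - a)\<bar> \<le> e * \<bar>y - x\<bar>"
          using 1 2 3 4 ab(2) by (simp add: algebra_simps abs_le_iff)
        show ?thesis
        proof (cases "x \<le> y")
          case True then show ?thesis using 5 by (simp add: a_def b_def max_def min_def)
        next
          case False
          then have "f b - f a - (r x - 1/2) * (b - a) = - (f y - f x - (r x - 1/2) * (y - x))"
            by (simp add: a_def b_def field_simps)
          then show ?thesis using 5 by simp
        qed
      qed simp
      then show ?thesis using d by (intro exI[of _ "min d1 d2"]) auto
    qed
    show "(f has_real_derivative (r x - 1/2)) (at x)"
      unfolding has_field_derivative_def has_derivative_at_alt
      using main by (auto intro: bounded_linear_mult_right)
  qed
  show thesis
  proof (rule that[of "\<lambda>x. r x - 1/2"])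
    show "\<bar>r x - 1/2\<bar> \<le> 1/2" for x using r01[of x] by (intro abs_leI) auto
    show "f b - f a = (\<integral>x\<in>{a..b}. r x - 1/2 \<partial>lborel)" if "a \<le> b" for a b
    proof -
      have "set_integrable lborel {a..b} (\<lambda>x. 1/2 :: real)"
        by (rule set_integrable_bounded_Icc[of _ "1/2"]) auto
      then have "(\<integral>x\<in>{a..b}. r x - 1/2 \<partial>lborel) = (\<integral>x\<in>{a..b}. r x \<partial>lborel) - (\<integral>x\<in>{a..b}. 1/2 \<partial>lborel)"
        by (intro set_integral_diff r_int)
      also have "(\<integral>x\<in>{a..b}. 1/2 \<partial>lborel) = (b - a) / 2"
        using that by (simp add: set_lebesgue_integral_def)
      finally show ?thesis using I[OF that] by simp
    qed
  qed (use der in auto)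
qed

theorem lipschitz_AE_derivative:
  fixes f :: "real \<Rightarrow> real"
  assumes f: "L-lipschitz_on UNIV f"
  obtains g where "g \<in> borel_measurable borel" "\<And>x. \<bar>g x\<bar> \<le> L + 1"
    "AE x in lborel. (f has_real_derivative g x) (at x)"
    "\<And>a b. a \<le> b \<Longrightarrow> f b - f a = (\<integral>x\<in>{a..b}. g x \<partial>lborel)"
proof -
  have L: "0 \<le> L" using lipschitz_on_nonneg[OF f] .
  \<comment> \<open>Division by c brings the Lipschitz constant below 1/2. The summand 1 keeps c
    positive when L is 0 and accounts for the bound \<open>L + 1\<close> in the conclusion.\<close>
  define c where "c = 2 * (L + 1)"
  have c: "0 < c" using L by (simp add: c_def)
  have "(1/2)-lipschitz_on UNIV (\<lambda>x. f x / c)"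
  proof (rule lipschitz_onI)
    fix x y
    have "dist (f x) (f y) \<le> L * dist x y" using lipschitz_onD[OF f] by simp
    also have "\<dots> \<le> c / 2 * dist x y" by (intro mult_right_mono) (auto simp: c_def)
    finally show "dist (f x / c) (f y / c) \<le> 1/2 * dist x y"
      using c by (simp add: dist_real_def field_simps abs_divide flip: diff_divide_distrib)
  qed simp
  then obtain g where g: "g \<in> borel_measurable borel" "\<And>x. \<bar>g x\<bar> \<le> 1/2"
    "AE x in lborel. ((\<lambda>x. f x / c) has_real_derivative g x) (at x)"
    "\<And>a b. a \<le> b \<Longrightarrow> f b / c - f a / c = (\<integral>x\<in>{a..b}. g x \<partial>lborel)"
    using lipschitz_half_AE_derivative by blast
  show thesis
  proof (rule that[of "\<lambda>x. c * g x"])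
    show "\<bar>c * g x\<bar> \<le> L + 1" for x
      proof -
      have "\<bar>c * g x\<bar> \<le> c * (1/2)" unfolding abs_mult using g(2)[of x] c by (auto intro: mult_left_mono)
      then show ?thesis by (simp add: c_def)
    qed
    show "AE x in lborel. (f has_real_derivative c * g x) (at x)"
      using g(3)
    proof eventually_elim
      case (elim x)
      from DERIV_cmult[OF elim, of c] show ?case using c by simp
    qed
    show "f b - f a = (\<integral>x\<in>{a..b}. c * g x \<partial>lborel)" if "a \<le> b" for a b
      using g(4)[OF that] c by (simp add: field_simps)
  qed (use g(1) in simp)
qed

section \<open>Determinants of positive forms\<close>

text \<open>Each term of the Leibniz sum contains exactly one factor from row k, so the determinant
  is linear in that row.\<close>

lemma det_on_row_combination:
  assumes I: "finite I" and k: "k \<in> I" and AB: "\<And>i j. i \<in> I \<Longrightarrow> i \<noteq> k \<Longrightarrow> B i j = A i j"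
    "\<And>i j. i \<in> I \<Longrightarrow> i \<noteq> k \<Longrightarrow> C i j = A i j" "\<And>j. C k j = A k j + c * B k j"
  shows "det_on I C = det_on I A + c * det_on I B"
proof -
  have split: "(\<Prod>i\<in>I. M i (p i)) = M k (p k) * (\<Prod>i\<in>I - {k}. M i (p i))" for M :: "'a \<Rightarrow> 'a \<Rightarrow> real" and p
    using I k by (simp add: prod.remove)
  have rest: "(\<Prod>i\<in>I - {k}. C i (p i)) = (\<Prod>i\<in>I - {k}. A i (p i))"
    "(\<Prod>i\<in>I - {k}. B i (p i)) = (\<Prod>i\<in>I - {k}. A i (p i))" for p
    by (auto intro!: prod.cong simp: AB)
  show ?thesis
    unfolding det_on_def split rest AB(3)
    by (simp add: algebra_simps sum.distrib sum_distrib_left)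
qed

text \<open>Composing permutations with the transposition of i and j reverses the sign and, the two
  rows being equal, leaves the products unchanged; the sum is its own negative.\<close>

lemma det_on_identical_rows:
  assumes I: "finite I" and ij: "i \<in> I" "j \<in> I" "i \<noteq> j" and eq: "\<And>l. A i l = A j l"
  shows "det_on I A = 0"
proof -
  let ?t = "Transposition.transpose i j"
  let ?P = "{p. p permutes I}"
  let ?f = "\<lambda>p. of_int (sign p) * (\<Prod>l\<in>I. A l (p l)) :: real"
  have t: "?t permutes I" using ij by (simp add: permutes_swap_id)
  have "?f (p \<circ> ?t) = - ?f p" if p: "p permutes I" for p
  proof -
    have "sign (p \<circ> ?t) = - sign p"
      using ij permutation_permutes[of p] p I by (subst sign_compose) (auto simp: permutation_swap_id sign_swap_id)
    moreover have "(\<Prod>l\<in>I. A l ((p \<circ> ?t) l)) = (\<Prod>l\<in>I. A l (p l))"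
    proof -
      have "(\<Prod>l\<in>I. A l ((p \<circ> ?t) l)) = (\<Prod>l\<in>I. A (?t l) ((p \<circ> ?t) (?t l)))"
        using prod.permute[OF t, of "\<lambda>l. A l ((p \<circ> ?t) l)"] unfolding o_def .
      also have "\<dots> = (\<Prod>l\<in>I. A l (p l))"
      proof (rule prod.cong[OF refl])
        fix l show "A (?t l) ((p \<circ> ?t) (?t l)) = A l (p l)"
          using eq ij(3) by (simp add: Transposition.transpose_def)
      qed
      finally show ?thesis .
    qed
    ultimately show ?thesis by simp
  qed
  then have "(\<Sum>p\<in>?P. ?f (p \<circ> ?t)) = - (\<Sum>p\<in>?P. ?f p)"
    by (simp add: sum_negf)
  moreover have "(\<Sum>p\<in>?P. ?f (p \<circ> ?t)) = (\<Sum>p\<in>?P. ?f p)"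
    by (rule sum_permutations_compose_right[OF t, symmetric])
  ultimately show ?thesis by (simp add: det_on_def)
qed

lemma det_on_add_row_multiples:
  assumes I: "finite I" and k: "k \<in> I" and F: "F \<subseteq> I - {k}"
  shows "det_on I (\<lambda>i j. if i \<in> F then A i j - c i * A k j else A i j) = det_on I A"
proof -
  have "finite F" using F I finite_subset by blast
  then show ?thesis using F
  proof (induction F rule: finite_induct)
    case (insert l F)
    let ?A = "\<lambda>F i j. if i \<in> F then A i j - c i * A k j else A i j"
    let ?B = "\<lambda>i j. if i = l then A k j else ?A F i j"
    have l: "l \<in> I" "l \<noteq> k" "k \<notin> F" using insert.prems by auto
    have "det_on I (?A (insert l F)) = det_on I (?A F) + (- c l) * det_on I ?B"
      using insert.hyps by (intro det_on_row_combination[OF I l(1)]) auto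
    also have "det_on I ?B = 0"
      using l by (intro det_on_identical_rows[OF I l(1) k l(2)]) auto
    finally show ?case using insert by simp
  qed simp
qed

text \<open>A permutation that moves k takes some other row to column k, where the entry is zero.
  Only permutations of I survive, each with the factor \<open>A k k\<close>.\<close>

lemma det_on_insert_zero_column:
  assumes I: "finite I" "k \<notin> I" and z: "\<And>i. i \<in> I \<Longrightarrow> A i k = 0"
  shows "det_on (insert k I) A = A k k * det_on I A"
proof -
  let ?f = "\<lambda>p. of_int (sign p) * (\<Prod>i\<in>insert k I. A i (p i)) :: real"
  have sub: "{p. p permutes I} \<subseteq> {p. p permutes insert k I}"
    by (auto intro: permutes_subset)
  have "det_on (insert k I) A = (\<Sum>p | p permutes I. ?f p)"
    unfolding det_on_def
  proof (rule sum.mono_neutral_right[OF _ sub])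
    show "finite {p. p permutes insert k I}" using I by (simp add: finite_permutations)
    show "\<forall>p\<in>{p. p permutes insert k I} - {p. p permutes I}. ?f p = 0"
    proof
      fix p assume p: "p \<in> {p. p permutes insert k I} - {p. p permutes I}"
      then have pk: "p permutes insert k I" and np: "\<not> p permutes I" by auto
      obtain i where i: "i \<in> insert k I" "p i = k"
        using permutes_image[OF pk] by (metis imageE insertI1)
      have "i \<noteq> k"
      proof
        assume "i = k"
        then have "p permutes I"
          using i pk by (intro permutes_superset[OF pk]) auto
        with np show False by simp
      qed
      then have "A i (p i) = 0" using i z by auto
      then have "(\<Prod>i\<in>insert k I. A i (p i)) = 0"
        using I i(1) by (intro prod_zero) auto
      then show "?f p = 0" by simp
    qed
  qed
  also have "\<dots> = (\<Sum>p | p permutes I. A k k * (of_int (sign p) * (\<Prod>i\<in>I. A i (p i))))"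
  proof (rule sum.cong[OF refl])
    fix p assume "p \<in> {p. p permutes I}"
    then have "p k = k" using I permutes_not_in by fastforce
    then show "?f p = A k k * (of_int (sign p) * (\<Prod>i\<in>I. A i (p i)))"
      using I by simp
  qed
  finally show ?thesis by (simp add: det_on_def sum_distrib_left)
qed

lemma det_on_cong:
  assumes "\<And>i j. i \<in> I \<Longrightarrow> j \<in> I \<Longrightarrow> A i j = B i j"
  shows "det_on I A = det_on I B"
  unfolding det_on_def
  using assms permutes_in_image by (intro sum.cong refl arg_cong2[where f="(*)"] prod.cong) fastforce+

text \<open>Induction on the index set through the Schur complement, which inherits the lower bound of the
  quadratic form because it is the minimum of that form over the eliminated variable.\<close>

theorem det_on_lower_bound:
  assumes "finite I" and "0 < l" and "\<And>i j. i \<in> I \<Longrightarrow> j \<in> I \<Longrightarrow> A i j = A j i"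
    and "\<And>x. l * (\<Sum>i\<in>I. (x i)\<^sup>2) \<le> (\<Sum>i\<in>I. \<Sum>j\<in>I. A i j * x i * x j)"
  shows "l ^ card I \<le> det_on I A"
  using assms
proof (induction I arbitrary: A rule: finite_induct)
  case empty
  then show ?case by (simp add: det_on_def)
next
  case (insert k I)
  have kI: "k \<notin> I" and fin: "finite I" using insert.hyps by auto
  have sym: "A i j = A j i" if "i \<in> insert k I" "j \<in> insert k I" for i j using insert.prems(2) that .
  have quad: "(\<Sum>i\<in>insert k I. \<Sum>j\<in>insert k I. A i j * x i * x j) =
      A k k * (x k)\<^sup>2 + 2 * x k * (\<Sum>i\<in>I. A k i * x i) + (\<Sum>i\<in>I. \<Sum>j\<in>I. A i j * x i * x j)" for x
  proof -
    have "(\<Sum>i\<in>I. A i k * x i * x k) = x k * (\<Sum>i\<in>I. A k i * x i)"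
      unfolding sum_distrib_left by (intro sum.cong refl) (simp add: sym ac_simps)
    moreover have "(\<Sum>i\<in>I. A k i * x k * x i) = x k * (\<Sum>i\<in>I. A k i * x i)"
      unfolding sum_distrib_left by (intro sum.cong refl) (simp add: ac_simps)
    ultimately show ?thesis
      using kI fin by (simp add: sum.distrib power2_eq_square algebra_simps)
  qed
  have pivot: "l \<le> A k k"
  proof -
    have z: "(\<Sum>i\<in>I. (if i = k then 1 else 0 :: real)\<^sup>2) = 0"
      "(\<Sum>i\<in>I. A k i * (if i = k then 1 else 0)) = 0"
      "(\<Sum>i\<in>I. \<Sum>j\<in>I. A i j * (if i = k then 1 else 0) * (if j = k then 1 else 0)) = 0"
      using kI by (auto intro!: sum.neutral)
    show ?thesis
      using insert.prems(3)[of "\<lambda>i. if i = k then 1 else 0"] z kI fin unfolding quad by simp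
  qed
  then have Ak: "0 < A k k" using insert.prems(1) by linarith
  define S where "S i j = A i j - A i k / A k k * A k j" for i j
  \<comment> \<open>One step of Gaussian elimination: the pivot row clears column k, and what
    remains on I is the Schur complement S.\<close>
  let ?B = "\<lambda>i j. if i \<in> I then A i j - A i k / A k k * A k j else A i j"
  have "det_on (insert k I) A = det_on (insert k I) ?B"
    using kI fin by (intro det_on_add_row_multiples[symmetric]) auto
  also have "\<dots> = ?B k k * det_on I ?B"
    using kI fin Ak by (intro det_on_insert_zero_column) auto
  also have "\<dots> = A k k * det_on I S"
    using kI by (auto simp: S_def intro!: det_on_cong)
  finally have det: "det_on (insert k I) A = A k k * det_on I S" .
  have "l ^ card I \<le> det_on I S"
  proof (rule insert.IH[OF insert.prems(1)])
    show "S i j = S j i" if "i \<in> I" "j \<in> I" for i j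
      using that by (simp add: S_def sym)
    fix x :: "'a \<Rightarrow> real"
    define b where "b = (\<Sum>i\<in>I. A k i * x i)"
    \<comment> \<open>The value \<open>- b / A k k\<close> minimises the quadratic form in its
      variable at k, the others being fixed at x; at this point the form of A equals the form of
      S.\<close>
    define y where "y = x(k := - b / A k k)"
    have yx: "y i = x i" if "i \<in> I" for i using that kI by (auto simp: y_def)
    have "l * (\<Sum>i\<in>I. (x i)\<^sup>2) \<le> l * (\<Sum>i\<in>insert k I. (y i)\<^sup>2)"
      using insert.prems(1) kI fin yx by (intro mult_left_mono) auto
    also have "\<dots> \<le> (\<Sum>i\<in>insert k I. \<Sum>j\<in>insert k I. A i j * y i * y j)"
      by (rule insert.prems(3))
    also have "\<dots> = A k k * (y k)\<^sup>2 + 2 * y k * (\<Sum>i\<in>I. A k i * x i) + (\<Sum>i\<in>I. \<Sum>j\<in>I. A i j * x i * x j)"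
      unfolding quad using yx by simp
    also have "A k k * (y k)\<^sup>2 + 2 * y k * (\<Sum>i\<in>I. A k i * x i) = - (b * b / A k k)"
      using Ak unfolding b_def[symmetric] by (simp add: y_def power2_eq_square field_simps)
    also have "b * b / A k k = (\<Sum>i\<in>I. \<Sum>j\<in>I. A i k / A k k * A k j * x i * x j)"
    proof -
      have "b * b = (\<Sum>i\<in>I. \<Sum>j\<in>I. (A k i * x i) * (A k j * x j))"
        unfolding b_def by (rule sum_product)
      then show ?thesis
        by (simp add: sum_divide_distrib) (intro sum.cong refl, simp add: sym)
    qed
    finally show "l * (\<Sum>i\<in>I. (x i)\<^sup>2) \<le> (\<Sum>i\<in>I. \<Sum>j\<in>I. S i j * x i * x j)"
      by (simp add: S_def algebra_simps sum_subtractf)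
  qed
  then have "l * l ^ card I \<le> A k k * det_on I S"
    using pivot insert.prems(1) by (intro mult_mono) auto
  then show ?case using det kI fin by simp
qed

section \<open>Lipschitz functions of several variables\<close>

locale finite_index =
  fixes J :: "'i set"
  assumes finite_J [simp]: "finite J"

sublocale finite_index \<subseteq> product_sigma_finite "\<lambda>_ :: 'i. lborel :: real measure"
  by standard

context finite_index
begin

abbreviation M :: "('i \<Rightarrow> real) measure" where
  "M \<equiv> PiM J (\<lambda>_. lborel)"

definition l1 :: "('i \<Rightarrow> real) \<Rightarrow> ('i \<Rightarrow> real) \<Rightarrow> real" where
  "l1 c c' = (\<Sum>i\<in>J. \<bar>c i - c' i\<bar>)"

definition lip :: "real \<Rightarrow> (('i \<Rightarrow> real) \<Rightarrow> real) \<Rightarrow> bool" where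
  "lip L v \<longleftrightarrow> 0 \<le> L \<and> (\<forall>c c'. \<bar>v c - v c'\<bar> \<le> L * l1 c c')"

text \<open>The restriction keeps shifted points in \<open>space M\<close>, at the price that the
  shift by 0 is the identity only there.\<close>

definition shift :: "('i \<Rightarrow> real) \<Rightarrow> real \<Rightarrow> ('i \<Rightarrow> real) \<Rightarrow> 'i \<Rightarrow> real" where
  "shift q t c = (\<lambda>i\<in>J. c i + t * q i)"

definition size1 :: "('i \<Rightarrow> real) \<Rightarrow> real" where
  "size1 q = (\<Sum>i\<in>J. \<bar>q i\<bar>)"

lemma size1_nonneg [simp]: "0 \<le> size1 q" by (simp add: size1_def sum_nonneg)

lemma l1_nonneg [simp]: "0 \<le> l1 c c'" by (simp add: l1_def sum_nonneg)

lemma l1_shift: "l1 (shift q s c) (shift q t c) = \<bar>s - t\<bar> * size1 q"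
proof -
  have "\<bar>shift q s c i - shift q t c i\<bar> = \<bar>s - t\<bar> * \<bar>q i\<bar>" if "i \<in> J" for i
    using that by (simp add: shift_def abs_mult[symmetric] algebra_simps)
  then show ?thesis by (simp add: l1_def size1_def sum_distrib_left)
qed

lemma lipD: "lip L v \<Longrightarrow> \<bar>v c - v c'\<bar> \<le> L * l1 c c'" by (simp add: lip_def)

lemma lip_nonneg: "lip L v \<Longrightarrow> 0 \<le> L" by (simp add: lip_def)

lemma lip_cong:
  assumes "lip L v" "\<And>i. i \<in> J \<Longrightarrow> c i = c' i"
  shows "v c = v c'"
proof -
  have "l1 c c' = 0" using assms(2) by (simp add: l1_def)
  then show ?thesis using lipD[OF assms(1), of c c'] by simp
qed

lemma shift_space [simp, intro]: "shift q t c \<in> space M"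
  by (simp add: shift_def space_PiM)

lemma shift_measurable [measurable]: "shift q t \<in> measurable M M"
  unfolding shift_def[abs_def] by measurable

lemma shift_shift: "shift q s (shift q t c) = shift q (s + t) c"
  by (auto simp: shift_def algebra_simps)

lemma shift_0: "c \<in> space M \<Longrightarrow> shift q 0 c = c"
  by (auto simp: shift_def space_PiM PiE_def extensional_def)

text \<open>Rounding every coordinate down to a multiple of \<open>1 / Suc k\<close> has countable
  range, so v after rounding is measurable, and by the Lipschitz bound it converges to v
  uniformly.\<close>

lemma lip_measurable:
  assumes v: "lip L v"
  shows "v \<in> borel_measurable M"
proof -
  define R where "R k = (\<lambda>c. \<lambda>i\<in>J. real_of_int \<lfloor>real (Suc k) * c i\<rfloor> / real (Suc k))" for k
  define S where "S k = PiE J (\<lambda>_. range (\<lambda>z::int. real_of_int z / real (Suc k)))" for k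
  have "countable (S k)" for k
    unfolding S_def by (intro countable_PiE) auto
  moreover have "R k \<in> measurable M (count_space (S k))" for k
  proof (subst measurable_count_space_eq_countable[OF \<open>countable (S k)\<close>], intro conjI ballI)
    show "R k \<in> space M \<rightarrow> S k" by (auto simp: R_def S_def)
    fix d assume d: "d \<in> S k"
    have "R k -` {d} \<inter> space M = {c \<in> space M. \<forall>i\<in>J. real_of_int \<lfloor>real (Suc k) * c i\<rfloor> / real (Suc k) = d i}"
    proof -
      have "R k c = d \<longleftrightarrow> (\<forall>i\<in>J. R k c i = d i)" for c
        using d by (auto simp: R_def S_def PiE_iff extensional_def fun_eq_iff)
      then show ?thesis by (auto simp: R_def)
    qed
    also have "\<dots> \<in> sets M" by measurable
    finally show "R k -` {d} \<inter> space M \<in> sets M" .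
  qed
  ultimately have meas: "(\<lambda>c. v (R k c)) \<in> borel_measurable M" for k
    by (intro measurable_compose_countable'[where g="R k" and I="S k" and f="\<lambda>d c. v d"]) auto
  show ?thesis
  proof (rule borel_measurable_LIMSEQ_metric[OF meas])
    fix c
    have le: "\<bar>v (R k c) - v c\<bar> \<le> L * (real (card J) * (1 / real (Suc k)))" for k
    proof -
      have "\<bar>R k c i - c i\<bar> \<le> 1 / real (Suc k)" if "i \<in> J" for i
      proof -
        have "\<bar>real_of_int \<lfloor>real (Suc k) * c i\<rfloor> - real (Suc k) * c i\<bar> \<le> 1" by linarith
        moreover have "R k c i - c i = (real_of_int \<lfloor>real (Suc k) * c i\<rfloor> - real (Suc k) * c i) / real (Suc k)"
          using that by (simp add: R_def diff_divide_distrib)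
        ultimately show ?thesis by (simp add: abs_divide divide_right_mono)
      qed
      then have "l1 (R k c) c \<le> real (card J) * (1 / real (Suc k))"
        unfolding l1_def by (rule sum_bounded_above)
      then show ?thesis
        using lipD[OF v, of "R k c" c] lip_nonneg[OF v] by (meson mult_left_mono order_trans)
    qed
    have "(\<lambda>k. L * (real (card J) * (1 / real (Suc k)))) \<longlonglongrightarrow> L * (real (card J) * 0)"
      by (intro tendsto_mult tendsto_const LIMSEQ_Suc lim_1_over_n)
    then have "(\<lambda>k. L * (real (card J) * (1 / real (Suc k)))) \<longlonglongrightarrow> 0" by simp
    moreover have "\<forall>\<^sub>F k in sequentially. norm (v (R k c) - v c) \<le> L * (real (card J) * (1 / real (Suc k)))"
      unfolding real_norm_def by (rule always_eventually[OF allI[OF le]])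
    ultimately have "(\<lambda>k. v (R k c) - v c) \<longlonglongrightarrow> 0" by (rule Lim_null_comparison[rotated])
    then show "(\<lambda>k. v (R k c)) \<longlonglongrightarrow> v c" by (rule LIM_zero_cancel)
  qed
qed

text \<open>Product measures are determined by boxes, where the scaling of each factor contributes
  one power of \<open>\<bar>\<rho>\<bar>\<close>. The value \<open>\<rho> = 1\<close> gives
  translation invariance; other values occur when a path inside a simplex is perturbed.\<close>

lemma M_affine:
  assumes "\<rho> \<noteq> (0::real)"
  shows "M = density (distr M M (\<lambda>c. \<lambda>i\<in>J. a i + \<rho> * c i)) (\<lambda>_. ennreal (\<bar>\<rho>\<bar> ^ card J))"
proof (rule PiM_eqI[symmetric])
  fix A :: "'i \<Rightarrow> real set" assume A: "\<And>i. i \<in> J \<Longrightarrow> A i \<in> sets lborel"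
  let ?T = "\<lambda>c. \<lambda>i\<in>J. a i + \<rho> * c i"
  let ?B = "\<lambda>i. (\<lambda>x. a i + \<rho> * x) -` A i"
  have B: "?B i \<in> sets lborel" if "i \<in> J" for i
    using measurable_sets[of "\<lambda>x. a i + \<rho> * x" borel borel "A i"] A[OF that] by simp
  have PA: "Pi\<^sub>E J A \<in> sets M" using A by (intro sets_PiM_I_finite) auto
  have pre: "?T -` Pi\<^sub>E J A \<inter> space M = Pi\<^sub>E J ?B"
    by (auto simp: space_PiM PiE_iff)
  have em: "emeasure lborel (A i) = ennreal \<bar>\<rho>\<bar> * emeasure lborel (?B i)" if "i \<in> J" for i
    using A[OF that] by (subst lborel_real_affine[OF assms, of "a i"])
      (simp add: emeasure_density nn_integral_cmult_indicator emeasure_distr)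
  have "emeasure (density (distr M M ?T) (\<lambda>_. ennreal (\<bar>\<rho>\<bar> ^ card J))) (Pi\<^sub>E J A)
      = ennreal (\<bar>\<rho>\<bar> ^ card J) * emeasure M (Pi\<^sub>E J ?B)"
    using PA by (simp add: emeasure_density nn_integral_cmult_indicator emeasure_distr pre)
  also have "emeasure M (Pi\<^sub>E J ?B) = (\<Prod>i\<in>J. emeasure lborel (?B i))"
    using B by (intro emeasure_PiM) auto
  also have "ennreal (\<bar>\<rho>\<bar> ^ card J) * \<dots> = (\<Prod>i\<in>J. ennreal \<bar>\<rho>\<bar> * emeasure lborel (?B i))"
    by (simp add: prod.distrib ennreal_power)
  also have "\<dots> = (\<Prod>i\<in>J. emeasure lborel (A i))"
    by (intro prod.cong refl) (simp only: em)
  finally show "emeasure (density (distr M M ?T) (\<lambda>_. ennreal (\<bar>\<rho>\<bar> ^ card J))) (Pi\<^sub>E J A) = (\<Prod>i\<in>J. emeasure lborel (A i))" .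
qed auto

lemma AE_affine:
  assumes "\<rho> \<noteq> (0::real)" "AE c in M. P c"
  shows "AE c in M. P (\<lambda>i\<in>J. a i + \<rho> * c i)"
proof -
  let ?T = "\<lambda>c. \<lambda>i\<in>J. a i + \<rho> * c i"
  have "AE c in density (distr M M ?T) (\<lambda>_. ennreal (\<bar>\<rho>\<bar> ^ card J)). P c"
    using assms(2) unfolding M_affine[OF assms(1), of a, symmetric] .
  then have "AE c in distr M M ?T. P c"
    using assms(1) by (subst (asm) AE_density) auto
  then show ?thesis by (rule AE_distrD[rotated]) measurable
qed

lemma M_shift: "distr M M (shift q t) = M"
proof -
  have "shift q t = (\<lambda>c. \<lambda>i\<in>J. t * q i + 1 * c i)" by (auto simp: shift_def fun_eq_iff)
  then show ?thesis using M_affine[of 1 "\<lambda>i. t * q i"] by (simp add: density_1)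
qed

lemma AE_shift: "AE c in M. P c \<Longrightarrow> AE c in M. P (shift q t c)"
  using AE_affine[of 1 P "\<lambda>i. t * q i"] by (simp add: shift_def add.commute)

lemma integral_shift:
  fixes F :: "_ \<Rightarrow> real"
  assumes "F \<in> borel_measurable M"
  shows "(\<integral>c. F (shift q t c) \<partial>M) = (\<integral>c. F c \<partial>M)"
  using integral_distr[OF shift_measurable assms, of q t] by (simp add: M_shift)

lemma lip_along:
  assumes v: "lip L v"
  shows "(L * size1 q)-lipschitz_on UNIV (\<lambda>t. v (shift q t c))"
proof (rule lipschitz_onI)
  fix s t
  show "dist (v (shift q s c)) (v (shift q t c)) \<le> L * size1 q * dist s t"
    using lipD[OF v, of "shift q s c" "shift q t c"] by (simp add: l1_shift dist_real_def ac_simps)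
qed (simp add: lip_nonneg[OF v])

section \<open>Directional derivatives\<close>

definition quot :: "(('i \<Rightarrow> real) \<Rightarrow> real) \<Rightarrow> ('i \<Rightarrow> real) \<Rightarrow> real \<Rightarrow> ('i \<Rightarrow> real) \<Rightarrow> real" where
  "quot v q t c = (v (shift q t c) - v (shift q 0 c)) / t"

lemma quot_bound:
  assumes "lip L v"
  shows "\<bar>quot v q t c\<bar> \<le> L * size1 q"
proof (cases "t = 0")
  case False
  have "\<bar>v (shift q t c) - v (shift q 0 c)\<bar> \<le> L * (\<bar>t\<bar> * size1 q)"
    using lipD[OF assms, of "shift q t c" "shift q 0 c"] by (simp add: l1_shift)
  then show ?thesis using False by (simp add: quot_def abs_divide field_simps)
qed (use lip_nonneg[OF assms] in \<open>simp add: quot_def\<close>)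

lemma quot_measurable:
  assumes "lip L v" shows "quot v q t \<in> borel_measurable M"
  unfolding quot_def[abs_def]
  using measurable_compose[OF shift_measurable lip_measurable[OF assms]] by measurable

lemma quot_shift: "quot v q s (shift q t c) = (v (shift q (s + t) c) - v (shift q t c)) / s"
  by (simp add: quot_def shift_shift)

text \<open>Existence of the derivative of \<open>v\<close> at \<open>c\<close> in direction \<open>q\<close>, with rational increments so that it is
  visibly a measurable condition.\<close>

definition cauchy_at :: "(('i \<Rightarrow> real) \<Rightarrow> real) \<Rightarrow> ('i \<Rightarrow> real) \<Rightarrow> ('i \<Rightarrow> real) \<Rightarrow> bool" where
  "cauchy_at v q c \<longleftrightarrow> (\<forall>k::nat. \<exists>m::nat. \<forall>s t :: rat.
     0 < \<bar>real_of_rat s\<bar> \<and> \<bar>real_of_rat s\<bar> < 1 / Suc m \<and> 0 < \<bar>real_of_rat t\<bar> \<and> \<bar>real_of_rat t\<bar> < 1 / Suc m \<longrightarrow>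
     \<bar>quot v q (real_of_rat s) c - quot v q (real_of_rat t) c\<bar> \<le> 1 / Suc k)"

text \<open>A limit along one fixed sequence is measurable in c without further argument. It is the
  directional derivative wherever that exists; elsewhere its value carries no meaning.\<close>

definition dd :: "(('i \<Rightarrow> real) \<Rightarrow> real) \<Rightarrow> ('i \<Rightarrow> real) \<Rightarrow> ('i \<Rightarrow> real) \<Rightarrow> real" where
  "dd v q c = lim (\<lambda>k. quot v q (1 / real (Suc k)) c)"

lemma dd_measurable:
  assumes "lip L v" shows "dd v q \<in> borel_measurable M"
  unfolding dd_def[abs_def] using quot_measurable[OF assms] by (intro borel_measurable_lim_metric)

lemma cauchy_at_measurable:
  assumes "lip L v" shows "{c \<in> space M. cauchy_at v q c} \<in> sets M"
  unfolding cauchy_at_def using quot_measurable[OF assms, measurable] by measurable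

lemma cauchy_atI:
  assumes "((\<lambda>t. quot v q t c) \<longlongrightarrow> l) (at 0)"
  shows "cauchy_at v q c"
  unfolding cauchy_at_def
proof
  fix k :: nat
  have "eventually (\<lambda>t. dist (quot v q t c) l < 1 / (2 * real (Suc k))) (at 0)"
    by (rule tendstoD[OF assms]) simp
  then obtain d where d: "0 < d" "\<And>t. t \<noteq> 0 \<Longrightarrow> \<bar>t\<bar> < d \<Longrightarrow> \<bar>quot v q t c - l\<bar> < 1 / (2 * real (Suc k))"
    by (auto simp: eventually_at dist_real_def)
  obtain m where m: "1 / real (Suc m) < d" using d(1) by (metis inverse_eq_divide reals_Archimedean)
  have "\<bar>quot v q s c - quot v q t c\<bar> \<le> 1 / Suc k"
    if "0 < \<bar>s\<bar>" "\<bar>s\<bar> < 1 / Suc m" "0 < \<bar>t\<bar>" "\<bar>t\<bar> < 1 / Suc m" for s t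
  proof -
    have "\<bar>quot v q s c - l\<bar> < 1 / (2 * real (Suc k))" "\<bar>quot v q t c - l\<bar> < 1 / (2 * real (Suc k))"
      using d(2)[of s] d(2)[of t] that m by auto
    then have "\<bar>(quot v q s c - l) - (quot v q t c - l)\<bar> \<le> 1 / (2 * real (Suc k)) + 1 / (2 * real (Suc k))"
      by (intro order_trans[OF abs_triangle_ineq4] add_mono less_imp_le)
    also have "\<dots> = 1 / Suc k" by (simp add: field_simps)
    finally show ?thesis by simp
  qed
  then show "\<exists>m::nat. \<forall>s t :: rat.
     0 < \<bar>real_of_rat s\<bar> \<and> \<bar>real_of_rat s\<bar> < 1 / Suc m \<and> 0 < \<bar>real_of_rat t\<bar> \<and> \<bar>real_of_rat t\<bar> < 1 / Suc m \<longrightarrow>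
     \<bar>quot v q (real_of_rat s) c - quot v q (real_of_rat t) c\<bar> \<le> 1 / Suc k"
    by blast
qed

text \<open>\<open>cauchy_at\<close> controls rational increments only. The quotient is continuous
  in t away from 0, so a bound violated at a real t would also be violated at rationals close to
  it.\<close>

lemma cauchy_atD:
  assumes v: "lip L v" and c: "cauchy_at v q c"
  shows "((\<lambda>t. quot v q t c) \<longlongrightarrow> dd v q c) (at 0)"
proof -
  define x where "x k = quot v q (1 / real (Suc k)) c" for k
  have rat: "1 / real (Suc k) = real_of_rat (1 / of_nat (Suc k))" for k
    by (simp add: of_rat_divide of_rat_add)
  have small: "0 < \<bar>real_of_rat (1 / of_nat (Suc i))\<bar>" "\<bar>real_of_rat (1 / of_nat (Suc i))\<bar> < 1 / Suc m"
    if "Suc m \<le> i" for i m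
    unfolding rat[symmetric] using that by (auto simp: field_simps)
  have close: "\<exists>m. \<forall>s t :: rat. 0 < \<bar>real_of_rat s\<bar> \<and> \<bar>real_of_rat s\<bar> < 1 / Suc m \<and> 0 < \<bar>real_of_rat t\<bar> \<and> \<bar>real_of_rat t\<bar> < 1 / Suc m \<longrightarrow>
     \<bar>quot v q (real_of_rat s) c - quot v q (real_of_rat t) c\<bar> \<le> 1 / Suc k" for k :: nat
    using c by (auto simp: cauchy_at_def)
  have "Cauchy x"
  proof (rule metric_CauchyI)
    fix e :: real assume "0 < e"
    then obtain k where k: "1 / real (Suc k) < e" by (metis inverse_eq_divide reals_Archimedean)
    obtain m :: nat where m: "\<And>s t :: rat. 0 < \<bar>real_of_rat s\<bar> \<Longrightarrow> \<bar>real_of_rat s\<bar> < 1 / Suc m \<Longrightarrow> 0 < \<bar>real_of_rat t\<bar> \<Longrightarrow> \<bar>real_of_rat t\<bar> < 1 / Suc m \<Longrightarrow>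
      \<bar>quot v q (real_of_rat s) c - quot v q (real_of_rat t) c\<bar> \<le> 1 / Suc k"
      using close[of k] by blast
    have "dist (x i) (x j) < e" if "Suc m \<le> i" "Suc m \<le> j" for i j
    proof -
      have "\<bar>x i - x j\<bar> \<le> 1 / Suc k"
        using m[OF small[OF that(1)] small[OF that(2)]] by (simp only: x_def rat[symmetric])
      then show ?thesis using k by (simp add: dist_real_def)
    qed
    then show "\<exists>M. \<forall>i\<ge>M. \<forall>j\<ge>M. dist (x i) (x j) < e" by blast
  qed
  then have lim: "x \<longlonglongrightarrow> dd v q c"
    unfolding dd_def x_def[symmetric] by (simp add: Cauchy_convergent_iff convergent_LIMSEQ_iff)
  show ?thesis
  proof (rule tendstoI)
    fix e :: real assume "0 < e"
    then obtain k where k: "1 / real (Suc k) < e" by (metis inverse_eq_divide reals_Archimedean)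
    obtain m :: nat where m: "\<And>s t :: rat. 0 < \<bar>real_of_rat s\<bar> \<Longrightarrow> \<bar>real_of_rat s\<bar> < 1 / Suc m \<Longrightarrow> 0 < \<bar>real_of_rat t\<bar> \<Longrightarrow> \<bar>real_of_rat t\<bar> < 1 / Suc m \<Longrightarrow>
      \<bar>quot v q (real_of_rat s) c - quot v q (real_of_rat t) c\<bar> \<le> 1 / Suc k"
      using close[of k] by blast
    have rle: "\<bar>quot v q (real_of_rat s) c - dd v q c\<bar> \<le> 1 / Suc k"
      if "0 < \<bar>real_of_rat s\<bar>" "\<bar>real_of_rat s\<bar> < 1 / Suc m" for s
    proof (rule LIMSEQ_le_const2)
      show "(\<lambda>j. \<bar>quot v q (real_of_rat s) c - x j\<bar>) \<longlonglongrightarrow> \<bar>quot v q (real_of_rat s) c - dd v q c\<bar>"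
        by (intro tendsto_rabs tendsto_diff tendsto_const lim)
      show "\<exists>N. \<forall>j\<ge>N. \<bar>quot v q (real_of_rat s) c - x j\<bar> \<le> 1 / Suc k"
        using m[OF that small] by (intro exI[of _ "Suc m"] allI impI) (simp only: x_def rat[symmetric])
    qed
    have "dist (quot v q t c) (dd v q c) < e" if t: "t \<noteq> 0" "\<bar>t\<bar> < 1 / Suc m" for t
    proof -
      have "isCont (\<lambda>t. v (shift q t c)) t"
      proof -
        have "(L * size1 q)-lipschitz_on UNIV (\<lambda>t. v (shift q t c))"
          by (rule lip_along[OF v])
        then show ?thesis using lipschitz_on_continuous_on by (metis continuous_on_eq_continuous_at open_UNIV UNIV_I)
      qed
      then have "isCont (\<lambda>t. quot v q t c) t"
        unfolding quot_def using t by (intro continuous_intros)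
      then have lt: "((\<lambda>s. \<bar>quot v q s c - dd v q c\<bar>) \<longlongrightarrow> \<bar>quot v q t c - dd v q c\<bar>) (at t)"
        by (intro tendsto_intros) (simp add: isCont_def)
      have "\<bar>quot v q t c - dd v q c\<bar> \<le> 1 / Suc k"
      proof (rule ccontr)
        assume "\<not> ?thesis"
        then have "eventually (\<lambda>s. 1 / Suc k < \<bar>quot v q s c - dd v q c\<bar>) (at t)"
          using order_tendstoD(1)[OF lt] by simp
        then obtain d where d: "0 < d" "\<And>s. s \<noteq> t \<Longrightarrow> \<bar>s - t\<bar> < d \<Longrightarrow> 1 / Suc k < \<bar>quot v q s c - dd v q c\<bar>"
          by (auto simp: eventually_at dist_real_def)
        \<comment> \<open>Besides staying within d of t, the rational has to be nonzero and below
          \<open>1 / Suc m\<close> in modulus, where \<open>rle\<close> applies.\<close>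
        define \<delta> where "\<delta> = min d (min \<bar>t\<bar> (1 / Suc m - \<bar>t\<bar>))"
        have \<delta>: "0 < \<delta>" using d t by (simp add: \<delta>_def)
        then obtain r where r: "t < real_of_rat r" "real_of_rat r < t + \<delta>"
          using of_rat_dense[of t "t + \<delta>"] by auto
        have "\<bar>real_of_rat r - t\<bar> < d" "0 < \<bar>real_of_rat r\<bar>" "\<bar>real_of_rat r\<bar> < 1 / Suc m"
          using r t unfolding \<delta>_def by linarith+
        then show False using d(2)[of "real_of_rat r"] rle[of r] r by force
      qed
      then show ?thesis using k by (simp add: dist_real_def)
    qed
    then show "eventually (\<lambda>t. dist (quot v q t c) (dd v q c) < e) (at 0)"
      by (auto simp: eventually_at dist_real_def intro!: exI[of _ "1 / Suc m"])
  qed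
qed

lemma AE_lborel_ex: "AE t in (lborel :: real measure). P t \<Longrightarrow> \<exists>t. P t"
proof (rule ccontr)
  assume "AE t in (lborel :: real measure). P t" "\<nexists>t. P t"
  then have "AE t in (lborel :: real measure). False" by simp
  then have "emeasure lborel (UNIV :: real set) = 0" by (simp add: AE_iff_measurable[of UNIV])
  then show False by simp
qed

text \<open>Fubini: a property that holds at almost every point of every line in direction \<open>q\<close> holds almost
  everywhere.\<close>

lemma AE_along:
  assumes meas: "{c \<in> space M. Q c} \<in> sets M" and along: "\<And>c. AE t in lborel. Q (shift q t c)"
  shows "AE c in M. Q c"
proof -
  interpret sM: sigma_finite_measure M by (rule sigma_finite) simp
  interpret P: pair_sigma_finite M "lborel :: real measure" by standard
  have joint: "(\<lambda>x. shift q (snd x) (fst x)) \<in> measurable (M \<Otimes>\<^sub>M lborel) M"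
    unfolding shift_def by measurable
  have "AE c in M. AE t in lborel. Q (shift q t c)" using along by simp
  then have "AE t in lborel. AE c in M. Q (shift q t c)"
    using measurable_sets[OF joint meas]
    by (subst (asm) P.AE_commute) (auto simp: vimage_def Int_def conj_commute)
  \<comment> \<open>A single good t suffices: the translation by -t preserves null sets and removes
    the shift.\<close>
  then obtain t where "AE c in M. Q (shift q t c)" using AE_lborel_ex by blast
  then have "AE c in M. Q (shift q t (shift q (-t) c))" by (rule AE_shift)
  then show ?thesis
    using AE_space by eventually_elim (simp add: shift_shift shift_0)
qed

lemma AE_cauchy_at:
  assumes v: "lip L v"
  shows "AE c in M. cauchy_at v q c"
proof (rule AE_along[OF cauchy_at_measurable[OF v]])
  fix c
  obtain g where "AE t in lborel. ((\<lambda>t. v (shift q t c)) has_real_derivative g t) (at t)"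
    by (rule lipschitz_AE_derivative[OF lip_along[OF v]])
  then show "AE t in lborel. cauchy_at v q (shift q t c)"
  proof eventually_elim
    case (elim t)
    have "((\<lambda>s. quot v q s (shift q t c)) \<longlongrightarrow> g t) (at 0)"
      using elim unfolding quot_shift DERIV_def by (simp add: add.commute)
    then show ?case by (rule cauchy_atI)
  qed
qed

lemma AE_dd:
  assumes "lip L v"
  shows "AE c in M. ((\<lambda>t. quot v q t c) \<longlongrightarrow> dd v q c) (at 0)"
  using AE_cauchy_at[OF assms] by eventually_elim (rule cauchy_atD[OF assms])

section \<open>Boxes and test functions\<close>

definition box :: "('i \<Rightarrow> real) \<Rightarrow> ('i \<Rightarrow> real) \<Rightarrow> ('i \<Rightarrow> real) set" where
  "box a b = {c \<in> space M. \<forall>i\<in>J. a i < c i \<and> c i < b i}"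

definition within_box :: "('i \<Rightarrow> real) \<Rightarrow> ('i \<Rightarrow> real) \<Rightarrow> (('i \<Rightarrow> real) \<Rightarrow> real) \<Rightarrow> bool" where
  "within_box a b \<psi> \<longleftrightarrow> (\<forall>c. \<psi> c \<noteq> 0 \<longrightarrow> (\<forall>i\<in>J. a i < c i \<and> c i < b i))"

lemma box_sets [measurable, simp]: "box a b \<in> sets M"
  unfolding box_def by measurable

lemma sigma_finite_M: "sigma_finite_measure M"
  by (rule sigma_finite) simp

lemma emeasure_box: "emeasure M (box a b) < \<infinity>"
proof -
  have "box a b = Pi\<^sub>E J (\<lambda>i. {a i<..<b i})" by (auto simp: box_def space_PiM PiE_iff extensional_def)
  then have "emeasure M (box a b) = (\<Prod>i\<in>J. emeasure lborel {a i<..<b i})"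
    by (simp add: emeasure_PiM)
  also have "\<dots> < \<infinity>"
  proof -
    have "emeasure lborel {a i<..<b i} \<noteq> top" for i by (cases "a i \<le> b i") auto
    then show ?thesis by (simp add: ennreal_prod_eq_top flip: less_top)
  qed
  finally show ?thesis .
qed

lemma integrable_on_box:
  fixes f :: "_ \<Rightarrow> real"
  assumes "f \<in> borel_measurable M" "AE c in M. \<bar>f c\<bar> \<le> C" "\<And>c. c \<in> space M \<Longrightarrow> c \<notin> box a b \<Longrightarrow> f c = 0"
  shows "integrable M f"
proof (rule integrableI_bounded_set[of "box a b" _ _ C])
  show "AE c in M. c \<in> box a b \<longrightarrow> norm (f c) \<le> C" using assms(2) by eventually_elim simp
  show "AE c in M. c \<notin> box a b \<longrightarrow> f c = 0" using assms(3) by (intro AE_I2) auto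
qed (use assms emeasure_box in auto)

lemma lip_box_bound:
  assumes "lip L v"
  obtains C where "0 \<le> C" "\<And>c. (\<And>i. i \<in> J \<Longrightarrow> a i < c i \<and> c i < b i) \<Longrightarrow> \<bar>v c\<bar> \<le> C"
proof -
  define C where "C = \<bar>v a\<bar> + L * l1 b a"
  have L: "0 \<le> L" using lip_nonneg[OF assms] .
  have "\<bar>v c\<bar> \<le> C" if "\<And>i. i \<in> J \<Longrightarrow> a i < c i \<and> c i < b i" for c
  proof -
    have "l1 c a \<le> l1 b a"
      unfolding l1_def using that by (intro sum_mono) force
    then have "L * l1 c a \<le> L * l1 b a" using L by (rule mult_left_mono)
    then show ?thesis using lipD[OF assms, of c a] unfolding C_def by linarith
  qed
  then show thesis using L by (intro that[of C]) (auto simp: C_def)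
qed

lemma within_box_bound:
  assumes "lip L \<psi>" "within_box a b \<psi>"
  obtains C where "0 \<le> C" "\<And>c. \<bar>\<psi> c\<bar> \<le> C"
proof -
  obtain C where C: "0 \<le> C" "\<And>c. (\<And>i. i \<in> J \<Longrightarrow> a i < c i \<and> c i < b i) \<Longrightarrow> \<bar>\<psi> c\<bar> \<le> C"
    using lip_box_bound[OF assms(1), of a b] by blast
  have "\<bar>\<psi> c\<bar> \<le> C" for c
    using C assms(2) unfolding within_box_def by (cases "\<psi> c = 0") auto
  then show thesis using C(1) that by blast
qed

text \<open>A product of trapezoids of slope k, one for each coordinate. The factors lie between 0
  and 1, so the product keeps the l1-Lipschitz constant k; as k grows it tends to the indicator of
  the open box.\<close>

definition tent :: "('i \<Rightarrow> real) \<Rightarrow> ('i \<Rightarrow> real) \<Rightarrow> nat \<Rightarrow> ('i \<Rightarrow> real) \<Rightarrow> real" where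
  "tent a b k c = (\<Prod>i\<in>J. max 0 (min 1 (real k * min (c i - a i) (b i - c i))))"

lemma tent_lip: "lip (real k) (tent a b k)"
  unfolding lip_def
proof (intro conjI allI)
  fix c c' :: "'i \<Rightarrow> real"
  let ?z = "\<lambda>c i. max 0 (min 1 (real k * min (c i - a i) (b i - c i)))"
  have one: "\<bar>?z c i - ?z c' i\<bar> \<le> real k * \<bar>c i - c' i\<bar>" for i
  proof -
    have "\<bar>max 0 (min 1 x) - max 0 (min 1 y)\<bar> \<le> \<bar>x - y\<bar>" for x y :: real by (auto simp: max_def min_def)
    moreover have "\<bar>min (x - p) (q - x) - min (y - p) (q - y)\<bar> \<le> \<bar>x - y\<bar>" for x y p q :: real
      by (auto simp: min_def)
    ultimately show ?thesis
      by (smt (verit, ccfv_SIG) abs_mult abs_of_nat mult_left_mono of_nat_0_le_iff right_diff_distrib)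
  qed
  have "norm (tent a b k c - tent a b k c') \<le> (\<Sum>i\<in>J. norm (?z c i - ?z c' i))"
    unfolding tent_def by (intro norm_prod_diff) auto
  also have "\<dots> \<le> (\<Sum>i\<in>J. real k * \<bar>c i - c' i\<bar>)"
    using one by (intro sum_mono) simp
  finally show "\<bar>tent a b k c - tent a b k c'\<bar> \<le> real k * l1 c c'"
    by (simp add: l1_def sum_distrib_left)
qed simp

lemma tent_within: "within_box a b (tent a b k)"
  unfolding within_box_def
proof (intro allI impI ballI)
  fix c i assume nz: "tent a b k c \<noteq> 0" and i: "i \<in> J"
  then have "max 0 (min 1 (real k * min (c i - a i) (b i - c i))) \<noteq> 0"
    by (auto simp: tent_def)
  moreover have "0 < x" if "max 0 (min 1 x) \<noteq> 0" for x :: real using that by (auto simp: max_def split: if_splits)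
  ultimately have "0 < real k * min (c i - a i) (b i - c i)" by blast
  then have "0 < min (c i - a i) (b i - c i)" by (simp add: zero_less_mult_iff)
  then show "a i < c i \<and> c i < b i" by simp
qed

lemma tent_bounds: "0 \<le> tent a b k c" "tent a b k c \<le> 1"
  by (auto simp: tent_def intro!: prod_nonneg prod_le_1)

lemma tent_tendsto:
  assumes c: "c \<in> space M"
  shows "(\<lambda>k. tent a b k c) \<longlonglongrightarrow> indicator (box a b) c"
proof (cases "c \<in> box a b")
  case True
  have "\<forall>\<^sub>F k in sequentially. max 0 (min 1 (real k * min (c i - a i) (b i - c i))) = 1" if "i \<in> J" for i
  proof -
    have p: "0 < min (c i - a i) (b i - c i)" using True that by (auto simp: box_def)
    then obtain N :: nat where "1 / min (c i - a i) (b i - c i) < real N" using reals_Archimedean2 by blast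
    then have N: "1 \<le> real N * min (c i - a i) (b i - c i)" using p by (simp add: field_simps del: min_less_iff_conj)
    have "1 \<le> real k * min (c i - a i) (b i - c i)" if "N \<le> k" for k
      using N mult_right_mono[of "real N" "real k" "min (c i - a i) (b i - c i)"] p that by linarith
    then show ?thesis by (intro eventually_sequentiallyI[of N]) simp
  qed
  then have "\<forall>\<^sub>F k in sequentially. \<forall>i\<in>J. max 0 (min 1 (real k * min (c i - a i) (b i - c i))) = 1"
    by (simp add: eventually_ball_finite)
  then have "\<forall>\<^sub>F k in sequentially. tent a b k c = 1"
    by eventually_elim (simp add: tent_def)
  then show ?thesis using True by (simp add: tendsto_eventually)
next
  case False
  then have "tent a b k c = 0" for k
    using tent_within[of a b k] c by (auto simp: within_box_def box_def)
  then show ?thesis using False by simp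
qed

text \<open>Tents of the smaller box are test functions of the larger one and tend to the indicator
  of the smaller; the absolute value of F on the larger box dominates.\<close>

lemma integral_subbox_zero:
  fixes F :: "('i \<Rightarrow> real) \<Rightarrow> real"
  assumes F [measurable]: "F \<in> borel_measurable M" and int: "integrable M (\<lambda>c. indicator (box a b) c * F c)"
    and zero: "\<And>L \<psi>. lip L \<psi> \<Longrightarrow> within_box a b \<psi> \<Longrightarrow> (\<integral>c. F c * \<psi> c \<partial>M) = 0"
    and b': "\<And>i. i \<in> J \<Longrightarrow> b' i \<le> b i"
  shows "(\<integral>c. indicator (box a b') c * F c \<partial>M) = 0"
proof -
  have sub: "within_box a b (tent a b' k)" for k
    using tent_within[of a b' k] b' by (auto simp: within_box_def intro: less_le_trans)
  have "(\<lambda>k. \<integral>c. F c * tent a b' k c \<partial>M) \<longlonglongrightarrow> (\<integral>c. F c * indicator (box a b') c \<partial>M)"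
  proof (rule integral_dominated_convergence[where w="\<lambda>c. \<bar>indicator (box a b) c * F c\<bar>"])
    show "integrable M (\<lambda>c. \<bar>indicator (box a b) c * F c\<bar>)" using int by (rule integrable_abs)
    show "AE c in M. (\<lambda>k. F c * tent a b' k c) \<longlonglongrightarrow> F c * indicator (box a b') c"
      by (intro AE_I2 tendsto_mult tendsto_const tent_tendsto)
    show "AE c in M. norm (F c * tent a b' k c) \<le> \<bar>indicator (box a b) c * F c\<bar>" for k
    proof (rule AE_I2)
      fix c assume c: "c \<in> space M"
      show "norm (F c * tent a b' k c) \<le> \<bar>indicator (box a b) c * F c\<bar>"
      proof (cases "tent a b' k c = 0")
        case False
        then have "c \<in> box a b" using sub[of k] c by (auto simp: within_box_def box_def)
        then show ?thesis using tent_bounds[of a b' k c]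
          by (simp add: abs_mult mult_left_le)
      qed simp
    qed
    show "(\<lambda>c. F c * tent a b' k c) \<in> borel_measurable M" for k
      using lip_measurable[OF tent_lip] by measurable
  qed measurable
  moreover have "(\<integral>c. F c * tent a b' k c \<partial>M) = 0" for k
    by (rule zero[OF tent_lip sub])
  ultimately show ?thesis by (simp add: LIMSEQ_const_iff mult.commute)
qed

text \<open>Lower orthants are stable under intersection, and each meets a box in a box with the
  same lower corner. They are therefore sets on which test functions can compare two
  measures.\<close>

lemma sets_M_generator:
  "sets M = sigma_sets (space M) {{c \<in> space M. \<forall>i\<in>J. c i < b i} | b. True}"
proof -
  have "sets M = sets (\<Pi>\<^sub>M i\<in>J. sigma UNIV (range (lessThan :: real \<Rightarrow> real set)))"
    by (intro sets_PiM_cong refl) (simp add: borel_Iio)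
  also have "\<dots> = sets (sigma (\<Pi>\<^sub>E i\<in>J. UNIV) {{f\<in>(\<Pi>\<^sub>E i\<in>J. UNIV). \<forall>i\<in>j. f i \<in> A i} | A j. j \<in> {J} \<and> A \<in> Pi j (\<lambda>_. range (lessThan :: real \<Rightarrow> real set))})"
  proof (rule sets_PiM_sigma)
    show "\<exists>S\<subseteq>range (lessThan :: real \<Rightarrow> real set). countable S \<and> UNIV = \<Union>S" if "i \<in> J" for i
    proof (intro exI[of _ "range (\<lambda>n::nat. {..<real n})"] conjI)
      show "UNIV = \<Union>(range (\<lambda>n::nat. {..<real n}))" using reals_Archimedean2 by auto
    qed auto
  qed auto
  also have "{{f\<in>(\<Pi>\<^sub>E i\<in>J. UNIV). \<forall>i\<in>j. f i \<in> A i} | A j. j \<in> {J} \<and> A \<in> Pi j (\<lambda>_. range (lessThan :: real \<Rightarrow> real set))}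
      = {{c \<in> space M. \<forall>i\<in>J. c i < b i} | b. True}" (is "?A = ?B")
  proof (intro equalityI subsetI)
    fix X assume "X \<in> ?A"
    then obtain A where X: "X = {f\<in>(\<Pi>\<^sub>E i\<in>J. UNIV). \<forall>i\<in>J. f i \<in> A i}" and A: "A \<in> Pi J (\<lambda>_. range lessThan)"
      by blast
    have "\<forall>i\<in>J. \<exists>b. A i = {..<b}" using A by (auto simp: Pi_iff)
    then obtain b where "\<forall>i\<in>J. A i = {..<b i}" by metis
    then have "X = {c \<in> space M. \<forall>i\<in>J. c i < b i}" using X by (auto simp: space_PiM)
    then show "X \<in> ?B" by blast
  next
    fix X assume "X \<in> ?B"
    then obtain b where "X = {c \<in> space M. \<forall>i\<in>J. c i < b i}" by blast
    then have "X = {f\<in>(\<Pi>\<^sub>E i\<in>J. UNIV). \<forall>i\<in>J. f i \<in> (\<lambda>i. {..<b i}) i}" by (auto simp: space_PiM)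
    moreover have "(\<lambda>i. {..<b i}) \<in> Pi J (\<lambda>_. range lessThan)" by auto
    ultimately show "X \<in> ?A" by (intro CollectI exI[of _ "\<lambda>i. {..<b i}"] exI[of _ J] conjI) auto
  qed
  also have "sets (sigma (\<Pi>\<^sub>E i\<in>J. UNIV) {{c \<in> space M. \<forall>i\<in>J. c i < b i} | b. True})
      = sigma_sets (space M) {{c \<in> space M. \<forall>i\<in>J. c i < b i} | b. True}"
    by (subst sets_measure_of) (auto simp: space_PiM)
  finally show ?thesis .
qed

text \<open>On the box, the positive and negative parts of F are densities of two finite measures,
  and vanishing against all test functions makes these agree on lower orthants. Equal measures have
  almost everywhere equal densities, and positive and negative parts can only be equal if both are
  zero.\<close>

lemma fundamental_lemma:
  fixes F :: "('i \<Rightarrow> real) \<Rightarrow> real"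
  assumes F [measurable]: "F \<in> borel_measurable M" and int: "integrable M (\<lambda>c. indicator (box a b) c * F c)"
    and zero: "\<And>L \<psi>. lip L \<psi> \<Longrightarrow> within_box a b \<psi> \<Longrightarrow> (\<integral>c. F c * \<psi> c \<partial>M) = 0"
  shows "AE c in M. c \<in> box a b \<longrightarrow> F c = 0"
proof -
  let ?p = "\<lambda>c. ennreal (indicator (box a b) c * max 0 (F c))"
  let ?m = "\<lambda>c. ennreal (indicator (box a b) c * max 0 (- F c))"
  have ip: "integrable M (\<lambda>c. indicator X c * max 0 (F c) :: real)" "integrable M (\<lambda>c. indicator X c * max 0 (- F c) :: real)"
    if X: "X \<subseteq> box a b" "X \<in> sets M" for X
  proof -
    have [measurable]: "X \<in> sets M" by (rule X(2))
    show "integrable M (\<lambda>c. indicator X c * max 0 (F c) :: real)"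
      by (rule Bochner_Integration.integrable_bound[OF int]) (use X(1) in \<open>auto simp: indicator_def\<close>)
    show "integrable M (\<lambda>c. indicator X c * max 0 (- F c) :: real)"
      by (rule Bochner_Integration.integrable_bound[OF int]) (use X(1) in \<open>auto simp: indicator_def\<close>)
  qed
  have eq: "emeasure (density M ?p) X = emeasure (density M ?m) X"
    if "X \<in> {{c \<in> space M. \<forall>i\<in>J. c i < b i} | b. True}" for X
  proof -
    from that obtain d where X: "X = {c \<in> space M. \<forall>i\<in>J. c i < d i}" by blast
    define b' where "b' i = min (b i) (d i)" for i
    have XB: "box a b \<inter> X = box a b'" by (auto simp: X box_def b'_def)
    have Xs [measurable]: "X \<in> sets M" unfolding X by measurable
    have sub: "box a b' \<subseteq> box a b" using XB by blast
    have "(\<integral>c. indicator (box a b') c * F c \<partial>M) = 0"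
      by (rule integral_subbox_zero[OF F int zero]) (auto simp: b'_def)
    moreover have "(\<integral>c. indicator (box a b') c * F c \<partial>M) = (\<integral>c. indicator (box a b') c * max 0 (F c) - indicator (box a b') c * max 0 (- F c) \<partial>M)"
      by (intro Bochner_Integration.integral_cong refl) (auto simp: indicator_def)
    moreover have "\<dots> = (\<integral>c. indicator (box a b') c * max 0 (F c) \<partial>M) - (\<integral>c. indicator (box a b') c * max 0 (- F c) \<partial>M)"
      by (intro Bochner_Integration.integral_diff ip sub) auto
    ultimately have e: "(\<integral>c. indicator (box a b') c * max 0 (F c) \<partial>M) = (\<integral>c. indicator (box a b') c * max 0 (- F c) \<partial>M)" by simp
    have "emeasure (density M ?p) X = (\<integral>\<^sup>+c. ennreal (indicator (box a b') c * max 0 (F c)) \<partial>M)"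
      by (subst emeasure_density) (auto simp: XB[symmetric] indicator_def intro!: nn_integral_cong)
    also have "\<dots> = ennreal (\<integral>c. indicator (box a b') c * max 0 (F c) \<partial>M)"
      by (intro nn_integral_eq_integral ip sub AE_I2) auto
    also have "\<dots> = ennreal (\<integral>c. indicator (box a b') c * max 0 (- F c) \<partial>M)" by (simp only: e)
    also have "\<dots> = (\<integral>\<^sup>+c. ennreal (indicator (box a b') c * max 0 (- F c)) \<partial>M)"
      by (intro nn_integral_eq_integral[symmetric] ip sub AE_I2) auto
    also have "\<dots> = emeasure (density M ?m) X"
      by (subst emeasure_density) (auto simp: XB[symmetric] indicator_def intro!: nn_integral_cong)
    finally show ?thesis .
  qed
  have "density M ?p = density M ?m"
  proof (rule measure_eqI_generator_eq[where \<Omega>="space M" and E="{{c \<in> space M. \<forall>i\<in>J. c i < b i} | b. True}"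
        and A="\<lambda>n::nat. {c \<in> space M. \<forall>i\<in>J. c i < real n}"])
    show "Int_stable {{c \<in> space M. \<forall>i\<in>J. c i < b i} | b. True}"
    proof (rule Int_stableI)
      fix X Y assume "X \<in> {{c \<in> space M. \<forall>i\<in>J. c i < b i} | b. True}" "Y \<in> {{c \<in> space M. \<forall>i\<in>J. c i < b i} | b. True}"
      then obtain b d where "X = {c \<in> space M. \<forall>i\<in>J. c i < b i}" "Y = {c \<in> space M. \<forall>i\<in>J. c i < d i}" by blast
      then have "X \<inter> Y = {c \<in> space M. \<forall>i\<in>J. c i < min (b i) (d i)}" by auto
      then show "X \<inter> Y \<in> {{c \<in> space M. \<forall>i\<in>J. c i < b i} | b. True}"
        by (intro CollectI exI[of _ "\<lambda>i. min (b i) (d i)"]) simp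
    qed
    show "(\<Union>n::nat. {c \<in> space M. \<forall>i\<in>J. c i < real n}) = space M"
    proof (intro equalityI subsetI)
      fix c assume c: "c \<in> space M"
      obtain n :: nat where n: "(\<Sum>i\<in>J. \<bar>c i\<bar>) < real n" using reals_Archimedean2 by blast
      have "c i < real n" if "i \<in> J" for i
        using member_le_sum[of i J "\<lambda>i. \<bar>c i\<bar>"] that n by simp
      then show "c \<in> (\<Union>n::nat. {c \<in> space M. \<forall>i\<in>J. c i < real n})" using c by blast
    qed auto
    show "emeasure (density M ?p) {c \<in> space M. \<forall>i\<in>J. c i < real n} \<noteq> \<infinity>" for n
    proof -
      have "emeasure (density M ?p) {c \<in> space M. \<forall>i\<in>J. c i < real n} \<le> (\<integral>\<^sup>+c. ?p c \<partial>M)"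
        by (subst emeasure_density) (auto simp: indicator_def intro!: nn_integral_mono)
      also have "\<dots> = ennreal (\<integral>c. indicator (box a b) c * max 0 (F c) \<partial>M)"
        by (intro nn_integral_eq_integral ip AE_I2) auto
      finally show ?thesis by (auto simp: top_unique)
    qed
    show "sets (density M ?p) = sigma_sets (space M) {{c \<in> space M. \<forall>i\<in>J. c i < b i} | b. True}"
      "sets (density M ?m) = sigma_sets (space M) {{c \<in> space M. \<forall>i\<in>J. c i < b i} | b. True}"
      by (simp_all only: sets_density sets_M_generator)
  qed (use eq in auto)
  then have "AE c in M. ?p c = ?m c"
    by (intro sigma_finite_measure.density_unique[OF sigma_finite_M]) auto
  then show ?thesis
    by eventually_elim (auto simp: indicator_def max_def split: if_splits)
qed

section \<open>Linearity in the direction and differentiability\<close>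

definition tk :: "nat \<Rightarrow> real" where "tk k = 1 / real (Suc k)"

lemma tk_pos [simp]: "0 < tk k" "tk k \<noteq> 0" "\<bar>tk k\<bar> \<le> 1" "tk k \<le> 1"
  by (auto simp: tk_def)

lemma tk_tendsto: "tk \<longlonglongrightarrow> 0"
  unfolding tk_def by (rule LIMSEQ_Suc[OF lim_1_over_n])

lemma tk_at: "filterlim tk (at 0) sequentially"
  using tk_tendsto by (simp add: filterlim_at)

lemma ddI:
  assumes "((\<lambda>t. quot v q t c) \<longlongrightarrow> l) (at 0)"
  shows "dd v q c = l"
proof -
  have "(\<lambda>k. quot v q (tk k) c) \<longlonglongrightarrow> l"
    by (rule filterlim_compose[OF assms tk_at])
  then show ?thesis unfolding dd_def tk_def by (rule limI)
qed

lemma AE_dd_bound: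
  assumes "lip L v"
  shows "AE c in M. \<bar>dd v q c\<bar> \<le> L * size1 q"
  using AE_dd[OF assms, of q]
proof eventually_elim
  case (elim c)
  have "((\<lambda>t. \<bar>quot v q t c\<bar>) \<longlongrightarrow> \<bar>dd v q c\<bar>) (at 0)" by (intro tendsto_rabs elim)
  then show ?case
    by (rule tendsto_upperbound) (auto intro!: always_eventually quot_bound[OF assms])
qed

lemma shift_tendsto_lip:
  assumes "lip L v"
  shows "(\<lambda>k. v (shift q (s * tk k) c)) \<longlonglongrightarrow> v (shift q 0 c)"
proof -
  have "isCont (\<lambda>t. v (shift q t c)) 0"
    using lipschitz_on_continuous_on[OF lip_along[OF assms]] by (metis continuous_on_eq_continuous_at open_UNIV UNIV_I)
  moreover have "(\<lambda>k. s * tk k) \<longlonglongrightarrow> 0" using tendsto_mult[OF tendsto_const tk_tendsto, of s] by simp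
  ultimately show ?thesis by (rule isCont_tendsto_compose)
qed

lemma within_shift:
  assumes "within_box a b \<psi>" "\<psi> (shift q t c) \<noteq> 0" "\<bar>t\<bar> \<le> 1" "c \<in> space M"
  shows "c \<in> box (\<lambda>i. a i - \<bar>q i\<bar>) (\<lambda>i. b i + \<bar>q i\<bar>)"
proof -
  have "a i - \<bar>q i\<bar> < c i \<and> c i < b i + \<bar>q i\<bar>" if i: "i \<in> J" for i
  proof -
    have "a i < c i + t * q i \<and> c i + t * q i < b i"
      using assms(1,2) i by (auto simp: within_box_def shift_def)
    moreover have "\<bar>t * q i\<bar> \<le> \<bar>q i\<bar>"
      using assms(3) by (simp add: abs_mult mult_left_le_one_le)
    ultimately show ?thesis by (auto simp: abs_le_iff)
  qed
  then show ?thesis using assms(4) by (auto simp: box_def)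
qed

text \<open>The test function is shifted in an unrelated direction r because additivity of
  derivatives leads to such mixed integrals; the shift disappears in the limit since
  \<open>\<psi>\<close> is continuous. The direction 0 gives the unshifted version.\<close>

lemma integral_quot_tendsto:
  assumes v: "lip L v" and \<psi>: "lip L' \<psi>" "within_box a b \<psi>"
  shows "(\<lambda>k. \<integral>c. quot v q (tk k) c * \<psi> (shift r (- tk k) c) \<partial>M) \<longlonglongrightarrow> (\<integral>c. dd v q c * \<psi> c \<partial>M)"
proof -
  obtain C where C: "0 \<le> C" "\<And>c. \<bar>\<psi> c\<bar> \<le> C" using within_box_bound[OF \<psi>] by blast
  let ?B = "box (\<lambda>i. a i - \<bar>r i\<bar>) (\<lambda>i. b i + \<bar>r i\<bar>)"
  have L: "0 \<le> L" by (rule lip_nonneg[OF v])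
  show ?thesis
  proof (rule integral_dominated_convergence[where w="\<lambda>c. indicator ?B c * (L * size1 q * C)"])
    show "integrable M (\<lambda>c. indicator ?B c * (L * size1 q * C) :: real)"
      using emeasure_box by (intro integrable_mult_left) auto
    show "AE c in M. (\<lambda>k. quot v q (tk k) c * \<psi> (shift r (- tk k) c)) \<longlonglongrightarrow> dd v q c * \<psi> c"
      using AE_dd[OF v, of q] AE_space
    proof eventually_elim
      case (elim c)
      have "(\<lambda>k. \<psi> (shift r (- tk k) c)) \<longlonglongrightarrow> \<psi> c"
        using shift_tendsto_lip[OF \<psi>(1), of r "-1" c] elim(2) by (simp add: shift_0)
      then show ?case
        by (intro tendsto_mult filterlim_compose[OF elim(1) tk_at])
    qed
    show "AE c in M. norm (quot v q (tk k) c * \<psi> (shift r (- tk k) c)) \<le> indicator ?B c * (L * size1 q * C)" for k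
    proof (rule AE_I2)
      fix c assume c: "c \<in> space M"
      show "norm (quot v q (tk k) c * \<psi> (shift r (- tk k) c)) \<le> indicator ?B c * (L * size1 q * C)"
      proof (cases "\<psi> (shift r (- tk k) c) = 0")
        case False
        then have "c \<in> ?B" using within_shift[OF \<psi>(2) False _ c] by simp
        moreover have "\<bar>quot v q (tk k) c\<bar> * \<bar>\<psi> (shift r (- tk k) c)\<bar> \<le> (L * size1 q) * C"
          using quot_bound[OF v] C L by (intro mult_mono) auto
        ultimately show ?thesis by (simp add: abs_mult)
      qed (use L C in simp)
    qed
    show "(\<lambda>c. quot v q (tk k) c * \<psi> (shift r (- tk k) c)) \<in> borel_measurable M" for k
      using quot_measurable[OF v] measurable_compose[OF shift_measurable lip_measurable[OF \<psi>(1)]] by measurable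
    show "(\<lambda>c. dd v q c * \<psi> c) \<in> borel_measurable M"
      using dd_measurable[OF v] lip_measurable[OF \<psi>(1)] by measurable
  qed
qed

lemma shift_zero_dir: "c \<in> space M \<Longrightarrow> shift (\<lambda>_. 0) t c = c"
  using shift_0[of c] by (simp add: shift_def)

lemma integral_quot_tendsto0:
  assumes v: "lip L v" and \<psi>: "lip L' \<psi>" "within_box a b \<psi>"
  shows "(\<lambda>k. \<integral>c. quot v q (tk k) c * \<psi> c \<partial>M) \<longlonglongrightarrow> (\<integral>c. dd v q c * \<psi> c \<partial>M)"
proof -
  have "(\<integral>c. quot v q (tk k) c * \<psi> (shift (\<lambda>_. 0) (- tk k) c) \<partial>M) = (\<integral>c. quot v q (tk k) c * \<psi> c \<partial>M)" for k
    by (intro Bochner_Integration.integral_cong refl) (simp add: shift_zero_dir)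
  then show ?thesis using integral_quot_tendsto[OF assms, of q "\<lambda>_. 0"] by simp
qed

lemma integrable_mult_within:
  assumes "f \<in> borel_measurable M" "AE c in M. \<bar>f c\<bar> \<le> B" and \<psi>: "lip L' \<psi>" "within_box a b \<psi>"
  shows "integrable M (\<lambda>c. f c * \<psi> c)"
proof -
  obtain C where C: "0 \<le> C" "\<And>c. \<bar>\<psi> c\<bar> \<le> C" using within_box_bound[OF \<psi>] by blast
  have "AE c in M. \<bar>f c * \<psi> c\<bar> \<le> B * C"
    using assms(2)
  proof eventually_elim
    case (elim c)
    then show ?case using C(1) C(2)[of c] unfolding abs_mult by (intro mult_mono) auto
  qed
  then show ?thesis
    using assms(1) lip_measurable[OF \<psi>(1)] \<psi>(2)
    by (intro integrable_on_box[of _ "B * C" a b]) (auto simp: within_box_def box_def)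
qed

text \<open>Directional derivatives of a Lipschitz function need not be additive at a given point. They are additive
  against test functions, because the difference quotients can be shifted onto the test function.\<close>

lemma AE_dd_add:
  assumes v: "lip L v"
  shows "AE c in M. dd v (\<lambda>i. q i + r i) c = dd v q c + dd v r c"
proof -
  define F where "F c = dd v (\<lambda>i. q i + r i) c - dd v q c - dd v r c" for c
  have F: "F \<in> borel_measurable M"
    unfolding F_def[abs_def] using dd_measurable[OF v] by measurable
  have Fb: "AE c in M. \<bar>F c\<bar> \<le> L * size1 (\<lambda>i. q i + r i) + L * size1 q + L * size1 r"
    using AE_dd_bound[OF v, of "\<lambda>i. q i + r i"] AE_dd_bound[OF v, of q] AE_dd_bound[OF v, of r]
    by eventually_elim (auto simp: F_def abs_le_iff)
  have "AE c in M. c \<in> box (\<lambda>_. - real n) (\<lambda>_. real n) \<longrightarrow> F c = 0" for n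
  proof (rule fundamental_lemma[OF F])
    show "integrable M (\<lambda>c. indicator (box (\<lambda>_. - real n) (\<lambda>_. real n)) c * F c)"
    proof (rule integrable_on_box[where a="\<lambda>_. - real n" and b="\<lambda>_. real n"])
      show "AE c in M. \<bar>indicator (box (\<lambda>_. - real n) (\<lambda>_. real n)) c * F c\<bar> \<le> L * size1 (\<lambda>i. q i + r i) + L * size1 q + L * size1 r"
        using Fb
      proof eventually_elim
        case (elim c)
        have "\<bar>indicator (box (\<lambda>_. - real n) (\<lambda>_. real n)) c * F c\<bar> \<le> \<bar>F c\<bar>" by (simp add: indicator_def)
        from order_trans[OF this elim] show ?case .
      qed
    qed (use F in auto)
    fix L' \<psi> assume \<psi>: "lip L' \<psi>" "within_box (\<lambda>_. - real n) (\<lambda>_. real n) \<psi>"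
    note int = integrable_mult_within[OF _ _ \<psi>]
    have qi: "integrable M (\<lambda>c. quot v q (tk k) c * \<psi> c)" for q k
      by (rule int[OF quot_measurable[OF v] AE_I2[OF quot_bound[OF v]]])
    have di: "integrable M (\<lambda>c. dd v q c * \<psi> c)" for q
      by (rule int[OF dd_measurable[OF v] AE_dd_bound[OF v]])
    \<comment> \<open>After translation by \<open>tk k\<close> along q, the quotient in direction r
      compares the points reached from c along \<open>q + r\<close> and along q. It is the
      difference of the quotients for \<open>q + r\<close> and q at c, an exact identity before any
      limit.\<close>
    have "(\<integral>c. quot v r (tk k) c * \<psi> (shift q (- tk k) c) \<partial>M)
        = (\<integral>c. quot v (\<lambda>i. q i + r i) (tk k) c * \<psi> c \<partial>M) - (\<integral>c. quot v q (tk k) c * \<psi> c \<partial>M)" for k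
    proof -
      let ?G = "\<lambda>c. quot v r (tk k) c * \<psi> (shift q (- tk k) c)"
      have G: "?G \<in> borel_measurable M"
        using quot_measurable[OF v] measurable_compose[OF shift_measurable lip_measurable[OF \<psi>(1)]] by measurable
      have "(\<integral>c. ?G c \<partial>M) = (\<integral>c. ?G (shift q (tk k) c) \<partial>M)" by (rule integral_shift[OF G, symmetric])
      also have "\<dots> = (\<integral>c. quot v (\<lambda>i. q i + r i) (tk k) c * \<psi> c - quot v q (tk k) c * \<psi> c \<partial>M)"
      proof (rule Bochner_Integration.integral_cong[OF refl])
        fix c assume c: "c \<in> space M"
        have "shift r (tk k) (shift q (tk k) c) = shift (\<lambda>i. q i + r i) (tk k) c"
          "shift r 0 (shift q (tk k) c) = shift q (tk k) c" "shift (\<lambda>i. q i + r i) 0 c = shift q 0 c"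
          by (auto simp: shift_def algebra_simps)
        then show "?G (shift q (tk k) c) = quot v (\<lambda>i. q i + r i) (tk k) c * \<psi> c - quot v q (tk k) c * \<psi> c"
          using c by (simp add: quot_def shift_shift shift_0 field_simps)
      qed
      also have "\<dots> = (\<integral>c. quot v (\<lambda>i. q i + r i) (tk k) c * \<psi> c \<partial>M) - (\<integral>c. quot v q (tk k) c * \<psi> c \<partial>M)"
        by (intro Bochner_Integration.integral_diff qi)
      finally show ?thesis .
    qed
    then have "(\<lambda>k. \<integral>c. quot v r (tk k) c * \<psi> (shift q (- tk k) c) \<partial>M)
        \<longlonglongrightarrow> (\<integral>c. dd v (\<lambda>i. q i + r i) c * \<psi> c \<partial>M) - (\<integral>c. dd v q c * \<psi> c \<partial>M)"
      using integral_quot_tendsto0[OF v \<psi>] by (simp add: tendsto_diff)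
    from LIMSEQ_unique[OF this integral_quot_tendsto[OF v \<psi>]]
    have "(\<integral>c. dd v (\<lambda>i. q i + r i) c * \<psi> c \<partial>M) - (\<integral>c. dd v q c * \<psi> c \<partial>M) = (\<integral>c. dd v r c * \<psi> c \<partial>M)" .
    moreover have "(\<integral>c. F c * \<psi> c \<partial>M) = (\<integral>c. dd v (\<lambda>i. q i + r i) c * \<psi> c \<partial>M) - (\<integral>c. dd v q c * \<psi> c \<partial>M) - (\<integral>c. dd v r c * \<psi> c \<partial>M)"
      unfolding F_def left_diff_distrib
      by (subst Bochner_Integration.integral_diff; (intro Bochner_Integration.integrable_diff di)?)
        (subst Bochner_Integration.integral_diff; (intro di)?; simp)
    ultimately show "(\<integral>c. F c * \<psi> c \<partial>M) = 0" by simp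
  qed
  then have "AE c in M. \<forall>n::nat. c \<in> box (\<lambda>_. - real n) (\<lambda>_. real n) \<longrightarrow> F c = 0"
    by (subst AE_all_countable) blast
  then show ?thesis using AE_space
  proof eventually_elim
    case (elim c)
    obtain n :: nat where n: "(\<Sum>i\<in>J. \<bar>c i\<bar>) < real n" using reals_Archimedean2 by blast
    have "\<bar>c i\<bar> < real n" if "i \<in> J" for i
      using member_le_sum[of i J "\<lambda>i. \<bar>c i\<bar>"] that n by simp
    then have "c \<in> box (\<lambda>_. - real n) (\<lambda>_. real n)" using elim(2) by (auto simp: box_def abs_less_iff minus_less_iff)
    then show ?case using elim(1) by (auto simp: F_def)
  qed
qed

lemma quot_cong: "(\<And>i. i \<in> J \<Longrightarrow> q i = q' i) \<Longrightarrow> quot v q = quot v q'"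
  by (auto simp: quot_def fun_eq_iff shift_def cong: restrict_cong)

lemma dd_cong: "(\<And>i. i \<in> J \<Longrightarrow> q i = q' i) \<Longrightarrow> dd v q = dd v q'"
  using quot_cong[of q q' v] by (simp add: dd_def fun_eq_iff)

lemma dd_scale:
  assumes "((\<lambda>t. quot v q t c) \<longlongrightarrow> dd v q c) (at 0)"
  shows "dd v (\<lambda>i. a * q i) c = a * dd v q c"
proof (rule ddI)
  show "((\<lambda>t. quot v (\<lambda>i. a * q i) t c) \<longlongrightarrow> a * dd v q c) (at 0)"
  proof (cases "a = 0")
    case True
    then show ?thesis by (simp add: quot_def shift_def)
  next
    case False
    have eq: "quot v (\<lambda>i. a * q i) t c = a * quot v q (a * t) c" for t
      using False by (simp add: quot_def shift_def ac_simps)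
    have "((\<lambda>t. a * t) \<longlongrightarrow> 0) (at 0)" by (auto intro!: tendsto_eq_intros)
    then have "filterlim (\<lambda>t. a * t) (at 0) (at (0::real))"
      using False by (simp add: filterlim_at eventually_at_filter)
    from filterlim_compose[OF assms this] show ?thesis
      unfolding eq by (intro tendsto_mult tendsto_const)
  qed
qed

definition unit :: "'i \<Rightarrow> 'i \<Rightarrow> real" where
  "unit i = (\<lambda>j. if j = i then 1 else 0)"

lemma size1_unit: "i \<in> J \<Longrightarrow> size1 (unit i) = 1"
  by (simp add: size1_def unit_def if_distrib sum.delta cong: if_cong)

lemma AE_dd_linear:
  assumes v: "lip L v"
  shows "AE c in M. dd v q c = (\<Sum>i\<in>J. q i * dd v (unit i) c)"
proof -
  have "finite I \<Longrightarrow> AE c in M. dd v (\<lambda>j. if j \<in> I then q j else 0) c = (\<Sum>i\<in>I. q i * dd v (unit i) c)" for I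
  proof (induction I rule: finite_induct)
    case empty
    have "dd v (\<lambda>j. 0) c = 0" for c by (rule ddI) (simp add: quot_def shift_def)
    then show ?case by simp
  next
    case (insert k I)
    have eq: "(\<lambda>j. (if j \<in> I then q j else 0) + q k * unit k j) = (\<lambda>j. if j \<in> insert k I then q j else 0)"
      using insert.hyps by (auto simp: unit_def fun_eq_iff)
    have "AE c in M. dd v (\<lambda>j. if j \<in> insert k I then q j else 0) c = dd v (\<lambda>j. if j \<in> I then q j else 0) c + dd v (\<lambda>j. q k * unit k j) c"
      using AE_dd_add[OF v, of "\<lambda>j. if j \<in> I then q j else 0" "\<lambda>j. q k * unit k j"] unfolding eq .
    then show ?case
      using insert.IH AE_dd[OF v, of "unit k"]
      by eventually_elim (use insert.hyps in \<open>simp add: dd_scale\<close>)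
  qed
  from this[OF finite_J] show ?thesis
    using dd_cong[of "\<lambda>j. if j \<in> J then q j else 0" q v] by simp
qed

text \<open>Outside a null set the derivatives in countably many directions are linear in the direction; these
  directions are dense, and the Lipschitz bound passes to all others.\<close>

theorem rademacher:
  assumes v: "lip L v"
  shows "AE c in M. \<forall>e>0. \<exists>d>0. \<forall>c'. l1 c' c < d \<longrightarrow>
    \<bar>v c' - v c - (\<Sum>i\<in>J. dd v (unit i) c * (c' i - c i))\<bar> \<le> e * l1 c' c"
proof -
  \<comment> \<open>The directions in the cube with coordinates between -1 and 1 that lie on the
    grid of mesh \<open>1 / Suc k\<close>. For fixed k they are finitely many, so their difference
    quotients converge uniformly; over all k they are countable and dense in the cube.\<close>
  define G where "G k = PiE J (\<lambda>_. (\<lambda>z::int. real_of_int z / real (Suc k)) ` {- int (Suc k)..int (Suc k)})" for k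
  have Gfin: "finite (G k)" for k unfolding G_def by (intro finite_PiE) auto
  have "AE c in M. \<forall>k. \<forall>q\<in>G k. ((\<lambda>t. quot v q t c) \<longlongrightarrow> dd v q c) (at 0) \<and> dd v q c = (\<Sum>i\<in>J. q i * dd v (unit i) c)"
    using AE_dd[OF v] AE_dd_linear[OF v] Gfin
    by (simp add: AE_all_countable AE_ball_countable countable_finite AE_conj_iff)
  then show ?thesis using AE_space
  proof eventually_elim
    case (elim c)
    show ?case
    proof (intro allI impI)
      fix e :: real assume e: "0 < e"
      define D where "D i = dd v (unit i) c" for i
      \<comment> \<open>The price of replacing a direction by a grid direction within one mesh width
        in each coordinate: the first summand comes from v, the second from the linear form.\<close>
      define S where "S = L * real (card J) + (\<Sum>i\<in>J. \<bar>D i\<bar>)"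
      have S0: "0 \<le> S" using lip_nonneg[OF v] by (auto simp: S_def intro!: add_nonneg_nonneg sum_nonneg)
      obtain k :: nat where k: "2 * S / e < real k" using reals_Archimedean2 by blast
      have Sk: "S / real (Suc k) \<le> e / 2"
      proof -
        have "2 * S < real k * e" using k e by (simp add: field_simps)
        also have "\<dots> \<le> real (Suc k) * e" using e by simp
        finally show ?thesis by (simp add: field_simps)
      qed
      have "\<forall>q\<in>G k. eventually (\<lambda>t. dist (quot v q t c) (dd v q c) < e/2) (at 0)"
        using elim(1) e by (intro ballI tendstoD) (blast, simp)
      then have "eventually (\<lambda>t. \<forall>q\<in>G k. dist (quot v q t c) (dd v q c) < e/2) (at 0)"
        using Gfin by (simp add: eventually_ball_finite)
      then obtain d where d: "0 < d" "\<And>t q. t \<noteq> 0 \<Longrightarrow> \<bar>t\<bar> < d \<Longrightarrow> q \<in> G k \<Longrightarrow> \<bar>quot v q t c - dd v q c\<bar> < e/2"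
        by (auto simp: eventually_at dist_real_def)
      have "\<bar>v c' - v c - (\<Sum>i\<in>J. D i * (c' i - c i))\<bar> \<le> e * l1 c' c" if c': "l1 c' c < d" for c'
      proof (cases "l1 c' c = 0")
        case True
        then have "\<forall>i\<in>J. c' i = c i" by (simp add: l1_def sum_nonneg_eq_0_iff)
        then show ?thesis using lip_cong[OF v, of c' c] e by simp
      next
        case False
        define \<rho> where "\<rho> = l1 c' c"
        have \<rho>: "0 < \<rho>" "\<rho> < d" using False c' l1_nonneg[of c' c] unfolding \<rho>_def by linarith+
        define w where "w i = (c' i - c i) / \<rho>" for i
        have w: "\<bar>w i\<bar> \<le> 1" if "i \<in> J" for i
          using member_le_sum[of i J "\<lambda>i. \<bar>c' i - c i\<bar>"] that \<rho> by (simp add: w_def abs_divide \<rho>_def l1_def)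
        define q where "q = (\<lambda>i\<in>J. real_of_int \<lfloor>real (Suc k) * w i\<rfloor> / real (Suc k))"
        have qG: "q \<in> G k"
          unfolding G_def q_def
        proof (intro restrict_PiE_iff[THEN iffD2] ballI imageI)
          fix i assume "i \<in> J"
          then have "\<bar>real (Suc k) * w i\<bar> \<le> real (Suc k)"
            using w[of i] by (simp add: abs_mult mult_left_le)
          then show "\<lfloor>real (Suc k) * w i\<rfloor> \<in> {- int (Suc k)..int (Suc k)}"
          proof -
            assume y: "\<bar>real (Suc k) * w i\<bar> \<le> real (Suc k)"
            have "real (Suc k) * w i < real (Suc k) + 1" "- real (Suc k) \<le> real (Suc k) * w i"
              using abs_le_D1[OF y] abs_le_D2[OF y] by linarith+
            then show ?thesis by (simp add: le_floor_iff floor_le_iff del: of_nat_Suc) 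
          qed
        qed
        have qw: "\<bar>w i - q i\<bar> \<le> 1 / real (Suc k)" if "i \<in> J" for i
        proof -
          have "\<bar>real (Suc k) * w i - real_of_int \<lfloor>real (Suc k) * w i\<rfloor>\<bar> \<le> 1" by linarith
          moreover have "w i - q i = (real (Suc k) * w i - real_of_int \<lfloor>real (Suc k) * w i\<rfloor>) / real (Suc k)"
            using that by (simp add: q_def diff_divide_distrib)
          ultimately show ?thesis by (simp add: abs_divide divide_right_mono)
        qed
        have cw: "c' i - c i = \<rho> * w i" for i using \<rho> by (simp add: w_def)
        have "l1 c' (shift q \<rho> c) = (\<Sum>i\<in>J. \<rho> * \<bar>w i - q i\<bar>)"
          unfolding l1_def
        proof (intro sum.cong refl)
          fix i assume i: "i \<in> J"
          have "c' i - shift q \<rho> c i = \<rho> * (w i - q i)"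
            using i cw[of i] by (simp add: shift_def algebra_simps)
          then show "\<bar>c' i - shift q \<rho> c i\<bar> = \<rho> * \<bar>w i - q i\<bar>" using \<rho> by (simp add: abs_mult)
        qed
        also have "\<dots> \<le> (\<Sum>i\<in>J. \<rho> * (1 / real (Suc k)))"
          using qw \<rho> by (intro sum_mono mult_left_mono) auto
        also have "\<dots> = \<rho> * (real (card J) / real (Suc k))" by simp
        finally have "L * l1 c' (shift q \<rho> c) \<le> L * (\<rho> * (real (card J) / real (Suc k)))"
          using lip_nonneg[OF v] by (rule mult_left_mono)
        then have 1: "\<bar>v c' - v (shift q \<rho> c)\<bar> \<le> \<rho> * (L * real (card J) / real (Suc k))"
          using lipD[OF v, of c' "shift q \<rho> c"] by (simp add: ac_simps)
        have "\<bar>quot v q \<rho> c - dd v q c\<bar> < e/2" using d(2)[of \<rho> q] \<rho> qG by simp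
        then have "\<rho> * \<bar>quot v q \<rho> c - dd v q c\<bar> \<le> \<rho> * (e/2)" using \<rho> by (intro mult_left_mono) auto
        moreover have "\<rho> * (quot v q \<rho> c - dd v q c) = v (shift q \<rho> c) - v c - \<rho> * dd v q c"
          using \<rho> elim(2) by (simp add: quot_def shift_0 field_simps)
        ultimately have 2: "\<bar>v (shift q \<rho> c) - v c - \<rho> * dd v q c\<bar> \<le> \<rho> * (e/2)"
          using \<rho> by (metis abs_mult abs_of_pos)
        have "\<rho> * dd v q c - (\<Sum>i\<in>J. D i * (c' i - c i)) = \<rho> * (\<Sum>i\<in>J. D i * (q i - w i))"
          using elim(1) qG unfolding cw
          by (simp add: D_def sum_distrib_left sum_subtractf algebra_simps)
        moreover have "\<bar>\<Sum>i\<in>J. D i * (q i - w i)\<bar> \<le> (\<Sum>i\<in>J. \<bar>D i\<bar> * (1 / real (Suc k)))"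
          using qw by (intro order_trans[OF sum_abs] sum_mono)
            (auto simp: abs_mult abs_minus_commute simp del: times_divide_eq_right intro!: mult_left_mono)
        ultimately have 3: "\<bar>\<rho> * dd v q c - (\<Sum>i\<in>J. D i * (c' i - c i))\<bar> \<le> \<rho> * ((\<Sum>i\<in>J. \<bar>D i\<bar>) / real (Suc k))"
          using \<rho> by (simp add: abs_mult sum_divide_distrib)
        have "\<bar>v c' - v c - (\<Sum>i\<in>J. D i * (c' i - c i))\<bar> \<le>
            \<bar>v c' - v (shift q \<rho> c)\<bar> + \<bar>v (shift q \<rho> c) - v c - \<rho> * dd v q c\<bar> + \<bar>\<rho> * dd v q c - (\<Sum>i\<in>J. D i * (c' i - c i))\<bar>"
          by linarith
        also have "\<dots> \<le> \<rho> * (L * real (card J) / real (Suc k)) + \<rho> * (e/2) + \<rho> * ((\<Sum>i\<in>J. \<bar>D i\<bar>) / real (Suc k))"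
          using 1 2 3 by linarith
        also have "\<dots> = \<rho> * (e/2 + S / real (Suc k))"
          by (simp add: S_def add_divide_distrib algebra_simps)
        also have "\<dots> \<le> \<rho> * e" proof (rule mult_left_mono)
          show "e/2 + S / real (Suc k) \<le> e" using Sk by linarith
        qed (use \<rho> in simp)
        finally show ?thesis by (simp add: \<rho>_def mult.commute)
      qed
      then show "\<exists>d>0. \<forall>c'. l1 c' c < d \<longrightarrow>
          \<bar>v c' - v c - (\<Sum>i\<in>J. dd v (unit i) c * (c' i - c i))\<bar> \<le> e * l1 c' c"
        using d(1) by (auto simp: D_def)
    qed
  qed
qed

text \<open>The discrete formula is exact: by translation invariance the difference quotient passes
  from v to \<open>\<psi>\<close> with increment \<open>- tk k\<close>. Both sides then converge by
  domination; v may be unbounded, but all integrands vanish outside a fixed box.\<close>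

lemma integration_by_parts:
  assumes v: "lip L v" and \<psi>: "lip L' \<psi>" "within_box a b \<psi>"
  shows "(\<integral>c. dd v q c * \<psi> c \<partial>M) = - (\<integral>c. v c * dd \<psi> q c \<partial>M)"
proof -
  \<comment> \<open>Enlarged by \<open>\<bar>q i\<bar>\<close> on each side, the box contains every
    point that a shift by at most 1 along q takes to where \<open>\<psi>\<close> is nonzero.\<close>
  let ?a = "\<lambda>i. a i - \<bar>q i\<bar>" and ?b = "\<lambda>i. b i + \<bar>q i\<bar>"
  obtain C where C: "0 \<le> C" "\<And>c. (\<And>i. i \<in> J \<Longrightarrow> ?a i < c i \<and> c i < ?b i) \<Longrightarrow> \<bar>v c\<bar> \<le> C"
    using lip_box_bound[OF v, of ?a ?b] by blast
  have Cb: "\<bar>v c\<bar> \<le> C" if "c \<in> box ?a ?b" for c using C(2) that by (auto simp: box_def)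
  obtain C' where C': "0 \<le> C'" "\<And>c. \<bar>\<psi> c\<bar> \<le> C'" using within_box_bound[OF \<psi>] by blast
  have vm [measurable]: "v \<in> borel_measurable M" and \<psi>m [measurable]: "\<psi> \<in> borel_measurable M"
    using lip_measurable v \<psi> by auto
  have sm [measurable]: "(\<lambda>c. \<psi> (shift q t c)) \<in> borel_measurable M" "(\<lambda>c. v (shift q t c)) \<in> borel_measurable M" for t
    by (rule measurable_compose[OF shift_measurable], measurable)+
  have zero: "\<psi> (shift q t c) = 0" if "c \<in> space M" "c \<notin> box ?a ?b" "\<bar>t\<bar> \<le> 1" for c t
    using within_shift[OF \<psi>(2)] that by blast
  have int: "integrable M (\<lambda>c. v c * \<psi> (shift q t c))" if t: "\<bar>t\<bar> \<le> 1" for t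
  proof (rule integrable_on_box[of _ "C * C'" ?a ?b])
    show "AE c in M. \<bar>v c * \<psi> (shift q t c)\<bar> \<le> C * C'"
    proof (rule AE_I2)
      fix c assume c: "c \<in> space M"
      show "\<bar>v c * \<psi> (shift q t c)\<bar> \<le> C * C'"
      proof (cases "c \<in> box ?a ?b")
        case True
        then show ?thesis unfolding abs_mult using Cb C C' by (intro mult_mono) auto
      qed (use zero[OF c _ t] C C' in auto)
    qed
  qed (auto simp: zero t)
  have eq: "(\<integral>c. quot v q (tk k) c * \<psi> c \<partial>M) = - (\<integral>c. v c * quot \<psi> q (- tk k) c \<partial>M)" for k
  proof -
    let ?G = "\<lambda>c. v c * \<psi> (shift q (- tk k) c) / tk k"
    have i0: "integrable M (\<lambda>c. v c * \<psi> c / tk k)"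
      using int[of 0] by (intro integrable_divide) (simp cong: Bochner_Integration.integrable_cong add: shift_0)
    have iG: "integrable M ?G" using int[of "- tk k"] by (intro integrable_divide) simp
    have Gs: "?G (shift q (tk k) c) = v (shift q (tk k) c) * \<psi> c / tk k" if "c \<in> space M" for c
      using that by (simp add: shift_shift shift_0)
    have i1: "integrable M (\<lambda>c. v (shift q (tk k) c) * \<psi> c / tk k)"
    proof -
      have "integrable (distr M M (shift q (tk k))) ?G" using iG by (simp add: M_shift)
      then have "integrable M (\<lambda>c. ?G (shift q (tk k) c))"
        by (rule integrable_distr[rotated]) measurable
      then show ?thesis using Gs by (simp cong: Bochner_Integration.integrable_cong)
    qed
    have "(\<integral>c. quot v q (tk k) c * \<psi> c \<partial>M) = (\<integral>c. v (shift q (tk k) c) * \<psi> c / tk k - v c * \<psi> c / tk k \<partial>M)"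
      by (intro Bochner_Integration.integral_cong refl) (simp add: quot_def shift_0 field_simps)
    also have "\<dots> = (\<integral>c. v (shift q (tk k) c) * \<psi> c / tk k \<partial>M) - (\<integral>c. v c * \<psi> c / tk k \<partial>M)"
      by (intro Bochner_Integration.integral_diff i0 i1)
    also have "(\<integral>c. v (shift q (tk k) c) * \<psi> c / tk k \<partial>M) = (\<integral>c. ?G (shift q (tk k) c) \<partial>M)"
      by (intro Bochner_Integration.integral_cong refl) (simp only: Gs)
    also have "\<dots> = (\<integral>c. ?G c \<partial>M)" by (intro integral_shift borel_measurable_integrable iG)
    also have "(\<integral>c. ?G c \<partial>M) - (\<integral>c. v c * \<psi> c / tk k \<partial>M) = (\<integral>c. ?G c - v c * \<psi> c / tk k \<partial>M)"
      by (intro Bochner_Integration.integral_diff[symmetric] i0 iG)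
    also have "\<dots> = (\<integral>c. - (v c * quot \<psi> q (- tk k) c) \<partial>M)"
      by (intro Bochner_Integration.integral_cong refl) (simp add: quot_def shift_0 field_simps)
    finally show ?thesis by simp
  qed
  have L': "0 \<le> L'" by (rule lip_nonneg[OF \<psi>(1)])
  have "(\<lambda>k. \<integral>c. v c * quot \<psi> q (- tk k) c \<partial>M) \<longlonglongrightarrow> (\<integral>c. v c * dd \<psi> q c \<partial>M)"
  proof (rule integral_dominated_convergence[where w="\<lambda>c. indicator (box ?a ?b) c * (C * (L' * size1 q))"])
    show "integrable M (\<lambda>c. indicator (box ?a ?b) c * (C * (L' * size1 q)) :: real)"
      using emeasure_box by (intro integrable_mult_left) auto
    have mt: "filterlim (\<lambda>k. - tk k) (at 0) sequentially"
      using tendsto_minus[OF tk_tendsto] by (simp add: filterlim_at)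
    show "AE c in M. (\<lambda>k. v c * quot \<psi> q (- tk k) c) \<longlonglongrightarrow> v c * dd \<psi> q c"
      using AE_dd[OF \<psi>(1), of q]
      by eventually_elim (intro tendsto_mult tendsto_const filterlim_compose[OF _ mt])
    show "AE c in M. norm (v c * quot \<psi> q (- tk k) c) \<le> indicator (box ?a ?b) c * (C * (L' * size1 q))" for k
    proof (rule AE_I2)
      fix c assume c: "c \<in> space M"
      show "norm (v c * quot \<psi> q (- tk k) c) \<le> indicator (box ?a ?b) c * (C * (L' * size1 q))"
      proof (cases "c \<in> box ?a ?b")
        case True
        then show ?thesis unfolding real_norm_def abs_mult using Cb C L' quot_bound[OF \<psi>(1)]
          by (simp add: mult_mono)
      next
        case False
        then show ?thesis using zero[OF c False, of "- tk k"] zero[OF c False, of 0] by (simp add: quot_def)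
      qed
    qed
  qed (use quot_measurable[OF \<psi>(1)] dd_measurable[OF \<psi>(1)] in measurable)
  then have "(\<lambda>k. \<integral>c. quot v q (tk k) c * \<psi> c \<partial>M) \<longlonglongrightarrow> - (\<integral>c. v c * dd \<psi> q c \<partial>M)"
    unfolding eq by (rule tendsto_minus)
  from LIMSEQ_unique[OF integral_quot_tendsto0[OF v \<psi>] this] show ?thesis .
qed

end

section \<open>Simplices and their charts\<close>

lemma bary_dist_nonneg [simp]: "0 \<le> bary_dist \<alpha> \<beta>"
  by (simp add: bary_dist_def sum_nonneg)

text \<open>The distances are arbitrary functions, as \<open>bary_dist\<close> is not the metric of
  a type; the few metric facts that the estimate uses appear as assumptions.\<close>

lemma locally_lipschitz_compose:
  assumes F: "locally_lipschitz S d d' F" and G: "locally_lipschitz T d' d'' G" and ST: "F ` S \<subseteq> T"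
    and d: "\<And>x y. 0 \<le> d x y" "\<And>x. d x x = 0" and d': "\<And>x y. 0 \<le> d' x y"
  shows "locally_lipschitz S d d'' (\<lambda>x. G (F x))"
  unfolding locally_lipschitz_def
proof
  fix x assume x: "x \<in> S"
  obtain r L where r: "0 < r" and L: "\<And>y z. y \<in> S \<Longrightarrow> z \<in> S \<Longrightarrow> d x y < r \<Longrightarrow> d x z < r \<Longrightarrow> d' (F y) (F z) \<le> L * d y z"
    using F x unfolding locally_lipschitz_def by meson
  have "F x \<in> T" using ST x by auto
  then obtain r' L' where r': "0 < r'" and L': "\<And>y z. y \<in> T \<Longrightarrow> z \<in> T \<Longrightarrow> d' (F x) y < r' \<Longrightarrow> d' (F x) z < r' \<Longrightarrow> d'' (G y) (G z) \<le> L' * d' y z"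
    using G unfolding locally_lipschitz_def by meson
  define \<rho> where "\<rho> = min r (r' / (\<bar>L\<bar> + 1))"
  have \<rho>: "0 < \<rho>" using r r' by (simp add: \<rho>_def add_nonneg_pos)
  have near: "d' (F x) (F y) < r'" if y: "y \<in> S" "d x y < \<rho>" for y
  proof -
    have "d' (F x) (F y) \<le> L * d x y" using L[OF x y(1)] y d(2) r by (simp add: \<rho>_def)
    also have "\<dots> \<le> (\<bar>L\<bar> + 1) * d x y" using d(1) by (intro mult_right_mono) auto
    also have "\<dots> < (\<bar>L\<bar> + 1) * (r' / (\<bar>L\<bar> + 1))"
      using y(2) by (intro mult_strict_left_mono) (auto simp: \<rho>_def)
    finally show ?thesis by simp
  qed
  have "d'' (G (F y)) (G (F z)) \<le> (\<bar>L'\<bar> * \<bar>L\<bar>) * d y z" if yz: "y \<in> S" "z \<in> S" "d x y < \<rho>" "d x z < \<rho>" for y z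
  proof -
    have "d'' (G (F y)) (G (F z)) \<le> L' * d' (F y) (F z)"
      using yz ST near by (intro L') auto
    also have "\<dots> \<le> \<bar>L'\<bar> * d' (F y) (F z)" using d' by (intro mult_right_mono) auto
    also have "d' (F y) (F z) \<le> \<bar>L\<bar> * d y z"
    proof -
      have "d' (F y) (F z) \<le> L * d y z" using L[of y z] yz by (simp add: \<rho>_def)
      also have "\<dots> \<le> \<bar>L\<bar> * d y z" using d(1) by (intro mult_right_mono) auto
      finally show ?thesis .
    qed
    finally show ?thesis by (simp add: mult_left_mono mult.assoc)
  qed
  then show "\<exists>r>0. \<exists>L. \<forall>y\<in>S. \<forall>z\<in>S. d x y < r \<and> d x z < r \<longrightarrow> d'' (G (F y)) (G (F z)) \<le> L * d y z"
    using \<rho> by blast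
qed

lemma locally_lipschitz_continuous_on:
  fixes F :: "'a::metric_space \<Rightarrow> 'b::metric_space"
  assumes "locally_lipschitz S dist dist F"
  shows "continuous_on S F"
  unfolding continuous_on_iff
proof (intro ballI allI impI)
  fix x and e :: real assume x: "x \<in> S" and e: "0 < e"
  obtain r L where r: "0 < r" and L: "\<And>y z. y \<in> S \<Longrightarrow> z \<in> S \<Longrightarrow> dist x y < r \<Longrightarrow> dist x z < r \<Longrightarrow> dist (F y) (F z) \<le> L * dist y z"
    using assms x unfolding locally_lipschitz_def by meson
  have "dist (F y) (F x) < e" if y: "y \<in> S" "dist y x < min r (e / (\<bar>L\<bar> + 1))" for y
  proof -
    have "dist (F y) (F x) \<le> L * dist y x" using L[OF y(1) x] y r by (simp add: dist_commute)
    also have "\<dots> \<le> (\<bar>L\<bar> + 1) * dist y x" by (intro mult_right_mono) auto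
    also have "\<dots> < (\<bar>L\<bar> + 1) * (e / (\<bar>L\<bar> + 1))"
      using y(2) by (intro mult_strict_left_mono) auto
    finally show ?thesis by simp
  qed
  then show "\<exists>d>0. \<forall>x'\<in>S. dist x' x < d \<longrightarrow> dist (F x') (F x) < e"
    using r e by (intro exI[of _ "min r (e / (\<bar>L\<bar> + 1))"]) (auto simp: add_nonneg_pos)
qed

locale riem_polyhedron =
  fixes P :: "('v, 'e::euclidean_space, 'x::metric_space) riem_poly"
  assumes riemannian: "riemannian_polyhedron P"
begin

abbreviation R :: "('v \<Rightarrow> real) set" where "R \<equiv> realization (cplx P)"

abbreviation maximal :: "'v set \<Rightarrow> bool" where "maximal s \<equiv> s \<in> maximal_simplices (cplx P)"

lemma simplicial: "simplicial_cplx (cplx P)" "countable (cplx P)" "locally_finite_cplx (cplx P)"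
    "finite_dimensional_cplx (cplx P)"
  and tri_homeo: "lipschitz_homeo R bary_dist UNIV dist (tri P)"
  and embed_homeo: "lipschitz_homeo R bary_dist (embed P ` R) dist (embed P)"
  and embed_closed: "closed (embed P ` R)"
  using riemannian by (auto simp: riemannian_polyhedron_def lipschitz_polyhedron_def euclidean_embedding_def)

lemma simplex_finite: "s \<in> cplx P \<Longrightarrow> finite s"
  using simplicial(1) unfolding simplicial_cplx_def by blast

lemma simplex_nonempty: "s \<in> cplx P \<Longrightarrow> s \<noteq> {}"
  using simplicial(1) unfolding simplicial_cplx_def by blast

lemma simplex_face: "s \<in> cplx P \<Longrightarrow> t \<subseteq> s \<Longrightarrow> t \<noteq> {} \<Longrightarrow> t \<in> cplx P"
  using simplicial(1) unfolding simplicial_cplx_def by blast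

lemma maximal_in: "maximal s \<Longrightarrow> s \<in> cplx P" by (simp add: maximal_simplices_def)

lemma bary_in: "bary P x \<in> R" and tri_bary [simp]: "tri P (bary P x) = x"
  and bary_tri: "\<alpha> \<in> R \<Longrightarrow> bary P (tri P \<alpha>) = \<alpha>"
proof -
  have b: "bij_betw (tri P) R UNIV" using tri_homeo by (simp add: lipschitz_homeo_def)
  then have i: "inj_on (tri P) R" "tri P ` R = UNIV" by (auto simp: bij_betw_def)
  have x: "x \<in> tri P ` R" using i(2) by simp
  show "bary P x \<in> R" unfolding bary_def by (rule the_inv_into_into[OF i(1) x order_refl])
  show "tri P (bary P x) = x" unfolding bary_def by (rule f_the_inv_into_f[OF i(1) x])
  show "\<alpha> \<in> R \<Longrightarrow> bary P (tri P \<alpha>) = \<alpha>" unfolding bary_def by (rule the_inv_into_f_f[OF i(1)])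
qed

lemma embed_inj: "inj_on (embed P) R"
  using embed_homeo by (simp add: lipschitz_homeo_def bij_betw_def)

lemma bary_lip: "locally_lipschitz UNIV dist bary_dist (bary P)"
proof -
  have "bary P = the_inv_into R (tri P)" by (auto simp: bary_def fun_eq_iff)
  then show ?thesis using tri_homeo by (simp add: lipschitz_homeo_def)
qed

lemma coord_lip: "locally_lipschitz UNIV dist dist (coord P)"
  unfolding coord_def[abs_def] using bary_in embed_homeo
  by (intro locally_lipschitz_compose[OF bary_lip, of R]) (auto simp: lipschitz_homeo_def)

lemma coord_continuous: "continuous_on UNIV (coord P)"
  by (rule locally_lipschitz_continuous_on[OF coord_lip])

lemma range_coord: "range (coord P) = embed P ` R"
proof (intro equalityI subsetI)
  fix y assume "y \<in> embed P ` R"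
  then obtain \<alpha> where "\<alpha> \<in> R" "y = embed P \<alpha>" by blast
  then have "y = coord P (tri P \<alpha>)" by (simp add: coord_def bary_tri)
  then show "y \<in> range (coord P)" by blast
qed (auto simp: coord_def bary_in)

lemma coord_closed: "closed (range (coord P))"
  using embed_closed by (simp add: range_coord)

lemma coord_inj: "inj (coord P)"
proof (rule injI)
  fix x y assume "coord P x = coord P y"
  then have "bary P x = bary P y"
    using embed_inj bary_in by (auto simp: coord_def inj_on_def)
  then show "x = y" by (metis tri_bary)
qed

lemma inv_coord [simp]: "the_inv (coord P) (coord P x) = x"
  by (rule the_inv_f_f[OF coord_inj])

lemma inv_coord_lip: "locally_lipschitz (range (coord P)) dist dist (the_inv (coord P))"
proof -
  have "locally_lipschitz (embed P ` R) dist dist (\<lambda>y. tri P (the_inv_into R (embed P) y))"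
  proof (rule locally_lipschitz_compose[where F="the_inv_into R (embed P)" and G="tri P" and T=R and d'=bary_dist])
    show "locally_lipschitz (embed P ` R) dist bary_dist (the_inv_into R (embed P))"
      using embed_homeo by (simp add: lipschitz_homeo_def)
    show "locally_lipschitz R bary_dist dist (tri P)"
      using tri_homeo by (simp add: lipschitz_homeo_def)
    show "the_inv_into R (embed P) ` embed P ` R \<subseteq> R"
      using the_inv_into_f_f[OF embed_inj] by auto
  qed auto
  moreover have "tri P (the_inv_into R (embed P) y) = the_inv (coord P) y" if "y \<in> range (coord P)" for y
  proof -
    from that obtain x where x: "y = coord P x" by blast
    have "the_inv_into R (embed P) y = bary P x"
      unfolding x coord_def by (rule the_inv_into_f_f[OF embed_inj bary_in])
    then show ?thesis using x by simp
  qed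
  ultimately show ?thesis unfolding range_coord[symmetric] by (simp add: locally_lipschitz_def)
qed

lemma inv_coord_continuous: "continuous_on (range (coord P)) (the_inv (coord P))"
  by (rule locally_lipschitz_continuous_on[OF inv_coord_lip])

lemma carrier_in: "carrier_simplex P x \<in> cplx P"
  using bary_in[of x] by (simp add: carrier_simplex_def realization_def)

lemma carrier_finite: "finite (carrier_simplex P x)"
  using carrier_in simplex_finite by blast

lemma bary_nonneg: "0 \<le> bary P x i"
  using bary_in[of x] by (simp add: realization_def)

text \<open>A single barycentric coordinate changes by at most \<open>bary_dist\<close>, its square
  being one summand there; the local Lipschitz property of \<open>bary P\<close> then gives
  continuity.\<close>

lemma bary_continuous: "continuous_on UNIV (\<lambda>x. bary P x i)"
proof -
  have "\<bar>bary P x i - bary P y i\<bar> \<le> bary_dist (bary P x) (bary P y)" for x y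
  proof (cases "bary P x i \<noteq> 0 \<or> bary P y i \<noteq> 0")
    case True
    have "{v. bary P x v \<noteq> 0 \<or> bary P y v \<noteq> 0} = carrier_simplex P x \<union> carrier_simplex P y"
      by (auto simp: carrier_simplex_def)
    then have "(bary P x i - bary P y i)\<^sup>2 \<le> (\<Sum>v | bary P x v \<noteq> 0 \<or> bary P y v \<noteq> 0. (bary P x v - bary P y v)\<^sup>2)"
      using True carrier_finite by (intro member_le_sum) auto
    then have "sqrt ((bary P x i - bary P y i)\<^sup>2) \<le> bary_dist (bary P x) (bary P y)"
      unfolding bary_dist_def by (rule real_sqrt_le_mono)
    then show ?thesis by simp
  qed simp
  then have "locally_lipschitz R bary_dist dist (\<lambda>\<alpha>. \<alpha> i)"
    unfolding locally_lipschitz_def dist_real_def using bary_tri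
    by (intro ballI exI[of _ 1] conjI exI[of _ 1]) (auto, metis)
  then have "locally_lipschitz UNIV dist dist (\<lambda>x. bary P x i)"
    using bary_in by (intro locally_lipschitz_compose[OF bary_lip, of R]) auto
  then show ?thesis by (rule locally_lipschitz_continuous_on)
qed

text \<open>Cardinalities of simplices are bounded, so among the simplices containing
  \<open>\<sigma>\<close> there is one of greatest cardinality, and it is maximal.\<close>

lemma maximal_above:
  assumes "\<sigma> \<in> cplx P" obtains s where "maximal s" "\<sigma> \<subseteq> s"
proof -
  obtain N where N: "\<And>s. s \<in> cplx P \<Longrightarrow> card s \<le> N"
    using simplicial(4) by (auto simp: finite_dimensional_cplx_def)
  obtain s where s: "s \<in> cplx P \<and> \<sigma> \<subseteq> s" "\<And>t. t \<in> cplx P \<and> \<sigma> \<subseteq> t \<Longrightarrow> card t \<le> card s"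
    using ex_has_greatest_nat[of "\<lambda>t. t \<in> cplx P \<and> \<sigma> \<subseteq> t" \<sigma> card "Suc N"] assms N by (force simp: less_Suc_eq_le)
  have "t = s" if "t \<in> cplx P" "s \<subseteq> t" for t
    using that s card_seteq[of t s] simplex_finite by (metis order_trans)
  then have "maximal s" using s(1) by (auto simp: maximal_simplices_def)
  with s(1) that show thesis by blast
qed

definition inter :: "'v set \<Rightarrow> 'x set" where
  "inter s = {x. carrier_simplex P x = s}"

text \<open>A carrier that contains a maximal simplex equals it. The open simplex is thus cut out by
  finitely many conditions \<open>bary P x i \<noteq> 0\<close>, which makes it open in the whole
  space.\<close>

lemma inter_eq:
  assumes "maximal s" shows "inter s = {x. \<forall>i\<in>s. bary P x i \<noteq> 0}"
proof -
  have "carrier_simplex P x = s \<longleftrightarrow> s \<subseteq> carrier_simplex P x" for x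
    using assms carrier_in[of x] by (auto simp: maximal_simplices_def)
  then show ?thesis by (auto simp: inter_def carrier_simplex_def)
qed

lemma inter_open: "maximal s \<Longrightarrow> open (inter s)"
proof -
  assume s: "maximal s"
  have "inter s = (\<Inter>i\<in>s. {x. bary P x i \<noteq> 0})" using inter_eq[OF s] by auto
  moreover have "finite s" using s maximal_in simplex_finite by blast
  ultimately show ?thesis
    by (auto intro!: open_INT open_Collect_neq bary_continuous continuous_on_const)
qed

text \<open>The open star of x. A point y in it lies with x in a common closed maximal simplex,
  which is how estimates on single simplices give continuity across faces.\<close>

lemma star_neighbourhood:
  obtains U where "open U" "x \<in> U" "\<And>y. y \<in> U \<Longrightarrow> carrier_simplex P x \<subseteq> carrier_simplex P y"
proof
  show "open (\<Inter>i\<in>carrier_simplex P x. {y. bary P y i \<noteq> 0})"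
    using carrier_finite by (auto intro!: open_INT open_Collect_neq bary_continuous continuous_on_const)
qed (auto simp: carrier_simplex_def)

lemma base_in: "s \<in> cplx P \<Longrightarrow> base_vertex s \<in> s"
  unfolding base_vertex_def using simplex_nonempty[of s] by (simp add: some_in_eq)

lemma free_finite: "s \<in> cplx P \<Longrightarrow> finite (free_vertices s)"
  using simplex_finite by (simp add: free_vertices_def)

lemma base_not_free [simp]: "base_vertex s \<notin> free_vertices s"
  by (simp add: free_vertices_def)

lemma simplex_insert: "s \<in> cplx P \<Longrightarrow> s = insert (base_vertex s) (free_vertices s)"
  using base_in by (auto simp: free_vertices_def)

lemma sum_simplex:
  fixes h :: "'v \<Rightarrow> 'b::comm_monoid_add"
  assumes "s \<in> cplx P" shows "sum h s = h (base_vertex s) + sum h (free_vertices s)"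
  using free_finite[OF assms] by (subst simplex_insert[OF assms]) simp

lemma realizationI:
  assumes s: "s \<in> cplx P" and "\<And>v. 0 \<le> \<alpha> v" "\<And>v. v \<notin> s \<Longrightarrow> \<alpha> v = 0" "sum \<alpha> s = 1"
  shows "\<alpha> \<in> R"
proof -
  have sub: "{v. \<alpha> v \<noteq> 0} \<subseteq> s" using assms(3) by blast
  have sum: "(\<Sum>v | \<alpha> v \<noteq> 0. \<alpha> v) = sum \<alpha> s"
    using simplex_finite[OF s] sub by (intro sum.mono_neutral_left) auto
  have "{v. \<alpha> v \<noteq> 0} \<noteq> {}"
  proof
    assume "{v. \<alpha> v \<noteq> 0} = {}"
    then have "sum \<alpha> s = 0" by simp
    with assms(4) show False by simp
  qed
  then have "{v. \<alpha> v \<noteq> 0} \<in> cplx P" using simplex_face[OF s sub] by blast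
  then show ?thesis using assms sum by (simp add: realization_def)
qed

lemma realization_sum:
  assumes "\<alpha> \<in> R" "finite s" "\<And>v. v \<notin> s \<Longrightarrow> \<alpha> v = 0"
  shows "sum \<alpha> s = 1"
proof -
  have "(\<Sum>v | \<alpha> v \<noteq> 0. \<alpha> v) = sum \<alpha> s"
    using assms by (intro sum.mono_neutral_left) auto
  then show ?thesis using assms(1) by (simp add: realization_def)
qed

lemma embed_sum:
  assumes "finite s" "\<And>v. v \<notin> s \<Longrightarrow> \<alpha> v = 0"
  shows "embed P \<alpha> = (\<Sum>v\<in>s. \<alpha> v *\<^sub>R vert P v)"
  unfolding embed_def using assms by (intro sum.mono_neutral_left) auto

section \<open>Parameters of a simplex and its tangent frame\<close>

definition chart :: "'v set \<Rightarrow> ('v \<Rightarrow> real) \<Rightarrow> 'x" where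
  "chart s c = tri P (param_point s c)"

definition param :: "'v set \<Rightarrow> 'x \<Rightarrow> 'v \<Rightarrow> real" where
  "param s x = restrict (bary P x) (free_vertices s)"

definition affine_map :: "'v set \<Rightarrow> ('v \<Rightarrow> real) \<Rightarrow> 'e" where
  "affine_map s c = vert P (base_vertex s) + (\<Sum>i\<in>free_vertices s. c i *\<^sub>R frame P s i)"

lemma param_point_sum:
  assumes "s \<in> cplx P" shows "sum (param_point s c) s = 1"
proof -
  have "sum (param_point s c) (free_vertices s) = sum c (free_vertices s)"
    by (intro sum.cong) (auto simp: param_point_def)
  then show ?thesis by (simp add: sum_simplex[OF assms]) (simp add: param_point_def)
qed

lemma param_point_outside: "s \<in> cplx P \<Longrightarrow> v \<notin> s \<Longrightarrow> param_point s c v = 0"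
  using base_in[of s] by (auto simp: param_point_def free_vertices_def)

lemma param_point_in:
  assumes "s \<in> cplx P" "c \<in> param_simplex s" shows "param_point s c \<in> R"
proof (rule realizationI[OF assms(1)])
  show "0 \<le> param_point s c v" for v using assms(2) by (auto simp: param_point_def param_simplex_def)
qed (auto simp: param_point_outside param_point_sum assms)

lemma bary_chart: "s \<in> cplx P \<Longrightarrow> c \<in> param_simplex s \<Longrightarrow> bary P (chart s c) = param_point s c"
  by (simp add: chart_def bary_tri param_point_in)

lemma embed_param_point:
  assumes "s \<in> cplx P" shows "embed P (param_point s c) = affine_map s c"
proof -
  have "embed P (param_point s c) = (\<Sum>v\<in>s. param_point s c v *\<^sub>R vert P v)"
    using assms by (intro embed_sum simplex_finite param_point_outside)
  also have "\<dots> = (1 - (\<Sum>w\<in>free_vertices s. c w)) *\<^sub>R vert P (base_vertex s) + (\<Sum>i\<in>free_vertices s. c i *\<^sub>R vert P i)"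
    unfolding sum_simplex[OF assms] by (simp add: param_point_def)
  also have "\<dots> = affine_map s c"
    by (simp add: affine_map_def frame_def scaleR_diff_right scaleR_diff_left sum_subtractf scaleR_sum_left)
  finally show ?thesis .
qed

lemma coord_chart: "s \<in> cplx P \<Longrightarrow> c \<in> param_simplex s \<Longrightarrow> coord P (chart s c) = affine_map s c"
  by (simp add: coord_def bary_chart embed_param_point)

lemma chart_closed: "s \<in> cplx P \<Longrightarrow> c \<in> param_simplex s \<Longrightarrow> chart s c \<in> closed_simplex P s"
  using param_point_outside by (force simp: closed_simplex_def carrier_simplex_def bary_chart)

lemma param_chart: "s \<in> cplx P \<Longrightarrow> c \<in> param_simplex s \<Longrightarrow> param s (chart s c) = c"
  by (auto simp: param_def bary_chart param_point_def param_simplex_def extensional_def fun_eq_iff)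

lemma closed_simplex_zero: "x \<in> closed_simplex P s \<Longrightarrow> v \<notin> s \<Longrightarrow> bary P x v = 0"
  by (auto simp: closed_simplex_def carrier_simplex_def)

lemma param_point_param:
  assumes "s \<in> cplx P" "x \<in> closed_simplex P s" shows "param_point s (param s x) = bary P x"
proof
  fix v
  have "sum (bary P x) s = 1"
    using assms closed_simplex_zero by (intro realization_sum bary_in simplex_finite) auto
  then have "bary P x (base_vertex s) = 1 - (\<Sum>w\<in>free_vertices s. bary P x w)"
    by (simp add: sum_simplex[OF assms(1)])
  moreover have "v \<in> free_vertices s \<or> v = base_vertex s \<or> v \<notin> s" by (auto simp: free_vertices_def)
  ultimately show "param_point s (param s x) v = bary P x v"
    using closed_simplex_zero[OF assms(2)] base_in[OF assms(1)]
    by (auto simp: param_point_def param_def free_vertices_def)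
qed

lemma param_in:
  assumes "s \<in> cplx P" "x \<in> closed_simplex P s" shows "param s x \<in> param_simplex s"
proof -
  have "sum (bary P x) s = 1"
    using assms closed_simplex_zero by (intro realization_sum bary_in simplex_finite) auto
  then have "(\<Sum>w\<in>free_vertices s. bary P x w) = 1 - bary P x (base_vertex s)"
    by (simp add: sum_simplex[OF assms(1)])
  then show ?thesis
    using bary_nonneg by (auto simp: param_simplex_def param_def)
qed

lemma chart_param: "s \<in> cplx P \<Longrightarrow> x \<in> closed_simplex P s \<Longrightarrow> chart s (param s x) = x"
  by (simp add: chart_def param_point_param)

lemma coord_affine: "s \<in> cplx P \<Longrightarrow> x \<in> closed_simplex P s \<Longrightarrow> coord P x = affine_map s (param s x)"
  using coord_chart[of s "param s x"] by (simp add: chart_param param_in)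

definition pint :: "'v set \<Rightarrow> ('v \<Rightarrow> real) set" where
  "pint s = {c \<in> extensional (free_vertices s). (\<forall>i\<in>free_vertices s. 0 < c i) \<and> (\<Sum>i\<in>free_vertices s. c i) < 1}"

lemma pint_subset: "pint s \<subseteq> param_simplex s"
  by (auto simp: pint_def param_simplex_def less_imp_le)

lemma inter_closed: "x \<in> inter s \<Longrightarrow> x \<in> closed_simplex P s"
  by (simp add: inter_def closed_simplex_def)

lemma chart_pint:
  assumes "s \<in> cplx P" "c \<in> pint s" shows "chart s c \<in> inter s"
proof -
  have c: "c \<in> param_simplex s" using pint_subset assms(2) by blast
  have "param_point s c v \<noteq> 0 \<longleftrightarrow> v \<in> s" for v
    using assms simplex_insert[OF assms(1)] param_point_outside[OF assms(1), of v c]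
    by (auto simp: param_point_def pint_def)
  then show ?thesis by (auto simp: inter_def carrier_simplex_def bary_chart[OF assms(1) c])
qed

lemma param_pint:
  assumes "s \<in> cplx P" "x \<in> inter s" shows "param s x \<in> pint s"
proof -
  have x: "x \<in> closed_simplex P s" using assms inter_closed by blast
  have nz: "bary P x v > 0" if "v \<in> s" for v
    using assms(2) that bary_nonneg[of x v] by (auto simp: inter_def carrier_simplex_def less_le)
  have "sum (bary P x) s = 1"
    using assms x closed_simplex_zero by (intro realization_sum bary_in simplex_finite) auto
  then have "(\<Sum>w\<in>free_vertices s. bary P x w) < 1"
    using nz[OF base_in[OF assms(1)]] by (simp add: sum_simplex[OF assms(1)])
  then show ?thesis using nz by (auto simp: pint_def param_def free_vertices_def)
qed

text \<open>Affine independence of the embedded vertices follows from injectivity of the embedding: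
  moving an interior point along a linear relation of the frame would give different points of the
  simplex with the same image.\<close>

lemma frame_independent:
  assumes s: "s \<in> cplx P" and zero: "(\<Sum>i\<in>free_vertices s. a i *\<^sub>R frame P s i) = 0" and i: "i \<in> free_vertices s"
  shows "a i = 0"
proof -
  let ?J = "free_vertices s"
  \<comment> \<open>With N the number of vertices, the parameters \<open>1 / N\<close> belong to the
    barycentre. A bounds each \<open>\<bar>a i\<bar>\<close> and the modulus of their sum, so a step
    of size at most \<open>t = 1 / (N * A)\<close> along a keeps every barycentric coordinate
    nonnegative, the one at the base vertex included.\<close>
  define N where "N = real (card ?J) + 1"
  define A where "A = (\<Sum>i\<in>?J. \<bar>a i\<bar>) + 1"
  define c where "c t = (\<lambda>i\<in>?J. 1 / N + t * a i)" for t
  have N: "0 < N" by (simp add: N_def add_nonneg_pos)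
  have A: "0 < A" by (simp add: A_def sum_nonneg add_nonneg_pos)
  define t where "t = 1 / (N * A)"
  have t: "0 < t" using N A by (simp add: t_def)
  have in_simplex: "c r \<in> param_simplex s" if r: "\<bar>r\<bar> \<le> t" for r
  proof -
    have ra: "\<bar>r * a i\<bar> \<le> 1 / N" if "i \<in> ?J" for i
    proof -
      have "\<bar>a i\<bar> \<le> A" using member_le_sum[of i ?J "\<lambda>i. \<bar>a i\<bar>"] that free_finite[OF s] by (simp add: A_def)
      then have "\<bar>r\<bar> * \<bar>a i\<bar> \<le> t * A" using r t by (intro mult_mono) auto
      then show ?thesis using A by (simp add: t_def abs_mult)
    qed
    have "\<bar>\<Sum>i\<in>?J. r * a i\<bar> \<le> t * A"
    proof -
      have "\<bar>\<Sum>i\<in>?J. a i\<bar> \<le> A" using sum_abs[of a ?J] unfolding A_def by linarith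
      then have "\<bar>r\<bar> * \<bar>\<Sum>i\<in>?J. a i\<bar> \<le> t * A" using r t by (intro mult_mono) auto
      then show ?thesis by (simp add: abs_mult sum_distrib_left[symmetric])
    qed
    then have "(\<Sum>i\<in>?J. 1 / N + r * a i) \<le> real (card ?J) / N + 1 / N"
      using A by (simp add: sum.distrib t_def abs_le_iff)
    also have "\<dots> = 1" using N by (simp add: N_def field_simps)
    finally have "(\<Sum>i\<in>?J. 1 / N + r * a i) \<le> 1" .
    moreover have "0 \<le> 1 / N + r * a i" if "i \<in> ?J" for i
      using abs_le_D2[OF ra[OF that]] by linarith
    ultimately show ?thesis by (auto simp: c_def param_simplex_def)
  qed
  have "affine_map s (c t) = affine_map s (c 0)"
    using zero by (simp add: affine_map_def c_def scaleR_add_left sum.distrib flip: scaleR_scaleR scaleR_right.sum)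
  then have "embed P (param_point s (c t)) = embed P (param_point s (c 0))"
    by (simp add: embed_param_point[OF s])
  then have "param_point s (c t) = param_point s (c 0)"
    using embed_inj param_point_in[OF s] in_simplex t by (auto simp: inj_on_def)
  then have "param_point s (c t) i = param_point s (c 0) i" by simp
  then show ?thesis using i t by (simp add: param_point_def c_def)
qed

lemma dual_exists:
  assumes s: "s \<in> cplx P" and i: "i \<in> free_vertices s"
  shows "\<exists>g. linear g \<and> (\<forall>j\<in>free_vertices s. g (frame P s j) = (if j = i then 1 else (0::real)))"
proof -
  let ?J = "free_vertices s" and ?f = "frame P s"
  have fin: "finite ?J" by (rule free_finite[OF s])
  have inj: "inj_on ?f ?J"
  proof (rule inj_onI)
    fix k l assume kl: "k \<in> ?J" "l \<in> ?J" "?f k = ?f l"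
    show "k = l"
    proof (rule ccontr)
      assume ne: "k \<noteq> l"
      let ?a = "\<lambda>j. if j = k then 1 else if j = l then -1 else (0::real)"
      have "(\<Sum>j\<in>?J. ?a j *\<^sub>R ?f j) = (\<Sum>j\<in>{k, l}. ?a j *\<^sub>R ?f j)"
        using fin kl by (intro sum.mono_neutral_right) auto
      also have "\<dots> = 0" using ne kl(3) by simp
      finally have "?a k = 0" by (rule frame_independent[OF s _ kl(1)])
      then show False by simp
    qed
  qed
  have "independent (?f ` ?J)"
  proof (rule independent_if_scalars_zero)
    fix h x assume h: "(\<Sum>x\<in>?f ` ?J. h x *\<^sub>R x) = 0" and x: "x \<in> ?f ` ?J"
    then obtain j where j: "j \<in> ?J" "x = ?f j" by blast
    have "(\<Sum>j\<in>?J. h (?f j) *\<^sub>R ?f j) = 0" using h by (simp add: sum.reindex[OF inj])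
    from frame_independent[OF s this j(1)] show "h x = 0" by (simp add: j)
  qed (use fin in simp)
  then obtain g where g: "linear g" "\<And>x. x \<in> ?f ` ?J \<Longrightarrow> g x = (if x = ?f i then 1 else (0::real))"
    using linear_independent_extend[of "?f ` ?J" "\<lambda>x. if x = ?f i then 1 else (0::real)"] by blast
  have "g (?f j) = (if j = i then 1 else 0)" if "j \<in> ?J" for j
    using g(2)[of "?f j"] inj i that by (auto simp: inj_on_def)
  with g(1) show ?thesis by blast
qed

text \<open>Coordinates with respect to the frame, extended to linear functionals on the whole
  Euclidean space; off the tangent space the choice is arbitrary. On a difference of two embedded
  points of s they give the difference of the parameters.\<close>

definition dual :: "'v set \<Rightarrow> 'v \<Rightarrow> 'e \<Rightarrow> real" where
  "dual s i = (SOME g. linear g \<and> (\<forall>j\<in>free_vertices s. g (frame P s j) = (if j = i then 1 else 0)))"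

lemma dual_linear: "s \<in> cplx P \<Longrightarrow> i \<in> free_vertices s \<Longrightarrow> linear (dual s i)"
  and dual_frame: "s \<in> cplx P \<Longrightarrow> i \<in> free_vertices s \<Longrightarrow> j \<in> free_vertices s \<Longrightarrow> dual s i (frame P s j) = (if j = i then 1 else 0)"
  using someI_ex[OF dual_exists, folded dual_def] by blast+

lemma dual_bounded_linear: "s \<in> cplx P \<Longrightarrow> i \<in> free_vertices s \<Longrightarrow> bounded_linear (dual s i)"
  using dual_linear linear_conv_bounded_linear by blast

lemma dual_sum:
  assumes s: "s \<in> cplx P" and i: "i \<in> free_vertices s"
  shows "dual s i (\<Sum>j\<in>free_vertices s. a j *\<^sub>R frame P s j) = a i"
proof -
  have "dual s i (\<Sum>j\<in>free_vertices s. a j *\<^sub>R frame P s j) = (\<Sum>j\<in>free_vertices s. a j * (if j = i then 1 else 0))"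
    using dual_linear[OF s i] by (simp add: linear_sum linear_scale dual_frame[OF s i])
  also have "\<dots> = a i" using free_finite[OF s] i by (simp add: if_distrib cong: if_cong)
  finally show ?thesis .
qed

lemma frame_base [simp]: "frame P s (base_vertex s) = 0" by (simp add: frame_def)

lemma frame_tangent: "s \<in> cplx P \<Longrightarrow> v \<in> s \<Longrightarrow> frame P s v \<in> tangent P s"
  unfolding frame_def tangent_def using base_in by (intro span_base) blast

lemma tangent_span: "s \<in> cplx P \<Longrightarrow> tangent P s = span (frame P s ` free_vertices s)"
proof (intro equalityI)
  assume s: "s \<in> cplx P"
  have f: "frame P s v \<in> span (frame P s ` free_vertices s)" if "v \<in> s" for v
    using that by (cases "v = base_vertex s") (auto simp: free_vertices_def intro: span_base span_zero)
  have "vert P v - vert P w = frame P s v - frame P s w" for v w by (simp add: frame_def)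
  then show "tangent P s \<subseteq> span (frame P s ` free_vertices s)"
    unfolding tangent_def using f by (intro span_minimal) (auto intro: span_diff)
  show "span (frame P s ` free_vertices s) \<subseteq> tangent P s"
    using frame_tangent[OF s] by (intro span_minimal) (auto simp: tangent_def free_vertices_def)
qed

lemma tangent_subspace: "subspace (tangent P s)" by (simp add: tangent_def)

lemma tangent_expand:
  assumes s: "s \<in> cplx P" and \<xi>: "\<xi> \<in> tangent P s"
  shows "\<xi> = (\<Sum>i\<in>free_vertices s. dual s i \<xi> *\<^sub>R frame P s i)"
proof -
  let ?g = "\<lambda>\<xi>. \<Sum>i\<in>free_vertices s. dual s i \<xi> *\<^sub>R frame P s i"
  have lin: "linear ?g"
    using dual_linear[OF s] by (intro linear_compose_sum ballI) (auto intro!: linearI simp: linear_add linear_scale scaleR_add_left)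
  show ?thesis
  proof (rule linear_eq_on_span[OF linear_ident lin])
    show "\<xi> \<in> span (frame P s ` free_vertices s)" using \<xi> tangent_span[OF s] by simp
    fix x assume "x \<in> frame P s ` free_vertices s"
    then obtain j where j: "j \<in> free_vertices s" "x = frame P s j" by blast
    have "?g (frame P s j) = (\<Sum>i\<in>free_vertices s. (if i = j then 1 else 0) *\<^sub>R frame P s i)"
      using dual_frame[OF s _ j(1)] by (intro sum.cong refl) auto
    also have "\<dots> = frame P s j"
      using free_finite[OF s] j by (simp add: if_distrib if_distribR cong: if_cong)
    finally show "x = ?g x" using j by simp
  qed
qed

lemma sum_frame_tangent: "s \<in> cplx P \<Longrightarrow> (\<Sum>i\<in>free_vertices s. a i *\<^sub>R frame P s i) \<in> tangent P s"
  using frame_tangent[of s] tangent_subspace[of s]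
  by (intro subspace_sum subspace_scale) (auto simp: free_vertices_def)

section \<open>The volume measure\<close>

abbreviation PM :: "'v set \<Rightarrow> ('v \<Rightarrow> real) measure" where
  "PM s \<equiv> PiM (free_vertices s) (\<lambda>_. lborel)"

lemma finite_index_free: "s \<in> cplx P \<Longrightarrow> finite_index (free_vertices s)"
  by (simp add: finite_index_def free_finite)

lemma space_PM: "space (PM s) = extensional (free_vertices s)"
  by (auto simp: space_PiM PiE_def)

lemma param_simplex_sets [measurable]: "s \<in> cplx P \<Longrightarrow> param_simplex s \<in> sets (PM s)"
proof -
  assume s: "s \<in> cplx P"
  note [simp] = free_finite[OF s]
  have "param_simplex s = {c \<in> space (PM s). (\<forall>v\<in>free_vertices s. 0 \<le> c v) \<and> (\<Sum>v\<in>free_vertices s. c v) \<le> 1}"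
    by (auto simp: param_simplex_def space_PM)
  also have "\<dots> \<in> sets (PM s)" by measurable
  finally show ?thesis .
qed

lemma pint_sets [measurable]: "s \<in> cplx P \<Longrightarrow> pint s \<in> sets (PM s)"
proof -
  assume s: "s \<in> cplx P"
  note [simp] = free_finite[OF s]
  have "pint s = {c \<in> space (PM s). (\<forall>v\<in>free_vertices s. 0 < c v) \<and> (\<Sum>v\<in>free_vertices s. c v) < 1}"
    by (auto simp: pint_def space_PM)
  also have "\<dots> \<in> sets (PM s)" by measurable
  finally show ?thesis .
qed

text \<open>The boundary of the parameter simplex lies in hyperplanes where one coordinate is 0 or
  the sum is 1. Lines along that coordinate, respectively along the diagonal, meet them in at most
  one point, so \<open>AE_along\<close> applies.\<close>

lemma AE_pint:
  assumes s: "s \<in> cplx P"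
  shows "AE c in PM s. c \<in> param_simplex s \<longrightarrow> c \<in> pint s"
proof -
  let ?J = "free_vertices s"
  interpret finite_index ?J by (rule finite_index_free[OF s])
  have "AE c in PM s. c i \<noteq> 0" if i: "i \<in> ?J" for i
  proof (rule AE_along[where q="unit i"])
    show "{c \<in> space (PM s). c i \<noteq> 0} \<in> sets (PM s)" using i by measurable
    fix c :: "'v \<Rightarrow> real"
    have "AE t in lborel. t \<noteq> - c i" by (rule AE_lborel_singleton)
    then show "AE t in lborel. shift (unit i) t c i \<noteq> 0"
      by eventually_elim (use i in \<open>auto simp: shift_def unit_def\<close>)
  qed
  then have 1: "AE c in PM s. \<forall>i\<in>?J. c i \<noteq> 0" by (subst AE_finite_all) auto
  have 2: "AE c in PM s. (\<Sum>i\<in>?J. c i) \<noteq> 1"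
  proof (rule AE_along[where q="\<lambda>_. 1"])
    show "{c \<in> space (PM s). (\<Sum>i\<in>?J. c i) \<noteq> 1} \<in> sets (PM s)" by measurable
    fix c :: "'v \<Rightarrow> real"
    have "AE t in lborel. t \<noteq> (1 - (\<Sum>i\<in>?J. c i)) / real (card ?J)" by (rule AE_lborel_singleton)
    then show "AE t in lborel. (\<Sum>i\<in>?J. shift (\<lambda>_. 1) t c i) \<noteq> 1"
    proof eventually_elim
      case (elim t)
      have "(\<Sum>i\<in>?J. shift (\<lambda>_. 1) t c i) = (\<Sum>i\<in>?J. c i) + real (card ?J) * t"
        by (simp add: shift_def sum.distrib)
      then show ?case using elim by (cases "?J = {}") (auto simp: field_simps)
    qed
  qed
  show ?thesis using 1 2
    by eventually_elim (auto simp: pint_def param_simplex_def less_le)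
qed

lemma AE_simplex_lebesgue:
  assumes "s \<in> cplx P"
  shows "(AE c in simplex_lebesgue s. Q c) \<longleftrightarrow> (AE c in PM s. c \<in> pint s \<longrightarrow> Q c)"
proof -
  have "(AE c in simplex_lebesgue s. Q c) \<longleftrightarrow> (AE c in PM s. c \<in> param_simplex s \<longrightarrow> Q c)"
    unfolding simplex_lebesgue_def using param_simplex_sets[OF assms] sets.sets_into_space[OF param_simplex_sets[OF assms]]
    by (subst AE_restrict_space_iff) (auto simp: AE_completion_iff Int_absorb2)
  also have "\<dots> \<longleftrightarrow> (AE c in PM s. c \<in> pint s \<longrightarrow> Q c)"
  proof
    assume "AE c in PM s. c \<in> param_simplex s \<longrightarrow> Q c"
    then show "AE c in PM s. c \<in> pint s \<longrightarrow> Q c"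
      by eventually_elim (use pint_subset in blast)
  next
    assume "AE c in PM s. c \<in> pint s \<longrightarrow> Q c"
    then show "AE c in PM s. c \<in> param_simplex s \<longrightarrow> Q c"
      using AE_pint[OF assms] by eventually_elim blast
  qed
  finally show ?thesis .
qed

lemma simplex_lebesgue_measurable: "f \<in> measurable (restrict_space (PM s) (param_simplex s)) N \<Longrightarrow> s \<in> cplx P \<Longrightarrow> f \<in> measurable (simplex_lebesgue s) N"
proof -
  assume f: "f \<in> measurable (restrict_space (PM s) (param_simplex s)) N" and s: "s \<in> cplx P"
  have "sets (restrict_space (PM s) (param_simplex s)) \<subseteq> sets (simplex_lebesgue s)"
    by (auto simp: simplex_lebesgue_def sets_restrict_space)
  moreover have "space (restrict_space (PM s) (param_simplex s)) = space (simplex_lebesgue s)"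
    by (simp add: simplex_lebesgue_def space_restrict_space)
  ultimately show ?thesis using f by (auto simp: measurable_def)
qed

lemma nn_integral_simplex_lebesgue:
  assumes "s \<in> cplx P"
  shows "(\<integral>\<^sup>+c. f c \<partial>simplex_lebesgue s) = (\<integral>\<^sup>+c. f c * indicator (pint s) c \<partial>PM s)"
proof -
  have "(\<integral>\<^sup>+c. f c \<partial>simplex_lebesgue s) = (\<integral>\<^sup>+c. f c * indicator (param_simplex s) c \<partial>PM s)"
    unfolding simplex_lebesgue_def using param_simplex_sets[OF assms] sets.sets_into_space[OF param_simplex_sets[OF assms]]
    by (subst nn_integral_restrict_space) (auto simp: nn_integral_completion Int_absorb2)
  also have "\<dots> = (\<integral>\<^sup>+c. f c * indicator (pint s) c \<partial>PM s)"
    using AE_pint[OF assms]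
    by (intro nn_integral_cong_AE, eventually_elim) (use pint_subset in \<open>auto simp: indicator_def\<close>)
  finally show ?thesis .
qed

lemma affine_map_measurable [measurable]: "affine_map s \<in> borel_measurable (PM s)"
proof -
  have "(\<lambda>c. c i *\<^sub>R frame P s i) \<in> borel_measurable (PM s)" if "i \<in> free_vertices s" for i
    using that by (intro borel_measurable_scaleR borel_measurable_const) measurable
  then show ?thesis unfolding affine_map_def[abs_def] by (intro borel_measurable_add borel_measurable_sum borel_measurable_const)
qed

lemma chart_eq_inv_coord: "s \<in> cplx P \<Longrightarrow> c \<in> param_simplex s \<Longrightarrow> chart s c = the_inv (coord P) (affine_map s c)"
  by (metis coord_chart inv_coord)

text \<open>The chart factors through the Euclidean space, as an affine map followed by the
  continuous inverse of \<open>coord P\<close>.\<close>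

lemma chart_measurable:
  assumes s: "s \<in> cplx P"
  shows "chart s \<in> measurable (restrict_space (PM s) (param_simplex s)) borel"
proof -
  have "affine_map s \<in> measurable (restrict_space (PM s) (param_simplex s)) (restrict_space borel (range (coord P)))"
  proof (rule measurable_restrict_space2)
    have "affine_map s c \<in> range (coord P)" if "c \<in> param_simplex s" for c
      using coord_chart[OF s that] by (metis rangeI)
    then show "affine_map s \<in> space (restrict_space (PM s) (param_simplex s)) \<rightarrow> range (coord P)"
      by (auto simp: space_restrict_space)
  qed (intro measurable_restrict_space1 affine_map_measurable)
  moreover have "the_inv (coord P) \<in> measurable (restrict_space borel (range (coord P))) borel"
    by (rule borel_measurable_continuous_on_restrict[OF inv_coord_continuous])
  ultimately have "(\<lambda>c. the_inv (coord P) (affine_map s c)) \<in> measurable (restrict_space (PM s) (param_simplex s)) borel"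
    by (rule measurable_compose)
  then show ?thesis
    using chart_eq_inv_coord[OF s] by (subst measurable_cong[where g="\<lambda>c. the_inv (coord P) (affine_map s c)"]) (auto simp: space_restrict_space)
qed

lemma param_measurable [measurable]: "param s \<in> measurable borel (PM s)"
  unfolding param_def[abs_def] restrict_def[symmetric]
  using borel_measurable_continuous_onI[OF bary_continuous]
  by (intro measurable_restrict) simp

definition good :: "real \<Rightarrow> 'v set \<Rightarrow> 'e \<Rightarrow> bool" where
  "good \<Lambda> s y \<longleftrightarrow> inner_product_on (tangent P s) (riem P s y) \<and>
     (\<forall>\<xi>\<in>tangent P s. (norm \<xi>)\<^sup>2 / \<Lambda>\<^sup>2 \<le> riem P s y \<xi> \<xi> \<and> riem P s y \<xi> \<xi> \<le> \<Lambda>\<^sup>2 * (norm \<xi>)\<^sup>2)"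

definition Lam :: real where
  "Lam = (SOME \<Lambda>. \<Lambda> > 0 \<and> (\<forall>s. maximal s \<longrightarrow> (AE c in simplex_lebesgue s. good \<Lambda> s (affine_map s c))))"

lemma Lam: "0 < Lam" "maximal s \<Longrightarrow> AE c in PM s. c \<in> pint s \<longrightarrow> good Lam s (affine_map s c)"
proof -
  have "\<exists>\<Lambda>>0. \<forall>s. maximal s \<longrightarrow> (AE c in simplex_lebesgue s. good \<Lambda> s (affine_map s c))"
  proof -
    obtain \<Lambda> where \<Lambda>: "\<Lambda> > 0" "\<And>s. maximal s \<Longrightarrow> AE c in simplex_lebesgue s.
        (let B = riem P s (embed P (param_point s c)) in
           inner_product_on (tangent P s) B \<and>
           (\<forall>\<xi>\<in>tangent P s. (norm \<xi>)\<^sup>2 / \<Lambda>\<^sup>2 \<le> B \<xi> \<xi> \<and> B \<xi> \<xi> \<le> \<Lambda>\<^sup>2 * (norm \<xi>)\<^sup>2))"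
      using riemannian unfolding riemannian_polyhedron_def by blast
    have "AE c in simplex_lebesgue s. good \<Lambda> s (affine_map s c)" if "maximal s" for s
      using \<Lambda>(2)[OF that] by (simp only: good_def Let_def embed_param_point[OF maximal_in[OF that]])
    with \<Lambda>(1) show ?thesis by blast
  qed
  from someI_ex[OF this, folded Lam_def]
  show "0 < Lam" "maximal s \<Longrightarrow> AE c in PM s. c \<in> pint s \<longrightarrow> good Lam s (affine_map s c)"
    by (auto simp: AE_simplex_lebesgue maximal_in)
qed

definition weight :: "'v set \<Rightarrow> ('v \<Rightarrow> real) \<Rightarrow> real" where
  "weight s c = sqrt (det_on (free_vertices s) (riem_comp P s c))"

lemma weight_measurable:
  assumes "maximal s" shows "weight s \<in> borel_measurable (simplex_lebesgue s)"
proof -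
  have m: "(\<lambda>c. riem_comp P s c i j) \<in> borel_measurable (simplex_lebesgue s)"
    if "i \<in> free_vertices s" "j \<in> free_vertices s" for i j
    using riemannian assms that by (auto simp: riemannian_polyhedron_def)
  have "(\<lambda>c. of_int (sign p) * (\<Prod>i\<in>free_vertices s. riem_comp P s c i (p i)) :: real) \<in> borel_measurable (simplex_lebesgue s)"
    if "p permutes free_vertices s" for p
    using that permutes_in_image[OF that] by (intro borel_measurable_times borel_measurable_const borel_measurable_prod m) auto
  then show ?thesis
    unfolding weight_def[abs_def] det_on_def
    by (intro measurable_compose[OF _ borel_measurable_sqrt] borel_measurable_sum) auto
qed

lemma inner_sum:
  assumes B: "inner_product_on T B" and T: "subspace T" and f: "\<And>i. i \<in> I \<Longrightarrow> f i \<in> T" and \<zeta>: "\<zeta> \<in> T"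
  shows "B (\<Sum>i\<in>I. a i *\<^sub>R f i) \<zeta> = (\<Sum>i\<in>I. a i * B (f i) \<zeta>)" "B \<zeta> (\<Sum>i\<in>I. a i *\<^sub>R f i) = (\<Sum>i\<in>I. a i * B \<zeta> (f i))"
proof -
  have z: "B 0 \<zeta> = 0" using B \<zeta> subspace_0[OF T] unfolding inner_product_on_def by (metis mult_zero_left scale_zero_left)
  have mem: "(\<Sum>i\<in>K. a i *\<^sub>R f i) \<in> T" if "K \<subseteq> I" for K
    using that f T by (intro subspace_sum subspace_scale) auto
  have "finite K \<Longrightarrow> K \<subseteq> I \<Longrightarrow> B (\<Sum>i\<in>K. a i *\<^sub>R f i) \<zeta> = (\<Sum>i\<in>K. a i * B (f i) \<zeta>)" for K
  proof (induction K rule: finite_induct)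
    case (insert k K)
    have "B (a k *\<^sub>R f k + (\<Sum>i\<in>K. a i *\<^sub>R f i)) \<zeta> = B (a k *\<^sub>R f k) \<zeta> + B (\<Sum>i\<in>K. a i *\<^sub>R f i) \<zeta>"
      using B insert.prems mem[of K] f \<zeta> subspace_scale[OF T] by (auto simp: inner_product_on_def)
    moreover have "B (a k *\<^sub>R f k) \<zeta> = a k * B (f k) \<zeta>"
      using B insert.prems f \<zeta> by (auto simp: inner_product_on_def)
    ultimately show ?case using insert by simp
  qed (simp add: z)
  then show 1: "B (\<Sum>i\<in>I. a i *\<^sub>R f i) \<zeta> = (\<Sum>i\<in>I. a i * B (f i) \<zeta>)"
    by (cases "finite I") (auto simp: z)
  have sym: "B \<zeta> \<eta> = B \<eta> \<zeta>" if "\<eta> \<in> T" for \<eta> using B \<zeta> that by (auto simp: inner_product_on_def)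
  show "B \<zeta> (\<Sum>i\<in>I. a i *\<^sub>R f i) = (\<Sum>i\<in>I. a i * B \<zeta> (f i))"
    unfolding sym[OF mem[OF order_refl]] 1 using f by (intro sum.cong refl) (simp add: sym)
qed

text \<open>Ellipticity of g refers to the Euclidean norm, while the determinant is taken in the
  frame of s. The dual functionals bound the coefficients of a vector by its norm, so the matrix of
  g in the frame is uniformly positive; \<open>\<kappa>\<close> depends on the shape of s.\<close>

lemma weight_lower:
  assumes s: "s \<in> cplx P"
  obtains \<kappa> where "0 < \<kappa>" "\<And>c. good Lam s (affine_map s c) \<Longrightarrow> \<kappa> \<le> weight s c"
proof -
  let ?J = "free_vertices s"
  have "\<exists>K. \<forall>i\<in>?J. \<forall>x. \<bar>dual s i x\<bar> \<le> K i * norm x"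
  proof -
    have "\<forall>i\<in>?J. \<exists>K. \<forall>x. \<bar>dual s i x\<bar> \<le> K * norm x"
      using bounded_linear.bounded[OF dual_bounded_linear[OF s]] by (auto simp: mult.commute)
    then show ?thesis by metis
  qed
  then obtain K where K: "\<And>i x. i \<in> ?J \<Longrightarrow> \<bar>dual s i x\<bar> \<le> K i * norm x" by blast
  define m where "m = (\<Sum>i\<in>?J. (K i)\<^sup>2) + 1"
  have m: "0 < m" by (simp add: m_def sum_nonneg add_nonneg_pos)
  \<comment> \<open>Two comparisons are combined: m passes from coefficients to the Euclidean norm
    and \<open>Lam\<^sup>2\<close> from there to g. The 1 in m keeps it positive when there are no
    free vertices.\<close>
  define l where "l = 1 / (m * Lam\<^sup>2)"
  have l: "0 < l" using m Lam(1) by (simp add: l_def)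
  have "sqrt (l ^ card ?J) \<le> weight s c" if g: "good Lam s (affine_map s c)" for c
    unfolding weight_def
  proof (rule real_sqrt_le_mono, rule det_on_lower_bound[OF free_finite[OF s] l])
    let ?B = "riem P s (affine_map s c)"
    have B: "inner_product_on (tangent P s) ?B" using g by (simp add: good_def)
    have fr: "frame P s i \<in> tangent P s" if "i \<in> ?J" for i
      using that frame_tangent[OF s] by (simp add: free_vertices_def)
    have rc: "riem_comp P s c i j = ?B (frame P s i) (frame P s j)" for i j
      by (simp add: riem_comp_def embed_param_point[OF s])
    show "riem_comp P s c i j = riem_comp P s c j i" if "i \<in> ?J" "j \<in> ?J" for i j
      unfolding rc using B fr that by (auto simp: inner_product_on_def)
    fix x :: "'v \<Rightarrow> real"
    let ?\<xi> = "\<Sum>i\<in>?J. x i *\<^sub>R frame P s i"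
    have \<xi>: "?\<xi> \<in> tangent P s" by (rule sum_frame_tangent[OF s])
    have "(\<Sum>i\<in>?J. (x i)\<^sup>2) \<le> (\<Sum>i\<in>?J. (K i)\<^sup>2 * (norm ?\<xi>)\<^sup>2)"
    proof (rule sum_mono)
      fix i assume i: "i \<in> ?J"
      have "\<bar>x i\<bar> \<le> K i * norm ?\<xi>" using K[OF i, of ?\<xi>] by (simp add: dual_sum[OF s i])
      then have "\<bar>x i\<bar>\<^sup>2 \<le> (K i * norm ?\<xi>)\<^sup>2" by (rule power_mono) simp
      then show "(x i)\<^sup>2 \<le> (K i)\<^sup>2 * (norm ?\<xi>)\<^sup>2" by (simp add: power_mult_distrib)
    qed
    also have "\<dots> \<le> m * (norm ?\<xi>)\<^sup>2" by (simp add: m_def sum_distrib_right distrib_right)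
    finally have "l * (\<Sum>i\<in>?J. (x i)\<^sup>2) \<le> l * (m * (norm ?\<xi>)\<^sup>2)" using l by (intro mult_left_mono) auto
    also have "\<dots> = (norm ?\<xi>)\<^sup>2 / Lam\<^sup>2" using m by (simp add: l_def)
    also have "\<dots> \<le> ?B ?\<xi> ?\<xi>" using g \<xi> by (simp add: good_def)
    also have "?B ?\<xi> ?\<xi> = (\<Sum>i\<in>?J. x i * ?B (frame P s i) ?\<xi>)"
      by (rule inner_sum(1)[OF B tangent_subspace fr \<xi>])
    also have "\<dots> = (\<Sum>i\<in>?J. \<Sum>j\<in>?J. riem_comp P s c i j * x i * x j)"
      unfolding rc sum_distrib_left
      by (intro sum.cong refl, subst inner_sum(2)[OF B tangent_subspace fr]) (auto simp: fr sum_distrib_left ac_simps)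
    finally show "l * (\<Sum>i\<in>?J. (x i)\<^sup>2) \<le> (\<Sum>i\<in>?J. \<Sum>j\<in>?J. riem_comp P s c i j * x i * x j)" .
  qed
  moreover have "0 < sqrt (l ^ card ?J)" using l by simp
  ultimately show thesis using that by blast
qed

definition vol0 :: "'x measure" where
  "vol0 = measure_of UNIV (sets borel)
     (\<lambda>A. \<integral>\<^sup>+ s. emeasure (simplex_volume P s) A \<partial>count_space (maximal_simplices (cplx P)))"

lemma vol_eq: "vol P = completion vol0"
  by (simp add: vol_def vol0_def)

lemma sets_vol0 [simp, measurable_cong]: "sets vol0 = sets borel"
  by (simp add: vol0_def) (metis sets.sigma_sets_eq space_borel)

lemma space_vol0 [simp]: "space vol0 = UNIV"
  using sets_eq_imp_space_eq[OF sets_vol0] by simp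

lemma sets_simplex_volume [simp]: "sets (simplex_volume P s) = sets borel"
  by (simp add: simplex_volume_def)

lemma emeasure_vol0:
  assumes "A \<in> sets borel"
  shows "emeasure vol0 A = (\<integral>\<^sup>+ s. emeasure (simplex_volume P s) A \<partial>count_space (maximal_simplices (cplx P)))"
  unfolding vol0_def
proof (rule emeasure_measure_of_sigma)
  show "sigma_algebra UNIV (sets borel)" using sets.sigma_algebra_axioms[of borel] by simp
  show "countably_additive (sets borel) (\<lambda>A. \<integral>\<^sup>+ s. emeasure (simplex_volume P s) A \<partial>count_space (maximal_simplices (cplx P)))"
    unfolding countably_additive_def
    by (intro allI impI) (subst nn_integral_suminf[symmetric], auto intro!: nn_integral_cong suminf_emeasure)
qed (use assms in \<open>auto simp: positive_def\<close>)

lemma nn_integral_simplex_volume: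
  assumes s: "maximal s" and F: "F \<in> borel_measurable borel"
  shows "(\<integral>\<^sup>+x. F x \<partial>simplex_volume P s) = (\<integral>\<^sup>+c. ennreal (weight s c) * F (chart s c) * indicator (pint s) c \<partial>PM s)"
proof -
  have sK: "s \<in> cplx P" using s maximal_in by blast
  have ch: "chart s \<in> measurable (simplex_lebesgue s) borel"
    by (rule simplex_lebesgue_measurable[OF chart_measurable[OF sK] sK])
  have w: "(\<lambda>c. ennreal (weight s c)) \<in> borel_measurable (simplex_lebesgue s)"
    using weight_measurable[OF s] by simp
  have "(\<integral>\<^sup>+x. F x \<partial>simplex_volume P s) = (\<integral>\<^sup>+c. F (chart s c) \<partial>density (simplex_lebesgue s) (\<lambda>c. ennreal (weight s c)))"
    unfolding simplex_volume_def weight_def[symmetric] chart_def[symmetric]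
    using ch F by (intro nn_integral_distr) auto
  also have "\<dots> = (\<integral>\<^sup>+c. ennreal (weight s c) * F (chart s c) \<partial>simplex_lebesgue s)"
    using w measurable_compose[OF ch F] by (intro nn_integral_density) auto
  finally show ?thesis by (simp add: nn_integral_simplex_lebesgue[OF sK])
qed

lemma simplex_volume_le:
  assumes s: "maximal s" shows "simplex_volume P s \<le> vol0"
proof -
  have "emeasure (simplex_volume P s) A \<le> emeasure vol0 A" if "A \<in> sets borel" for A
  proof -
    have "emeasure (simplex_volume P s) A = (\<integral>\<^sup>+t. emeasure (simplex_volume P t) A \<partial>count_space {s})"
      by (simp add: nn_integral_count_space_finite)
    also have "\<dots> \<le> (\<integral>\<^sup>+t. emeasure (simplex_volume P t) A \<partial>count_space (maximal_simplices (cplx P)))"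
    proof -
      have "(\<integral>\<^sup>+t. emeasure (simplex_volume P t) A \<partial>count_space {s}) = (\<integral>\<^sup>+t. emeasure (simplex_volume P t) A * indicator {s} t \<partial>count_space (maximal_simplices (cplx P)))"
        using s by (subst nn_integral_count_space_indicator, simp, subst nn_integral_count_space_indicator, simp)
          (auto intro!: nn_integral_cong simp: indicator_def)
      also have "\<dots> \<le> (\<integral>\<^sup>+t. emeasure (simplex_volume P t) A \<partial>count_space (maximal_simplices (cplx P)))"
        by (intro nn_integral_mono) (auto simp: indicator_def)
      finally show ?thesis .
    qed
    finally show ?thesis using that by (simp add: emeasure_vol0)
  qed
  moreover have "emeasure (simplex_volume P s) A = 0" if "A \<notin> sets borel" for A
    using that by (simp add: emeasure_notin_sets)
  ultimately show ?thesis
    by (auto simp: le_measure_iff le_fun_def dest: sets_eq_imp_space_eq) (metis zero_le)+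
qed

text \<open>The bound on the density in this direction carries null sets and convergence of
  integrals from the volume measure to Lebesgue measure in the parameters; see
  \<open>AE_chart\<close> and \<open>nn_integral_push\<close>.\<close>

lemma nn_integral_vol_lower:
  assumes s: "maximal s"
  obtains \<kappa> :: real where "0 < \<kappa>" "\<And>F. F \<in> borel_measurable borel \<Longrightarrow>
    ennreal \<kappa> * (\<integral>\<^sup>+c. F (chart s c) * indicator (pint s) c \<partial>PM s) \<le> (\<integral>\<^sup>+x. F x \<partial>vol P)"
proof -
  have sK: "s \<in> cplx P" using s maximal_in by blast
  obtain \<kappa> where \<kappa>: "0 < \<kappa>" "\<And>c. good Lam s (affine_map s c) \<Longrightarrow> \<kappa> \<le> weight s c"
    using weight_lower[OF sK] by blast
  have "ennreal \<kappa> * (\<integral>\<^sup>+c. F (chart s c) * indicator (pint s) c \<partial>PM s) \<le> (\<integral>\<^sup>+x. F x \<partial>vol P)"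
    if F: "F \<in> borel_measurable borel" for F
  proof -
    have Fm: "(\<lambda>c. F (chart s c) * indicator (pint s) c) \<in> borel_measurable (PM s)"
    proof -
      have "(\<lambda>c. F (chart s c)) \<in> borel_measurable (restrict_space (PM s) (param_simplex s))"
        by (rule measurable_compose[OF chart_measurable[OF sK] F])
      then have "(\<lambda>c. F (chart s c) * indicator (param_simplex s) c) \<in> borel_measurable (PM s)"
        using param_simplex_sets[OF sK] by (subst (asm) borel_measurable_restrict_space_iff_ennreal) auto
      then have "(\<lambda>c. (F (chart s c) * indicator (param_simplex s) c) * indicator (pint s) c) \<in> borel_measurable (PM s)"
        using pint_sets[OF sK] by measurable
      also have "(\<lambda>c. (F (chart s c) * indicator (param_simplex s) c) * indicator (pint s) c) = (\<lambda>c. F (chart s c) * indicator (pint s) c)"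
        using pint_subset[of s] by (auto simp: indicator_def fun_eq_iff)
      finally show ?thesis .
    qed
    have "ennreal \<kappa> * (\<integral>\<^sup>+c. F (chart s c) * indicator (pint s) c \<partial>PM s) = (\<integral>\<^sup>+c. ennreal \<kappa> * (F (chart s c) * indicator (pint s) c) \<partial>PM s)"
      by (rule nn_integral_cmult[OF Fm, symmetric])
    also have "\<dots> \<le> (\<integral>\<^sup>+c. ennreal (weight s c) * F (chart s c) * indicator (pint s) c \<partial>PM s)"
    proof (rule nn_integral_mono_AE)
      show "AE c in PM s. ennreal \<kappa> * (F (chart s c) * indicator (pint s) c) \<le> ennreal (weight s c) * F (chart s c) * indicator (pint s) c"
        using Lam(2)[OF s]
        by eventually_elim (use \<kappa> in \<open>auto simp: indicator_def intro!: mult_right_mono ennreal_leI\<close>)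
    qed
    also have "\<dots> = (\<integral>\<^sup>+x. F x \<partial>simplex_volume P s)" by (rule nn_integral_simplex_volume[OF s F, symmetric])
    also have "\<dots> \<le> (\<integral>\<^sup>+x. F x \<partial>vol0)" by (intro nn_integral_mono_measure simplex_volume_le s) simp
    finally show ?thesis by (simp add: vol_eq nn_integral_completion)
  qed
  with \<kappa>(1) show thesis using that by blast
qed

lemma AE_chart:
  assumes s: "maximal s" and Q: "AE x in vol P. Q x"
  shows "AE c in PM s. c \<in> pint s \<longrightarrow> Q (chart s c)"
proof -
  have sK: "s \<in> cplx P" using s maximal_in by blast
  from Q have "AE x in vol0. Q x" unfolding vol_eq AE_completion_iff .
  then obtain N where N: "N \<in> sets borel" "emeasure vol0 N = 0" "\<And>x. x \<notin> N \<Longrightarrow> Q x"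
    by (auto elim!: AE_E simp: subset_eq) (metis)
  obtain \<kappa> :: real where \<kappa>: "0 < \<kappa>" "\<And>F. F \<in> borel_measurable borel \<Longrightarrow>
    ennreal \<kappa> * (\<integral>\<^sup>+c. F (chart s c) * indicator (pint s) c \<partial>PM s) \<le> (\<integral>\<^sup>+x. F x \<partial>vol P)"
    using nn_integral_vol_lower[OF s] by blast
  have "ennreal \<kappa> * (\<integral>\<^sup>+c. indicator N (chart s c) * indicator (pint s) c \<partial>PM s) \<le> (\<integral>\<^sup>+x. indicator N x \<partial>vol P)"
    using N by (intro \<kappa>(2)) auto
  also have "\<dots> = 0" using N by (simp add: vol_eq nn_integral_completion)
  finally have z: "(\<integral>\<^sup>+c. indicator N (chart s c) * indicator (pint s) c \<partial>PM s) = 0"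
    using \<kappa>(1) by simp
  have "(\<lambda>c. indicator N (chart s c) :: ennreal) \<in> borel_measurable (restrict_space (PM s) (param_simplex s))"
    using N(1) by (intro measurable_compose[OF chart_measurable[OF sK]]) auto
  then have "(\<lambda>c. indicator N (chart s c) * indicator (param_simplex s) c :: ennreal) \<in> borel_measurable (PM s)"
    using param_simplex_sets[OF sK] by (subst (asm) borel_measurable_restrict_space_iff_ennreal) auto
  then have "(\<lambda>c. (indicator N (chart s c) * indicator (param_simplex s) c) * indicator (pint s) c :: ennreal) \<in> borel_measurable (PM s)"
    using pint_sets[OF sK] by measurable
  also have "(\<lambda>c. (indicator N (chart s c) * indicator (param_simplex s) c) * indicator (pint s) c :: ennreal) = (\<lambda>c. indicator N (chart s c) * indicator (pint s) c)"
    using pint_subset[of s] by (auto simp: indicator_def fun_eq_iff)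
  finally have "AE c in PM s. (indicator N (chart s c) * indicator (pint s) c :: ennreal) = 0"
    using z by (subst (asm) nn_integral_0_iff_AE) auto
  then show ?thesis
    by eventually_elim (auto simp: indicator_def N(3) split: if_splits)
qed

text \<open>The converse transfer: a Lebesgue null set stays null under any density, so no
  ellipticity enters. The conclusion also records that almost every point lies in an open maximal
  simplex.\<close>

lemma AE_volI:
  assumes Q: "\<And>s. maximal s \<Longrightarrow> AE c in PM s. c \<in> pint s \<longrightarrow> Q (chart s c)"
  shows "AE x in vol P. (\<exists>s. maximal s \<and> x \<in> inter s) \<and> Q x"
proof -
  have "\<exists>N. N \<in> null_sets (PM s) \<and> (\<forall>c\<in>pint s. c \<notin> N \<longrightarrow> Q (chart s c))" if s: "maximal s" for s
  proof -
    from Q[OF s] obtain N where "N \<in> null_sets (PM s)" "{c \<in> space (PM s). \<not> (c \<in> pint s \<longrightarrow> Q (chart s c))} \<subseteq> N"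
      by (auto simp: eventually_ae_filter)
    moreover have "pint s \<subseteq> space (PM s)" by (auto simp: pint_def space_PM)
    ultimately show ?thesis by blast
  qed
  then obtain N where N: "\<And>s. maximal s \<Longrightarrow> N s \<in> null_sets (PM s)" "\<And>s c. maximal s \<Longrightarrow> c \<in> pint s \<Longrightarrow> c \<notin> N s \<Longrightarrow> Q (chart s c)"
    by metis
  have cnt: "countable (maximal_simplices (cplx P))"
    using simplicial(2) by (rule countable_subset[rotated]) (auto simp: maximal_simplices_def)
  let ?I = "\<Union>s\<in>maximal_simplices (cplx P). inter s"
  \<comment> \<open>Z collects the points outside all open maximal simplices and the images of the
    exceptional sets. Writing these images as preimages under \<open>param s\<close> makes Z a Borel
    set.\<close>
  define Z where "Z = - ?I \<union> (\<Union>s\<in>maximal_simplices (cplx P). inter s \<inter> (param s -` N s))"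
  have Ns: "N s \<in> sets (PM s)" if "maximal s" for s using N(1)[OF that] by auto
  have "param s -` N s \<in> sets borel" if "maximal s" for s
    using measurable_sets[OF param_measurable Ns[OF that]] by simp
  then have Zb: "Z \<in> sets borel"
    unfolding Z_def using cnt inter_open
    by (intro sets.Un sets.countable_UN' sets.Int borel_open borel_closed closed_Compl open_UN) auto
  have "emeasure (simplex_volume P s) Z = 0" if s: "maximal s" for s
  proof -
    have sK: "s \<in> cplx P" using s maximal_in by blast
    have "emeasure (simplex_volume P s) Z = (\<integral>\<^sup>+x. indicator Z x \<partial>simplex_volume P s)" using Zb by simp
    also have "\<dots> = (\<integral>\<^sup>+c. ennreal (weight s c) * indicator Z (chart s c) * indicator (pint s) c \<partial>PM s)"
      using Zb by (intro nn_integral_simplex_volume s) auto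
    also have "\<dots> = (\<integral>\<^sup>+c. 0 \<partial>PM s)"
    proof (rule nn_integral_cong_AE)
      show "AE c in PM s. ennreal (weight s c) * indicator Z (chart s c) * indicator (pint s) c = 0"
        using AE_not_in[OF N(1)[OF s]]
      proof eventually_elim
        case (elim c)
        show ?case
        proof (cases "c \<in> pint s")
          case True
          have ch: "chart s c \<in> inter s" by (rule chart_pint[OF sK True])
          have "param s (chart s c) = c" using True pint_subset by (intro param_chart[OF sK]) auto
          moreover have "t = s" if "chart s c \<in> inter t" for t using that ch by (simp add: inter_def)
          ultimately have "chart s c \<notin> Z" using ch s elim unfolding Z_def by auto metis
          then show ?thesis by simp
        qed simp
      qed
    qed
    finally show ?thesis by simp
  qed
  then have "emeasure vol0 Z = 0"
    using Zb by (subst emeasure_vol0) (auto simp: nn_integral_0_iff_AE AE_count_space)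
  then have "AE x in vol0. x \<notin> Z" using Zb by (intro AE_not_in) (auto simp: null_sets_def)
  then have "AE x in vol0. (\<exists>s. maximal s \<and> x \<in> inter s) \<and> Q x"
  proof eventually_elim
    case (elim x)
    then obtain s where s: "maximal s" "x \<in> inter s" by (auto simp: Z_def)
    have sK: "s \<in> cplx P" using s maximal_in by blast
    have "Q (chart s (param s x))"
      using elim s param_pint[OF sK s(2)] by (intro N(2)[OF s(1)]) (auto simp: Z_def)
    then show ?case using s chart_param[OF sK inter_closed[OF s(2)]] by auto
  qed
  then show ?thesis unfolding vol_eq AE_completion_iff .
qed

end

section \<open>The intrinsic distance\<close>

text \<open>Pairs closer than \<open>\<delta>\<close> lie together in one of finitely many balls
  with a local constant, because the covering uses half the radii. For all other pairs boundedness
  of the image gives the constant \<open>2 * B / \<delta>\<close>.\<close>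

lemma locally_lipschitz_compact:
  fixes F :: "'a::metric_space \<Rightarrow> 'b::metric_space"
  assumes F: "locally_lipschitz S dist dist F" and S: "compact S"
  obtains L where "L-lipschitz_on S F"
proof (cases "S = {}")
  case True
  then show thesis using that[of 0] by simp
next
  case False
  have "\<forall>x\<in>S. \<exists>r L. 0 < r \<and> (\<forall>y\<in>S. \<forall>z\<in>S. dist x y < r \<and> dist x z < r \<longrightarrow> dist (F y) (F z) \<le> L * dist y z)"
    using F unfolding locally_lipschitz_def by meson
  then obtain r L where r: "\<And>x. x \<in> S \<Longrightarrow> 0 < r x"
    and L: "\<And>x y z. x \<in> S \<Longrightarrow> y \<in> S \<Longrightarrow> z \<in> S \<Longrightarrow> dist x y < r x \<Longrightarrow> dist x z < r x \<Longrightarrow> dist (F y) (F z) \<le> L x * dist y z"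
    by metis
  have "S \<subseteq> (\<Union>x\<in>S. ball x (r x / 2))" using r by force
  then obtain D where D: "D \<subseteq> S" "finite D" "S \<subseteq> (\<Union>x\<in>D. ball x (r x / 2))"
    using compactE_image[OF S, of S "\<lambda>x. ball x (r x / 2)"] by auto
  then have "D \<noteq> {}" using False by auto
  define \<delta> where "\<delta> = Min ((\<lambda>x. r x / 2) ` D)"
  have \<delta>: "0 < \<delta>" using D \<open>D \<noteq> {}\<close> r by (auto simp: \<delta>_def)
  have \<delta>_le: "\<delta> \<le> r x / 2" if "x \<in> D" for x
    unfolding \<delta>_def using D that by (intro Min_le) auto
  define M where "M = (\<Sum>x\<in>D. \<bar>L x\<bar>)"
  have M: "0 \<le> M" "\<And>x. x \<in> D \<Longrightarrow> L x \<le> M"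
    using D member_le_sum[of _ D "\<lambda>x. \<bar>L x\<bar>"] by (auto simp: M_def sum_nonneg intro: order_trans[OF abs_ge_self])
  have "bounded (F ` S)"
    using compact_continuous_image[OF locally_lipschitz_continuous_on[OF F] S] by (rule compact_imp_bounded)
  then obtain a B where B: "\<And>x. x \<in> S \<Longrightarrow> dist a (F x) \<le> B" by (auto simp: bounded_def)
  have B0: "0 \<le> B" using B False by (meson ex_in_conv zero_le_dist order_trans)
  have "(M + 2 * B / \<delta>)-lipschitz_on S F"
  proof (rule lipschitz_onI)
    fix y z assume yz: "y \<in> S" "z \<in> S"
    show "dist (F y) (F z) \<le> (M + 2 * B / \<delta>) * dist y z"
    proof (cases "dist y z < \<delta>")
      case True
      obtain x where x: "x \<in> D" "dist x y < r x / 2" using D yz by auto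
      have "dist x z \<le> dist x y + dist y z" by (rule dist_triangle)
      then have z: "dist x z < r x" using x True \<delta>_le[OF x(1)] by simp
      have xS: "x \<in> S" using x D by auto
      have "dist (F y) (F z) \<le> L x * dist y z"
        by (rule L[OF xS yz _ z]) (use x r[OF xS] in simp)
      also have "\<dots> \<le> (M + 2 * B / \<delta>) * dist y z"
        using M(2)[OF x(1)] B0 \<delta> by (intro mult_right_mono) (auto intro: add_increasing2)
      finally show ?thesis .
    next
      case False
      have "dist (F y) (F z) \<le> 2 * B" using B[OF yz(1)] B[OF yz(2)] dist_triangle3[of "F y" "F z" a] by simp
      also have "\<dots> = 2 * B / \<delta> * \<delta>" using \<delta> by simp
      also have "\<dots> \<le> 2 * B / \<delta> * dist y z" using False B0 \<delta> by (intro mult_left_mono) auto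
      also have "\<dots> \<le> (M + 2 * B / \<delta>) * dist y z" using M by (intro mult_right_mono) auto
      finally show ?thesis .
    qed
  qed (use M B0 \<delta> in auto)
  then show thesis by (rule that)
qed

lemma lipschitz_imp_locally_lipschitz:
  "L-lipschitz_on S F \<Longrightarrow> locally_lipschitz S dist dist F"
  unfolding locally_lipschitz_def by (meson lipschitz_onD zero_less_one)

context riem_polyhedron
begin

definition regular :: "'x \<Rightarrow> bool" where
  "regular x \<longleftrightarrow> (\<exists>s. maximal s \<and> x \<in> inter s \<and> good Lam s (coord P x))"

lemma AE_regular: "AE x in vol P. regular x"
proof -
  have "AE x in vol P. (\<exists>s. maximal s \<and> x \<in> inter s) \<and> (\<forall>s. maximal s \<longrightarrow> x \<in> inter s \<longrightarrow> good Lam s (coord P x))"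
  proof (rule AE_volI)
    fix s assume s: "maximal s"
    have sK: "s \<in> cplx P" using s maximal_in by blast
    show "AE c in PM s. c \<in> pint s \<longrightarrow> (\<forall>t. maximal t \<longrightarrow> chart s c \<in> inter t \<longrightarrow> good Lam t (coord P (chart s c)))"
      using Lam(2)[OF s]
    proof eventually_elim
      case (elim c)
      show ?case
      proof (intro impI allI)
        fix t assume c: "c \<in> pint s" and t: "chart s c \<in> inter t"
        have "chart s c \<in> inter s" by (rule chart_pint[OF sK c])
        then have "t = s" using t by (simp add: inter_def)
        moreover have "c \<in> param_simplex s" using c pint_subset by blast
        ultimately show "good Lam t (coord P (chart s c))" using elim c by (simp add: coord_chart[OF sK])
      qed
    qed
  qed
  then show ?thesis by eventually_elim (auto simp: regular_def)
qed

lemma gnorm_bounds: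
  assumes "good Lam s (coord P x)" "x \<in> inter s" "\<xi> \<in> tangent P s"
  shows "norm \<xi> \<le> Lam * gnorm P x \<xi>" "gnorm P x \<xi> \<le> Lam * norm \<xi>"
proof -
  have g: "ginner P x \<xi> \<xi> = riem P s (coord P x) \<xi> \<xi>" using assms(2) by (simp add: ginner_def inter_def)
  have b: "(norm \<xi>)\<^sup>2 / Lam\<^sup>2 \<le> ginner P x \<xi> \<xi>" "ginner P x \<xi> \<xi> \<le> Lam\<^sup>2 * (norm \<xi>)\<^sup>2"
    using assms by (auto simp: g good_def)
  have "sqrt ((norm \<xi>)\<^sup>2 / Lam\<^sup>2) \<le> gnorm P x \<xi>" unfolding gnorm_def using b(1) by (rule real_sqrt_le_mono)
  then show "norm \<xi> \<le> Lam * gnorm P x \<xi>" using Lam(1) by (simp add: real_sqrt_divide field_simps)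
  have "gnorm P x \<xi> \<le> sqrt (Lam\<^sup>2 * (norm \<xi>)\<^sup>2)" unfolding gnorm_def using b(2) by (rule real_sqrt_le_mono)
  then show "gnorm P x \<xi> \<le> Lam * norm \<xi>" using Lam(1) by (simp add: real_sqrt_mult)
qed

lemma coord_diff_tangent:
  assumes "s \<in> cplx P" "x \<in> closed_simplex P s" "y \<in> closed_simplex P s"
  shows "coord P x - coord P y \<in> tangent P s"
proof -
  have "coord P x - coord P y = (\<Sum>i\<in>free_vertices s. (param s x i - param s y i) *\<^sub>R frame P s i)"
    by (simp add: coord_affine[OF assms(1,2)] coord_affine[OF assms(1,3)] affine_map_def scaleR_diff_left sum_subtractf)
  then show ?thesis using sum_frame_tangent[OF assms(1)] by simp
qed

lemma path_coord_lipschitz: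
  assumes "L-lipschitz_on {0..1::real} \<gamma>"
  obtains L' where "L'-lipschitz_on {0..1} (\<lambda>t. coord P (\<gamma> t))"
proof -
  have "locally_lipschitz {0..1} dist dist (\<lambda>t. coord P (\<gamma> t))"
    by (rule locally_lipschitz_compose[OF lipschitz_imp_locally_lipschitz[OF assms] coord_lip]) auto
  then show thesis using locally_lipschitz_compact[of "{0..1::real}"] that by (metis compact_Icc)
qed

text \<open>Near time t the path stays in the open simplex, so its difference quotients lie in the
  tangent space, which is closed and therefore contains their limit.\<close>

lemma path_derivative_tangent:
  assumes s: "maximal s" and \<gamma>: "continuous_on {0..1::real} \<gamma>" and t: "0 < t" "t < 1" "\<gamma> t \<in> inter s"
    and D: "((\<lambda>t. coord P (\<gamma> t)) has_vector_derivative v) (at t)"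
  shows "v \<in> tangent P s"
proof -
  have sK: "s \<in> cplx P" using s maximal_in by blast
  have "isCont \<gamma> t" using \<gamma> t continuous_on_interior[of "{0..1}" \<gamma> t] by (simp add: interior_atLeastAtMost_real)
  then have ev: "eventually (\<lambda>\<tau>. \<gamma> \<tau> \<in> inter s) (at t)"
    using inter_open[OF s] t(3) by (simp add: continuous_within tendsto_def)
  have lim: "((\<lambda>\<tau>. (1 / (\<tau> - t)) *\<^sub>R (coord P (\<gamma> \<tau>) - coord P (\<gamma> t))) \<longlongrightarrow> v) (at t)"
  proof (rule LIM_zero_cancel, rule tendsto_norm_zero_cancel)
    have "((\<lambda>\<tau>. norm (coord P (\<gamma> \<tau>) - coord P (\<gamma> t) - (\<tau> - t) *\<^sub>R v) / norm (\<tau> - t)) \<longlongrightarrow> 0) (at t)"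
      using D unfolding has_vector_derivative_def has_derivative_iff_norm by simp
    moreover have "\<forall>\<^sub>F \<tau> in at t. norm (coord P (\<gamma> \<tau>) - coord P (\<gamma> t) - (\<tau> - t) *\<^sub>R v) / norm (\<tau> - t) =
        norm ((1 / (\<tau> - t)) *\<^sub>R (coord P (\<gamma> \<tau>) - coord P (\<gamma> t)) - v)"
      unfolding eventually_at_filter
    proof (intro always_eventually allI impI)
      fix \<tau> assume "\<tau> \<noteq> t"
      then have "(1 / (\<tau> - t)) *\<^sub>R (coord P (\<gamma> \<tau>) - coord P (\<gamma> t)) - v = (1 / (\<tau> - t)) *\<^sub>R (coord P (\<gamma> \<tau>) - coord P (\<gamma> t) - (\<tau> - t) *\<^sub>R v)"
        by (simp add: scaleR_diff_right)
      then show "norm (coord P (\<gamma> \<tau>) - coord P (\<gamma> t) - (\<tau> - t) *\<^sub>R v) / norm (\<tau> - t) =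
        norm ((1 / (\<tau> - t)) *\<^sub>R (coord P (\<gamma> \<tau>) - coord P (\<gamma> t)) - v)"
        by (simp add: divide_inverse mult.commute)
    qed
    ultimately show "((\<lambda>\<tau>. norm ((1 / (\<tau> - t)) *\<^sub>R (coord P (\<gamma> \<tau>) - coord P (\<gamma> t)) - v)) \<longlongrightarrow> 0) (at t)"
      by (simp add: tendsto_cong)
  qed
  show ?thesis
  proof (rule Lim_in_closed_set[OF closed_subspace[OF tangent_subspace] _ _ lim])
    show "eventually (\<lambda>\<tau>. (1 / (\<tau> - t)) *\<^sub>R (coord P (\<gamma> \<tau>) - coord P (\<gamma> t)) \<in> tangent P s) (at t)"
      using ev by eventually_elim
        (intro subspace_scale tangent_subspace coord_diff_tangent sK inter_closed t(3))
  qed simp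
qed

text \<open>The bound \<open>Lam\<close> compares the two metrics only off a null set, which is why the paths have to avoid \<open>N\<close>.\<close>

lemma glength_lower:
  assumes N: "N \<in> null_sets (vol P)" "\<And>x. x \<notin> N \<Longrightarrow> regular x" and \<gamma>: "\<gamma> \<in> lipschitz_paths N x y"
  shows "ennreal (dist (coord P x) (coord P y) / Lam) \<le> glength P \<gamma>"
proof -
  obtain L where L: "L-lipschitz_on {0..1} \<gamma>" and ends: "\<gamma> 0 = x" "\<gamma> 1 = y"
    and null: "{t \<in> {0..1}. \<gamma> t \<in> N} \<in> null_sets lebesgue"
    using \<gamma> by (auto simp: lipschitz_paths_def)
  define c where "c t = coord P (\<gamma> t)" for t
  obtain L' where L': "L'-lipschitz_on {0..1} c" using path_coord_lipschitz[OF L] by (auto simp: c_def[abs_def])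
  \<comment> \<open>Clamping the parameter extends the path beyond the unit interval, and the inner
    product makes it scalar; \<open>lipschitz_AE_derivative\<close> is for real functions on the
    line.\<close>
  define f where "f u t = inner u (c (max 0 (min 1 t)))" for u :: 'e and t :: real
  have fL: "(norm u * L')-lipschitz_on UNIV (f u)" for u
  proof (rule lipschitz_onI)
    fix s t :: real
    have "dist (c (max 0 (min 1 s))) (c (max 0 (min 1 t))) \<le> L' * dist (max 0 (min 1 s)) (max 0 (min 1 t))"
      by (rule lipschitz_onD[OF L']) auto
    also have "\<dots> \<le> L' * dist s t"
      using lipschitz_on_nonneg[OF L'] by (intro mult_left_mono) (auto simp: dist_real_def max_def min_def)
    finally have "norm u * norm (c (max 0 (min 1 s)) - c (max 0 (min 1 t))) \<le> norm u * (L' * dist s t)"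
      by (intro mult_left_mono) (auto simp: dist_norm)
    moreover have "dist (f u s) (f u t) \<le> norm u * norm (c (max 0 (min 1 s)) - c (max 0 (min 1 t)))"
      unfolding f_def dist_real_def inner_diff_right[symmetric] by (rule Cauchy_Schwarz_ineq2)
    ultimately show "dist (f u s) (f u t) \<le> norm u * L' * dist s t" by (simp add: mult.assoc)
  qed (use lipschitz_on_nonneg[OF L'] in simp)
  obtain h where h: "\<And>b. AE t in lborel. (f b has_real_derivative h b t) (at t)"
  proof -
    have "\<forall>b. \<exists>h. AE t in lborel. (f b has_real_derivative h t) (at t)"
    proof
      fix b
      obtain h where "AE t in lborel. (f b has_real_derivative h t) (at t)"
        by (rule lipschitz_AE_derivative[OF fL[of b]])
      then show "\<exists>h. AE t in lborel. (f b has_real_derivative h t) (at t)" by blast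
    qed
    then show thesis using that by metis
  qed
  show ?thesis
  proof (cases "c 0 = c 1")
    case True
    then show ?thesis using ends by (simp add: c_def)
  next
    case False
    \<comment> \<open>In the direction u the scalar function grows by the full distance of the end
      points, so the integral of its derivative, which is at most the speed, bounds that
      distance.\<close>
    define u where "u = (c 1 - c 0) /\<^sub>R norm (c 1 - c 0)"
    have u: "norm u = 1" "inner u (c 1 - c 0) = norm (c 1 - c 0)"
      using False by (auto simp: u_def dot_square_norm power2_eq_square)
    obtain g where g: "g \<in> borel_measurable borel" "\<And>x. \<bar>g x\<bar> \<le> norm u * L' + 1"
      "AE x in lborel. (f u has_real_derivative g x) (at x)"
      "\<And>a b. a \<le> b \<Longrightarrow> f u b - f u a = (\<integral>x\<in>{a..b}. g x \<partial>lborel)"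
      using lipschitz_AE_derivative[OF fL, of u] by blast
    have gi: "set_integrable lborel {0..1} g" by (rule set_integrable_bounded_Icc[OF g(1,2)])
    have "norm (c 1 - c 0) = f u 1 - f u 0" using u(2) by (simp add: f_def inner_diff_right)
    also have "\<dots> = (\<integral>x\<in>{0..1}. g x \<partial>lborel)" by (rule g(4)) simp
    also have "\<dots> \<le> (\<integral>x\<in>{0..1}. \<bar>g x\<bar> \<partial>lborel)"
      by (intro set_integral_mono gi set_integrable_abs) auto
    finally have "dist (coord P x) (coord P y) \<le> (\<integral>x\<in>{0..1}. \<bar>g x\<bar> \<partial>lborel)"
      by (simp add: c_def ends dist_norm norm_minus_commute)
    then have "ennreal (dist (coord P x) (coord P y) / Lam) \<le> ennreal ((\<integral>x\<in>{0..1}. \<bar>g x\<bar> \<partial>lborel) / Lam)"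
      using Lam(1) by (intro ennreal_leI divide_right_mono) auto
    also have "(\<integral>x\<in>{0..1}. \<bar>g x\<bar> \<partial>lborel) / Lam = (\<integral>x. indicator {0..1} x * \<bar>g x\<bar> / Lam \<partial>lborel)"
      by (simp add: set_lebesgue_integral_def)
    also have "ennreal \<dots> = (\<integral>\<^sup>+x. ennreal (indicator {0..1} x * \<bar>g x\<bar> / Lam) \<partial>lborel)"
      using set_integrable_abs[OF gi] Lam(1) unfolding set_integrable_def
      by (intro nn_integral_eq_integral[symmetric] integrable_divide AE_I2) auto
    also have "\<dots> \<le> (\<integral>\<^sup>+ t. ennreal (gnorm P (\<gamma> t) (vector_derivative c (at t within {0..1}))) * indicator {0..1} t \<partial>lborel)"
    proof (rule nn_integral_mono_AE)
      \<comment> \<open>At almost every time all coordinates are differentiable, hence the path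
        itself is differentiable in the Euclidean space.\<close>
      have bas: "AE t in lborel. \<forall>b\<in>Basis. (f b has_real_derivative h b t) (at t)"
        using h by (intro AE_ball_countable[THEN iffD2]) (auto intro: countable_finite)
      have "AE t in lebesgue. t \<notin> {t \<in> {0..1}. \<gamma> t \<in> N}" by (rule AE_not_in[OF null])
      then have nin: "AE t in lborel. t \<notin> {t \<in> {0..1}. \<gamma> t \<in> N}" by (simp only: AE_completion_iff)
      have "AE t in lborel. t \<noteq> (0::real)" "AE t in lborel. t \<noteq> (1::real)" by (rule AE_lborel_singleton)+
      then show "AE t in lborel. ennreal (indicator {0..1} t * \<bar>g t\<bar> / Lam) \<le>
          ennreal (gnorm P (\<gamma> t) (vector_derivative c (at t within {0..1}))) * indicator {0..1} t"
        using bas nin g(3)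
      proof eventually_elim
        case (elim t)
        show ?case
        proof (cases "t \<in> {0..1}")
          case True
          then have t: "0 < t" "t < 1" using elim by auto
          have same: "((\<lambda>\<tau>. inner b (c \<tau>)) has_real_derivative d) (at t)"
            if "(f b has_real_derivative d) (at t)" for b d
            using that by (rule has_field_derivative_transform_within_open[where S="{0<..<1}"]) (use t in \<open>auto simp: f_def\<close>)
          have bd: "((\<lambda>\<tau>. inner b (c \<tau>)) has_vector_derivative h b t) (at t)" if "b \<in> Basis" for b
            using same elim that by (simp add: has_real_derivative_iff_has_vector_derivative[symmetric])
          define v where "v = (\<Sum>b\<in>Basis. h b t *\<^sub>R b)"
          have vd: "(c has_vector_derivative v) (at t)"
          proof -
            have "((\<lambda>\<tau>. \<Sum>b\<in>Basis. inner b (c \<tau>) *\<^sub>R b) has_vector_derivative v) (at t)"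
              unfolding v_def
            proof (intro has_vector_derivative_sum)
              fix b :: 'e assume b: "b \<in> Basis"
              show "((\<lambda>\<tau>. inner b (c \<tau>) *\<^sub>R b) has_vector_derivative h b t *\<^sub>R b) (at t)"
                using bounded_linear.has_vector_derivative[OF bounded_linear_scaleR_left bd[OF b], of b] .
            qed
            moreover have "(\<lambda>\<tau>. \<Sum>b\<in>Basis. inner b (c \<tau>) *\<^sub>R b) = c"
              by (simp add: fun_eq_iff inner_commute[of _ "c _"] euclidean_representation)
            ultimately show ?thesis by simp
          qed
          have "regular (\<gamma> t)" using elim True N(2) by auto
          then obtain s where s: "maximal s" "\<gamma> t \<in> inter s" "good Lam s (coord P (\<gamma> t))" by (auto simp: regular_def)
          have vT: "v \<in> tangent P s"
            using vd lipschitz_on_continuous_on[OF L] t s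
            by (intro path_derivative_tangent[OF s(1), of \<gamma> t]) (auto simp: c_def[abs_def])
          have "((\<lambda>\<tau>. inner u (c \<tau>)) has_vector_derivative inner u v) (at t)"
            by (rule bounded_linear.has_vector_derivative[OF bounded_linear_inner_right vd])
          moreover have "((\<lambda>\<tau>. inner u (c \<tau>)) has_vector_derivative g t) (at t)"
            using same elim by (simp add: has_real_derivative_iff_has_vector_derivative[symmetric])
          ultimately have "g t = inner u v" by (rule vector_derivative_unique_at[symmetric])
          then have "\<bar>g t\<bar> \<le> norm v" using Cauchy_Schwarz_ineq2[of u v] u(1) by simp
          also have "\<dots> \<le> Lam * gnorm P (\<gamma> t) v" by (rule gnorm_bounds(1)[OF s(3,2) vT])
          finally have "\<bar>g t\<bar> / Lam \<le> gnorm P (\<gamma> t) v" using Lam(1) by (simp add: field_simps)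
          moreover have "vector_derivative c (at t within {0..1}) = v"
          proof (rule vector_derivative_within_cbox[of 0 1 t, unfolded cbox_interval])
            show "(c has_vector_derivative v) (at t within {0..1})" using vd by (rule has_vector_derivative_at_within)
          qed (use True in auto)
          ultimately show ?thesis using True by (simp add: ennreal_leI)
        qed simp
      qed
    qed
    also have "\<dots> = glength P \<gamma>"
      unfolding glength_def c_def by (simp add: nn_integral_completion)
    finally show ?thesis .
  qed
qed

lemma regular_null_set:
  obtains N where "N \<in> null_sets (vol P)" "\<And>x. x \<notin> N \<Longrightarrow> regular x"
proof -
  have "space (vol P) = UNIV" by (simp add: vol_eq)
  then show thesis using AE_regular that by (auto simp: eventually_ae_filter subset_eq)
qed

text \<open>As \<open>gdist\<close> is a supremum over null sets, one suitable null set is enough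
  for a lower bound: a set outside which g is comparable with the Euclidean metric.\<close>

lemma coord_le_gdist: "ennreal (dist (coord P x) (coord P y)) \<le> ennreal Lam * gdist P x y"
proof -
  obtain N where N: "N \<in> null_sets (vol P)" "\<And>x. x \<notin> N \<Longrightarrow> regular x" using regular_null_set by blast
  have "ennreal (dist (coord P x) (coord P y) / Lam) \<le> (INF \<gamma>\<in>lipschitz_paths N x y. glength P \<gamma>)"
    using glength_lower[OF N] by (intro INF_greatest)
  also have "\<dots> \<le> gdist P x y" unfolding gdist_def by (rule SUP_upper[OF N(1)])
  finally have "ennreal Lam * ennreal (dist (coord P x) (coord P y) / Lam) \<le> ennreal Lam * gdist P x y"
    by (rule mult_left_mono) simp
  then show ?thesis using Lam(1) by (simp flip: ennreal_mult)
qed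

lemma param_simplex_01:
  assumes "s \<in> cplx P" "c \<in> param_simplex s" "i \<in> free_vertices s"
  shows "0 \<le> c i" "c i \<le> 1"
proof -
  show "0 \<le> c i" using assms by (simp add: param_simplex_def)
  have "c i \<le> (\<Sum>i\<in>free_vertices s. c i)"
    using assms free_finite[OF assms(1)] by (intro member_le_sum) (auto simp: param_simplex_def)
  also have "\<dots> \<le> 1" using assms by (simp add: param_simplex_def)
  finally show "c i \<le> 1" .
qed

lemma affine_map_diff: "affine_map s c - affine_map s c' = (\<Sum>i\<in>free_vertices s. (c i - c' i) *\<^sub>R frame P s i)"
  by (simp add: affine_map_def scaleR_diff_left sum_subtractf)

lemma affine_map_diff_bound:
  assumes "s \<in> cplx P" "c \<in> param_simplex s" "c' \<in> param_simplex s"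
  shows "norm (affine_map s c - affine_map s c') \<le> (\<Sum>i\<in>free_vertices s. norm (frame P s i))"
  unfolding affine_map_diff
proof (rule order_trans[OF norm_sum], rule sum_mono)
  fix i assume i: "i \<in> free_vertices s"
  have "\<bar>c i - c' i\<bar> \<le> 1"
    using param_simplex_01[OF assms(1,2) i] param_simplex_01[OF assms(1,3) i] by (intro abs_leI) linarith+
  then show "norm ((c i - c' i) *\<^sub>R frame P s i) \<le> norm (frame P s i)" by (simp add: mult_left_le_one_le)
qed

lemma pint_not_null:
  assumes s: "s \<in> cplx P" and Q: "AE c in PM s. Q c"
  shows "\<exists>c\<in>pint s. Q c"
proof (rule ccontr)
  assume neg: "\<not> ?thesis"
  let ?J = "free_vertices s"
  interpret finite_index ?J by (rule finite_index_free[OF s])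
  define N where "N = real (card ?J) + 1"
  have N: "0 < N" by (simp add: N_def add_nonneg_pos)
  define X where "X = Pi\<^sub>E ?J (\<lambda>_. {0<..<1 / N})"
  have X: "X \<in> sets (PM s)" unfolding X_def by (intro sets_PiM_I_finite) auto
  have "X \<subseteq> pint s"
  proof
    fix c assume c: "c \<in> X"
    have "(\<Sum>i\<in>?J. c i) \<le> (\<Sum>i\<in>?J. 1 / N)" using c by (intro sum_mono) (auto simp: X_def PiE_iff less_imp_le)
    also have "\<dots> < 1" using N by (simp add: N_def field_simps)
    finally show "c \<in> pint s" using c by (auto simp: X_def pint_def PiE_iff)
  qed
  note Xp = this
  have "AE c in PM s. c \<notin> X" using Q by eventually_elim (use neg Xp in auto)
  then have "emeasure (PM s) X = 0" using AE_iff_null_sets[OF X] by (auto dest: null_setsD1)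
  moreover have "emeasure (PM s) X = (\<Prod>i\<in>?J. emeasure lborel {0<..<1 / N})"
    unfolding X_def by (intro emeasure_PiM) auto
  ultimately have "(\<Prod>i\<in>?J. emeasure lborel {0<..<1 / N}) = 0" by simp
  then show False using N by (auto simp: prod_zero_iff ennreal_eq_0_iff)
qed

text \<open>Broken segments from \<open>x\<close> to \<open>y\<close> through a point \<open>w z\<close> close to the midpoint: for fixed \<open>t\<close> the position
  depends on \<open>z\<close> through a similarity, so by Fubini almost every \<open>z\<close> gives a path that avoids the null set
  at almost all times.\<close>

lemma short_path:
  assumes s: "maximal s" and x: "x \<in> closed_simplex P s" and y: "y \<in> closed_simplex P s"
    and Z: "Z \<in> null_sets (vol P)" and \<eta>: "0 < \<eta>" "\<eta> \<le> 1"
  shows "\<exists>\<gamma>\<in>lipschitz_paths Z x y. glength P \<gamma> \<le>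
    ennreal (Lam * (dist (coord P x) (coord P y) + 2 * \<eta> * (\<Sum>i\<in>free_vertices s. norm (frame P s i))))"
proof -
  let ?J = "free_vertices s"
  have sK: "s \<in> cplx P" using s maximal_in by blast
  interpret finite_index ?J by (rule finite_index_free[OF sK])
  define D where "D = (\<Sum>i\<in>?J. norm (frame P s i))"
  define a b where "a = param s x" and "b = param s y"
  have ab: "a \<in> param_simplex s" "b \<in> param_simplex s" "chart s a = x" "chart s b = y"
    using x y sK by (simp_all add: a_def b_def param_in chart_param)
  \<comment> \<open>\<open>\<alpha>\<close> rises from 0 to 1 during the first half of the time and
    \<open>\<beta>\<close> during the second, so that one formula traverses both segments.\<close>
  define \<alpha> \<beta> where "\<alpha> t = 2 * min t (1/2)" and "\<beta> t = 2 * max t (1/2) - 1" for t :: real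
  have \<alpha>\<beta>: "0 \<le> 1 - \<alpha> t" "0 < \<alpha> t - \<beta> t" "0 \<le> \<beta> t" if "0 < t" "t < 1" for t
    using that by (auto simp: \<alpha>_def \<beta>_def min_def max_def)
  \<comment> \<open>A convex combination of the midpoint of a and b with z. The share of z pushes
    the point into the open simplex and is the free variable for Fubini.\<close>
  define w where "w z = (\<lambda>i\<in>?J. (1 - \<eta>) * (a i + b i) / 2 + \<eta> * z i)" for z :: "'v \<Rightarrow> real"
  define p where "p z t = (\<lambda>i\<in>?J. a i + \<alpha> t * (w z i - a i) + \<beta> t * (b i - w z i))" for z :: "'v \<Rightarrow> real" and t
  have sum_le: "(\<Sum>i\<in>?J. a i) \<le> 1" "(\<Sum>i\<in>?J. b i) \<le> 1" "\<And>i. i \<in> ?J \<Longrightarrow> 0 \<le> a i" "\<And>i. i \<in> ?J \<Longrightarrow> 0 \<le> b i"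
    using ab by (auto simp: param_simplex_def)
  have w_in: "w z \<in> pint s" if z: "z \<in> pint s" for z
  proof -
    have pos: "0 < w z i" if "i \<in> ?J" for i
    proof -
      have "0 < \<eta> * z i" "0 \<le> (1 - \<eta>) * (a i + b i) / 2"
        using z that \<eta> sum_le by (auto simp: pint_def)
      then show ?thesis using that by (simp add: w_def add_nonneg_pos)
    qed
    have "(\<Sum>i\<in>?J. w z i) = (1 - \<eta>) / 2 * ((\<Sum>i\<in>?J. a i) + (\<Sum>i\<in>?J. b i)) + \<eta> * (\<Sum>i\<in>?J. z i)"
      by (simp add: w_def sum.distrib sum_distrib_left[symmetric] sum_divide_distrib[symmetric])
    also have "\<dots> \<le> (1 - \<eta>) / 2 * (1 + 1) + \<eta> * (\<Sum>i\<in>?J. z i)"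
      using \<eta> sum_le by (intro add_mono mult_left_mono) auto
    also have "\<dots> < (1 - \<eta>) / 2 * (1 + 1) + \<eta> * 1"
      using \<eta> z by (intro add_strict_left_mono mult_strict_left_mono) (auto simp: pint_def)
    also have "\<dots> = 1" by (simp add: field_simps)
    finally show ?thesis using pos by (simp add: pint_def w_def[of z])
  qed
  have p_eq: "p z t i = (1 - \<alpha> t) * a i + (\<alpha> t - \<beta> t) * w z i + \<beta> t * b i" if "i \<in> ?J" for z t i
    using that by (simp add: p_def algebra_simps)
  have p_in: "p z t \<in> pint s" if z: "z \<in> pint s" and t: "0 < t" "t < 1" for z t
  proof -
    have wz: "w z \<in> pint s" by (rule w_in[OF z])
    have pos: "0 < p z t i" if "i \<in> ?J" for i
    proof -
      have "0 < (\<alpha> t - \<beta> t) * w z i" using \<alpha>\<beta>[OF t] wz that by (auto simp: pint_def)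
      moreover have "0 \<le> (1 - \<alpha> t) * a i" "0 \<le> \<beta> t * b i" using \<alpha>\<beta>[OF t] sum_le that by auto
      ultimately show ?thesis by (simp add: p_eq[OF that])
    qed
    have "(\<Sum>i\<in>?J. p z t i) = (1 - \<alpha> t) * (\<Sum>i\<in>?J. a i) + (\<alpha> t - \<beta> t) * (\<Sum>i\<in>?J. w z i) + \<beta> t * (\<Sum>i\<in>?J. b i)"
      by (simp add: p_eq sum.distrib sum_distrib_left[symmetric])
    also have "\<dots> \<le> (1 - \<alpha> t) * 1 + (\<alpha> t - \<beta> t) * (\<Sum>i\<in>?J. w z i) + \<beta> t * 1"
      using \<alpha>\<beta>[OF t] sum_le by (intro add_mono mult_left_mono) auto
    also have "\<dots> < (1 - \<alpha> t) * 1 + (\<alpha> t - \<beta> t) * 1 + \<beta> t * 1"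
      using \<alpha>\<beta>[OF t] wz by (intro add_strict_right_mono add_strict_left_mono mult_strict_left_mono) (auto simp: pint_def)
    finally show ?thesis using pos by (simp add: pint_def p_def[of z])
  qed
  have "AE x in vol P. x \<notin> Z \<and> regular x" using AE_not_in[OF Z] AE_regular by eventually_elim simp
  from AE_chart[OF s this] obtain N where N: "N \<in> null_sets (PM s)"
    and NQ: "\<And>c. c \<in> pint s \<Longrightarrow> c \<notin> N \<Longrightarrow> chart s c \<notin> Z \<and> regular (chart s c)"
  proof -
    assume "AE c in PM s. c \<in> pint s \<longrightarrow> chart s c \<notin> Z \<and> regular (chart s c)"
    then obtain N where "N \<in> null_sets (PM s)" "{c \<in> space (PM s). \<not> (c \<in> pint s \<longrightarrow> chart s c \<notin> Z \<and> regular (chart s c))} \<subseteq> N"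
      by (auto simp: eventually_ae_filter)
    moreover have "pint s \<subseteq> space (PM s)" by (auto simp: pint_def space_PM)
    ultimately show thesis using that by blast
  qed
  have slice: "AE z in PM s. 0 < t \<and> t < 1 \<longrightarrow> p z t \<notin> N" for t
  proof (cases "0 < t \<and> t < 1")
    case True
    \<comment> \<open>For fixed t strictly between 0 and 1 the coefficient of z is positive, so
      \<open>p z t\<close> is a nonsingular affine function of z and pulls null sets back to null
      sets.\<close>
    have "AE z in PM s. (\<lambda>i\<in>?J. ((1 - \<alpha> t) * a i + (\<alpha> t - \<beta> t) * ((1 - \<eta>) * (a i + b i) / 2) + \<beta> t * b i) + ((\<alpha> t - \<beta> t) * \<eta>) * z i) \<notin> N"
      using \<alpha>\<beta>[of t] True \<eta> by (intro AE_affine AE_not_in[OF N]) auto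
    moreover have "(\<lambda>i\<in>?J. ((1 - \<alpha> t) * a i + (\<alpha> t - \<beta> t) * ((1 - \<eta>) * (a i + b i) / 2) + \<beta> t * b i) + ((\<alpha> t - \<beta> t) * \<eta>) * z i) = p z t" for z
    proof
      fix i show "(\<lambda>i\<in>?J. ((1 - \<alpha> t) * a i + (\<alpha> t - \<beta> t) * ((1 - \<eta>) * (a i + b i) / 2) + \<beta> t * b i) + ((\<alpha> t - \<beta> t) * \<eta>) * z i) i = p z t i"
      proof (cases "i \<in> ?J")
        case True
        then show ?thesis unfolding p_eq[OF True] by (simp add: w_def algebra_simps)
      qed (simp add: p_def)
    qed
    ultimately show ?thesis by simp
  qed auto
  interpret sM: sigma_finite_measure M by (rule sigma_finite) simp
  interpret PP: pair_sigma_finite M "lborel :: real measure" by standard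
  have wj: "(\<lambda>x. w (fst x) i) \<in> borel_measurable (M \<Otimes>\<^sub>M lborel)" if "i \<in> ?J" for i
    unfolding w_def using that by simp
  have joint: "(\<lambda>x. p (fst x) (snd x)) \<in> measurable (M \<Otimes>\<^sub>M lborel) M"
    unfolding p_def \<alpha>_def \<beta>_def
    by (intro measurable_restrict) (use wj in measurable)
  have "AE z in M. AE t in lborel. 0 < t \<and> t < 1 \<longrightarrow> p z t \<notin> N"
  proof (subst PP.AE_commute)
    have Ns: "N \<in> sets M" using N by auto
    have "(\<lambda>x. p (fst x) (snd x)) -` N \<inter> space (M \<Otimes>\<^sub>M lborel) \<in> sets (M \<Otimes>\<^sub>M lborel)"
      by (rule measurable_sets[OF joint Ns])
    then have [measurable]: "Measurable.pred (M \<Otimes>\<^sub>M lborel) (\<lambda>x. p (fst x) (snd x) \<in> N)"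
      by (simp add: pred_def vimage_def Int_def conj_commute)
    show "{x \<in> space (M \<Otimes>\<^sub>M lborel). 0 < snd x \<and> snd x < 1 \<longrightarrow> p (fst x) (snd x) \<notin> N} \<in> sets (M \<Otimes>\<^sub>M lborel)"
      by measurable
    show "AE t in lborel. AE z in M. 0 < t \<and> t < 1 \<longrightarrow> p z t \<notin> N" using slice by simp
  qed
  from pint_not_null[OF sK this] obtain z where z: "z \<in> pint s"
    and zt: "AE t in lborel. 0 < t \<and> t < 1 \<longrightarrow> p z t \<notin> N" by blast
  define A B W where "A = affine_map s a" and "B = affine_map s b" and "W = affine_map s (w z)"
  define e where "e t = A + \<alpha> t *\<^sub>R (W - A) + \<beta> t *\<^sub>R (B - W)" for t
  have e_eq: "affine_map s (p z t) = e t" for t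
  proof -
    have "affine_map s (p z t) - A = \<alpha> t *\<^sub>R (W - A) + \<beta> t *\<^sub>R (B - W)"
      unfolding A_def W_def B_def affine_map_diff scaleR_sum_right sum.distrib[symmetric]
      by (intro sum.cong refl) (simp add: p_def algebra_simps)
    then show ?thesis by (simp add: e_def algebra_simps)
  qed
  have ends: "p z 0 = a" "p z 1 = b"
    using ab by (auto simp: p_def \<alpha>_def \<beta>_def fun_eq_iff param_simplex_def extensional_def)
  have p_simplex: "p z t \<in> param_simplex s" if "t \<in> {0..1}" for t
    using p_in[OF z, of t] pint_subset ends ab that by (cases "t = 0"; cases "t = 1") auto
  define \<gamma> where "\<gamma> t = chart s (p z t)" for t
  have c\<gamma>: "coord P (\<gamma> t) = e t" if "t \<in> {0..1}" for t
    unfolding \<gamma>_def using coord_chart[OF sK p_simplex[OF that]] e_eq by simp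
  have \<gamma>inv: "\<gamma> t = the_inv (coord P) (e t)" if "t \<in> {0..1}" for t
    using c\<gamma>[OF that] inv_coord[of "\<gamma> t"] by simp
  have eL: "(2 * (norm (W - A) + norm (B - W)))-lipschitz_on {0..1} e"
  proof (rule lipschitz_onI)
    fix t u :: real
    have "\<bar>\<alpha> t - \<alpha> u\<bar> \<le> 2 * \<bar>t - u\<bar>" "\<bar>\<beta> t - \<beta> u\<bar> \<le> 2 * \<bar>t - u\<bar>"
    proof -
      have "\<bar>min t (1/2) - min u (1/2)\<bar> \<le> \<bar>t - u\<bar>" "\<bar>max t (1/2) - max u (1/2)\<bar> \<le> \<bar>t - u\<bar>"
        by (auto simp: min_def max_def)
      moreover have "\<alpha> t - \<alpha> u = 2 * (min t (1/2) - min u (1/2))" "\<beta> t - \<beta> u = 2 * (max t (1/2) - max u (1/2))"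
        by (simp_all add: \<alpha>_def \<beta>_def)
      ultimately show "\<bar>\<alpha> t - \<alpha> u\<bar> \<le> 2 * \<bar>t - u\<bar>" "\<bar>\<beta> t - \<beta> u\<bar> \<le> 2 * \<bar>t - u\<bar>"
        by (simp_all only: abs_mult abs_numeral)
    qed
    then have "norm ((\<alpha> t - \<alpha> u) *\<^sub>R (W - A)) + norm ((\<beta> t - \<beta> u) *\<^sub>R (B - W)) \<le> 2 * \<bar>t - u\<bar> * norm (W - A) + 2 * \<bar>t - u\<bar> * norm (B - W)"
      unfolding norm_scaleR by (intro add_mono mult_right_mono) auto
    moreover have "e t - e u = (\<alpha> t - \<alpha> u) *\<^sub>R (W - A) + (\<beta> t - \<beta> u) *\<^sub>R (B - W)"
      by (simp add: e_def algebra_simps)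
    ultimately have "norm (e t - e u) \<le> 2 * \<bar>t - u\<bar> * norm (W - A) + 2 * \<bar>t - u\<bar> * norm (B - W)"
      by (metis norm_triangle_le)
    then show "dist (e t) (e u) \<le> 2 * (norm (W - A) + norm (B - W)) * dist t u"
      by (simp add: dist_norm algebra_simps)
  qed simp
  have "locally_lipschitz {0..1} dist dist (\<lambda>t. the_inv (coord P) (e t))"
  proof (rule locally_lipschitz_compose[OF lipschitz_imp_locally_lipschitz[OF eL] inv_coord_lip])
    show "e ` {0..1} \<subseteq> range (coord P)" using c\<gamma> by (metis image_subsetI rangeI)
  qed auto
  then have "locally_lipschitz {0..1} dist dist \<gamma>"
    using \<gamma>inv by (simp add: locally_lipschitz_def)
  then obtain L where L: "L-lipschitz_on {0..1} \<gamma>" using locally_lipschitz_compact by blast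
  have ae: "AE t in lborel. t \<in> {0..1} \<longrightarrow> t \<noteq> 1/2 \<and> 0 < t \<and> t < 1 \<and> \<gamma> t \<notin> Z \<and> regular (\<gamma> t) \<and> \<gamma> t \<in> inter s"
  proof -
    have "AE t in lborel. t \<noteq> (0::real)" "AE t in lborel. t \<noteq> (1::real)" "AE t in lborel. t \<noteq> (1/2::real)" by (rule AE_lborel_singleton)+
    then show ?thesis using zt
      by eventually_elim (use NQ p_in[OF z] chart_pint[OF sK] in \<open>auto simp: \<gamma>_def less_le\<close>)
  qed
  have null: "{t \<in> {0..1}. \<gamma> t \<in> Z} \<in> null_sets lebesgue"
  proof -
    have "AE t in lebesgue. t \<notin> {t \<in> {0..1}. \<gamma> t \<in> Z}"
      unfolding AE_completion_iff using ae by eventually_elim auto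
    then show ?thesis by (simp add: completion.null_sets_iff_AE)
  qed
  have mem: "\<gamma> \<in> lipschitz_paths Z x y"
    using L null ab by (auto simp: lipschitz_paths_def \<gamma>_def ends)
  \<comment> \<open>The velocities on the two halves are nearly \<open>B - A\<close>: the midpoint
    contributes \<open>(1 - \<eta>) *\<^sub>R (B - A)\<close>, and z only a term of norm at most
    \<open>2 * \<eta> * D\<close>, where D bounds the diameter of the simplex.\<close>
  have half: "norm (2 *\<^sub>R (W - A)) \<le> dist (coord P x) (coord P y) + 2 * \<eta> * D"
    "norm (2 *\<^sub>R (B - W)) \<le> dist (coord P x) (coord P y) + 2 * \<eta> * D"
  proof -
    have zs: "z \<in> param_simplex s" using z pint_subset by blast
    have d: "dist (coord P x) (coord P y) = norm (B - A)"
      using coord_affine[OF sK x] coord_affine[OF sK y] by (simp add: A_def B_def a_def b_def dist_norm norm_minus_commute)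
    have 1: "2 *\<^sub>R (W - A) = (1 - \<eta>) *\<^sub>R (B - A) + (2 * \<eta>) *\<^sub>R (affine_map s z - A)"
      unfolding A_def W_def B_def affine_map_diff scaleR_sum_right sum.distrib[symmetric]
    proof (intro sum.cong refl)
      fix i assume i: "i \<in> ?J"
      have "2 * (w z i - a i) = (1 - \<eta>) * (b i - a i) + (2 * \<eta>) * (z i - a i)" using i by (simp add: w_def field_simps)
      then show "2 *\<^sub>R (w z i - a i) *\<^sub>R frame P s i = (1 - \<eta>) *\<^sub>R (b i - a i) *\<^sub>R frame P s i + (2 * \<eta>) *\<^sub>R (z i - a i) *\<^sub>R frame P s i"
        by (simp only: scaleR_scaleR scaleR_left_distrib[symmetric])
    qed
    have 2: "2 *\<^sub>R (B - W) = (1 - \<eta>) *\<^sub>R (B - A) + (2 * \<eta>) *\<^sub>R (B - affine_map s z)"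
      unfolding A_def W_def B_def affine_map_diff scaleR_sum_right sum.distrib[symmetric]
    proof (intro sum.cong refl)
      fix i assume i: "i \<in> ?J"
      have "2 * (b i - w z i) = (1 - \<eta>) * (b i - a i) + (2 * \<eta>) * (b i - z i)" using i by (simp add: w_def field_simps)
      then show "2 *\<^sub>R (b i - w z i) *\<^sub>R frame P s i = (1 - \<eta>) *\<^sub>R (b i - a i) *\<^sub>R frame P s i + (2 * \<eta>) *\<^sub>R (b i - z i) *\<^sub>R frame P s i"
        by (simp only: scaleR_scaleR scaleR_left_distrib[symmetric])
    qed
    have n: "norm ((1 - \<eta>) *\<^sub>R (B - A)) \<le> norm (B - A)" using \<eta> by (simp add: mult_left_le_one_le)
    have "norm ((2 * \<eta>) *\<^sub>R (affine_map s z - A)) \<le> 2 * \<eta> * D" "norm ((2 * \<eta>) *\<^sub>R (B - affine_map s z)) \<le> 2 * \<eta> * D"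
      using affine_map_diff_bound[OF sK zs ab(1)] affine_map_diff_bound[OF sK ab(2) zs] \<eta> by (auto simp: A_def B_def D_def)
    then show "norm (2 *\<^sub>R (W - A)) \<le> dist (coord P x) (coord P y) + 2 * \<eta> * D"
      "norm (2 *\<^sub>R (B - W)) \<le> dist (coord P x) (coord P y) + 2 * \<eta> * D"
      unfolding 1 2 d using n by (meson add_mono norm_triangle_le)+
  qed
  define C where "C = Lam * (dist (coord P x) (coord P y) + 2 * \<eta> * D)"
  have "glength P \<gamma> = (\<integral>\<^sup>+ t. ennreal (gnorm P (\<gamma> t) (vector_derivative (\<lambda>\<tau>. coord P (\<gamma> \<tau>)) (at t within {0..1}))) * indicator {0..1} t \<partial>lborel)"
    unfolding glength_def by (simp add: nn_integral_completion)
  also have "\<dots> \<le> (\<integral>\<^sup>+ t. ennreal C * indicator {0..1::real} t \<partial>lborel)"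
  proof (rule nn_integral_mono_AE)
    show "AE t in lborel. ennreal (gnorm P (\<gamma> t) (vector_derivative (\<lambda>\<tau>. coord P (\<gamma> \<tau>)) (at t within {0..1}))) * indicator {0..1} t \<le> ennreal C * indicator {0..1} t"
      using ae
    proof eventually_elim
      case (elim t)
      show ?case
      proof (cases "t \<in> {0..1}")
        case True
        with elim have t: "t \<noteq> 1/2" "0 < t" "t < 1" "regular (\<gamma> t)" "\<gamma> t \<in> inter s" by auto
        have g: "good Lam s (coord P (\<gamma> t))" using t(4,5) by (auto simp: regular_def inter_def)
        have "\<exists>v. ((\<lambda>\<tau>. coord P (\<gamma> \<tau>)) has_vector_derivative v) (at t) \<and> norm v \<le> dist (coord P x) (coord P y) + 2 * \<eta> * D"
        proof (cases "t < 1/2")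
          case True
          have "((\<lambda>\<tau>. A + (2 * \<tau>) *\<^sub>R (W - A)) has_vector_derivative 2 *\<^sub>R (W - A)) (at t)"
            by (auto intro!: derivative_eq_intros simp: has_vector_derivative_def fun_eq_iff)
          then have "((\<lambda>\<tau>. coord P (\<gamma> \<tau>)) has_vector_derivative 2 *\<^sub>R (W - A)) (at t)"
            by (rule has_vector_derivative_transform_within_open[where S="{0<..<1/2}"])
              (use True t in \<open>auto simp: c\<gamma> e_def \<alpha>_def \<beta>_def\<close>)
          then show ?thesis using half(1) by blast
        next
          case False
          have "((\<lambda>\<tau>. W + (2 * \<tau> - 1) *\<^sub>R (B - W)) has_vector_derivative 2 *\<^sub>R (B - W)) (at t)"
            by (auto intro!: derivative_eq_intros simp: has_vector_derivative_def fun_eq_iff)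
          then have "((\<lambda>\<tau>. coord P (\<gamma> \<tau>)) has_vector_derivative 2 *\<^sub>R (B - W)) (at t)"
            by (rule has_vector_derivative_transform_within_open[where S="{1/2<..<1}"])
              (use False t in \<open>auto simp: c\<gamma> e_def \<alpha>_def \<beta>_def\<close>)
          then show ?thesis using half(2) by blast
        qed
        then obtain v where v: "((\<lambda>\<tau>. coord P (\<gamma> \<tau>)) has_vector_derivative v) (at t)"
          "norm v \<le> dist (coord P x) (coord P y) + 2 * \<eta> * D" by blast
        have vT: "v \<in> tangent P s"
          using v lipschitz_on_continuous_on[OF L] t by (intro path_derivative_tangent[OF s, of \<gamma> t]) auto
        have "vector_derivative (\<lambda>\<tau>. coord P (\<gamma> \<tau>)) (at t within {0..1}) = v"
        proof (rule vector_derivative_within_cbox[of 0 1 t, unfolded cbox_interval])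
          show "((\<lambda>\<tau>. coord P (\<gamma> \<tau>)) has_vector_derivative v) (at t within {0..1})"
            using v(1) by (rule has_vector_derivative_at_within)
        qed (use True in auto)
        moreover have "gnorm P (\<gamma> t) v \<le> C"
          unfolding C_def using order_trans[OF gnorm_bounds(2)[OF g t(5) vT] mult_left_mono[OF v(2) less_imp_le[OF Lam(1)]]] .
        ultimately show ?thesis using True by (simp add: ennreal_leI)
      qed simp
    qed
  qed
  also have "\<dots> = ennreal C" by (simp add: nn_integral_cmult_indicator)
  finally have "glength P \<gamma> \<le> ennreal C" .
  then show ?thesis using mem unfolding C_def D_def by blast
qed

lemma gdist_le_coord:
  assumes s: "maximal s" and x: "x \<in> closed_simplex P s" and y: "y \<in> closed_simplex P s"
  shows "gdist P x y \<le> ennreal (Lam * dist (coord P x) (coord P y))"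
  unfolding gdist_def
proof (rule SUP_least)
  fix Z assume Z: "Z \<in> null_sets (vol P)"
  define D where "D = (\<Sum>i\<in>free_vertices s. norm (frame P s i))"
  have D: "0 \<le> D" by (simp add: D_def sum_nonneg)
  show "(INF \<gamma>\<in>lipschitz_paths Z x y. glength P \<gamma>) \<le> ennreal (Lam * dist (coord P x) (coord P y))"
  proof (rule ennreal_le_epsilon)
    fix e :: real assume e: "0 < e"
    \<comment> \<open>Chosen so that the excess \<open>2 * \<eta> * D * Lam\<close> in the length is
      at most e; the 1 added to D guards against \<open>D = 0\<close>.\<close>
    define \<eta> where "\<eta> = min 1 (e / (2 * Lam * (D + 1)))"
    have \<eta>: "0 < \<eta>" "\<eta> \<le> 1" using e D Lam(1) by (auto simp: \<eta>_def)
    have "2 * \<eta> * D * Lam \<le> e"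
    proof -
      have "\<eta> * (2 * Lam * (D + 1)) \<le> e / (2 * Lam * (D + 1)) * (2 * Lam * (D + 1))"
        using D Lam(1) by (intro mult_right_mono) (auto simp: \<eta>_def)
      also have "\<dots> = e" using D Lam(1) by simp
      finally have "\<eta> * (2 * Lam * (D + 1)) \<le> e" .
      moreover have "2 * \<eta> * D * Lam \<le> \<eta> * (2 * Lam * (D + 1))" using \<eta> Lam(1) by (simp add: algebra_simps)
      ultimately show ?thesis by linarith
    qed
    then have le: "Lam * (dist (coord P x) (coord P y) + 2 * \<eta> * D) \<le> Lam * dist (coord P x) (coord P y) + e"
      by (simp add: algebra_simps)
    obtain \<gamma> where \<gamma>: "\<gamma> \<in> lipschitz_paths Z x y" "glength P \<gamma> \<le> ennreal (Lam * (dist (coord P x) (coord P y) + 2 * \<eta> * D))"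
      using short_path[OF s x y Z \<eta>] unfolding D_def by blast
    have "(INF \<gamma>\<in>lipschitz_paths Z x y. glength P \<gamma>) \<le> glength P \<gamma>" by (rule INF_lower[OF \<gamma>(1)])
    also note \<gamma>(2)
    also have "ennreal (Lam * (dist (coord P x) (coord P y) + 2 * \<eta> * D)) \<le> ennreal (Lam * dist (coord P x) (coord P y) + e)"
      by (rule ennreal_leI[OF le])
    also have "\<dots> = ennreal (Lam * dist (coord P x) (coord P y)) + ennreal e"
      using Lam(1) e by (intro ennreal_plus) auto
    finally show "(INF \<gamma>\<in>lipschitz_paths Z x y. glength P \<gamma>) \<le> ennreal (Lam * dist (coord P x) (coord P y)) + ennreal e" .
  qed
qed

section \<open>Lipschitz functions for the intrinsic distance\<close>

lemma glip_constant:
  assumes "glipschitz_on P U u"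
  obtains L where "0 \<le> L" "\<And>x y. x \<in> U \<Longrightarrow> y \<in> U \<Longrightarrow> ennreal \<bar>u x - u y\<bar> \<le> ennreal L * gdist P x y"
proof -
  obtain L where L: "\<And>x y. x \<in> U \<Longrightarrow> y \<in> U \<Longrightarrow> ennreal \<bar>u x - u y\<bar> \<le> ennreal L * gdist P x y"
    using assms by (auto simp: glipschitz_on_def)
  have "ennreal L = ennreal (max 0 L)" by (simp add: max_def ennreal_neg)
  with L show thesis by (intro that[of "max 0 L"]) auto
qed

text \<open>One constant serves all simplices, because \<open>Lam\<close> does. The connecting paths
  may leave U, which is harmless as \<open>gdist\<close> is the distance of the whole space.\<close>

lemma glip_simplex:
  assumes "glipschitz_on P U u"
  obtains L where "0 \<le> L" "\<And>s x y. maximal s \<Longrightarrow> x \<in> U \<Longrightarrow> y \<in> U \<Longrightarrow> x \<in> closed_simplex P s \<Longrightarrow> y \<in> closed_simplex P s \<Longrightarrow>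
    \<bar>u x - u y\<bar> \<le> L * dist (coord P x) (coord P y)"
proof -
  obtain L where L: "0 \<le> L" "\<And>x y. x \<in> U \<Longrightarrow> y \<in> U \<Longrightarrow> ennreal \<bar>u x - u y\<bar> \<le> ennreal L * gdist P x y"
    using glip_constant[OF assms] by blast
  have "\<bar>u x - u y\<bar> \<le> (L * Lam) * dist (coord P x) (coord P y)"
    if s: "maximal s" "x \<in> U" "y \<in> U" "x \<in> closed_simplex P s" "y \<in> closed_simplex P s" for s x y
  proof -
    have "ennreal \<bar>u x - u y\<bar> \<le> ennreal L * ennreal (Lam * dist (coord P x) (coord P y))"
      using L(2)[OF s(2,3)] mult_left_mono[OF gdist_le_coord[OF s(1,4,5)], of "ennreal L"] by (meson order_trans zero_le)
    also have "\<dots> = ennreal (L * (Lam * dist (coord P x) (coord P y)))"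
      using L(1) Lam(1) by (intro ennreal_mult[symmetric]) auto
    finally show ?thesis using L(1) Lam(1) by (simp add: mult.assoc)
  qed
  moreover have "0 \<le> L * Lam" using L Lam(1) by simp
  ultimately show thesis using that by blast
qed

text \<open>The topology comes from the class metric, so continuity is not immediate from a bound by
  \<open>gdist\<close>. Points near x share a closed maximal simplex with x, where
  \<open>glip_simplex\<close> applies, and \<open>coord P\<close> is continuous.\<close>

lemma glip_continuous:
  assumes u: "glipschitz_on P U u" and U: "open U"
  shows "continuous_on U u"
proof (rule continuous_at_imp_continuous_on, rule ballI)
  fix x assume x: "x \<in> U"
  obtain L where L: "0 \<le> L" "\<And>s x y. maximal s \<Longrightarrow> x \<in> U \<Longrightarrow> y \<in> U \<Longrightarrow> x \<in> closed_simplex P s \<Longrightarrow> y \<in> closed_simplex P s \<Longrightarrow>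
    \<bar>u x - u y\<bar> \<le> L * dist (coord P x) (coord P y)" using glip_simplex[OF u] by blast
  obtain V where V: "open V" "x \<in> V" "\<And>y. y \<in> V \<Longrightarrow> carrier_simplex P x \<subseteq> carrier_simplex P y"
    using star_neighbourhood by blast
  have near: "\<bar>u y - u x\<bar> \<le> L * dist (coord P y) (coord P x)" if y: "y \<in> U \<inter> V" for y
  proof -
    obtain s where "maximal s" "carrier_simplex P y \<subseteq> s" using maximal_above[OF carrier_in] by blast
    then show ?thesis using V(3) y x by (intro L(2)) (auto simp: closed_simplex_def)
  qed
  have "isCont (coord P) x" using coord_continuous by (simp add: continuous_on_eq_continuous_at)
  then have "((\<lambda>y. L * dist (coord P y) (coord P x)) \<longlongrightarrow> L * dist (coord P x) (coord P x)) (at x)"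
    by (intro tendsto_intros) (simp add: isCont_def)
  then have lim: "((\<lambda>y. L * dist (coord P y) (coord P x)) \<longlongrightarrow> 0) (at x)" by simp
  have "\<forall>\<^sub>F y in at x. norm (u y - u x) \<le> L * dist (coord P y) (coord P x)"
    unfolding eventually_at_topological
    by (rule exI[of _ "U \<inter> V"]) (use U V x near in auto)
  from Lim_null_comparison[OF this lim] show "isCont u x"
    unfolding isCont_def by (rule LIM_zero_cancel)
qed

text \<open>This is the source of test functions: the cutoffs and the exhaustion are obtained from
  functions of the Euclidean coordinates.\<close>

lemma glip_of_coord:
  assumes "L-lipschitz_on UNIV F"
  shows "glipschitz_on P UNIV (\<lambda>x. F (coord P x) :: real)"
  unfolding glipschitz_on_def
proof (intro exI[of _ "L * Lam"] ballI)
  fix x y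
  have L: "0 \<le> L" by (rule lipschitz_on_nonneg[OF assms])
  have "ennreal \<bar>F (coord P x) - F (coord P y)\<bar> \<le> ennreal (L * dist (coord P x) (coord P y))"
    using lipschitz_onD[OF assms, of "coord P x" "coord P y"] by (intro ennreal_leI) (simp add: dist_real_def)
  also have "\<dots> = ennreal L * ennreal (dist (coord P x) (coord P y))" using L by (intro ennreal_mult) auto
  also have "\<dots> \<le> ennreal L * (ennreal Lam * gdist P x y)" by (intro mult_left_mono coord_le_gdist) simp
  also have "\<dots> = ennreal (L * Lam) * gdist P x y"
    using L Lam(1) by (simp add: ennreal_mult mult.assoc)
  finally show "ennreal \<bar>F (coord P x) - F (coord P y)\<bar> \<le> ennreal (L * Lam) * gdist P x y" .
qed

end

section \<open>Differentials and Riemannian gradients\<close>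

context finite_index
begin

lemma l1_triangle: "l1 a c \<le> l1 a b + l1 b c"
  unfolding l1_def sum.distrib[symmetric] by (intro sum_mono) linarith

lemma l1_commute: "l1 a b = l1 b a"
  by (simp add: l1_def abs_minus_commute)

text \<open>McShane's formula: the lower envelope of the cones \<open>f d + K * l1 c d\<close> with
  d in W. The Lipschitz bound on W keeps it finite and equal to f there.\<close>

lemma mcshane_extension:
  assumes K: "0 \<le> K" and f: "\<And>c c'. c \<in> W \<Longrightarrow> c' \<in> W \<Longrightarrow> \<bar>f c - f c'\<bar> \<le> K * l1 c c'"
  obtains v where "lip K v" "\<And>c. c \<in> W \<Longrightarrow> v c = f c"
proof (cases "W = {}")
  case True
  have "lip K (\<lambda>_. 0)" using K by (simp add: lip_def)
  then show thesis using True that by blast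
next
  case False
  define v where "v c = (INF d\<in>W. f d + K * l1 c d)" for c
  obtain d0 where d0: "d0 \<in> W" using False by blast
  have bdd: "bdd_below ((\<lambda>d. f d + K * l1 c d) ` W)" for c
  proof (rule bdd_belowI2)
    fix d assume d: "d \<in> W"
    have "f d0 - f d \<le> K * l1 d0 d" using f[OF d0 d] by linarith
    also have "\<dots> \<le> K * (l1 d0 c + l1 c d)" using K by (intro mult_left_mono l1_triangle)
    finally show "f d0 - K * l1 d0 c \<le> f d + K * l1 c d" by (simp add: algebra_simps)
  qed
  have one: "v c - v c' \<le> K * l1 c c'" for c c'
  proof -
    have "v c - K * l1 c c' \<le> v c'"
      unfolding v_def[of c']
    proof (rule cINF_greatest[OF False])
      fix d assume d: "d \<in> W"
      have "v c \<le> f d + K * l1 c d" unfolding v_def by (rule cINF_lower[OF bdd d])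
      also have "\<dots> \<le> f d + K * (l1 c c' + l1 c' d)" using K by (intro add_left_mono mult_left_mono l1_triangle)
      finally show "v c - K * l1 c c' \<le> f d + K * l1 c' d" by (simp add: algebra_simps)
    qed
    then show ?thesis by simp
  qed
  have "lip K v"
    unfolding lip_def using K one[of c c' for c c'] by (auto simp: abs_le_iff) (metis one l1_commute)
  moreover have "v c = f c" if c: "c \<in> W" for c
  proof (rule antisym)
    have "v c \<le> f c + K * l1 c c" unfolding v_def by (rule cINF_lower[OF bdd c])
    then show "v c \<le> f c" by (simp add: l1_def)
    show "f c \<le> v c"
      unfolding v_def
    proof (rule cINF_greatest[OF False])
      fix d assume d: "d \<in> W"
      show "f c \<le> f d + K * l1 c d" using f[OF c d] by linarith
    qed
  qed
  ultimately show thesis using that by blast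
qed

end

context riem_polyhedron
begin

text \<open>The conditions under which the definite description in \<open>rgrad\<close> denotes a
  vector: x is interior to a maximal simplex, g is an inner product there, and u has a derivative
  along the simplex. Only the values of D on tangent vectors matter.\<close>

definition differential :: "('x \<Rightarrow> real) \<Rightarrow> 'x \<Rightarrow> 'v set \<Rightarrow> ('e \<Rightarrow> real) \<Rightarrow> bool" where
  "differential u x s D \<longleftrightarrow> maximal s \<and> x \<in> inter s \<and> good Lam s (coord P x) \<and>
     ((\<lambda>y. u (the_inv (coord P) y)) has_derivative D) (at (coord P x) within coord P ` closed_simplex P s)"

lemma differentialD:
  assumes "differential u x s D"
  shows "maximal s" "x \<in> inter s" "good Lam s (coord P x)" "s \<in> cplx P" "carrier_simplex P x = s"
    "((\<lambda>y. u (the_inv (coord P) y)) has_derivative D) (at (coord P x) within coord P ` closed_simplex P s)"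
  using assms maximal_in by (auto simp: differential_def inter_def)

text \<open>The parameters of an interior point can be changed a little in every direction. This
  lets derivatives taken within the simplex be tested on all tangent vectors.\<close>

lemma tangent_step:
  assumes s: "s \<in> cplx P" and x: "x \<in> inter s" and \<xi>: "\<xi> \<in> tangent P s" and V: "open V" "x \<in> V"
  shows "\<forall>\<^sub>F t in at (0::real). \<exists>y\<in>closed_simplex P s \<inter> V. coord P y = coord P x + t *\<^sub>R \<xi>"
proof -
  let ?J = "free_vertices s"
  define c where "c = param s x"
  have c: "c \<in> pint s" unfolding c_def by (rule param_pint[OF s x])
  define d where "d t = (\<lambda>i\<in>?J. c i + t * dual s i \<xi>)" for t :: real
  have lim: "((\<lambda>t. c i + t * dual s i \<xi>) \<longlongrightarrow> c i) (at 0)" for i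
    by (auto intro!: tendsto_eq_intros)
  have "\<forall>\<^sub>F t in at 0. 0 < c i + t * dual s i \<xi>" if "i \<in> ?J" for i
    using c that by (intro order_tendstoD(1)[OF lim]) (auto simp: pint_def)
  then have 1: "\<forall>\<^sub>F t in at 0. \<forall>i\<in>?J. 0 < c i + t * dual s i \<xi>"
    using free_finite[OF s] by (simp add: eventually_ball_finite)
  have "((\<lambda>t. \<Sum>i\<in>?J. c i + t * dual s i \<xi>) \<longlongrightarrow> (\<Sum>i\<in>?J. c i)) (at 0)"
    by (intro tendsto_sum lim)
  then have 2: "\<forall>\<^sub>F t in at 0. (\<Sum>i\<in>?J. c i + t * dual s i \<xi>) < 1"
    using c by (intro order_tendstoD(2)) (auto simp: pint_def)
  have aff: "affine_map s (d t) = coord P x + t *\<^sub>R \<xi>" for t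
  proof -
    have "affine_map s (d t) - affine_map s c = t *\<^sub>R (\<Sum>i\<in>?J. dual s i \<xi> *\<^sub>R frame P s i)"
      unfolding affine_map_diff scaleR_sum_right by (intro sum.cong refl) (simp add: d_def)
    also have "\<dots> = t *\<^sub>R \<xi>" using tangent_expand[OF s \<xi>] by simp
    finally show ?thesis using coord_affine[OF s inter_closed[OF x]] by (simp add: c_def algebra_simps)
  qed
  obtain W where W: "open W" "W \<inter> range (coord P) = the_inv (coord P) -` V \<inter> range (coord P)"
    using inv_coord_continuous V(1) by (metis continuous_on_open_invariant)
  have "coord P x \<in> W" using W V by (metis IntE IntI inv_coord rangeI vimageI)
  moreover have "((\<lambda>t. coord P x + t *\<^sub>R \<xi>) \<longlongrightarrow> coord P x) (at 0)" by (auto intro!: tendsto_eq_intros)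
  ultimately have 3: "\<forall>\<^sub>F t in at 0. coord P x + t *\<^sub>R \<xi> \<in> W" using W(1) by (rule topological_tendstoD[rotated 2])
  show ?thesis using 1 2 3
  proof eventually_elim
    case (elim t)
    have "d t \<in> pint s" using elim by (simp add: pint_def d_def)
    then have dt: "d t \<in> param_simplex s" using pint_subset by blast
    have cc: "coord P (chart s (d t)) = coord P x + t *\<^sub>R \<xi>" using coord_chart[OF s dt] aff by simp
    then have "chart s (d t) \<in> V" using elim(3) W(2) by (metis IntE IntI inv_coord rangeI vimageE)
    then show ?case using cc chart_closed[OF s dt] by blast
  qed
qed

text \<open>The simplex may have smaller dimension than the Euclidean space, so a derivative within
  it is determined on tangent vectors only. These are approached by short steps that stay in the
  simplex.\<close>

lemma differential_unique:
  assumes D: "differential u x s D" and D': "((\<lambda>y. u (the_inv (coord P) y)) has_derivative D') (at (coord P x) within coord P ` closed_simplex P s)"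
    and \<xi>: "\<xi> \<in> tangent P s"
  shows "D' \<xi> = D \<xi>"
proof -
  have "((\<lambda>y. u (the_inv (coord P) y) - u (the_inv (coord P) y)) has_derivative (\<lambda>h. D' h - D h)) (at (coord P x) within coord P ` closed_simplex P s)"
    by (intro has_derivative_diff D' differentialD(6)[OF D])
  then have E: "bounded_linear (\<lambda>h. D' h - D h)" "\<And>e. 0 < e \<Longrightarrow> \<exists>d>0. \<forall>y\<in>coord P ` closed_simplex P s. norm (y - coord P x) < d \<longrightarrow>
      norm (D' (y - coord P x) - D (y - coord P x)) \<le> e * norm (y - coord P x)"
    unfolding has_derivative_within_alt by (auto simp: abs_minus_commute)
  have "\<bar>D' \<xi> - D \<xi>\<bar> \<le> e * norm \<xi>" if e: "0 < e" for e
  proof -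
    obtain d where d: "0 < d" "\<And>y. y \<in> coord P ` closed_simplex P s \<Longrightarrow> norm (y - coord P x) < d \<Longrightarrow>
      norm (D' (y - coord P x) - D (y - coord P x)) \<le> e * norm (y - coord P x)" using E(2)[OF e] by blast
    have "((\<lambda>t::real. norm (t *\<^sub>R \<xi>)) \<longlongrightarrow> 0) (at 0)" by (auto intro!: tendsto_eq_intros)
    then have "\<forall>\<^sub>F t in at 0. norm (t *\<^sub>R \<xi>) < d" using d(1) by (rule order_tendstoD(2))
    moreover have "\<forall>\<^sub>F t in at (0::real). t \<noteq> 0" by (simp add: eventually_at_filter)
    ultimately have "\<forall>\<^sub>F t in at (0::real). \<bar>D' \<xi> - D \<xi>\<bar> \<le> e * norm \<xi>"
      using tangent_step[OF differentialD(4,2)[OF D] \<xi> open_UNIV UNIV_I]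
    proof eventually_elim
      case (elim t)
      then have "norm (D' (t *\<^sub>R \<xi>) - D (t *\<^sub>R \<xi>)) \<le> e * norm (t *\<^sub>R \<xi>)"
        using d(2)[of "coord P x + t *\<^sub>R \<xi>"] by (metis IntE add_diff_cancel_left' imageI)
      moreover have "D' (t *\<^sub>R \<xi>) - D (t *\<^sub>R \<xi>) = t * (D' \<xi> - D \<xi>)"
        using linear_scale[OF bounded_linear.linear[OF E(1)], of t \<xi>] by simp
      ultimately have "\<bar>t\<bar> * \<bar>D' \<xi> - D \<xi>\<bar> \<le> \<bar>t\<bar> * (e * norm \<xi>)" by (simp add: abs_mult ac_simps)
      then show ?case using elim(2) by simp
    qed
    then show ?thesis by simp
  qed
  then have le: "\<And>e. 0 < e \<Longrightarrow> \<bar>D' \<xi> - D \<xi>\<bar> \<le> e * norm \<xi>" .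
  have "\<bar>D' \<xi> - D \<xi>\<bar> \<le> 0"
  proof (rule field_le_epsilon)
    fix e :: real assume e: "0 < e"
    have "\<bar>D' \<xi> - D \<xi>\<bar> \<le> e / (norm \<xi> + 1) * norm \<xi>" using e by (intro le) (simp add: add_nonneg_pos)
    also have "\<dots> \<le> e" using e by (simp add: field_simps add_pos_nonneg)
    finally show "\<bar>D' \<xi> - D \<xi>\<bar> \<le> 0 + e" by simp
  qed
  then show ?thesis by simp
qed

lemma inner_product_frame:
  assumes s: "s \<in> cplx P" and B: "inner_product_on (tangent P s) B" and G: "G \<in> tangent P s" and \<xi>: "\<xi> \<in> tangent P s"
  shows "B G \<xi> = (\<Sum>i\<in>free_vertices s. dual s i \<xi> * B G (frame P s i))"
proof -
  have fr: "frame P s i \<in> tangent P s" if "i \<in> free_vertices s" for i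
    using that frame_tangent[OF s] by (simp add: free_vertices_def)
  have "B G (\<Sum>i\<in>free_vertices s. dual s i \<xi> *\<^sub>R frame P s i) = (\<Sum>i\<in>free_vertices s. dual s i \<xi> * B G (frame P s i))"
    by (rule inner_sum(2)[OF B tangent_subspace fr G])
  then show ?thesis using tangent_expand[OF s \<xi>] by simp
qed

text \<open>Riesz representation by counting dimensions: the map that sends G to the vector with
  coefficients \<open>B G (frame P s i)\<close> is injective on the tangent space because B is
  positive, hence onto.\<close>

lemma riesz_tangent:
  assumes s: "s \<in> cplx P" and B: "inner_product_on (tangent P s) B" and D: "linear D"
  obtains G where "G \<in> tangent P s" "\<And>\<xi>. \<xi> \<in> tangent P s \<Longrightarrow> B G \<xi> = D \<xi>"
proof -
  let ?J = "free_vertices s" and ?T = "tangent P s"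
  \<comment> \<open>B is bilinear on the tangent space only; composing with the projection
    \<open>\<pi>\<close> gives a map that is linear on the whole Euclidean space.\<close>
  define \<pi> where "\<pi> x = (\<Sum>i\<in>?J. dual s i x *\<^sub>R frame P s i)" for x
  have \<pi>T: "\<pi> x \<in> ?T" for x unfolding \<pi>_def by (rule sum_frame_tangent[OF s])
  have \<pi>id: "\<pi> x = x" if "x \<in> ?T" for x unfolding \<pi>_def using tangent_expand[OF s that] by simp
  have \<pi>lin: "linear \<pi>"
    unfolding \<pi>_def using dual_linear[OF s] by (intro linear_compose_sum ballI) (auto intro!: linearI simp: linear_add linear_scale scaleR_add_left)
  have fr: "frame P s i \<in> ?T" if "i \<in> ?J" for i
    using that frame_tangent[OF s] by (simp add: free_vertices_def)
  have "linear (\<lambda>x. B (\<pi> x) (frame P s i))" if "i \<in> ?J" for i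
    using B \<pi>T fr[OF that] by (intro linearI) (auto simp: linear_add[OF \<pi>lin] linear_scale[OF \<pi>lin] inner_product_on_def)
  then have lin: "linear (\<lambda>x. \<Sum>i\<in>?J. B (\<pi> x) (frame P s i) *\<^sub>R frame P s i)" (is "linear ?\<phi>")
  proof (intro linear_compose_sum ballI)
    fix i assume "\<And>i. i \<in> ?J \<Longrightarrow> linear (\<lambda>x. B (\<pi> x) (frame P s i))" "i \<in> ?J"
    then have l: "linear (\<lambda>x. B (\<pi> x) (frame P s i))" by blast
    show "linear (\<lambda>x. B (\<pi> x) (frame P s i) *\<^sub>R frame P s i)"
      by (rule linearI) (simp_all add: linear_add[OF l] linear_scale[OF l] scaleR_add_left)
  qed
  have \<phi>T: "?\<phi> x \<in> ?T" for x by (rule sum_frame_tangent[OF s])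
  have inj: "x = 0" if x: "x \<in> ?T" and z: "?\<phi> x = 0" for x
  proof -
    have "B x (frame P s i) = 0" if "i \<in> ?J" for i
      using frame_independent[OF s z that] by (simp add: \<pi>id[OF x])
    then have "B x x = 0" unfolding inner_product_frame[OF s B x x] by simp
    moreover have "0 < B \<xi> \<xi>" if "\<xi> \<in> ?T" "\<xi> \<noteq> 0" for \<xi>
      using B that unfolding inner_product_on_def by blast
    ultimately show ?thesis using x by force
  qed
  have "inj_on ?\<phi> ?T"
    using inj linear_injective_on_subspace_0[OF lin tangent_subspace] by blast
  then have "dim (?\<phi> ` ?T) = dim ?T"
    using tangent_subspace by (intro dim_image_eq lin) (simp add: span_eq_iff[THEN iffD2])
  then have onto: "?\<phi> ` ?T = ?T"
    using \<phi>T linear_subspace_image[OF lin tangent_subspace] tangent_subspace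
    by (intro subspace_dim_equal) auto
  have "(\<Sum>i\<in>?J. D (frame P s i) *\<^sub>R frame P s i) \<in> ?\<phi> ` ?T"
    unfolding onto by (rule sum_frame_tangent[OF s])
  then obtain G where G: "G \<in> ?T" and eq: "(\<Sum>i\<in>?J. D (frame P s i) *\<^sub>R frame P s i) = ?\<phi> G" by blast
  have GD: "B G (frame P s i) = D (frame P s i)" if "i \<in> ?J" for i
    using arg_cong[OF eq, of "dual s i"] by (simp add: dual_sum[OF s that] \<pi>id[OF G])
  have "B G \<xi> = D \<xi>" if \<xi>: "\<xi> \<in> ?T" for \<xi>
  proof -
    have "D \<xi> = D (\<Sum>i\<in>?J. dual s i \<xi> *\<^sub>R frame P s i)" using tangent_expand[OF s \<xi>] by simp
    also have "\<dots> = (\<Sum>i\<in>?J. dual s i \<xi> * D (frame P s i))" by (simp add: linear_sum[OF D] linear_scale[OF D])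
    finally show ?thesis unfolding inner_product_frame[OF s B G \<xi>] using GD by simp
  qed
  with G that show thesis by blast
qed

text \<open>Resolves the definite description: a representing vector exists by
  \<open>riesz_tangent\<close>, and two candidates coincide because their difference has length
  zero.\<close>

lemma rgrad_differential:
  assumes D: "differential u x s D"
  shows "rgrad P u x \<in> tangent P s" "\<And>\<xi>. \<xi> \<in> tangent P s \<Longrightarrow> ginner P x (rgrad P u x) \<xi> = D \<xi>"
proof -
  let ?B = "ginner P x"
  have Bx: "?B = riem P s (coord P x)" by (simp add: ginner_def differentialD(5)[OF D] fun_eq_iff)
  have B: "inner_product_on (tangent P s) ?B" unfolding Bx using differentialD(3)[OF D] by (simp add: good_def)
  let ?Q = "\<lambda>G. G \<in> tangent P s \<and>
        (\<exists>D. ((\<lambda>y. u (the_inv (coord P) y)) has_derivative D)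
                (at (coord P x) within coord P ` closed_simplex P s) \<and>
             (\<forall>\<xi>\<in>tangent P s. ?B G \<xi> = D \<xi>))"
  have lin: "linear D" using has_derivative_linear[OF differentialD(6)[OF D]] .
  obtain G where G: "G \<in> tangent P s" "\<And>\<xi>. \<xi> \<in> tangent P s \<Longrightarrow> ?B G \<xi> = D \<xi>"
    using riesz_tangent[OF differentialD(4)[OF D] B lin] by blast
  have uniq: "G' = G" if Q: "?Q G'" for G'
  proof -
    obtain D' where D': "((\<lambda>y. u (the_inv (coord P) y)) has_derivative D') (at (coord P x) within coord P ` closed_simplex P s)"
      "\<And>\<xi>. \<xi> \<in> tangent P s \<Longrightarrow> ?B G' \<xi> = D' \<xi>" using Q by blast
    have T: "G' \<in> tangent P s" using Q by blast
    have dT: "G' - G \<in> tangent P s" by (rule subspace_diff[OF tangent_subspace T G(1)])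
    have "?B G' (G' - G) = ?B G (G' - G)"
      using D'(2)[OF dT] G(2)[OF dT] differential_unique[OF D D'(1) dT] by simp
    moreover have "?B ((G' - G) + G) (G' - G) = ?B (G' - G) (G' - G) + ?B G (G' - G)"
      using B dT G(1) unfolding inner_product_on_def by blast
    ultimately have "?B (G' - G) (G' - G) = 0" by simp
    moreover have "0 < ?B \<xi> \<xi>" if "\<xi> \<in> tangent P s" "\<xi> \<noteq> 0" for \<xi>
      using B that unfolding inner_product_on_def by blast
    ultimately have "G' - G = 0" using dT by force
    then show ?thesis by simp
  qed
  have "?Q G" using G differentialD(6)[OF D] by blast
  then have "rgrad P u x = G"
    unfolding rgrad_def differentialD(5)[OF D] using uniq by (rule the_equality)
  then show "rgrad P u x \<in> tangent P s" "\<And>\<xi>. \<xi> \<in> tangent P s \<Longrightarrow> ?B (rgrad P u x) \<xi> = D \<xi>"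
    using G by auto
qed

lemma differential_bound:
  assumes D: "differential u x s D" and U: "open U" "x \<in> U" and \<xi>: "\<xi> \<in> tangent P s"
    and L: "\<And>y. y \<in> U \<Longrightarrow> y \<in> closed_simplex P s \<Longrightarrow> \<bar>u y - u x\<bar> \<le> L * dist (coord P y) (coord P x)"
  shows "\<bar>D \<xi>\<bar> \<le> L * norm \<xi>"
proof -
  have E: "bounded_linear D" "\<And>e. 0 < e \<Longrightarrow> \<exists>d>0. \<forall>y\<in>coord P ` closed_simplex P s. norm (y - coord P x) < d \<longrightarrow>
      norm (u (the_inv (coord P) y) - u x - D (y - coord P x)) \<le> e * norm (y - coord P x)"
    using differentialD(6)[OF D] unfolding has_derivative_within_alt by auto
  have le: "\<bar>D \<xi>\<bar> \<le> (L + e) * norm \<xi>" if e: "0 < e" for e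
  proof -
    obtain d where d: "0 < d" "\<And>y. y \<in> coord P ` closed_simplex P s \<Longrightarrow> norm (y - coord P x) < d \<Longrightarrow>
      norm (u (the_inv (coord P) y) - u x - D (y - coord P x)) \<le> e * norm (y - coord P x)" using E(2)[OF e] by blast
    have "((\<lambda>t::real. norm (t *\<^sub>R \<xi>)) \<longlongrightarrow> 0) (at 0)" by (auto intro!: tendsto_eq_intros)
    then have "\<forall>\<^sub>F t in at 0. norm (t *\<^sub>R \<xi>) < d" using d(1) by (rule order_tendstoD(2))
    moreover have "\<forall>\<^sub>F t in at (0::real). t \<noteq> 0" by (simp add: eventually_at_filter)
    ultimately have "\<forall>\<^sub>F t in at (0::real). \<bar>D \<xi>\<bar> \<le> (L + e) * norm \<xi>"
      using tangent_step[OF differentialD(4,2)[OF D] \<xi> U]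
    proof eventually_elim
      case (elim t)
      then obtain y where y: "y \<in> closed_simplex P s" "y \<in> U" "coord P y = coord P x + t *\<^sub>R \<xi>" by blast
      have dy: "coord P y - coord P x = t *\<^sub>R \<xi>" by (simp add: y(3))
      have "norm (u (the_inv (coord P) (coord P y)) - u x - D (coord P y - coord P x)) \<le> e * norm (coord P y - coord P x)"
        using y(1) elim(1) by (intro d(2)) (auto simp: dy)
      then have "\<bar>u y - u x - D (t *\<^sub>R \<xi>)\<bar> \<le> e * norm (t *\<^sub>R \<xi>)"
        unfolding dy by simp
      moreover have "\<bar>u y - u x\<bar> \<le> L * norm (t *\<^sub>R \<xi>)" using L[OF y(2,1)] y(3) by (simp add: dist_norm)
      ultimately have "\<bar>D (t *\<^sub>R \<xi>)\<bar> \<le> (L + e) * norm (t *\<^sub>R \<xi>)" unfolding distrib_right by linarith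
      then have "\<bar>t\<bar> * \<bar>D \<xi>\<bar> \<le> \<bar>t\<bar> * ((L + e) * norm \<xi>)"
        using linear_scale[OF bounded_linear.linear[OF E(1)], of t \<xi>] by (simp add: abs_mult ac_simps)
      then show ?case using elim(2) by simp
    qed
    then show ?thesis by simp
  qed
  show ?thesis
  proof (rule field_le_epsilon)
    fix e :: real assume e: "0 < e"
    have "\<bar>D \<xi>\<bar> \<le> (L + e / (norm \<xi> + 1)) * norm \<xi>" using e by (intro le) (simp add: add_nonneg_pos)
    also have "\<dots> = L * norm \<xi> + e / (norm \<xi> + 1) * norm \<xi>" by (simp add: distrib_right)
    also have "e / (norm \<xi> + 1) * norm \<xi> \<le> e" using e by (simp add: field_simps add_pos_nonneg)
    finally show "\<bar>D \<xi>\<bar> \<le> L * norm \<xi> + e" by simp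
  qed
qed

abbreviation lip_in :: "'v set \<Rightarrow> real \<Rightarrow> (('v \<Rightarrow> real) \<Rightarrow> real) \<Rightarrow> bool" where
  "lip_in s \<equiv> finite_index.lip (free_vertices s)"

abbreviation partial :: "'v set \<Rightarrow> (('v \<Rightarrow> real) \<Rightarrow> real) \<Rightarrow> 'v \<Rightarrow> ('v \<Rightarrow> real) \<Rightarrow> real" where
  "partial s v i \<equiv> finite_index.dd (free_vertices s) v (finite_index.unit i)"

lemma inter_preimage_open:
  assumes "maximal s" "open U" "x \<in> inter s" "x \<in> U"
  obtains \<delta> where "0 < \<delta>" "\<And>y. dist (coord P y) (coord P x) < \<delta> \<Longrightarrow> y \<in> inter s \<inter> U"
proof -
  have "open (inter s \<inter> U)" using inter_open[OF assms(1)] assms(2) by blast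
  then obtain W where W: "open W" "W \<inter> range (coord P) = the_inv (coord P) -` (inter s \<inter> U) \<inter> range (coord P)"
    using inv_coord_continuous by (metis continuous_on_open_invariant)
  have "coord P x \<in> W" using W assms by (metis IntE IntI inv_coord rangeI vimageI)
  then obtain \<delta> where \<delta>: "0 < \<delta>" "ball (coord P x) \<delta> \<subseteq> W" using W(1) open_contains_ball by blast
  have "y \<in> inter s \<inter> U" if "dist (coord P y) (coord P x) < \<delta>" for y
  proof -
    have "coord P y \<in> W" using \<delta>(2) that by (auto simp: dist_commute)
    then have "coord P y \<in> the_inv (coord P) -` (inter s \<inter> U)" using W(2) by blast
    then show ?thesis by simp
  qed
  with \<delta>(1) that show thesis by blast
qed

text \<open>The extension v lives on the whole parameter space, where Rademacher's theorem is
  available. Near an interior point belonging to U it agrees with u in the chart, so its derivative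
  is that of u; the functionals \<open>dual s i\<close> convert Euclidean increments into parameter
  increments.\<close>

theorem chart_extension:
  assumes s: "maximal s" and U: "open U" and u: "glipschitz_on P U u"
  obtains K v where "lip_in s K v" "\<And>c. c \<in> pint s \<Longrightarrow> chart s c \<in> U \<Longrightarrow> v c = u (chart s c)"
    "AE c in PM s. c \<in> pint s \<longrightarrow> chart s c \<in> U \<longrightarrow>
       differential u (chart s c) s (\<lambda>\<xi>. \<Sum>i\<in>free_vertices s. partial s v i c * dual s i \<xi>)"
proof -
  let ?J = "free_vertices s"
  have sK: "s \<in> cplx P" using s maximal_in by blast
  interpret finite_index ?J by (rule finite_index_free[OF sK])
  obtain L where L: "0 \<le> L" "\<And>s x y. maximal s \<Longrightarrow> x \<in> U \<Longrightarrow> y \<in> U \<Longrightarrow> x \<in> closed_simplex P s \<Longrightarrow> y \<in> closed_simplex P s \<Longrightarrow>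
    \<bar>u x - u y\<bar> \<le> L * dist (coord P x) (coord P y)" using glip_simplex[OF u] by blast
  define W where "W = {c \<in> pint s. chart s c \<in> U}"
  define F where "F = (\<Sum>i\<in>?J. norm (frame P s i))"
  have F: "0 \<le> F" by (simp add: F_def sum_nonneg)
  have affine: "norm (affine_map s c - affine_map s c') \<le> F * l1 c c'" for c c'
    unfolding affine_map_diff l1_def sum_distrib_left
  proof (rule order_trans[OF norm_sum], rule sum_mono)
    fix i assume i: "i \<in> ?J"
    have "norm (frame P s i) \<le> F" unfolding F_def using i by (intro member_le_sum) auto
    then show "norm ((c i - c' i) *\<^sub>R frame P s i) \<le> F * \<bar>c i - c' i\<bar>"
      by (simp add: mult.commute mult_right_mono)
  qed
  have "\<bar>u (chart s c) - u (chart s c')\<bar> \<le> (L * F) * l1 c c'" if "c \<in> W" "c' \<in> W" for c c'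
  proof -
    have p: "c \<in> param_simplex s" "c' \<in> param_simplex s" using that pint_subset by (auto simp: W_def)
    have "\<bar>u (chart s c) - u (chart s c')\<bar> \<le> L * dist (coord P (chart s c)) (coord P (chart s c'))"
      using that p by (intro L(2)[OF s] chart_closed sK) (auto simp: W_def)
    also have "\<dots> \<le> L * (F * l1 c c')"
      using affine L(1) by (intro mult_left_mono) (auto simp: coord_chart[OF sK] p dist_norm)
    finally show ?thesis by (simp add: mult.assoc)
  qed
  then obtain v where v: "lip (L * F) v" "\<And>c. c \<in> W \<Longrightarrow> v c = u (chart s c)"
    using mcshane_extension[of "L * F" W "\<lambda>c. u (chart s c)"] L(1) F by (metis mult_nonneg_nonneg)
  have "\<exists>K. \<forall>i\<in>?J. \<forall>x. \<bar>dual s i x\<bar> \<le> K i * norm x"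
  proof -
    have "\<forall>i\<in>?J. \<exists>K. \<forall>x. \<bar>dual s i x\<bar> \<le> K * norm x"
      using bounded_linear.bounded[OF dual_bounded_linear[OF sK]] by (auto simp: mult.commute)
    then show ?thesis by metis
  qed
  then obtain K where K: "\<And>i x. i \<in> ?J \<Longrightarrow> \<bar>dual s i x\<bar> \<le> K i * norm x" by blast
  \<comment> \<open>C bounds the l1 distance of parameters by the Euclidean distance of points;
    Rademacher's estimate is therefore used with \<open>e / C\<close>.\<close>
  define C where "C = (\<Sum>i\<in>?J. \<bar>K i\<bar>) + 1"
  have C: "0 < C" by (simp add: C_def sum_nonneg add_nonneg_pos)
  have dualC: "(\<Sum>i\<in>?J. \<bar>dual s i x\<bar>) \<le> C * norm x" for x
  proof -
    have "(\<Sum>i\<in>?J. \<bar>dual s i x\<bar>) \<le> (\<Sum>i\<in>?J. \<bar>K i\<bar> * norm x)"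
      by (intro sum_mono order_trans[OF K] mult_right_mono) auto
    also have "\<dots> \<le> C * norm x" by (simp add: C_def sum_distrib_right distrib_right)
    finally show ?thesis .
  qed
  have "AE c in PM s. c \<in> pint s \<longrightarrow> chart s c \<in> U \<longrightarrow>
       differential u (chart s c) s (\<lambda>\<xi>. \<Sum>i\<in>?J. dd v (unit i) c * dual s i \<xi>)"
    using rademacher[OF v(1)] Lam(2)[OF s]
  proof eventually_elim
    case (elim c)
    show ?case
    proof (intro impI)
      assume cp: "c \<in> pint s" and cU: "chart s c \<in> U"
      have cs: "c \<in> param_simplex s" using cp pint_subset by blast
      let ?x = "chart s c"
      let ?D = "\<lambda>\<xi>. \<Sum>i\<in>?J. dd v (unit i) c * dual s i \<xi>"
      have xi: "?x \<in> inter s" by (rule chart_pint[OF sK cp])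
      obtain \<delta> where \<delta>: "0 < \<delta>" "\<And>y. dist (coord P y) (coord P ?x) < \<delta> \<Longrightarrow> y \<in> inter s \<inter> U"
        using inter_preimage_open[OF s U xi cU] by blast
      have bl: "bounded_linear ?D"
        by (intro bounded_linear_sum bounded_linear_const_mult dual_bounded_linear sK)
      have "((\<lambda>y. u (the_inv (coord P) y)) has_derivative ?D) (at (coord P ?x) within coord P ` closed_simplex P s)"
        unfolding has_derivative_within_alt
      proof (intro conjI bl allI impI)
        fix e :: real assume e: "0 < e"
        obtain d where d: "0 < d" "\<And>c'. l1 c' c < d \<Longrightarrow>
          \<bar>v c' - v c - (\<Sum>i\<in>?J. dd v (unit i) c * (c' i - c i))\<bar> \<le> e / C * l1 c' c"
        proof -
          have "0 < e / C" using e C by simp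
          then have "\<exists>d>0. \<forall>c'. l1 c' c < d \<longrightarrow>
            \<bar>v c' - v c - (\<Sum>i\<in>?J. dd v (unit i) c * (c' i - c i))\<bar> \<le> e / C * l1 c' c" using elim(1) by blast
          then show thesis using that by blast
        qed
        have "norm (u (the_inv (coord P) y) - u (the_inv (coord P) (coord P ?x)) - ?D (y - coord P ?x)) \<le> e * norm (y - coord P ?x)"
          if y: "y \<in> coord P ` closed_simplex P s" "norm (y - coord P ?x) < min \<delta> (d / C)" for y
        proof -
          obtain x' where x': "y = coord P x'" using y by blast
          have x'U: "x' \<in> inter s" "x' \<in> U" using \<delta>(2)[of x'] y(2) x' by (auto simp: dist_norm)
          define c' where "c' = param s x'"
          have ch: "chart s c' = x'" unfolding c'_def by (rule chart_param[OF sK inter_closed[OF x'U(1)]])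
          have c'W: "c' \<in> W" using param_pint[OF sK x'U(1)] x'U ch by (simp add: W_def c'_def)
          have yA: "y = affine_map s c'" using coord_affine[OF sK inter_closed[OF x'U(1)]] by (simp add: x' c'_def)
          have dif: "dual s i (y - coord P ?x) = c' i - c i" if "i \<in> ?J" for i
            unfolding yA coord_chart[OF sK cs] affine_map_diff by (rule dual_sum[OF sK that])
          have l: "l1 c' c \<le> C * norm (y - coord P ?x)"
            using dualC[of "y - coord P ?x"] dif by (simp add: l1_def)
          also have "\<dots> < C * (d / C)" using C y(2) by (intro mult_strict_left_mono) auto
          finally have "l1 c' c < d" using C by simp
          then have "\<bar>v c' - v c - (\<Sum>i\<in>?J. dd v (unit i) c * (c' i - c i))\<bar> \<le> e / C * l1 c' c" by (rule d(2))
          also have "\<dots> \<le> e / C * (C * norm (y - coord P ?x))" using l e C by (intro mult_left_mono) auto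
          also have "\<dots> = e * norm (y - coord P ?x)" using C by simp
          also have "v c' = u (the_inv (coord P) y)" using v(2)[OF c'W] ch x' by simp
          also have "v c = u (the_inv (coord P) (coord P ?x))" using v(2)[of c] cp cU by (simp add: W_def)
          also have "(\<Sum>i\<in>?J. dd v (unit i) c * (c' i - c i)) = ?D (y - coord P ?x)" using dif by simp
          finally show ?thesis by simp
        qed
        \<comment> \<open>The radius \<open>\<delta>\<close> keeps the point in the open simplex and
          in U, and \<open>d / C\<close> puts its parameters in the range of the derivative
          estimate.\<close>
        then show "\<exists>d>0. \<forall>y\<in>coord P ` closed_simplex P s. norm (y - coord P ?x) < d \<longrightarrow>
            norm (u (the_inv (coord P) y) - u (the_inv (coord P) (coord P ?x)) - ?D (y - coord P ?x)) \<le> e * norm (y - coord P ?x)"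
          using \<delta>(1) d(1) C by (intro exI[of _ "min \<delta> (d / C)"]) auto
      qed
      moreover have "good Lam s (coord P ?x)" using elim(2) cp by (simp add: coord_chart[OF sK cs])
      ultimately show "differential u ?x s ?D" using s xi by (simp add: differential_def)
    qed
  qed
  with v show thesis using that by (auto simp: W_def)
qed

end

section \<open>Uniqueness of Sobolev gradients\<close>

lemma choice_on: "(\<And>j. j \<in> J \<Longrightarrow> \<exists>m. Q j m) \<Longrightarrow> \<exists>m. \<forall>j\<in>J. Q j (m j)"
  by metis

text \<open>Off the closed box \<open>\<psi>\<close> vanishes for all small increments, so the
  derivative is zero; the faces of the box are null sets.\<close>

lemma (in finite_index) AE_dd_within:
  assumes \<psi>: "lip L \<psi>" "within_box a b \<psi>"
  shows "AE c in M. c \<notin> box a b \<longrightarrow> dd \<psi> q c = 0"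
proof -
  have "AE c in M. c i \<noteq> r" if i: "i \<in> J" for i r
  proof (rule AE_along[where q="unit i"])
    show "{c \<in> space M. c i \<noteq> r} \<in> sets M" using i by measurable
    fix c :: "'i \<Rightarrow> real"
    have "AE t in lborel. t \<noteq> r - c i" by (rule AE_lborel_singleton)
    then show "AE t in lborel. shift (unit i) t c i \<noteq> r"
      by eventually_elim (use i in \<open>auto simp: shift_def unit_def\<close>)
  qed
  then have "AE c in M. \<forall>i\<in>J. c i \<noteq> a i \<and> c i \<noteq> b i"
    by (subst AE_finite_all) auto
  then show ?thesis using AE_space AE_dd[OF \<psi>(1), of q]
  proof eventually_elim
    case (elim c)
    show ?case
    proof
      assume "c \<notin> box a b"
      then obtain i where i: "i \<in> J" "c i < a i \<or> b i < c i"
        using elim(1,2) by (force simp: box_def)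
      have lim: "((\<lambda>t. c i + t * q i) \<longlongrightarrow> c i) (at 0)" by (auto intro!: tendsto_eq_intros)
      have "\<forall>\<^sub>F t in at 0. c i + t * q i < a i \<or> b i < c i + t * q i"
        using i(2)
      proof
        assume "c i < a i"
        from order_tendstoD(2)[OF lim this] show ?thesis by eventually_elim simp
      next
        assume "b i < c i"
        from order_tendstoD(1)[OF lim this] show ?thesis by eventually_elim simp
      qed
      then have "\<forall>\<^sub>F t in at 0. quot \<psi> q t c = 0"
      proof eventually_elim
        case (elim t)
        have "\<psi> (shift q t c) = 0" "\<psi> (shift q 0 c) = 0"
          using \<psi>(2) elim i by (force simp: within_box_def shift_def)+
        then show ?case by (simp add: quot_def)
      qed
      then have "((\<lambda>t. quot \<psi> q t c) \<longlongrightarrow> 0) (at 0)" by (rule tendsto_eventually)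
      then show "dd \<psi> q c = 0" by (rule ddI)
    qed
  qed
qed

text \<open>On a set of finite measure, a function at finite L2 distance from a bounded one is
  integrable, by the pointwise bound \<open>le\<close>.\<close>

lemma (in finite_index) integrable_near_bounded:
  fixes h p :: "_ \<Rightarrow> real"
  assumes [measurable]: "h \<in> borel_measurable M" "p \<in> borel_measurable M"
    and B: "AE c in M. c \<in> box a b \<longrightarrow> \<bar>p c\<bar> \<le> B"
    and fin: "(\<integral>\<^sup>+c. ennreal ((p c - h c)\<^sup>2) * indicator (box a b) c \<partial>M) < \<infinity>"
  shows "integrable M (\<lambda>c. indicator (box a b) c * h c)"
proof (rule integrableI_bounded)
  have le: "\<bar>x\<bar> \<le> \<bar>B\<bar> + 1 + (y - x)\<^sup>2" if "\<bar>y\<bar> \<le> B" for x y :: real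
  proof -
    have "\<bar>y - x\<bar> \<le> 1 + (y - x)\<^sup>2"
    proof -
      have "2 * \<bar>y - x\<bar> \<le> (y - x)\<^sup>2 + 1" using sum_squares_bound[of "\<bar>y - x\<bar>" 1] by simp
      then show ?thesis using zero_le_power2[of "y - x"] by argo
    qed
    then show ?thesis using that by linarith
  qed
  have "(\<integral>\<^sup>+c. ennreal (norm (indicator (box a b) c * h c)) \<partial>M) \<le>
      (\<integral>\<^sup>+c. ennreal (\<bar>B\<bar> + 1) * indicator (box a b) c + ennreal ((p c - h c)\<^sup>2) * indicator (box a b) c \<partial>M)"
    using B by (intro nn_integral_mono_AE, eventually_elim)
      (auto simp: indicator_def simp flip: ennreal_plus intro!: ennreal_leI le)
  also have "\<dots> = ennreal (\<bar>B\<bar> + 1) * emeasure M (box a b) + (\<integral>\<^sup>+c. ennreal ((p c - h c)\<^sup>2) * indicator (box a b) c \<partial>M)"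
    by (subst nn_integral_add) (auto simp: nn_integral_cmult_indicator simp del: ennreal_plus)
  also have "\<dots> < \<infinity>" using fin emeasure_box[of a b] by (auto simp: ennreal_mult_less_top less_top simp del: ennreal_plus)
  finally show "(\<integral>\<^sup>+c. ennreal (norm (indicator (box a b) c * h c)) \<partial>M) < \<infinity>" .
qed measurable

lemma integrable_mult_bounded:
  fixes f g :: "_ \<Rightarrow> real"
  assumes f: "integrable M f" and [measurable]: "g \<in> borel_measurable M" and C: "AE x in M. \<bar>g x\<bar> \<le> C"
  shows "integrable M (\<lambda>x. f x * g x)"
proof (rule Bochner_Integration.integrable_bound[OF integrable_mult_left[OF integrable_abs[OF f], of C]])
  show "AE x in M. norm (f x * g x) \<le> norm (\<bar>f x\<bar> * C)"
    using C by eventually_elim (auto simp: abs_mult intro!: mult_left_mono)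
qed (use f in measurable)

text \<open>A form of Young's inequality that stands in for Cauchy-Schwarz when L2 convergence has
  to imply L1 convergence: on a box of finite measure the first term is small with e, the second by
  convergence.\<close>

lemma abs_sum_le_squares:
  assumes "0 < (e::real)" shows "\<bar>y\<bar> + \<bar>z\<bar> \<le> e + 1 / e * (y\<^sup>2 + z\<^sup>2)"
proof -
  have "2 * \<bar>x\<bar> * e \<le> x\<^sup>2 + e\<^sup>2" for x using sum_squares_bound[of "\<bar>x\<bar>" e] by simp
  from this[of y] this[of z] have "(\<bar>y\<bar> + \<bar>z\<bar>) * e \<le> e * e + (y\<^sup>2 + z\<^sup>2) / 2"
    unfolding power2_eq_square distrib_right by argo
  also have "\<dots> \<le> e * e + (y\<^sup>2 + z\<^sup>2)" by simp
  also have "\<dots> = (e + 1 / e * (y\<^sup>2 + z\<^sup>2)) * e" using assms by (simp add: field_simps)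
  finally show ?thesis using assms by (simp only: mult_le_cancel_right)
qed

context riem_polyhedron
begin

text \<open>Measurability for the completed volume does not pass through the chart directly, so m is
  first replaced by a Borel function; \<open>AE_chart\<close> controls the exceptional set.\<close>

lemma pull_back_measurable:
  fixes m :: "'x \<Rightarrow> real"
  assumes s: "maximal s" and m: "m \<in> borel_measurable (vol P)"
  obtains m' where "m' \<in> borel_measurable (PM s)" "AE c in PM s. c \<in> pint s \<longrightarrow> m (chart s c) = m' c"
proof -
  have sK: "s \<in> cplx P" using s maximal_in by blast
  obtain n where n: "n \<in> borel_measurable vol0" "AE x in vol0. m x = n x"
    using completion_ex_borel_measurable_real[of m vol0] m by (auto simp: vol_eq)
  have "AE x in vol P. m x = n x" using n(2) unfolding vol_eq AE_completion_iff .
  then have 1: "AE c in PM s. c \<in> pint s \<longrightarrow> m (chart s c) = n (chart s c)" by (rule AE_chart[OF s])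
  have "(\<lambda>c. n (chart s c)) \<in> borel_measurable (restrict_space (PM s) (param_simplex s))"
    using n(1) by (intro measurable_compose[OF chart_measurable[OF sK]]) (simp cong: measurable_cong_sets)
  then have 2: "(\<lambda>c. indicator (param_simplex s) c *\<^sub>R n (chart s c)) \<in> borel_measurable (PM s)"
    using param_simplex_sets[OF sK] by (subst (asm) borel_measurable_restrict_space_iff) auto
  show thesis
  proof (rule that[OF 2])
    show "AE c in PM s. c \<in> pint s \<longrightarrow> m (chart s c) = indicator (param_simplex s) c *\<^sub>R n (chart s c)"
      using 1 by eventually_elim (use pint_subset[of s] in \<open>auto simp: indicator_def\<close>)
  qed
qed

lemma riem_comp_measurable:
  assumes s: "maximal s" and ij: "i \<in> free_vertices s" "j \<in> free_vertices s"
  obtains r where "r \<in> borel_measurable (PM s)" "AE c in PM s. c \<in> pint s \<longrightarrow> riem_comp P s c i j = r c"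
proof -
  have sK: "s \<in> cplx P" using s maximal_in by blast
  have "(\<lambda>c. riem_comp P s c i j) \<in> borel_measurable (restrict_space (completion (PM s)) (param_simplex s))"
    using riemannian s ij by (auto simp: riemannian_polyhedron_def simplex_lebesgue_def)
  then have "(\<lambda>c. indicator (param_simplex s) c *\<^sub>R riem_comp P s c i j) \<in> borel_measurable (completion (PM s))"
    using param_simplex_sets[OF sK] by (subst (asm) borel_measurable_restrict_space_iff) auto
  then obtain r where r: "r \<in> borel_measurable (PM s)" "AE c in PM s. indicator (param_simplex s) c *\<^sub>R riem_comp P s c i j = r c"
    using completion_ex_borel_measurable_real by blast
  show thesis
  proof (rule that[OF r(1)])
    show "AE c in PM s. c \<in> pint s \<longrightarrow> riem_comp P s c i j = r c"
      using r(2) by eventually_elim (use pint_subset[of s] in \<open>auto simp: indicator_def\<close>)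
  qed
qed

lemma ginner_frame:
  assumes s: "maximal s" and x: "x \<in> inter s" and g: "good Lam s (coord P x)" and G: "G \<in> tangent P s" and i: "i \<in> free_vertices s"
  shows "ginner P x G (frame P s i) = (\<Sum>j\<in>free_vertices s. dual s j G * riem_comp P s (param s x) j i)"
proof -
  have sK: "s \<in> cplx P" using s maximal_in by blast
  have fr: "frame P s i \<in> tangent P s" if "i \<in> free_vertices s" for i
    using that frame_tangent[OF sK] by (simp add: free_vertices_def)
  have B: "inner_product_on (tangent P s) (riem P s (coord P x))" using g by (simp add: good_def)
  have "riem P s (coord P x) (\<Sum>j\<in>free_vertices s. dual s j G *\<^sub>R frame P s j) (frame P s i) = (\<Sum>j\<in>free_vertices s. dual s j G * riem P s (coord P x) (frame P s j) (frame P s i))"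
    by (rule inner_sum(1)[OF B tangent_subspace fr fr[OF i]])
  moreover have "ginner P x = riem P s (coord P x)" using x by (simp add: ginner_def inter_def fun_eq_iff)
  moreover have "riem P s (coord P x) (frame P s j) (frame P s i) = riem_comp P s (param s x) j i" for j
    by (simp add: riem_comp_def embed_param_point[OF sK] coord_affine[OF sK inter_closed[OF x]])
  ultimately show ?thesis using tangent_expand[OF sK G] by simp
qed

lemma ginner_le_gnorm:
  assumes g: "good Lam s (coord P x)" and x: "x \<in> inter s" and T: "\<xi> \<in> tangent P s" "\<eta> \<in> tangent P s"
  shows "(ginner P x \<xi> \<eta>)\<^sup>2 \<le> (Lam * norm \<eta>)\<^sup>2 * (gnorm P x \<xi>)\<^sup>2"
proof -
  let ?B = "ginner P x"
  have Bx: "?B = riem P s (coord P x)" using x by (simp add: ginner_def inter_def fun_eq_iff)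
  have B: "inner_product_on (tangent P s) ?B" unfolding Bx using g by (simp add: good_def)
  have nn: "0 \<le> ?B \<zeta> \<zeta>" if "\<zeta> \<in> tangent P s" for \<zeta>
  proof (cases "\<zeta> = 0")
    case True
    then show ?thesis using B that unfolding inner_product_on_def by (metis mult_zero_left order_refl scale_zero_left)
  qed (use B that in \<open>auto simp: inner_product_on_def less_imp_le\<close>)
  have cs: "(?B \<xi> \<eta>)\<^sup>2 \<le> ?B \<xi> \<xi> * ?B \<eta> \<eta>"
  proof (cases "\<eta> = 0")
    case True
    have "?B \<eta> \<xi> = 0" using B T True unfolding inner_product_on_def by (metis mult_zero_left scale_zero_left)
    then have "?B \<xi> \<eta> = 0" using B T unfolding inner_product_on_def by auto
    then show ?thesis using nn T by simp
  next
    case False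
    define a b c where "a = ?B \<eta> \<eta>" and "b = ?B \<xi> \<eta>" and "c = ?B \<xi> \<xi>"
    have a: "0 < a" using B T False by (auto simp: a_def inner_product_on_def)
    \<comment> \<open>The Cauchy-Schwarz argument without division: \<open>?z\<close> is a times the
      component of \<open>\<xi>\<close> orthogonal to \<open>\<eta>\<close>, and its square length
      is nonnegative.\<close>
    let ?z = "a *\<^sub>R \<xi> + (- b) *\<^sub>R \<eta>"
    have mem: "a *\<^sub>R \<xi> \<in> tangent P s" "(- b) *\<^sub>R \<eta> \<in> tangent P s" using T tangent_subspace subspace_scale by blast+
    then have z: "?z \<in> tangent P s" using tangent_subspace subspace_add by blast
    have lin: "?B ?z \<zeta> = a * ?B \<xi> \<zeta> - b * ?B \<eta> \<zeta>" if "\<zeta> \<in> tangent P s" for \<zeta>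
    proof -
      have "?B ?z \<zeta> = ?B (a *\<^sub>R \<xi>) \<zeta> + ?B ((- b) *\<^sub>R \<eta>) \<zeta>" using B mem that unfolding inner_product_on_def by blast
      moreover have "?B (a *\<^sub>R \<xi>) \<zeta> = a * ?B \<xi> \<zeta>" "?B ((- b) *\<^sub>R \<eta>) \<zeta> = (- b) * ?B \<eta> \<zeta>"
        using B T that unfolding inner_product_on_def by blast+
      ultimately show ?thesis by simp
    qed
    have sym: "?B \<zeta> \<zeta>' = ?B \<zeta>' \<zeta>" if "\<zeta> \<in> tangent P s" "\<zeta>' \<in> tangent P s" for \<zeta> \<zeta>'
      using B that unfolding inner_product_on_def by blast
    have "?B ?z ?z = a * ?B ?z \<xi> - b * ?B ?z \<eta>" unfolding lin[OF z] sym[OF T(1) z] sym[OF T(2) z] ..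
    moreover have "?B ?z \<xi> = a * c - b * b"
      unfolding lin[OF T(1)] sym[OF T(2,1)] by (simp only: b_def c_def)
    moreover have "?B ?z \<eta> = 0"
      unfolding lin[OF T(2)] a_def[symmetric] b_def[symmetric] by simp
    ultimately have "?B ?z ?z = a * (a * c - b * b)" by simp
    then have "0 \<le> a * (a * c - b * b)" using nn[OF z] by simp
    then have "b * b \<le> c * a" using a by (simp add: zero_le_mult_iff mult.commute)
    then show ?thesis by (simp add: a_def b_def c_def power2_eq_square)
  qed
  have "(gnorm P x \<xi>)\<^sup>2 = ?B \<xi> \<xi>" using nn[OF T(1)] by (simp add: gnorm_def)
  moreover have "?B \<eta> \<eta> \<le> (Lam * norm \<eta>)\<^sup>2" unfolding Bx using g T(2) by (simp add: good_def power_mult_distrib)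
  ultimately show ?thesis
    using cs nn[OF T(1)] mult_left_mono[of "?B \<eta> \<eta>" "(Lam * norm \<eta>)\<^sup>2" "?B \<xi> \<xi>"] by (simp add: mult.commute)
qed

text \<open>E is transported to a Borel function on the space, supported in the open simplex. F
  enters only through the domination, so it may be an integrand whose measurability is
  unknown.\<close>

lemma nn_integral_push:
  assumes s: "maximal s" and Q: "Q \<in> sets (PM s)" "Q \<subseteq> pint s"
  obtains \<kappa> :: real where "0 < \<kappa>" "\<And>E F. E \<in> borel_measurable (PM s) \<Longrightarrow> (AE c in PM s. c \<in> Q \<longrightarrow> E c \<le> F (chart s c)) \<Longrightarrow>
     ennreal \<kappa> * (\<integral>\<^sup>+c. E c * indicator Q c \<partial>PM s) \<le> (\<integral>\<^sup>+x. F x \<partial>vol P)"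
proof -
  have sK: "s \<in> cplx P" using s maximal_in by blast
  obtain \<kappa> :: real where \<kappa>: "0 < \<kappa>" "\<And>F. F \<in> borel_measurable borel \<Longrightarrow>
    ennreal \<kappa> * (\<integral>\<^sup>+c. F (chart s c) * indicator (pint s) c \<partial>PM s) \<le> (\<integral>\<^sup>+x. F x \<partial>vol P)"
    using nn_integral_vol_lower[OF s] by blast
  have "ennreal \<kappa> * (\<integral>\<^sup>+c. E c * indicator Q c \<partial>PM s) \<le> (\<integral>\<^sup>+x. F x \<partial>vol P)"
    if E: "E \<in> borel_measurable (PM s)" and le: "AE c in PM s. c \<in> Q \<longrightarrow> E c \<le> F (chart s c)" for E F
  proof -
    let ?H = "\<lambda>x. E (param s x) * indicator Q (param s x) * indicator (inter s) x"
    have Hm: "?H \<in> borel_measurable borel"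
      using measurable_compose[OF param_measurable E] measurable_compose[OF param_measurable borel_measurable_indicator[OF Q(1)]] inter_open[OF s]
      by (intro borel_measurable_times_ennreal borel_measurable_indicator borel_open) auto
    have Hc: "?H (chart s c) = E c * indicator Q c" if "c \<in> pint s" for c
      using that chart_pint[OF sK that] param_chart[OF sK, of c] pint_subset[of s] by (auto simp: subset_eq)
    have "AE x in vol P. (\<exists>s. maximal s \<and> x \<in> inter s) \<and> ?H x \<le> F x"
    proof (rule AE_volI)
      fix t assume t: "maximal t"
      show "AE c in PM t. c \<in> pint t \<longrightarrow> ?H (chart t c) \<le> F (chart t c)"
      proof (cases "t = s")
        case True
        show ?thesis unfolding True using le
        proof eventually_elim
          case (elim c)
          then show ?case using Hc[of c] by (cases "c \<in> Q") auto
        qed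
      next
        case False
        have "?H (chart t c) = 0" if "c \<in> pint t" for c
          using chart_pint[OF maximal_in[OF t] that] False by (simp add: inter_def)
        then show ?thesis by (intro AE_I2 impI) (simp only: zero_le)
      qed
    qed
    then have "AE x in vol P. ?H x \<le> F x" by eventually_elim blast
    then have "(\<integral>\<^sup>+x. ?H x \<partial>vol P) \<le> (\<integral>\<^sup>+x. F x \<partial>vol P)"
      by (rule nn_integral_mono_AE)
    moreover have "(\<integral>\<^sup>+c. ?H (chart s c) * indicator (pint s) c \<partial>PM s) = (\<integral>\<^sup>+c. E c * indicator Q c \<partial>PM s)"
    proof (rule nn_integral_cong)
      fix c show "?H (chart s c) * indicator (pint s) c = E c * indicator Q c"
      proof (cases "c \<in> pint s")
        case False
        then have "c \<notin> Q" using Q(2) by blast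
        with False show ?thesis by simp
      qed (simp only: Hc, simp)
    qed
    ultimately show ?thesis using \<kappa>(2)[OF Hm] by simp
  qed
  with \<kappa>(1) that show thesis by blast
qed

text \<open>The order of limits is the point: for fixed e first k tends to infinity, which removes
  the term with the large factor \<open>1 / e\<close>, and then e tends to 0.\<close>

lemma real_le_of_square_limit:
  fixes A :: real
  assumes m: "m < \<infinity>" and C: "0 \<le> C" and I: "I \<longlonglongrightarrow> (0::ennreal)"
    and le: "\<And>k e. 0 < e \<Longrightarrow> ennreal \<bar>A\<bar> \<le> ennreal C * (ennreal e * m + ennreal (1 / e) * I k)"
  shows "A = 0"
proof -
  have "ennreal \<bar>A\<bar> \<le> ennreal C * (ennreal e * m)" if e: "0 < e" for e
  proof -
    have "(\<lambda>k. ennreal C * (ennreal e * m + ennreal (1 / e) * I k)) \<longlonglongrightarrow> ennreal C * (ennreal e * m + ennreal (1 / e) * 0)"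
      by (intro ennreal_tendsto_cmult tendsto_add tendsto_const I) auto
    then show ?thesis using le[OF e] by (intro LIMSEQ_le_const[of _ "ennreal C * (ennreal e * m)"]) auto
  qed
  moreover obtain r where r: "m = ennreal r" "0 \<le> r" using m by (cases m) auto
  ultimately have "\<bar>A\<bar> \<le> C * (e * r)" if "0 < e" for e
    using that C by (simp add: ennreal_mult[symmetric])
  note this[of "e / (C * r + 1)" for e]
  moreover have "C * (e / (C * r + 1) * r) \<le> e" if "0 < e" for e
    using that C r by (simp add: field_simps add_pos_nonneg)
  moreover have "0 < C * r + 1" using C r by (simp add: add_nonneg_pos)
  ultimately have "\<bar>A\<bar> \<le> e" if "0 < e" for e using that by (meson divide_pos_pos order_trans)
  then show ?thesis by (metis abs_le_zero_iff field_le_epsilon add_0)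
qed

text \<open>A Sobolev gradient satisfies the weak form of its definition against Lipschitz test functions
  in the parameters of a simplex: the approximating Lipschitz functions do, by
  integration by parts, and the volume density is bounded below.\<close>

lemma sobolev_weak:
  assumes s: "maximal s" and U: "open U" and sob: "sobolev_grad P U f G"
    and Q: "\<And>c. c \<in> finite_index.box (free_vertices s) a b \<Longrightarrow> c \<in> pint s \<and> chart s c \<in> U" and i: "i \<in> free_vertices s"
    and H: "H \<in> borel_measurable (PM s)" "AE c in PM s. c \<in> finite_index.box (free_vertices s) a b \<longrightarrow> ginner P (chart s c) (G (chart s c)) (frame P s i) = H c"
    and F: "F \<in> borel_measurable (PM s)" "AE c in PM s. c \<in> finite_index.box (free_vertices s) a b \<longrightarrow> f (chart s c) = F c"
    and \<psi>: "lip_in s L \<psi>" "finite_index.within_box (free_vertices s) a b \<psi>"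
  shows "integrable (PM s) (\<lambda>c. indicator (finite_index.box (free_vertices s) a b) c * H c)"
    "(\<integral>c. H c * \<psi> c \<partial>PM s) = - (\<integral>c. F c * (indicator (finite_index.box (free_vertices s) a b) c * partial s \<psi> i c) \<partial>PM s)"
proof -
  let ?J = "free_vertices s"
  have sK: "s \<in> cplx P" using s maximal_in by blast
  interpret finite_index ?J by (rule finite_index_free[OF sK])
  let ?Q = "box a b" and ?I = "indicator (box a b) :: _ \<Rightarrow> real"
  have fri: "frame P s i \<in> tangent P s" using i frame_tangent[OF sK] by (simp add: free_vertices_def)
  obtain \<phi> where \<phi>: "\<And>k::nat. \<phi> k \<in> lip12 P U"
    and conv: "(\<lambda>k. \<integral>\<^sup>+ x\<in>U. ennreal ((\<phi> k x - f x)\<^sup>2 + (gnorm P x (rgrad P (\<phi> k) x - G x))\<^sup>2) \<partial>vol P) \<longlonglongrightarrow> 0"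
    using sob by (auto simp: sobolev_grad_def)
  have GT: "AE x in vol P. x \<in> U \<longrightarrow> G x \<in> tangent P (carrier_simplex P x)" using sob by (simp add: sobolev_grad_def)
  have "\<exists>K v. lip K v \<and> (\<forall>c\<in>pint s. chart s c \<in> U \<longrightarrow> v c = \<phi> k (chart s c)) \<and>
    (AE c in PM s. c \<in> pint s \<longrightarrow> chart s c \<in> U \<longrightarrow> differential (\<phi> k) (chart s c) s (\<lambda>\<xi>. \<Sum>i\<in>?J. dd v (unit i) c * dual s i \<xi>))" for k
  proof -
    have g: "glipschitz_on P U (\<phi> k)" using \<phi>[of k] by (simp add: lip12_def)
    show ?thesis by (rule chart_extension[OF s U g]) blast
  qed
  from choice[OF allI[OF this]] obtain K where
    "\<forall>k. \<exists>v. lip (K k) v \<and> (\<forall>c\<in>pint s. chart s c \<in> U \<longrightarrow> v c = \<phi> k (chart s c)) \<and>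
    (AE c in PM s. c \<in> pint s \<longrightarrow> chart s c \<in> U \<longrightarrow> differential (\<phi> k) (chart s c) s (\<lambda>\<xi>. \<Sum>i\<in>?J. dd v (unit i) c * dual s i \<xi>))" ..
  from choice[OF this] obtain v where v: "\<And>k. lip (K k) (v k)" "\<And>k c. c \<in> pint s \<Longrightarrow> chart s c \<in> U \<Longrightarrow> v k c = \<phi> k (chart s c)"
    "\<And>k. AE c in PM s. c \<in> pint s \<longrightarrow> chart s c \<in> U \<longrightarrow> differential (\<phi> k) (chart s c) s (\<lambda>\<xi>. \<Sum>i\<in>?J. dd (v k) (unit i) c * dual s i \<xi>)"
    by blast
  define p where "p k = dd (v k) (unit i)" for k
  have pm [measurable]: "p k \<in> borel_measurable (PM s)" and vm [measurable]: "v k \<in> borel_measurable (PM s)" for k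
    unfolding p_def using dd_measurable[OF v(1)] lip_measurable[OF v(1)] by auto
  note [measurable] = H(1) F(1)
  \<comment> \<open>The square bounds the component along \<open>frame P s i\<close> by
    \<open>gnorm\<close>; with the summand 1 the same C also serves the difference of the functions
    themselves.\<close>
  define C where "C = (Lam * norm (frame P s i))\<^sup>2 + 1"
  have C: "1 \<le> C" by (simp add: C_def)
  define S where "S k = (\<integral>\<^sup>+c. ennreal ((p k c - H c)\<^sup>2 + (v k c - F c)\<^sup>2) * indicator ?Q c \<partial>PM s)" for k
  have Qs: "?Q \<in> sets (PM s)" "?Q \<subseteq> pint s" using Q by auto
  obtain \<kappa> :: real where \<kappa>: "0 < \<kappa>" "\<And>E F. E \<in> borel_measurable (PM s) \<Longrightarrow> (AE c in PM s. c \<in> ?Q \<longrightarrow> E c \<le> F (chart s c)) \<Longrightarrow>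
     ennreal \<kappa> * (\<integral>\<^sup>+c. E c * indicator ?Q c \<partial>PM s) \<le> (\<integral>\<^sup>+x. F x \<partial>vol P)"
    using nn_integral_push[OF s Qs] by blast
  have S_le: "ennreal (\<kappa> / C) * S k \<le> (\<integral>\<^sup>+ x\<in>U. ennreal ((\<phi> k x - f x)\<^sup>2 + (gnorm P x (rgrad P (\<phi> k) x - G x))\<^sup>2) \<partial>vol P)" for k
  proof -
    let ?E = "\<lambda>c. ennreal (((p k c - H c)\<^sup>2 + (v k c - F c)\<^sup>2) / C)"
    have "ennreal \<kappa> * (\<integral>\<^sup>+c. ?E c * indicator ?Q c \<partial>PM s) \<le> (\<integral>\<^sup>+ x\<in>U. ennreal ((\<phi> k x - f x)\<^sup>2 + (gnorm P x (rgrad P (\<phi> k) x - G x))\<^sup>2) \<partial>vol P)"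
    proof (rule \<kappa>(2))
      show "?E \<in> borel_measurable (PM s)" by measurable
      show "AE c in PM s. c \<in> ?Q \<longrightarrow> ?E c \<le> ennreal ((\<phi> k (chart s c) - f (chart s c))\<^sup>2 + (gnorm P (chart s c) (rgrad P (\<phi> k) (chart s c) - G (chart s c)))\<^sup>2) * indicator U (chart s c)"
        using v(3)[of k] AE_chart[OF s GT] H(2) F(2)
      proof eventually_elim
        case (elim c)
        show ?case
        proof
          assume c: "c \<in> ?Q"
          have cp: "c \<in> pint s" "chart s c \<in> U" using Q[OF c] by auto
          let ?x = "chart s c"
          have D: "differential (\<phi> k) ?x s (\<lambda>\<xi>. \<Sum>i\<in>?J. dd (v k) (unit i) c * dual s i \<xi>)" using elim cp by blast
          note DD = differentialD[OF D]
          have g: "rgrad P (\<phi> k) ?x \<in> tangent P s" "ginner P ?x (rgrad P (\<phi> k) ?x) (frame P s i) = p k c"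
          proof -
            show "rgrad P (\<phi> k) ?x \<in> tangent P s" by (rule rgrad_differential(1)[OF D])
            have "(\<Sum>j\<in>?J. dd (v k) (unit j) c * dual s j (frame P s i)) = (\<Sum>j\<in>?J. if j = i then dd (v k) (unit j) c else 0)"
              using i by (intro sum.cong refl) (auto simp: dual_frame[OF sK])
            then show "ginner P ?x (rgrad P (\<phi> k) ?x) (frame P s i) = p k c"
              unfolding rgrad_differential(2)[OF D fri] using i by (simp add: p_def)
          qed
          have GT': "G ?x \<in> tangent P s" using elim(2) cp DD(5) by simp
          have dT: "rgrad P (\<phi> k) ?x - G ?x \<in> tangent P s" by (rule subspace_diff[OF tangent_subspace g(1) GT'])
          have B: "inner_product_on (tangent P s) (ginner P ?x)"
          proof -
            have "ginner P ?x = riem P s (coord P ?x)" by (simp add: ginner_def DD(5) fun_eq_iff)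
            then show ?thesis using DD(3) by (simp add: good_def)
          qed
          have "ginner P ?x ((rgrad P (\<phi> k) ?x - G ?x) + G ?x) (frame P s i) = ginner P ?x (rgrad P (\<phi> k) ?x - G ?x) (frame P s i) + ginner P ?x (G ?x) (frame P s i)"
            using B dT GT' fri unfolding inner_product_on_def by blast
          then have y: "p k c - H c = ginner P ?x (rgrad P (\<phi> k) ?x - G ?x) (frame P s i)"
            using g(2) elim(3) c by simp
          have y2: "(p k c - H c)\<^sup>2 \<le> C * (gnorm P ?x (rgrad P (\<phi> k) ?x - G ?x))\<^sup>2"
            unfolding y C_def using ginner_le_gnorm[OF DD(3,2) dT fri] by (simp add: distrib_right add_increasing2)
          have "v k c - F c = \<phi> k ?x - f ?x" using v(2)[OF cp] elim(4) c by simp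
          then have "(v k c - F c)\<^sup>2 \<le> C * (\<phi> k ?x - f ?x)\<^sup>2" using C mult_right_mono[of 1 C "(\<phi> k ?x - f ?x)\<^sup>2"] by simp
          with y2 have "(p k c - H c)\<^sup>2 + (v k c - F c)\<^sup>2 \<le> C * ((\<phi> k ?x - f ?x)\<^sup>2 + (gnorm P ?x (rgrad P (\<phi> k) ?x - G ?x))\<^sup>2)"
            by (simp add: distrib_left)
          then have "((p k c - H c)\<^sup>2 + (v k c - F c)\<^sup>2) / C \<le> (\<phi> k ?x - f ?x)\<^sup>2 + (gnorm P ?x (rgrad P (\<phi> k) ?x - G ?x))\<^sup>2"
            using C by (simp add: divide_le_eq mult.commute)
          then show "?E c \<le> ennreal ((\<phi> k ?x - f ?x)\<^sup>2 + (gnorm P ?x (rgrad P (\<phi> k) ?x - G ?x))\<^sup>2) * indicator U ?x"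
            using cp by (simp add: ennreal_leI del: ennreal_plus)
        qed
      qed
    qed
    moreover have "(\<integral>\<^sup>+c. ?E c * indicator ?Q c \<partial>PM s) = ennreal (1 / C) * S k"
      unfolding S_def using C
      by (subst nn_integral_cmult[symmetric]) (auto intro!: nn_integral_cong simp: indicator_def simp flip: ennreal_mult simp del: ennreal_plus)
    ultimately show ?thesis using \<kappa>(1) C by (simp add: mult.assoc[symmetric] flip: ennreal_mult)
  qed
  have S0: "S \<longlonglongrightarrow> 0"
  proof (rule tendsto_sandwich[OF _ _ tendsto_const])
    let ?I = "\<lambda>k. \<integral>\<^sup>+ x\<in>U. ennreal ((\<phi> k x - f x)\<^sup>2 + (gnorm P x (rgrad P (\<phi> k) x - G x))\<^sup>2) \<partial>vol P"
    show "(\<lambda>k. ennreal (C / \<kappa>) * ?I k) \<longlonglongrightarrow> 0"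
      using ennreal_tendsto_cmult[OF _ conv, of "ennreal (C / \<kappa>)"] by simp
    have "S k \<le> ennreal (C / \<kappa>) * ?I k" for k
      using mult_left_mono[OF S_le[of k], of "ennreal (C / \<kappa>)"] C \<kappa>(1)
      by (simp add: mult.assoc[symmetric] flip: ennreal_mult)
    then show "\<forall>\<^sub>F k in sequentially. S k \<le> ennreal (C / \<kappa>) * ?I k" by (simp add: always_eventually)
  qed auto
  have "\<forall>\<^sub>F k in sequentially. S k < 1" using order_tendstoD(2)[OF S0, of 1] by simp
  then obtain N where N: "\<And>k. N \<le> k \<Longrightarrow> S k < \<infinity>"
    unfolding eventually_sequentially by (metis ennreal_one_less_top infinity_ennreal_def less_trans)
  have pb: "AE c in PM s. c \<in> ?Q \<longrightarrow> \<bar>p k c\<bar> \<le> K k * size1 (unit i)" for k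
    using AE_dd_bound[OF v(1), of k "unit i"] by eventually_elim (simp add: p_def)
  have "\<exists>C. \<forall>c\<in>?Q. \<bar>v k c\<bar> \<le> C" for k
    by (rule lip_box_bound[OF v(1)[of k], of a b]) (rule exI, auto simp: box_def)
  then obtain Cv where Cv: "\<And>k c. c \<in> ?Q \<Longrightarrow> \<bar>v k c\<bar> \<le> Cv k" by metis
  \<comment> \<open>From some index on the L2 distances are finite; comparison with the bounded
    approximants \<open>p N\<close> and \<open>v N\<close> makes H and F integrable on the
    box.\<close>
  have fin: "(\<integral>\<^sup>+c. ennreal ((p N c - H c)\<^sup>2) * indicator ?Q c \<partial>PM s) < \<infinity>"
    "(\<integral>\<^sup>+c. ennreal ((v N c - F c)\<^sup>2) * indicator ?Q c \<partial>PM s) < \<infinity>"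
  proof -
    have "(\<integral>\<^sup>+c. ennreal ((p N c - H c)\<^sup>2) * indicator ?Q c \<partial>PM s) \<le> S N"
      unfolding S_def by (intro nn_integral_mono mult_right_mono ennreal_leI) auto
    then show "(\<integral>\<^sup>+c. ennreal ((p N c - H c)\<^sup>2) * indicator ?Q c \<partial>PM s) < \<infinity>"
      by (rule le_less_trans) (rule N[OF order_refl])
    have "(\<integral>\<^sup>+c. ennreal ((v N c - F c)\<^sup>2) * indicator ?Q c \<partial>PM s) \<le> S N"
      unfolding S_def by (intro nn_integral_mono mult_right_mono ennreal_leI) auto
    then show "(\<integral>\<^sup>+c. ennreal ((v N c - F c)\<^sup>2) * indicator ?Q c \<partial>PM s) < \<infinity>"
      by (rule le_less_trans) (rule N[OF order_refl])
  qed
  show iH: "integrable (PM s) (\<lambda>c. ?I c * H c)"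
    by (rule integrable_near_bounded[OF _ _ pb fin(1)]) measurable
  have iF: "integrable (PM s) (\<lambda>c. ?I c * F c)"
    by (rule integrable_near_bounded[OF _ _ _ fin(2), of "Cv N"]) (use Cv in auto)
  have ip: "integrable (PM s) (\<lambda>c. ?I c * p k c)" for k
    by (rule integrable_near_bounded[where p = "p k" and h = "p k", OF _ _ pb]) auto
  have iv: "integrable (PM s) (\<lambda>c. ?I c * v k c)" for k
    by (rule integrable_near_bounded[of _ "v k" a b "Cv k"]) (use Cv in auto)
  obtain C\<psi> where C\<psi>: "0 \<le> C\<psi>" "\<And>c. \<bar>\<psi> c\<bar> \<le> C\<psi>" using within_box_bound[OF \<psi>] by blast
  define D where "D = (\<lambda>c. ?I c * dd \<psi> (unit i) c)"
  have L: "0 \<le> L" by (rule lip_nonneg[OF \<psi>(1)])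
  have \<psi>m [measurable]: "\<psi> \<in> borel_measurable (PM s)" "dd \<psi> (unit i) \<in> borel_measurable (PM s)"
    using lip_measurable[OF \<psi>(1)] dd_measurable[OF \<psi>(1)] by auto
  have Dm [measurable]: "D \<in> borel_measurable (PM s)" unfolding D_def by measurable
  have Db: "AE c in PM s. \<bar>D c\<bar> \<le> L"
    using AE_dd_bound[OF \<psi>(1), of "unit i"] by eventually_elim (use L i in \<open>auto simp: D_def indicator_def size1_unit\<close>)
  have \<psi>b: "AE c in PM s. \<bar>\<psi> c\<bar> \<le> C\<psi>" using C\<psi> by simp
  have \<psi>I: "h c * \<psi> c = (?I c * h c) * \<psi> c" if "c \<in> space (PM s)" for h c
    using \<psi>(2) that by (cases "\<psi> c = 0") (auto simp: within_box_def box_def)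
  have DI: "h c * D c = (?I c * h c) * D c" for h c by (simp add: D_def indicator_def)
  \<comment> \<open>A is the defect in the claimed identity. The approximants have defect zero, so A
    is bounded by their L1 distances from H and F.\<close>
  define A where "A = (\<integral>c. H c * \<psi> c \<partial>PM s) + (\<integral>c. F c * D c \<partial>PM s)"
  have "ennreal \<bar>A\<bar> \<le> ennreal (C\<psi> + L) * (ennreal e * emeasure (PM s) ?Q + ennreal (1 / e) * S k)" if e: "0 < e" for k e
  proof -
    \<comment> \<open>Integration by parts for the Lipschitz function \<open>v k\<close>; cutting
      the derivative of \<open>\<psi>\<close> down to the box changes it only on a null set.\<close>
    have ibp: "(\<integral>c. p k c * \<psi> c \<partial>PM s) + (\<integral>c. v k c * D c \<partial>PM s) = 0"
    proof -
      have "(\<integral>c. v k c * D c \<partial>PM s) = (\<integral>c. v k c * dd \<psi> (unit i) c \<partial>PM s)"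
        using AE_dd_within[OF \<psi>, of "unit i"]
        by (intro integral_cong_AE, measurable, eventually_elim) (auto simp: D_def indicator_def)
      then show ?thesis using integration_by_parts[OF v(1) \<psi>, of k "unit i"] by (simp add: p_def)
    qed
    have i1: "integrable (PM s) (\<lambda>c. (?I c * H c) * \<psi> c)" "integrable (PM s) (\<lambda>c. (?I c * p k c) * \<psi> c)"
      "integrable (PM s) (\<lambda>c. (?I c * F c) * D c)" "integrable (PM s) (\<lambda>c. (?I c * v k c) * D c)"
      by (rule integrable_mult_bounded[OF iH \<psi>m(1) \<psi>b] integrable_mult_bounded[OF ip \<psi>m(1) \<psi>b]
          integrable_mult_bounded[OF iF Dm Db] integrable_mult_bounded[OF iv Dm Db])+
    have e1: "(\<integral>c. h c * \<psi> c \<partial>PM s) = (\<integral>c. (?I c * h c) * \<psi> c \<partial>PM s)" for h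
      by (intro Bochner_Integration.integral_cong refl \<psi>I)
    have e2: "(\<integral>c. h c * D c \<partial>PM s) = (\<integral>c. (?I c * h c) * D c \<partial>PM s)" for h
      by (intro Bochner_Integration.integral_cong refl DI)
    let ?g = "\<lambda>c. ((?I c * H c) * \<psi> c - (?I c * p k c) * \<psi> c) + ((?I c * F c) * D c - (?I c * v k c) * D c)"
    have ig: "integrable (PM s) ?g" by (intro Bochner_Integration.integrable_add Bochner_Integration.integrable_diff i1)
    have "A = (\<integral>c. ?g c \<partial>PM s)"
    proof -
      have "(\<integral>c. ?g c \<partial>PM s) = ((\<integral>c. (?I c * H c) * \<psi> c \<partial>PM s) - (\<integral>c. (?I c * p k c) * \<psi> c \<partial>PM s))
          + ((\<integral>c. (?I c * F c) * D c \<partial>PM s) - (\<integral>c. (?I c * v k c) * D c \<partial>PM s))"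
        using i1 by (simp only: Bochner_Integration.integral_add Bochner_Integration.integral_diff Bochner_Integration.integrable_diff)
      then show ?thesis
        using ibp unfolding A_def e1[of H] e1[of "p k"] e2[of F] e2[of "v k"] by linarith
    qed
    then have "ennreal \<bar>A\<bar> \<le> (\<integral>\<^sup>+c. ennreal (norm (?g c)) \<partial>PM s)"
      using integral_norm_bound_ennreal[OF ig] by simp
    also have "\<dots> \<le> (\<integral>\<^sup>+c. ennreal (C\<psi> + L) * (ennreal e * indicator ?Q c + ennreal (1 / e) * (ennreal ((p k c - H c)\<^sup>2 + (v k c - F c)\<^sup>2) * indicator ?Q c)) \<partial>PM s)"
    proof (rule nn_integral_mono_AE)
      show "AE c in PM s. ennreal (norm (?g c)) \<le> ennreal (C\<psi> + L) * (ennreal e * indicator ?Q c + ennreal (1 / e) * (ennreal ((p k c - H c)\<^sup>2 + (v k c - F c)\<^sup>2) * indicator ?Q c))"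
        using Db
      proof eventually_elim
        case (elim c)
        show ?case
        proof (cases "c \<in> ?Q")
          case True
          have "?g c = (H c - p k c) * \<psi> c + (F c - v k c) * D c" using True by (simp add: algebra_simps)
          then have "\<bar>?g c\<bar> \<le> \<bar>H c - p k c\<bar> * \<bar>\<psi> c\<bar> + \<bar>F c - v k c\<bar> * \<bar>D c\<bar>"
            by (metis abs_mult abs_triangle_ineq)
          also have "\<dots> \<le> \<bar>H c - p k c\<bar> * (C\<psi> + L) + \<bar>F c - v k c\<bar> * (C\<psi> + L)"
            using C\<psi> elim L by (intro add_mono mult_left_mono) (auto intro: add_increasing add_increasing2)
          also have "\<dots> = (C\<psi> + L) * (\<bar>p k c - H c\<bar> + \<bar>v k c - F c\<bar>)"
            by (simp add: abs_minus_commute algebra_simps)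
          also have "\<dots> \<le> (C\<psi> + L) * (e + 1 / e * ((p k c - H c)\<^sup>2 + (v k c - F c)\<^sup>2))"
            using C\<psi> L by (intro mult_left_mono abs_sum_le_squares e) auto
          finally have "ennreal (norm (?g c)) \<le> ennreal ((C\<psi> + L) * (e + 1 / e * ((p k c - H c)\<^sup>2 + (v k c - F c)\<^sup>2)))"
            unfolding real_norm_def by (rule ennreal_leI)
          also have "\<dots> = ennreal (C\<psi> + L) * (ennreal e + ennreal (1 / e) * ennreal ((p k c - H c)\<^sup>2 + (v k c - F c)\<^sup>2))"
            using C\<psi>(1) L e by (subst ennreal_mult, simp, simp, subst ennreal_plus, simp, simp, subst ennreal_mult) (auto simp del: ennreal_plus)
          finally show ?thesis using True by simp
        qed simp
      qed
    qed
    also have "\<dots> = ennreal (C\<psi> + L) * (ennreal e * emeasure (PM s) ?Q + ennreal (1 / e) * S k)"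
      unfolding S_def
    proof -
      define G where "G c = ennreal ((p k c - H c)\<^sup>2 + (v k c - F c)\<^sup>2) * indicator ?Q c" for c
      have Gm: "G \<in> borel_measurable (PM s)" unfolding G_def[abs_def]
        by (intro borel_measurable_times_ennreal measurable_compose[OF _ measurable_ennreal] borel_measurable_add
            borel_measurable_power borel_measurable_diff borel_measurable_indicator pm vm H(1) F(1) Qs(1))
      have Im: "(\<lambda>c. ennreal e * indicator ?Q c) \<in> borel_measurable (PM s)"
        by (intro borel_measurable_times_ennreal borel_measurable_const borel_measurable_indicator Qs(1))
      have Gm': "(\<lambda>c. ennreal (1 / e) * G c) \<in> borel_measurable (PM s)"
        by (intro borel_measurable_times_ennreal borel_measurable_const Gm)
      show "(\<integral>\<^sup>+c. ennreal (C\<psi> + L) * (ennreal e * indicator ?Q c + ennreal (1 / e) * (ennreal ((p k c - H c)\<^sup>2 + (v k c - F c)\<^sup>2) * indicator ?Q c)) \<partial>PM s)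
        = ennreal (C\<psi> + L) * (ennreal e * emeasure (PM s) ?Q + ennreal (1 / e) * (\<integral>\<^sup>+c. ennreal ((p k c - H c)\<^sup>2 + (v k c - F c)\<^sup>2) * indicator ?Q c \<partial>PM s))"
        unfolding G_def[symmetric]
        by (simp only: nn_integral_cmult[OF borel_measurable_add[OF Im Gm']] nn_integral_add[OF Im Gm'] nn_integral_cmult[OF Gm]
            nn_integral_cmult_indicator[OF Qs(1)])
    qed
    finally show ?thesis .
  qed
  then have "A = 0"
    using C\<psi>(1) L by (intro real_le_of_square_limit[OF emeasure_box[of a b] _ S0, of "C\<psi> + L"]) auto
  then show "(\<integral>c. H c * \<psi> c \<partial>PM s) = - (\<integral>c. F c * (?I c * partial s \<psi> i c) \<partial>PM s)"
    by (simp add: A_def D_def)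
qed

lemma chart_box_cover:
  assumes s: "maximal s" and U: "open U" and c: "c \<in> pint s" "chart s c \<in> U"
  obtains a b :: "'v \<Rightarrow> rat" where "c \<in> finite_index.box (free_vertices s) (\<lambda>i. real_of_rat (a i)) (\<lambda>i. real_of_rat (b i))"
    "finite_index.box (free_vertices s) (\<lambda>i. real_of_rat (a i)) (\<lambda>i. real_of_rat (b i)) \<subseteq> {c \<in> pint s. chart s c \<in> U}"
proof -
  let ?J = "free_vertices s"
  have sK: "s \<in> cplx P" using s maximal_in by blast
  interpret finite_index ?J by (rule finite_index_free[OF sK])
  have cs: "c \<in> param_simplex s" using c pint_subset by blast
  obtain \<delta> where \<delta>: "0 < \<delta>" "\<And>y. dist (coord P y) (coord P (chart s c)) < \<delta> \<Longrightarrow> y \<in> inter s \<inter> U"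
    using inter_preimage_open[OF s U chart_pint[OF sK c(1)] c(2)] by blast
  define F where "F = (\<Sum>i\<in>?J. norm (frame P s i)) + 1"
  have F: "0 < F" by (simp add: F_def sum_nonneg add_nonneg_pos)
  \<comment> \<open>The margin of c: its distances to the faces of the parameter simplex, and
    \<open>\<delta> / F\<close> for staying inside U. Deviations with l1 norm below m are
    allowed.\<close>
  define m where "m = Min (insert (\<delta> / F) (insert (1 - (\<Sum>i\<in>?J. c i)) (c ` ?J)))"
  have m: "0 < m" using c(1) \<delta> F by (auto simp: m_def pint_def)
  have mle: "m \<le> \<delta> / F" "m \<le> 1 - (\<Sum>i\<in>?J. c i)" "\<And>i. i \<in> ?J \<Longrightarrow> m \<le> c i"
    unfolding m_def by (intro Min_le; use free_finite[OF sK] in auto)+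
  \<comment> \<open>Coordinatewise deviations of at most h have l1 norm below m.\<close>
  define h where "h = m / (real (card ?J) + 1)"
  have h: "0 < h" "real (card ?J) * h < m" using m by (auto simp: h_def field_simps)
  have "\<forall>i. \<exists>r. c i - h < real_of_rat r \<and> real_of_rat r < c i" "\<forall>i. \<exists>r. c i < real_of_rat r \<and> real_of_rat r < c i + h"
    using h(1) by (auto intro!: of_rat_dense)
  then obtain a b where a: "\<And>i. c i - h < real_of_rat (a i)" "\<And>i. real_of_rat (a i) < c i"
    and b: "\<And>i. c i < real_of_rat (b i)" "\<And>i. real_of_rat (b i) < c i + h" by metis
  show thesis
  proof (rule that)
    show "c \<in> box (\<lambda>i. real_of_rat (a i)) (\<lambda>i. real_of_rat (b i))"
      using a b c(1) by (auto simp: box_def space_PM pint_def)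
    show "box (\<lambda>i. real_of_rat (a i)) (\<lambda>i. real_of_rat (b i)) \<subseteq> {c \<in> pint s. chart s c \<in> U}"
    proof
      fix d assume d: "d \<in> box (\<lambda>i. real_of_rat (a i)) (\<lambda>i. real_of_rat (b i))"
      have near: "\<bar>d i - c i\<bar> \<le> h" if "i \<in> ?J" for i
      proof -
        have "real_of_rat (a i) < d i" "d i < real_of_rat (b i)" using d that by (auto simp: box_def)
        then show ?thesis using a(1)[of i] b(2)[of i] by (intro abs_leI) linarith+
      qed
      then have l: "(\<Sum>i\<in>?J. \<bar>d i - c i\<bar>) < m"
        using sum_bounded_above[of ?J "\<lambda>i. \<bar>d i - c i\<bar>" h] h(2) by simp
      have "0 < d i" if "i \<in> ?J" for i
      proof -
        have "\<bar>d i - c i\<bar> < m" using member_le_sum[of i ?J "\<lambda>i. \<bar>d i - c i\<bar>"] that l by simp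
        then show ?thesis using mle(3)[OF that] abs_ge_minus_self[of "d i - c i"] by argo
      qed
      moreover have "(\<Sum>i\<in>?J. d i) < 1"
      proof -
        have "(\<Sum>i\<in>?J. d i) - (\<Sum>i\<in>?J. c i) \<le> (\<Sum>i\<in>?J. \<bar>d i - c i\<bar>)"
          unfolding sum_subtractf[symmetric] by (intro sum_mono abs_ge_self)
        then show ?thesis using l mle(2) by linarith
      qed
      ultimately have dp: "d \<in> pint s" using d by (simp add: pint_def box_def space_PM)
      then have ds: "d \<in> param_simplex s" using pint_subset by blast
      have "dist (coord P (chart s d)) (coord P (chart s c)) \<le> (\<Sum>i\<in>?J. norm ((d i - c i) *\<^sub>R frame P s i))"
        unfolding dist_norm coord_chart[OF sK ds] coord_chart[OF sK cs] affine_map_diff by (rule norm_sum)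
      also have "\<dots> \<le> (\<Sum>i\<in>?J. F * \<bar>d i - c i\<bar>)"
      proof (rule sum_mono)
        fix i assume i: "i \<in> ?J"
        have "norm (frame P s i) \<le> F" unfolding F_def using i member_le_sum[of i ?J "\<lambda>i. norm (frame P s i)"] by simp
        then show "norm ((d i - c i) *\<^sub>R frame P s i) \<le> F * \<bar>d i - c i\<bar>" by (simp add: mult.commute mult_right_mono)
      qed
      also have "\<dots> < F * m" unfolding sum_distrib_left[symmetric] using l F by (rule mult_strict_left_mono)
      also have "\<dots> \<le> F * (\<delta> / F)" using mle(1) F by (intro mult_left_mono) auto
      finally have "chart s d \<in> U" using \<delta>(2)[of "chart s d"] F by simp
      with dp show "d \<in> {c \<in> pint s. chart s c \<in> U}" by simp
    qed
  qed
qed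

lemma countable_box_cover:
  assumes s: "maximal s" and U: "open U"
    and ae: "\<And>a b. finite_index.box (free_vertices s) a b \<subseteq> {c \<in> pint s. chart s c \<in> U} \<Longrightarrow>
      AE c in PM s. c \<in> finite_index.box (free_vertices s) a b \<longrightarrow> Q c"
  shows "AE c in PM s. c \<in> pint s \<longrightarrow> chart s c \<in> U \<longrightarrow> Q c"
proof -
  let ?J = "free_vertices s"
  have sK: "s \<in> cplx P" using s maximal_in by blast
  interpret finite_index ?J by (rule finite_index_free[OF sK])
  \<comment> \<open>The rational corners are taken extensional on the finite set of free vertices,
    which makes the family of boxes countable whatever the set of all vertices is.\<close>
  define I where "I = {(a, b). a \<in> PiE ?J (\<lambda>_. UNIV :: rat set) \<and> b \<in> PiE ?J (\<lambda>_. UNIV :: rat set) \<and>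
    box (\<lambda>i. real_of_rat (a i)) (\<lambda>i. real_of_rat (b i)) \<subseteq> {c \<in> pint s. chart s c \<in> U}}"
  have "countable (PiE ?J (\<lambda>_. UNIV :: rat set) \<times> PiE ?J (\<lambda>_. UNIV :: rat set))"
    by (intro countable_SIGMA countable_PiE) auto
  then have cI: "countable I" by (rule countable_subset[rotated]) (auto simp: I_def)
  have "AE c in PM s. \<forall>p\<in>I. c \<in> box (\<lambda>i. real_of_rat (fst p i)) (\<lambda>i. real_of_rat (snd p i)) \<longrightarrow> Q c"
    using cI by (intro AE_ball_countable[THEN iffD2] ballI ae) (auto simp: I_def)
  then show ?thesis
  proof eventually_elim
    case (elim c)
    show ?case
    proof (intro impI)
      assume c: "c \<in> pint s" "chart s c \<in> U"
      obtain a b where ab: "c \<in> box (\<lambda>i. real_of_rat (a i)) (\<lambda>i. real_of_rat (b i))"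
        "box (\<lambda>i. real_of_rat (a i)) (\<lambda>i. real_of_rat (b i)) \<subseteq> {c \<in> pint s. chart s c \<in> U}"
        using chart_box_cover[OF s U c] by blast
      have eq: "box (\<lambda>i. real_of_rat (restrict a ?J i)) (\<lambda>i. real_of_rat (restrict b ?J i)) = box (\<lambda>i. real_of_rat (a i)) (\<lambda>i. real_of_rat (b i))"
        by (auto simp: box_def)
      have "(restrict a ?J, restrict b ?J) \<in> I" using ab(2) eq by (auto simp: I_def)
      then have "c \<in> box (\<lambda>i. real_of_rat (restrict a ?J i)) (\<lambda>i. real_of_rat (restrict b ?J i)) \<longrightarrow> Q c"
        using bspec[OF elim, of "(restrict a ?J, restrict b ?J)"] by (simp only: fst_conv snd_conv) blast
      with ab(1) show "Q c" unfolding eq by blast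
    qed
  qed
qed

lemma ginner_representative:
  assumes s: "maximal s" and sob: "sobolev_grad P U f G" and i: "i \<in> free_vertices s"
  obtains H where "H \<in> borel_measurable (PM s)" "AE c in PM s. c \<in> pint s \<longrightarrow> chart s c \<in> U \<longrightarrow> ginner P (chart s c) (G (chart s c)) (frame P s i) = H c"
proof -
  let ?J = "free_vertices s"
  have sK: "s \<in> cplx P" using s maximal_in by blast
  have "\<exists>m. m \<in> borel_measurable (PM s) \<and> (AE c in PM s. c \<in> pint s \<longrightarrow> dual s j (indicator U (chart s c) *\<^sub>R G (chart s c)) = m c)" if j: "j \<in> ?J" for j
  proof -
    have "(\<lambda>x. indicator U x *\<^sub>R G x) \<in> borel_measurable (vol P)"
      using sob by (simp add: sobolev_grad_def set_borel_measurable_def)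
    then have "(\<lambda>x. dual s j (indicator U x *\<^sub>R G x)) \<in> borel_measurable (vol P)"
      by (rule measurable_compose) (intro borel_measurable_continuous_onI linear_continuous_on dual_bounded_linear sK j)
    from pull_back_measurable[OF s this] show ?thesis by blast
  qed
  then obtain m where m: "\<And>j. j \<in> ?J \<Longrightarrow> m j \<in> borel_measurable (PM s)"
    "\<And>j. j \<in> ?J \<Longrightarrow> AE c in PM s. c \<in> pint s \<longrightarrow> dual s j (indicator U (chart s c) *\<^sub>R G (chart s c)) = m j c"
    using choice_on[of ?J "\<lambda>j m. m \<in> borel_measurable (PM s) \<and> (AE c in PM s. c \<in> pint s \<longrightarrow> dual s j (indicator U (chart s c) *\<^sub>R G (chart s c)) = m c)"]
    by blast
  have "\<exists>r. r \<in> borel_measurable (PM s) \<and> (AE c in PM s. c \<in> pint s \<longrightarrow> riem_comp P s c j i = r c)" if j: "j \<in> ?J" for j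
    using riem_comp_measurable[OF s j i] by blast
  then obtain r where r: "\<And>j. j \<in> ?J \<Longrightarrow> r j \<in> borel_measurable (PM s)"
    "\<And>j. j \<in> ?J \<Longrightarrow> AE c in PM s. c \<in> pint s \<longrightarrow> riem_comp P s c j i = r j c"
    using choice_on[of ?J "\<lambda>j r. r \<in> borel_measurable (PM s) \<and> (AE c in PM s. c \<in> pint s \<longrightarrow> riem_comp P s c j i = r c)"]
    by blast
  have GT: "AE x in vol P. x \<in> U \<longrightarrow> G x \<in> tangent P (carrier_simplex P x)" using sob by (simp add: sobolev_grad_def)
  show thesis
  proof (rule that)
    show "(\<lambda>c. \<Sum>j\<in>?J. m j c * r j c) \<in> borel_measurable (PM s)"
      by (intro borel_measurable_sum borel_measurable_times m r)
    have "AE c in PM s. \<forall>j\<in>?J. c \<in> pint s \<longrightarrow> dual s j (indicator U (chart s c) *\<^sub>R G (chart s c)) = m j c"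
      using m(2) free_finite[OF sK] by (subst AE_finite_all) auto
    moreover have "AE c in PM s. \<forall>j\<in>?J. c \<in> pint s \<longrightarrow> riem_comp P s c j i = r j c"
      using r(2) free_finite[OF sK] by (subst AE_finite_all) auto
    ultimately show "AE c in PM s. c \<in> pint s \<longrightarrow> chart s c \<in> U \<longrightarrow> ginner P (chart s c) (G (chart s c)) (frame P s i) = (\<Sum>j\<in>?J. m j c * r j c)"
      using AE_chart[OF s GT] Lam(2)[OF s]
    proof eventually_elim
      case (elim c)
      show ?case
      proof (intro impI)
        assume c: "c \<in> pint s" "chart s c \<in> U"
        have cs: "c \<in> param_simplex s" using c pint_subset by blast
        have x: "chart s c \<in> inter s" by (rule chart_pint[OF sK c(1)])
        have g: "good Lam s (coord P (chart s c))" using elim c by (simp add: coord_chart[OF sK cs])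
        have GT': "G (chart s c) \<in> tangent P s" using elim c x by (simp add: inter_def)
        show "ginner P (chart s c) (G (chart s c)) (frame P s i) = (\<Sum>j\<in>?J. m j c * r j c)"
          unfolding ginner_frame[OF s x g GT' i] param_chart[OF sK cs]
          using elim c by (intro sum.cong refl) auto
      qed
    qed
  qed
qed

text \<open>The right-hand side of \<open>sobolev_weak\<close> contains f but no gradient, so the
  frame components of both gradients have the same integrals against all test functions of a box and
  agree by \<open>fundamental_lemma\<close>. The frame components determine a tangent vector because
  g is positive.\<close>

theorem sobolev_grad_unique:
  assumes U: "open U" and V: "open V" and G1: "sobolev_grad P U f G1" and G2: "sobolev_grad P V f G2"
  shows "AE x in vol P. x \<in> U \<inter> V \<longrightarrow> G1 x = G2 x"
proof -
  have "AE x in vol P. (\<exists>s. maximal s \<and> x \<in> inter s) \<and> (x \<in> U \<inter> V \<longrightarrow> G1 x = G2 x)"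
  proof (rule AE_volI)
    fix s assume s: "maximal s"
    let ?J = "free_vertices s"
    have sK: "s \<in> cplx P" using s maximal_in by blast
    interpret finite_index ?J by (rule finite_index_free[OF sK])
    have fr: "frame P s i \<in> tangent P s" if "i \<in> ?J" for i
      using that frame_tangent[OF sK] by (simp add: free_vertices_def)
    have comp: "AE c in PM s. c \<in> pint s \<longrightarrow> chart s c \<in> U \<inter> V \<longrightarrow>
        ginner P (chart s c) (G1 (chart s c)) (frame P s i) = ginner P (chart s c) (G2 (chart s c)) (frame P s i)" if i: "i \<in> ?J" for i
    proof (rule countable_box_cover[OF s])
      show "open (U \<inter> V)" using U V by blast
      fix a b assume sub: "box a b \<subseteq> {c \<in> pint s. chart s c \<in> U \<inter> V}"
      obtain H1 where H1 [measurable]: "H1 \<in> borel_measurable (PM s)"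
        and H1e: "AE c in PM s. c \<in> pint s \<longrightarrow> chart s c \<in> U \<longrightarrow> ginner P (chart s c) (G1 (chart s c)) (frame P s i) = H1 c"
        using ginner_representative[OF s G1 i] by blast
      obtain H2 where H2 [measurable]: "H2 \<in> borel_measurable (PM s)"
        and H2e: "AE c in PM s. c \<in> pint s \<longrightarrow> chart s c \<in> V \<longrightarrow> ginner P (chart s c) (G2 (chart s c)) (frame P s i) = H2 c"
        using ginner_representative[OF s G2 i] by blast
      have "(\<lambda>x. indicator U x *\<^sub>R f x) \<in> borel_measurable (vol P)"
        using G1 by (simp add: sobolev_grad_def set_borel_measurable_def)
      then obtain F where F: "F \<in> borel_measurable (PM s)" "AE c in PM s. c \<in> pint s \<longrightarrow> indicator U (chart s c) *\<^sub>R f (chart s c) = F c"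
        using pull_back_measurable[OF s] by blast
      have F': "AE c in PM s. c \<in> box a b \<longrightarrow> f (chart s c) = F c"
        using F(2) by eventually_elim (use sub in auto)
      have H1': "AE c in PM s. c \<in> box a b \<longrightarrow> ginner P (chart s c) (G1 (chart s c)) (frame P s i) = H1 c"
        using H1e by eventually_elim (use sub in auto)
      have H2': "AE c in PM s. c \<in> box a b \<longrightarrow> ginner P (chart s c) (G2 (chart s c)) (frame P s i) = H2 c"
        using H2e by eventually_elim (use sub in auto)
      have Q1: "c \<in> box a b \<Longrightarrow> c \<in> pint s \<and> chart s c \<in> U" and Q2: "c \<in> box a b \<Longrightarrow> c \<in> pint s \<and> chart s c \<in> V" for c
        using sub by auto
      note w1 = sobolev_weak[OF s U G1 Q1 i H1 H1' F(1) F'] and w2 = sobolev_weak[OF s V G2 Q2 i H2 H2' F(1) F']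
      \<comment> \<open>Integrability of \<open>H1\<close> and \<open>H2\<close> does not involve
        the test function, so the zero function serves to extract it from
        \<open>sobolev_weak\<close>.\<close>
      have z: "lip 0 (\<lambda>_. 0)" "within_box a b (\<lambda>_. 0)" by (auto simp: lip_def within_box_def)
      have int: "integrable M (\<lambda>c. indicator (box a b) c * H1 c)" "integrable M (\<lambda>c. indicator (box a b) c * H2 c)"
        using w1(1)[OF _ z] w2(1)[OF _ z] by auto
      have "AE c in M. c \<in> box a b \<longrightarrow> H1 c - H2 c = 0"
      proof (rule fundamental_lemma)
        show "integrable M (\<lambda>c. indicator (box a b) c * (H1 c - H2 c))"
          unfolding right_diff_distrib by (intro Bochner_Integration.integrable_diff int)
        fix L \<psi> assume \<psi>: "lip L \<psi>" "within_box a b \<psi>"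
        obtain C where C: "\<And>c. \<bar>\<psi> c\<bar> \<le> C" using within_box_bound[OF \<psi>] by blast
        have \<psi>I: "indicator (box a b) c * h c * \<psi> c = h c * \<psi> c" if "c \<in> space M" for h :: "_ \<Rightarrow> real" and c
          using \<psi>(2) that by (cases "\<psi> c = 0") (auto simp: within_box_def box_def)
        have i1: "integrable M (\<lambda>c. h c * \<psi> c)" if "integrable M (\<lambda>c. indicator (box a b) c * h c)" for h
          using integrable_mult_bounded[OF that lip_measurable[OF \<psi>(1)], of C] C
          by (simp add: \<psi>I cong: Bochner_Integration.integrable_cong)
        have "(\<integral>c. (H1 c - H2 c) * \<psi> c \<partial>M) = (\<integral>c. H1 c * \<psi> c \<partial>M) - (\<integral>c. H2 c * \<psi> c \<partial>M)"
          unfolding left_diff_distrib by (intro Bochner_Integration.integral_diff i1 int)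
        also have "\<dots> = 0" using w1(2)[OF _ \<psi>] w2(2)[OF _ \<psi>] by simp
        finally show "(\<integral>c. (H1 c - H2 c) * \<psi> c \<partial>M) = 0" .
      qed measurable
      then show "AE c in PM s. c \<in> box a b \<longrightarrow> ginner P (chart s c) (G1 (chart s c)) (frame P s i) = ginner P (chart s c) (G2 (chart s c)) (frame P s i)"
        using H1' H2' by eventually_elim auto
    qed
    have T1: "AE x in vol P. x \<in> U \<longrightarrow> G1 x \<in> tangent P (carrier_simplex P x)" using G1 by (simp add: sobolev_grad_def)
    have T2: "AE x in vol P. x \<in> V \<longrightarrow> G2 x \<in> tangent P (carrier_simplex P x)" using G2 by (simp add: sobolev_grad_def)
    have "AE c in PM s. \<forall>i\<in>?J. c \<in> pint s \<longrightarrow> chart s c \<in> U \<inter> V \<longrightarrow>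
        ginner P (chart s c) (G1 (chart s c)) (frame P s i) = ginner P (chart s c) (G2 (chart s c)) (frame P s i)"
      using comp by (subst AE_finite_all) auto
    then show "AE c in PM s. c \<in> pint s \<longrightarrow> (chart s c \<in> U \<inter> V \<longrightarrow> G1 (chart s c) = G2 (chart s c))"
      using AE_chart[OF s T1] AE_chart[OF s T2] Lam(2)[OF s]
    proof eventually_elim
      case (elim c)
      show ?case
      proof (intro impI)
        assume c: "c \<in> pint s" "chart s c \<in> U \<inter> V"
        have cs: "c \<in> param_simplex s" using c pint_subset by blast
        let ?x = "chart s c"
        have x: "?x \<in> inter s" by (rule chart_pint[OF sK c(1)])
        have B: "inner_product_on (tangent P s) (ginner P ?x)"
        proof -
          have "ginner P ?x = riem P s (coord P ?x)" using x by (simp add: ginner_def inter_def fun_eq_iff)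
          then show ?thesis using elim c by (simp add: coord_chart[OF sK cs] good_def)
        qed
        have G: "G1 ?x \<in> tangent P s" "G2 ?x \<in> tangent P s" using elim c x by (auto simp: inter_def)
        have d: "G1 ?x - G2 ?x \<in> tangent P s" by (rule subspace_diff[OF tangent_subspace G])
        have "ginner P ?x (G1 ?x) (G1 ?x - G2 ?x) = ginner P ?x (G2 ?x) (G1 ?x - G2 ?x)"
          unfolding inner_product_frame[OF sK B G(1) d] inner_product_frame[OF sK B G(2) d]
          using elim c by (intro sum.cong refl) auto
        moreover have "ginner P ?x ((G1 ?x - G2 ?x) + G2 ?x) (G1 ?x - G2 ?x) = ginner P ?x (G1 ?x - G2 ?x) (G1 ?x - G2 ?x) + ginner P ?x (G2 ?x) (G1 ?x - G2 ?x)"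
          using B d G unfolding inner_product_on_def by blast
        ultimately have "ginner P ?x (G1 ?x - G2 ?x) (G1 ?x - G2 ?x) = 0" by simp
        moreover have "0 < ginner P ?x \<xi> \<xi>" if "\<xi> \<in> tangent P s" "\<xi> \<noteq> 0" for \<xi>
          using B that unfolding inner_product_on_def by blast
        ultimately have "G1 ?x - G2 ?x = 0" using d by force
        then show "G1 ?x = G2 ?x" by simp
      qed
    qed
  qed
  then show ?thesis by eventually_elim blast
qed

section \<open>Gradients of local Sobolev functions\<close>

text \<open>\<open>coord P\<close> is a homeomorphism onto a closed subset of the Euclidean space,
  where closed bounded sets are compact.\<close>

lemma compact_of_coord:
  assumes "closed S" "bounded (coord P ` S)" shows "compact S"
proof -
  have "coord P ` S = range (coord P) \<inter> the_inv (coord P) -` S" by force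
  then have "closed (coord P ` S)"
    using continuous_closed_preimage[OF inv_coord_continuous coord_closed assms(1)] by simp
  then have "compact (coord P ` S)" using assms(2) by (simp add: compact_eq_bounded_closed)
  moreover have "continuous_on (coord P ` S) (the_inv (coord P))"
    by (rule continuous_on_subset[OF inv_coord_continuous]) auto
  ultimately have "compact (the_inv (coord P) ` coord P ` S)" using compact_continuous_image by blast
  then show ?thesis by (simp add: image_image)
qed

lemma closed_simplex_closed: "closed (closed_simplex P s)"
proof -
  have "closed_simplex P s = (\<Inter>v\<in>- s. {x. bary P x v = 0})"
    by (auto simp: closed_simplex_def carrier_simplex_def)
  then show ?thesis by (auto intro!: closed_INT closed_Collect_eq bary_continuous continuous_on_const)
qed

lemma compact_closure_inter:
  assumes s: "s \<in> cplx P" shows "compact (closure (inter s))"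
proof (rule compact_of_coord)
  have sub: "closure (inter s) \<subseteq> closed_simplex P s"
    using inter_closed by (intro closure_minimal closed_simplex_closed) auto
  have "norm (coord P x - coord P y) \<le> (\<Sum>i\<in>free_vertices s. norm (frame P s i))"
    if "x \<in> closed_simplex P s" "y \<in> closed_simplex P s" for x y
    unfolding coord_affine[OF s that(1)] coord_affine[OF s that(2)]
    by (intro affine_map_diff_bound s param_in that)
  then have "bounded (coord P ` closed_simplex P s)"
    unfolding bounded_two_points by (auto simp: dist_norm)
  then show "bounded (coord P ` closure (inter s))" using sub by (meson bounded_subset image_mono)
qed simp

lemma coord_inter_convex:
  assumes s: "s \<in> cplx P" shows "convex (coord P ` inter s)"
proof (rule convexI)
  fix y z :: 'e and u v :: real
  assume "y \<in> coord P ` inter s" "z \<in> coord P ` inter s" and uv: "0 \<le> u" "0 \<le> v" "u + v = 1"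
  then obtain x x' where x: "x \<in> inter s" "y = coord P x" and x': "x' \<in> inter s" "z = coord P x'" by blast
  let ?J = "free_vertices s"
  define c where "c = (\<lambda>i\<in>?J. u * param s x i + v * param s x' i)"
  have p: "param s x \<in> pint s" "param s x' \<in> pint s" using param_pint[OF s] x x' by auto
  have "(\<Sum>i\<in>?J. c i) = u * (\<Sum>i\<in>?J. param s x i) + v * (\<Sum>i\<in>?J. param s x' i)"
    by (simp add: c_def sum.distrib sum_distrib_left)
  also have "\<dots> < 1"
    using p uv convex_bound_lt[of "\<Sum>i\<in>?J. param s x i" 1 "\<Sum>i\<in>?J. param s x' i" u v] by (simp add: pint_def)
  moreover have "0 < u * param s x i + v * param s x' i" if "i \<in> ?J" for i
  proof -
    have "0 < param s x i" "0 < param s x' i" using p that by (auto simp: pint_def)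
    then show ?thesis using uv by (cases "u = 0") (auto intro: add_pos_nonneg)
  qed
  ultimately have c: "c \<in> pint s" by (auto simp: pint_def c_def)
  have "affine_map s c = (u + v) *\<^sub>R vert P (base_vertex s) + (\<Sum>i\<in>?J. c i *\<^sub>R frame P s i)"
    using uv by (simp add: affine_map_def)
  also have "\<dots> = u *\<^sub>R affine_map s (param s x) + v *\<^sub>R affine_map s (param s x')"
    by (simp add: affine_map_def c_def scaleR_add_left scaleR_add_right sum.distrib scaleR_sum_right)
  also have "\<dots> = u *\<^sub>R y + v *\<^sub>R z"
    using coord_affine[OF s] inter_closed x x' by simp
  finally have "coord P (chart s c) = u *\<^sub>R y + v *\<^sub>R z"
    using coord_chart[OF s] pint_subset c by (simp add: subset_eq)
  then show "u *\<^sub>R y + v *\<^sub>R z \<in> coord P ` inter s" using chart_pint[OF s c] by (metis imageI)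
qed

text \<open>It makes the open maximal simplices domains to which the definition of
  \<open>W12_loc\<close> applies. They are connected because they are convex in Euclidean
  coordinates.\<close>

lemma inter_domain:
  assumes s: "maximal s" shows "rel_compact_domain (inter s)"
proof -
  have sK: "s \<in> cplx P" using s maximal_in by blast
  have "connected (the_inv (coord P) ` coord P ` inter s)"
    by (intro connected_continuous_image continuous_on_subset[OF inv_coord_continuous] convex_connected coord_inter_convex sK) auto
  then have "connected (inter s)" by (simp add: image_image)
  moreover have "inter s \<noteq> {}" using pint_not_null[OF sK, of "\<lambda>_. True"] chart_pint[OF sK] by auto
  ultimately show ?thesis
    using inter_open[OF s] compact_closure_inter[OF sK] by (simp add: rel_compact_domain_def)
qed

lemma AE_inter: "AE x in vol P. \<exists>s. maximal s \<and> x \<in> inter s"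
  using AE_volI[of "\<lambda>_. True"] by simp

lemma countable_maximal: "countable (maximal_simplices (cplx P))"
  using simplicial(2) by (rule countable_subset[rotated]) (auto simp: maximal_simplices_def)

lemma AE_vol_pieces:
  assumes "\<And>s. maximal s \<Longrightarrow> AE x in vol P. x \<in> inter s \<longrightarrow> Q x"
  shows "AE x in vol P. Q x"
proof -
  have "AE x in vol P. \<forall>s\<in>maximal_simplices (cplx P). x \<in> inter s \<longrightarrow> Q x"
    by (rule AE_ball_countable[OF countable_maximal, THEN iffD2]) (use assms in blast)
  with AE_inter show ?thesis by eventually_elim blast
qed

lemma borel_vol: "m \<in> borel_measurable borel \<Longrightarrow> m \<in> borel_measurable (vol P)"
  unfolding vol_eq by (intro measurable_completion) (simp cong: measurable_cong_sets)

text \<open>The volume is complete, so a change on a null set preserves measurability of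
  preimages.\<close>

lemma measurable_vol_AE:
  fixes F G :: "'x \<Rightarrow> 'b::topological_space"
  assumes F: "F \<in> borel_measurable (vol P)" and eq: "AE x in vol P. F x = G x"
  shows "G \<in> borel_measurable (vol P)"
proof (rule borel_measurableI)
  have sp: "space (vol P) = UNIV" by (simp add: vol_eq)
  fix S :: "'b set" assume "open S"
  then have "F -` S \<in> sets (vol P)" using measurable_sets[OF F, of S] by (simp add: sp)
  moreover have "AE x in vol P. x \<in> F -` S \<longleftrightarrow> x \<in> G -` S" using eq by eventually_elim simp
  ultimately show "G -` S \<inter> space (vol P) \<in> sets (vol P)"
    by (simp only: vol_eq space_completion space_vol0 Int_UNIV_right) (rule completion.in_sets_AE, assumption+, simp)
qed

lemma inter_borel: "s \<in> cplx P \<Longrightarrow> inter s \<in> sets borel"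
proof -
  assume s: "s \<in> cplx P"
  have "inter s = closed_simplex P s \<inter> (\<Inter>v\<in>s. {x. bary P x v \<noteq> 0})"
    by (auto simp: inter_def closed_simplex_def carrier_simplex_def)
  moreover have "open (\<Inter>v\<in>s. {x. bary P x v \<noteq> 0})"
    using simplex_finite[OF s] by (auto intro!: open_INT open_Collect_neq bary_continuous continuous_on_const)
  ultimately show ?thesis using closed_simplex_closed by (auto intro!: sets.Int)
qed

text \<open>The carrier is a measurable function with countably many values, so measurable pieces
  chosen by it are measurable together; completeness absorbs the null set where F differs.\<close>

lemma measurable_vol_pieces:
  fixes F :: "'x \<Rightarrow> real"
  assumes F: "\<And>s. maximal s \<Longrightarrow> \<exists>m. m \<in> borel_measurable (vol P) \<and> (AE x in vol P. x \<in> inter s \<longrightarrow> F x = m x)"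
  shows "F \<in> borel_measurable (vol P)"
proof -
  obtain m where m: "\<forall>s\<in>maximal_simplices (cplx P). m s \<in> borel_measurable (vol P) \<and> (AE x in vol P. x \<in> inter s \<longrightarrow> F x = m s x)"
    using choice_on[of "maximal_simplices (cplx P)" "\<lambda>s m. m \<in> borel_measurable (vol P) \<and> (AE x in vol P. x \<in> inter s \<longrightarrow> F x = m x)"] F
    by blast
  let ?G = "\<lambda>s x. if maximal s then m s x else 0"
  have sp: "space (vol P) = UNIV" by (simp add: vol_eq)
  have c: "carrier_simplex P \<in> measurable (vol P) (count_space (cplx P))"
    unfolding vol_eq
  proof (rule measurable_completion)
    show "carrier_simplex P \<in> measurable vol0 (count_space (cplx P))"
      unfolding measurable_count_space_eq_countable[OF simplicial(2)] space_vol0 sets_vol0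
      using carrier_in inter_borel by (auto simp: inter_def vimage_def)
  qed
  have "(\<lambda>x. ?G (carrier_simplex P x) x) \<in> borel_measurable (vol P)"
  proof (rule measurable_compose_countable'[OF _ c simplicial(2)])
    fix s show "?G s \<in> borel_measurable (vol P)" using m by (cases "maximal s") auto
  qed
  moreover have "AE x in vol P. ?G (carrier_simplex P x) x = F x"
  proof (rule AE_vol_pieces)
    fix s assume s: "maximal s"
    with m have "AE x in vol P. x \<in> inter s \<longrightarrow> F x = m s x" by blast
    then show "AE x in vol P. x \<in> inter s \<longrightarrow> ?G (carrier_simplex P x) x = F x"
      by eventually_elim (use s in \<open>auto simp: inter_def\<close>)
  qed
  ultimately show ?thesis by (rule measurable_vol_AE)
qed

lemma sobolev_grad_cong:
  assumes sob: "sobolev_grad P U u G" and eq: "AE x in vol P. x \<in> U \<longrightarrow> G x = G' x"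
  shows "sobolev_grad P U u G'"
proof -
  have "AE x in vol P. indicator U x *\<^sub>R G x = indicator U x *\<^sub>R G' x"
    using eq by eventually_elim (auto simp: indicator_def)
  then have "set_borel_measurable (vol P) U G'"
    using sob measurable_vol_AE[of "\<lambda>x. indicator U x *\<^sub>R G x" "\<lambda>x. indicator U x *\<^sub>R G' x"]
    unfolding sobolev_grad_def set_borel_measurable_def by blast
  moreover have "AE x in vol P. x \<in> U \<longrightarrow> G' x \<in> tangent P (carrier_simplex P x)"
    using sob[unfolded sobolev_grad_def, THEN conjunct2, THEN conjunct2, THEN conjunct1] eq by eventually_elim auto
  moreover have "(\<integral>\<^sup>+ x\<in>U. ennreal ((\<phi> k x - u x)\<^sup>2 + (gnorm P x (rgrad P (\<phi> k) x - G' x))\<^sup>2) \<partial>vol P) =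
      (\<integral>\<^sup>+ x\<in>U. ennreal ((\<phi> k x - u x)\<^sup>2 + (gnorm P x (rgrad P (\<phi> k) x - G x))\<^sup>2) \<partial>vol P)" for \<phi> :: "nat \<Rightarrow> 'x \<Rightarrow> real" and k
    using eq by (intro nn_integral_cong_AE, eventually_elim) (auto simp: indicator_def)
  ultimately show ?thesis using sob unfolding sobolev_grad_def by simp
qed

theorem sgrad_sobolev:
  assumes f: "f \<in> W12_loc P" and U: "rel_compact_domain U"
  shows "sobolev_grad P U f (sgrad P f)"
proof -
  have ex: "\<exists>G. sobolev_grad P V f G" if "rel_compact_domain V" for V
    using f that by (auto simp: W12_loc_def W12_def)
  then obtain Gs where Gs: "\<forall>s\<in>maximal_simplices (cplx P). sobolev_grad P (inter s) f (Gs s)"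
    using choice_on[of "maximal_simplices (cplx P)" "\<lambda>s G. sobolev_grad P (inter s) f G"] inter_domain by blast
  \<comment> \<open>Measurability of G on a domain is not proved from the pieces: on each domain G
    agrees almost everywhere with a gradient given there and inherits its properties by
    \<open>sobolev_grad_cong\<close>.\<close>
  define G where "G x = Gs (carrier_simplex P x) x" for x
  have "sobolev_grad P V f G" if V: "rel_compact_domain V" for V
  proof -
    obtain GV where GV: "sobolev_grad P V f GV" using ex[OF V] by blast
    have "AE x in vol P. x \<in> V \<longrightarrow> GV x = G x"
    proof (rule AE_vol_pieces)
      fix s assume s: "maximal s"
      have "AE x in vol P. x \<in> V \<inter> inter s \<longrightarrow> GV x = Gs s x"
        using V Gs s by (intro sobolev_grad_unique[OF _ inter_open[OF s] GV]) (auto simp: rel_compact_domain_def)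
      then show "AE x in vol P. x \<in> inter s \<longrightarrow> x \<in> V \<longrightarrow> GV x = G x"
        by eventually_elim (auto simp: G_def inter_def)
    qed
    then show ?thesis by (rule sobolev_grad_cong[OF GV])
  qed
  then have "\<exists>G. \<forall>U. rel_compact_domain U \<longrightarrow> sobolev_grad P U f G" by blast
  from someI_ex[OF this] show ?thesis using U unfolding sgrad_def by blast
qed

lemma AE_sgrad_tangent:
  assumes f: "f \<in> W12_loc P"
  shows "AE x in vol P. sgrad P f x \<in> tangent P (carrier_simplex P x)"
proof (rule AE_vol_pieces)
  fix s assume "maximal s"
  then show "AE x in vol P. x \<in> inter s \<longrightarrow> sgrad P f x \<in> tangent P (carrier_simplex P x)"
    using sgrad_sobolev[OF f inter_domain] by (simp add: sobolev_grad_def)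
qed

lemma AE_differential:
  assumes "glipschitz_on P UNIV u" shows "AE x in vol P. \<exists>s D. differential u x s D"
proof -
  have "AE x in vol P. (\<exists>s. maximal s \<and> x \<in> inter s) \<and> (\<exists>s D. differential u x s D)"
  proof (rule AE_volI)
    fix s assume s: "maximal s"
    show "AE c in PM s. c \<in> pint s \<longrightarrow> (\<exists>t D. differential u (chart s c) t D)"
      by (rule chart_extension[OF s open_UNIV assms]) (erule AE_mp, auto)
  qed
  then show ?thesis by eventually_elim blast
qed

text \<open>Paired with a gradient, g disappears and only the differential is left. This gives
  linearity in u and measurability of the integrand without studying \<open>rgrad\<close> as a
  vector field.\<close>

lemma ginner_rgrad:
  assumes D: "differential u x s D" and \<xi>: "\<xi> \<in> tangent P s"
  shows "ginner P x \<xi> (rgrad P u x) = D \<xi>"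
proof -
  have "ginner P x = riem P s (coord P x)" by (simp add: ginner_def differentialD(5)[OF D] fun_eq_iff)
  then have "ginner P x \<xi> (rgrad P u x) = ginner P x (rgrad P u x) \<xi>"
    using differentialD(3)[OF D] rgrad_differential(1)[OF D] \<xi> by (simp add: good_def inner_product_on_def)
  then show ?thesis using rgrad_differential(2)[OF D \<xi>] by simp
qed

lemma ginner_rgrad_add:
  assumes "differential u x s D" "differential v x t E" and \<xi>: "\<xi> \<in> tangent P (carrier_simplex P x)"
  shows "ginner P x \<xi> (rgrad P (\<lambda>y. u y + v y) x) = ginner P x \<xi> (rgrad P u x) + ginner P x \<xi> (rgrad P v x)"
proof -
  have t: "t = s" using assms differentialD(5) by blast
  have "differential (\<lambda>y. u y + v y) x s (\<lambda>\<xi>. D \<xi> + E \<xi>)"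
    using assms(1,2) unfolding t differential_def by (auto intro: has_derivative_add)
  from ginner_rgrad[OF this] ginner_rgrad[OF assms(1)] ginner_rgrad[OF assms(2)] show ?thesis
    using \<xi> t differentialD(5)[OF assms(1)] by simp
qed

lemma ginner_rgrad_scale:
  assumes "differential u x s D" and \<xi>: "\<xi> \<in> tangent P (carrier_simplex P x)"
  shows "ginner P x \<xi> (rgrad P (\<lambda>y. a * u y) x) = a * ginner P x \<xi> (rgrad P u x)"
proof -
  have "differential (\<lambda>y. a * u y) x s (\<lambda>\<xi>. a * D \<xi>)"
    using assms(1) unfolding differential_def by (auto intro: has_derivative_mult_right)
  from ginner_rgrad[OF this] ginner_rgrad[OF assms(1)] show ?thesis
    using \<xi> differentialD(5)[OF assms(1)] by simp
qed

text \<open>In an open maximal simplex the integrand is the differential of h applied to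
  \<open>sgrad P f\<close>: a finite sum of partial derivatives of an extension of h times
  coordinates of the gradient, all of them measurable.\<close>

lemma integrand_measurable:
  assumes f: "f \<in> W12_loc P" and h: "glipschitz_on P UNIV h"
  shows "(\<lambda>x. ginner P x (sgrad P f x) (rgrad P h x)) \<in> borel_measurable (vol P)"
proof (rule measurable_vol_pieces)
  fix s assume s: "maximal s"
  let ?J = "free_vertices s"
  have sK: "s \<in> cplx P" using s maximal_in by blast
  interpret finite_index ?J by (rule finite_index_free[OF sK])
  obtain K v where v: "lip K v" "AE c in PM s. c \<in> pint s \<longrightarrow> chart s c \<in> UNIV \<longrightarrow>
       differential h (chart s c) s (\<lambda>\<xi>. \<Sum>i\<in>?J. partial s v i c * dual s i \<xi>)"
    by (rule chart_extension[OF s open_UNIV h]) (rule that)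
  define m where "m x = (\<Sum>i\<in>?J. partial s v i (param s x) * dual s i (indicator (inter s) x *\<^sub>R sgrad P f x))" for x
  have "(\<lambda>x. indicator (inter s) x *\<^sub>R sgrad P f x) \<in> borel_measurable (vol P)"
    using sgrad_sobolev[OF f inter_domain[OF s]] by (simp add: sobolev_grad_def set_borel_measurable_def)
  then have "(\<lambda>x. dual s i (indicator (inter s) x *\<^sub>R sgrad P f x)) \<in> borel_measurable (vol P)" if "i \<in> ?J" for i
    by (rule measurable_compose) (intro borel_measurable_continuous_onI linear_continuous_on dual_bounded_linear sK that)
  moreover have "(\<lambda>x. partial s v i (param s x)) \<in> borel_measurable (vol P)" for i
    by (intro borel_vol measurable_compose[OF param_measurable dd_measurable[OF v(1)]])
  ultimately have "m \<in> borel_measurable (vol P)"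
    unfolding m_def by (intro borel_measurable_sum borel_measurable_times)
  moreover have "AE x in vol P. x \<in> inter s \<longrightarrow> differential h x s (\<lambda>\<xi>. \<Sum>i\<in>?J. partial s v i (param s x) * dual s i \<xi>)"
  proof -
    have "AE x in vol P. (\<exists>t. maximal t \<and> x \<in> inter t) \<and> (x \<in> inter s \<longrightarrow> differential h x s (\<lambda>\<xi>. \<Sum>i\<in>?J. partial s v i (param s x) * dual s i \<xi>))"
    proof (rule AE_volI)
      fix t assume t: "maximal t"
      show "AE c in PM t. c \<in> pint t \<longrightarrow> (chart t c \<in> inter s \<longrightarrow> differential h (chart t c) s (\<lambda>\<xi>. \<Sum>i\<in>?J. partial s v i (param s (chart t c)) * dual s i \<xi>))"
      proof (cases "t = s")
        case True
        show ?thesis unfolding True using v(2)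
        proof eventually_elim
          case (elim c)
          show ?case
          proof (intro impI)
            assume "c \<in> pint s"
            with elim param_chart[OF sK, of c] pint_subset[of s]
            show "differential h (chart s c) s (\<lambda>\<xi>. \<Sum>i\<in>?J. partial s v i (param s (chart s c)) * dual s i \<xi>)" by auto
          qed
        qed
      next
        case False
        then have "c \<in> pint t \<Longrightarrow> chart t c \<notin> inter s" for c
          using chart_pint[OF maximal_in[OF t]] by (auto simp: inter_def)
        then show ?thesis by auto
      qed
    qed
    then show ?thesis by eventually_elim blast
  qed
  then have "AE x in vol P. x \<in> inter s \<longrightarrow> ginner P x (sgrad P f x) (rgrad P h x) = m x"
    using AE_sgrad_tangent[OF f]
  proof eventually_elim
    case (elim x)
    show ?case
    proof
      assume x: "x \<in> inter s"
      with elim have "differential h x s (\<lambda>\<xi>. \<Sum>i\<in>?J. partial s v i (param s x) * dual s i \<xi>)" "sgrad P f x \<in> tangent P s"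
        by (auto simp: inter_def)
      from ginner_rgrad[OF this] x show "ginner P x (sgrad P f x) (rgrad P h x) = m x" by (simp add: m_def)
    qed
  qed
  ultimately show "\<exists>m. m \<in> borel_measurable (vol P) \<and> (AE x in vol P. x \<in> inter s \<longrightarrow> ginner P x (sgrad P f x) (rgrad P h x) = m x)"
    by blast
qed

text \<open>The differential of h is bounded by L in the Euclidean norm and hence by
  \<open>L * Lam\<close> with respect to g. The domination is used directly on the nonnegative
  integrals, so \<open>gnorm\<close> of the gradient needs no measurability proof.\<close>

theorem integrand_integrable:
  assumes f: "f \<in> W12_loc P" and fin: "(\<integral>\<^sup>+ x. ennreal (gnorm P x (sgrad P f x)) \<partial>vol P) < \<infinity>"
    and h: "glipschitz_on P UNIV h"
  shows "integrable (vol P) (\<lambda>x. ginner P x (sgrad P f x) (rgrad P h x))"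
proof -
  obtain L where L: "0 \<le> L" "\<And>s x y. maximal s \<Longrightarrow> x \<in> UNIV \<Longrightarrow> y \<in> UNIV \<Longrightarrow> x \<in> closed_simplex P s \<Longrightarrow> y \<in> closed_simplex P s
      \<Longrightarrow> \<bar>h x - h y\<bar> \<le> L * dist (coord P x) (coord P y)"
    using glip_simplex[OF h] by blast
  \<comment> \<open>The summand 1 makes C positive, so that the integrand may be divided by
    it.\<close>
  define C where "C = L * Lam + 1"
  have C: "0 < C" using L(1) Lam(1) by (simp add: C_def add_nonneg_pos)
  let ?I = "\<lambda>x. ginner P x (sgrad P f x) (rgrad P h x)"
  have le: "AE x in vol P. ennreal (norm (?I x / C)) \<le> ennreal (gnorm P x (sgrad P f x))"
    using AE_differential[OF h] AE_sgrad_tangent[OF f]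
  proof eventually_elim
    case (elim x)
    then obtain s D where D: "differential h x s D" by blast
    have T: "sgrad P f x \<in> tangent P s" using elim differentialD(5)[OF D] by simp
    have xs: "x \<in> closed_simplex P s" by (rule inter_closed[OF differentialD(2)[OF D]])
    have "\<bar>D (sgrad P f x)\<bar> \<le> L * norm (sgrad P f x)"
      using L(2)[OF differentialD(1)[OF D]] xs by (intro differential_bound[OF D open_UNIV UNIV_I T]) auto
    also have "\<dots> \<le> L * (Lam * gnorm P x (sgrad P f x))"
      using gnorm_bounds(1)[OF differentialD(3,2)[OF D] T] L(1) by (intro mult_left_mono) auto
    also have "\<dots> \<le> C * gnorm P x (sgrad P f x)"
    proof -
      have "0 \<le> Lam * gnorm P x (sgrad P f x)"
        using gnorm_bounds(1)[OF differentialD(3,2)[OF D] T] norm_ge_zero order_trans by blast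
      then have "0 \<le> gnorm P x (sgrad P f x)" using Lam(1) by (simp add: zero_le_mult_iff)
      then show ?thesis by (simp add: C_def distrib_right)
    qed
    finally have "\<bar>?I x\<bar> \<le> C * gnorm P x (sgrad P f x)" by (simp add: ginner_rgrad[OF D T])
    then show ?case using C by (intro ennreal_leI) (simp add: abs_divide divide_le_eq mult.commute)
  qed
  have "integrable (vol P) (\<lambda>x. ?I x / C)"
  proof (rule integrableI_bounded)
    show "(\<lambda>x. ?I x / C) \<in> borel_measurable (vol P)"
      by (intro borel_measurable_divide borel_measurable_const integrand_measurable f h)
    show "(\<integral>\<^sup>+x. ennreal (norm (?I x / C)) \<partial>vol P) < \<infinity>"
      using nn_integral_mono_AE[OF le] fin by (rule le_less_trans)
  qed
  from integrable_mult_right[OF this, of C] show ?thesis using C by simp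
qed

section \<open>The functional of a subharmonic function\<close>

lemma glip_add:
  assumes "glipschitz_on P U u" "glipschitz_on P U v"
  shows "glipschitz_on P U (\<lambda>x. u x + v x)"
proof -
  obtain K where K: "0 \<le> K" "\<And>x y. x \<in> U \<Longrightarrow> y \<in> U \<Longrightarrow> ennreal \<bar>u x - u y\<bar> \<le> ennreal K * gdist P x y"
    using glip_constant[OF assms(1)] by blast
  obtain L where L: "0 \<le> L" "\<And>x y. x \<in> U \<Longrightarrow> y \<in> U \<Longrightarrow> ennreal \<bar>v x - v y\<bar> \<le> ennreal L * gdist P x y"
    using glip_constant[OF assms(2)] by blast
  have "ennreal \<bar>(u x + v x) - (u y + v y)\<bar> \<le> ennreal (K + L) * gdist P x y" if "x \<in> U" "y \<in> U" for x y
  proof -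
    have "ennreal \<bar>(u x + v x) - (u y + v y)\<bar> \<le> ennreal (\<bar>u x - u y\<bar> + \<bar>v x - v y\<bar>)"
      by (intro ennreal_leI) (simp add: abs_diff_triangle_ineq)
    also have "\<dots> = ennreal \<bar>u x - u y\<bar> + ennreal \<bar>v x - v y\<bar>" by simp
    also have "\<dots> \<le> ennreal K * gdist P x y + ennreal L * gdist P x y" using K(2) L(2) that by (intro add_mono)
    also have "\<dots> = ennreal (K + L) * gdist P x y" using K(1) L(1) by (simp add: distrib_right)
    finally show ?thesis .
  qed
  then show ?thesis unfolding glipschitz_on_def by blast
qed

lemma glip_dominated:
  assumes v: "glipschitz_on P U v" and C: "0 \<le> C"
    and le: "\<And>x y. x \<in> U \<Longrightarrow> y \<in> U \<Longrightarrow> \<bar>u x - u y\<bar> \<le> C * \<bar>v x - v y\<bar>"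
  shows "glipschitz_on P U u"
proof -
  obtain L where L: "0 \<le> L" "\<And>x y. x \<in> U \<Longrightarrow> y \<in> U \<Longrightarrow> ennreal \<bar>v x - v y\<bar> \<le> ennreal L * gdist P x y"
    using glip_constant[OF v] by blast
  have "ennreal \<bar>u x - u y\<bar> \<le> ennreal (C * L) * gdist P x y" if "x \<in> U" "y \<in> U" for x y
  proof -
    have "ennreal \<bar>u x - u y\<bar> \<le> ennreal C * ennreal \<bar>v x - v y\<bar>"
      using le[OF that] C by (simp add: ennreal_leI flip: ennreal_mult)
    also have "\<dots> \<le> ennreal C * (ennreal L * gdist P x y)" by (intro mult_left_mono L(2) that) simp
    finally show ?thesis using C L(1) by (simp add: ennreal_mult mult.assoc)
  qed
  then show ?thesis unfolding glipschitz_on_def by blast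
qed

lemma glip_mult:
  assumes u: "glipschitz_on P UNIV u" "\<And>x. \<bar>u x\<bar> \<le> A" and v: "glipschitz_on P UNIV v" "\<And>x. \<bar>v x\<bar> \<le> B"
  shows "glipschitz_on P UNIV (\<lambda>x. u x * v x)"
proof -
  obtain K where K: "0 \<le> K" "\<And>x y. ennreal \<bar>u x - u y\<bar> \<le> ennreal K * gdist P x y"
    using glip_constant[OF u(1)] by (metis UNIV_I)
  obtain L where L: "0 \<le> L" "\<And>x y. ennreal \<bar>v x - v y\<bar> \<le> ennreal L * gdist P x y"
    using glip_constant[OF v(1)] by (metis UNIV_I)
  have A: "0 \<le> A" and B: "0 \<le> B" using order_trans[OF abs_ge_zero u(2)] order_trans[OF abs_ge_zero v(2)] by auto
  have "ennreal \<bar>u x * v x - u y * v y\<bar> \<le> ennreal (A * L + B * K) * gdist P x y" for x y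
  proof -
    have "\<bar>u x * v x - u y * v y\<bar> = \<bar>u x * (v x - v y) + v y * (u x - u y)\<bar>" by (simp add: algebra_simps)
    also have "\<dots> \<le> \<bar>u x\<bar> * \<bar>v x - v y\<bar> + \<bar>v y\<bar> * \<bar>u x - u y\<bar>" by (metis abs_mult abs_triangle_ineq)
    also have "\<dots> \<le> A * \<bar>v x - v y\<bar> + B * \<bar>u x - u y\<bar>" by (intro add_mono mult_right_mono u v) auto
    finally have "ennreal \<bar>u x * v x - u y * v y\<bar> \<le> ennreal (A * \<bar>v x - v y\<bar> + B * \<bar>u x - u y\<bar>)" by (rule ennreal_leI)
    also have "\<dots> = ennreal A * ennreal \<bar>v x - v y\<bar> + ennreal B * ennreal \<bar>u x - u y\<bar>" using A B by (simp add: ennreal_mult)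
    also have "\<dots> \<le> ennreal A * (ennreal L * gdist P x y) + ennreal B * (ennreal K * gdist P x y)"
      by (intro add_mono mult_left_mono K L) auto
    also have "\<dots> = ennreal (A * L + B * K) * gdist P x y"
      using A B K(1) L(1) by (simp add: ennreal_mult mult.assoc distrib_right)
    finally show ?thesis .
  qed
  then show ?thesis unfolding glipschitz_on_def by blast
qed

lemma Lip_cD:
  assumes "h \<in> Lip_c P"
  shows "glipschitz_on P UNIV h" "compact (closure {x. h x \<noteq> 0})" "continuous_on UNIV h"
  using assms glip_continuous[of UNIV h] by (auto simp: Lip_c_def)

lemma Lip_cI:
  assumes "glipschitz_on P UNIV k" and h: "compact (closure {x. h x \<noteq> 0})" and "\<And>x. h x = 0 \<Longrightarrow> k x = 0"
  shows "k \<in> Lip_c P"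
proof -
  have "closure {x. k x \<noteq> 0} \<subseteq> closure {x. h x \<noteq> 0}" using assms(3) by (intro closure_mono) auto
  then have "closure {x. k x \<noteq> 0} = closure {x. h x \<noteq> 0} \<inter> closure {x. k x \<noteq> 0}" by blast
  then have "compact (closure {x. k x \<noteq> 0})" using compact_Int_closed[OF h closed_closure] by metis
  then show ?thesis using assms(1) by (simp add: Lip_c_def)
qed

lemma Lip_c_bounded:
  assumes h: "h \<in> Lip_c P" obtains B where "\<And>x. \<bar>h x\<bar> \<le> B"
proof -
  have "compact (h ` closure {x. h x \<noteq> 0})"
    using Lip_cD[OF h] by (intro compact_continuous_image continuous_on_subset[OF Lip_cD(3)[OF h]]) auto
  then obtain B where B: "\<forall>y\<in>h ` closure {x. h x \<noteq> 0}. norm y \<le> B"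
    by (auto dest!: compact_imp_bounded simp only: bounded_iff)
  have "\<bar>h x\<bar> \<le> max B 0" for x
  proof (cases "h x = 0")
    case False
    then have "x \<in> closure {x. h x \<noteq> 0}" by (intro subsetD[OF closure_subset]) simp
    then have "\<bar>h x\<bar> \<le> B" using B by auto
    then show ?thesis by simp
  qed simp
  then show thesis by (rule that)
qed

lemma Lip_c_add:
  assumes "h \<in> Lip_c P" "k \<in> Lip_c P" shows "(\<lambda>x. h x + k x) \<in> Lip_c P"
proof (rule Lip_cI[of _ "\<lambda>x. \<bar>h x\<bar> + \<bar>k x\<bar>"])
  have "{x. \<bar>h x\<bar> + \<bar>k x\<bar> \<noteq> 0} = {x. h x \<noteq> 0} \<union> {x. k x \<noteq> 0}" by auto
  then show "compact (closure {x. \<bar>h x\<bar> + \<bar>k x\<bar> \<noteq> 0})" using assms by (simp add: Lip_c_def closure_Un compact_Un)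
qed (use assms glip_add in \<open>auto simp: Lip_c_def\<close>)

lemma Lip_c_dominated:
  assumes h: "h \<in> Lip_c P" and C: "0 \<le> C" and k: "\<And>x y. \<bar>k x - k y\<bar> \<le> C * \<bar>h x - h y\<bar>" "\<And>x. h x = 0 \<Longrightarrow> k x = 0"
  shows "k \<in> Lip_c P"
  using h by (intro Lip_cI[OF glip_dominated[OF _ C k(1)] _ k(2)]) (auto simp: Lip_c_def)

lemma Lip_c_mult:
  assumes u: "glipschitz_on P UNIV u" "\<And>x. \<bar>u x\<bar> \<le> A" and h: "h \<in> Lip_c P"
  shows "(\<lambda>x. u x * h x) \<in> Lip_c P"
proof -
  obtain B where B: "\<And>x. \<bar>h x\<bar> \<le> B" using Lip_c_bounded[OF h] by blast
  show ?thesis using h by (intro Lip_cI[OF glip_mult[OF u _ B], where h = h]) (auto simp: Lip_c_def)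
qed

lemma clip_lipschitz: "\<bar>max 0 (min 1 a) - max 0 (min 1 b)\<bar> \<le> \<bar>a - b :: real\<bar>"
  by (auto simp: max_def min_def)

lemma glip_clip:
  assumes "C-lipschitz_on UNIV F" shows "glipschitz_on P UNIV (\<lambda>x. max 0 (min 1 (F (coord P x)))) "
  by (rule glip_dominated[OF glip_of_coord[OF assms], of 1]) (use clip_lipschitz in auto)

text \<open>The distance to the complement is measured in the Euclidean space, since Lipschitz
  functions of \<open>coord P\<close> are Lipschitz for \<open>gdist\<close>. It is positive on U
  because the image of the complement is closed.\<close>

lemma cutoffs:
  assumes U: "open U"
  shows "\<exists>g :: nat \<Rightarrow> 'x \<Rightarrow> real. (\<forall>x. g 0 x = 0) \<and> (\<forall>k x. g k x \<le> g (Suc k) x \<and> g k x \<le> 1) \<and>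
    (\<forall>k x. x \<notin> U \<longrightarrow> g k x = 0) \<and> (\<forall>x\<in>U. \<exists>k. g k x = 1) \<and> (\<forall>k. \<forall>h\<in>Lip_c P. (\<lambda>x. g k x * h x) \<in> Lip_c P)"
proof -
  let ?A = "coord P ` (- U)"
  \<comment> \<open>\<open>infdist\<close> to the empty set is 0 by convention, so the case of an
    empty complement needs its own positive value.\<close>
  define \<delta> where "\<delta> y = (if U = UNIV then 1 else infdist y ?A)" for y
  have \<delta>0: "0 \<le> \<delta> y" for y by (simp add: \<delta>_def infdist_nonneg)
  have \<delta>L: "\<bar>\<delta> y - \<delta> z\<bar> \<le> dist y z" for y z
    using infdist_triangle_abs[of y ?A z] by (simp add: \<delta>_def)
  have pos: "0 < \<delta> (coord P x)" if x: "x \<in> U" for x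
  proof (cases "U = UNIV")
    case False
    have "?A = range (coord P) \<inter> the_inv (coord P) -` (- U)" by force
    then have cl: "closed ?A"
      using continuous_closed_preimage[OF inv_coord_continuous coord_closed, of "- U"] U by (simp add: closed_Compl)
    moreover have "coord P x \<notin> ?A" using x coord_inj by (auto dest: injD)
    ultimately have "infdist (coord P x) ?A \<noteq> 0"
      using in_closed_iff_infdist_zero[OF cl] False by blast
    then show ?thesis using infdist_nonneg[of "coord P x" ?A] False by (simp add: \<delta>_def)
  qed (simp add: \<delta>_def)
  define g where "g k x = max 0 (min 1 (real k * \<delta> (coord P x)))" for k :: nat and x
  have "(\<lambda>x. g k x * h x) \<in> Lip_c P" if "h \<in> Lip_c P" for k h
  proof (rule Lip_c_mult[OF _ _ that])
    have "(real k)-lipschitz_on UNIV (\<lambda>y. real k * \<delta> y)"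
    proof (rule lipschitz_onI)
      fix y z
      have "dist (real k * \<delta> y) (real k * \<delta> z) = real k * \<bar>\<delta> y - \<delta> z\<bar>" by (simp add: dist_real_def abs_mult flip: right_diff_distrib)
      then show "dist (real k * \<delta> y) (real k * \<delta> z) \<le> real k * dist y z" using \<delta>L by (simp add: mult_left_mono)
    qed simp
    from glip_clip[OF this] show "glipschitz_on P UNIV (g k)" by (simp add: g_def[abs_def])
    show "\<bar>g k x\<bar> \<le> 1" for x by (simp add: g_def)
  qed
  moreover have "\<exists>k. g k x = 1" if "x \<in> U" for x
  proof -
    have "0 < \<delta> (coord P x)" by (rule pos[OF that])
    from reals_Archimedean3[OF this] obtain k :: nat where "1 < real k * \<delta> (coord P x)" by blast
    then have "g k x = 1" by (simp add: g_def)
    then show ?thesis ..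
  qed
  moreover have "g k x \<le> g (Suc k) x" for k x
    unfolding g_def using \<delta>0 by (intro max.mono min.mono mult_right_mono order_refl) auto
  moreover have "g k x = 0" if "x \<notin> U" for k x
  proof -
    have "infdist (coord P x) ?A = 0" using that by (intro infdist_zero) blast
    then show ?thesis using that by (auto simp: g_def \<delta>_def)
  qed
  ultimately show ?thesis by (intro exI[of _ g]) (auto simp: g_def)
qed

lemma exhaustion:
  "\<exists>\<eta> :: nat \<Rightarrow> 'x \<Rightarrow> real. \<forall>k x. \<eta> k \<in> Lip_c P \<and> 0 \<le> \<eta> k x \<and> \<eta> k x \<le> \<eta> (Suc k) x \<and> \<eta> k x \<le> 1 \<and> (\<exists>j. \<eta> j x = 1)"
proof -
  \<comment> \<open>The function is 1 where the coordinates have norm at most k and vanishes from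
    norm \<open>Suc k\<close> on; bounded coordinates give compact support by
    \<open>compact_of_coord\<close>.\<close>
  define \<eta> where "\<eta> k x = max 0 (min 1 (real (Suc k) - norm (coord P x)))" for k :: nat and x
  have "\<eta> k \<in> Lip_c P" for k
  proof -
    have "1-lipschitz_on UNIV (\<lambda>y :: 'e. real (Suc k) - norm y)"
      by (rule lipschitz_onI) (auto simp: dist_real_def dist_norm intro: order_trans[OF _ norm_triangle_ineq3] simp: abs_minus_commute)
    from glip_clip[OF this] have "glipschitz_on P UNIV (\<eta> k)" by (simp only: \<eta>_def[abs_def])
    moreover have "compact (closure {x. \<eta> k x \<noteq> 0})"
    proof (rule compact_of_coord)
      have "closure {x. \<eta> k x \<noteq> 0} \<subseteq> {x. norm (coord P x) \<le> real (Suc k)}"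
        by (intro closure_minimal closed_Collect_le continuous_on_norm coord_continuous continuous_on_const) (auto simp: \<eta>_def max_def min_def split: if_splits)
      then show "bounded (coord P ` closure {x. \<eta> k x \<noteq> 0})" by (auto simp: bounded_iff intro!: exI[of _ "real (Suc k)"])
    qed simp
    ultimately show ?thesis by (simp add: Lip_c_def)
  qed
  moreover have "\<exists>j. \<eta> j x = 1" for x
  proof -
    obtain j :: nat where "norm (coord P x) < real j" using reals_Archimedean2 by blast
    then have "\<eta> j x = 1" by (simp add: \<eta>_def)
    then show ?thesis ..
  qed
  moreover have "\<eta> k x \<le> \<eta> (Suc k) x" for k x
    unfolding \<eta>_def by (intro max.mono min.mono order_refl) simp
  ultimately show ?thesis by (intro exI[of _ \<eta>]) (auto simp: \<eta>_def)
qed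

text \<open>The sign in front of the integral turns weak subharmonicity into positivity. Linearity
  holds because the gradients of two test functions and of their combinations exist together at
  almost every point.\<close>

theorem subharmonic_functional:
  assumes f: "f \<in> W12_loc P" and sub: "weakly_subharmonic P f"
    and fin: "(\<integral>\<^sup>+ x. ennreal (gnorm P x (sgrad P f x)) \<partial>vol P) < \<infinity>"
  shows "lipschitz_functional (Lip_c P) (\<lambda>h. - (\<integral>x. ginner P x (sgrad P f x) (rgrad P h x) \<partial>vol P))"
proof (rule lipschitz_functional.intro)
  fix h k :: "'x \<Rightarrow> real" and a :: real
  assume h: "h \<in> Lip_c P"
  note gh = Lip_cD(1)[OF h]
  note mh = integrand_measurable[OF f gh]
  show "continuous_on UNIV h" "compact (closure {x. h x \<noteq> 0})" using Lip_cD[OF h] by auto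
  show sc: "(\<lambda>x. a * h x) \<in> Lip_c P"
    by (rule Lip_c_dominated[OF h, of "\<bar>a\<bar>"]) (auto simp flip: right_diff_distrib simp: abs_mult)
  have "(\<integral>x. ginner P x (sgrad P f x) (rgrad P (\<lambda>x. a * h x) x) \<partial>vol P) = (\<integral>x. a * ginner P x (sgrad P f x) (rgrad P h x) \<partial>vol P)"
  proof (rule integral_cong_AE)
    show "AE x in vol P. ginner P x (sgrad P f x) (rgrad P (\<lambda>x. a * h x) x) = a * ginner P x (sgrad P f x) (rgrad P h x)"
      using AE_differential[OF gh] AE_sgrad_tangent[OF f] by eventually_elim (blast intro: ginner_rgrad_scale)
  qed (intro borel_measurable_times borel_measurable_const mh integrand_measurable f Lip_cD(1) sc)+
  then show "- (\<integral>x. ginner P x (sgrad P f x) (rgrad P (\<lambda>x. a * h x) x) \<partial>vol P) = a * - (\<integral>x. ginner P x (sgrad P f x) (rgrad P h x) \<partial>vol P)"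
    by simp
  show "(\<lambda>x. F (h x)) \<in> Lip_c P" if "1-lipschitz_on UNIV F" "F 0 = (0::real)" for F
    by (rule Lip_c_dominated[OF h, of 1]) (use that lipschitz_onD[OF that(1)] in \<open>auto simp: dist_real_def\<close>)
  show "0 \<le> - (\<integral>x. ginner P x (sgrad P f x) (rgrad P h x) \<partial>vol P)" if "\<And>x. 0 \<le> h x"
    using sub h that unfolding weakly_subharmonic_def by simp
  assume k: "k \<in> Lip_c P"
  note gk = Lip_cD(1)[OF k]
  show hk: "(\<lambda>x. h x + k x) \<in> Lip_c P" by (rule Lip_c_add[OF h k])
  have "(\<integral>x. ginner P x (sgrad P f x) (rgrad P (\<lambda>x. h x + k x) x) \<partial>vol P)
      = (\<integral>x. ginner P x (sgrad P f x) (rgrad P h x) + ginner P x (sgrad P f x) (rgrad P k x) \<partial>vol P)"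
  proof (rule integral_cong_AE)
    show "AE x in vol P. ginner P x (sgrad P f x) (rgrad P (\<lambda>x. h x + k x) x) = ginner P x (sgrad P f x) (rgrad P h x) + ginner P x (sgrad P f x) (rgrad P k x)"
      using AE_differential[OF gh] AE_differential[OF gk] AE_sgrad_tangent[OF f] by eventually_elim (blast intro: ginner_rgrad_add)
  qed (intro borel_measurable_add mh integrand_measurable f Lip_cD(1) hk gk)+
  also have "\<dots> = (\<integral>x. ginner P x (sgrad P f x) (rgrad P h x) \<partial>vol P) + (\<integral>x. ginner P x (sgrad P f x) (rgrad P k x) \<partial>vol P)"
    by (intro Bochner_Integration.integral_add integrand_integrable f fin gh gk)
  finally show "- (\<integral>x. ginner P x (sgrad P f x) (rgrad P (\<lambda>x. h x + k x) x) \<partial>vol P)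
      = - (\<integral>x. ginner P x (sgrad P f x) (rgrad P h x) \<partial>vol P) + - (\<integral>x. ginner P x (sgrad P f x) (rgrad P k x) \<partial>vol P)"
    by simp
qed (erule cutoffs, rule exhaustion)

end

theorem theorem4p1:
  fixes P :: "('v, 'e::euclidean_space, 'x::metric_space) riem_poly"
    and n :: nat and f :: "'x \<Rightarrow> real"
  assumes "riemannian_polyhedron P"
    and "pseudomanifold P n"
    and "poly_boundary P = {}"
    and "f \<in> W12_loc P"
    and "weakly_subharmonic P f"
    and "(\<integral>\<^sup>+ x. ennreal (gnorm P x (sgrad P f x)) \<partial>vol P) < \<infinity>"
  shows "\<exists>!m :: 'x measure. locally_finite_borel m \<and>
    (\<forall>h\<in>Lip_c P. (\<integral>x. h x \<partial>m) = - (\<integral>x. ginner P x (sgrad P f x) (rgrad P h x) \<partial>vol P))"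
proof -
  interpret riem_polyhedron P by standard (rule assms(1))
  interpret lipschitz_functional "Lip_c P" "\<lambda>h. - (\<integral>x. ginner P x (sgrad P f x) (rgrad P h x) \<partial>vol P)"
    by (rule subharmonic_functional[OF assms(4-6)])
  show ?thesis by (rule representation)
qed

end
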